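(* Let $n\ge2$, let $I\subset\mathbb{R}$ be an interval with $|I|=1$, and let $n'=n/(n-1)$. Let $X(I^{n-1})$ be an r.i. space with upper Boyd index $\overline{\alpha}_X<1$, and let $Z_{\mathcal{R}(X,L^\infty)}(I^n)$ be the r.i. space of all measurable $f$ on $I^n$ with $$\|f\|_{Z_{\mathcal{R}(X,L^\infty)}(I^n)}=\left\|\int_{t^{n'}}^1f^{**}(s)\,s^{-1/n'}\,ds\right\|_{\overline{X}(0,1)}<\infty .$$ Then the Sobolev embedding $$W^1Z_{\mathcal{R}(X,L^\infty)}(I^n)\hookrightarrow\mathcal{R}(X,L^\infty)$$ holds. Moreover, $Z_{\mathcal{R}(X,L^\infty)}(I^n)$ is the largest r.i. domain space for which this embedding holds; that is, if $Z(I^n)$ is an r.i. space with $W^1Z(I^n)\hookrightarrow\mathcal{R}(X,L^\infty)$, then $Z(I^n)\hookrightarrow Z_{\mathcal{R}(X,L^\infty)}(I^n)$.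
   Context: Rearrangements: for a measurable real function $f$ on $I^m$ ($m\ge1$, $|I|=1$), $\lambda_f(t)=|\{x:|f(x)|>t\}|$, $f^*(t)=\inf\{s\ge 0:\lambda_f(s)\le t\}$ and $f^{**}(t)=t^{-1}\int_0^tf^*(s)\,ds$. R.i. spaces: a Banach function norm is a map $\rho$ from non-negative measurable functions on $I^m$ to $[0,\infty]$ with: $\rho(f)=0$ iff $f=0$ a.e., $\rho(f+g)\le\rho(f)+\rho(g)$, $\rho(\alpha f)=\alpha\rho(f)$ for $\alpha\ge0$; $0\le g\le f$ a.e. implies $\rho(g)\le\rho(f)$; $0\le f_j\uparrow f$ a.e. implies $\rho(f_j)\uparrow\rho(f)$; $\rho(\chi_{I^m})<\infty$; $\int_{I^m}f\,dx\le C\rho(f)$ for a constant $C$. The space $X(I^m)=\{f \text{ measurable}:\|f\|_{X(I^m)}:=\rho(|f|)<\infty\}$ is rearrangement invariant (r.i.) if $\|f\|_{X(I^m)}=\|g\|_{X(I^m)}$ whenever $\lambda_f=\lambda_g$. R.i. spaces on $(0,1)$ are defined in the same way. By the Luxemburg representation theorem, for an r.i. space $X(I^m)$ there is an r.i. space $\overline{X}(0,1)$ with $\|f\|_{X(I^m)}=\|f^*\|_{\overline{X}(0,1)}$ for all $f$. Upper Boyd index: for $t>0$ and $f$ measurable on $(0,1)$ let $E_tf(s)=f(s/t)$ if $0\le s\le\min(1,t)$ and $E_tf(s)=0$ otherwise; let $h_X(t)$ be the operator norm of $E_t$ on $\overline{X}(0,1)$ (always finite). Then $\overline{\alpha}_X=\inf_{1<t<\infty}\frac{\log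 h_X(t)}{\log t}$. Sobolev space: $W^1Z(I^n)=\{u\in Z(I^n):|\nabla u|\in Z(I^n)\}$ ($\nabla u$ the distributional gradient, $|\cdot|$ Euclidean length), with norm $\|u\|_{W^1Z(I^n)}=\|u\|_{Z(I^n)}+\||\nabla u|\|_{Z(I^n)}$. Mixed norm spaces: for $x\in I^n$ and $k\in\{1,\dots,n\}$ let $\widehat{x}_k\in I^{n-1}$ be $x$ with its $k$th coordinate removed. For r.i. spaces $X(I^{n-1})$, $Y(I)$, let $\psi_k(f,Y)(\widehat{x}_k)=\|f(\widehat{x}_k,\cdot)\|_{Y(I)}$ (norm in the $k$th variable), $\|f\|_{\mathcal{R}_k(X,Y)}=\|\psi_k(f,Y)\|_{X(I^{n-1})}$, $\mathcal{R}_k(X,Y)=\{f:\|f\|_{\mathcal{R}_k(X,Y)}<\infty\}$, and $\mathcal{R}(X,Y)=\bigcap_{k=1}^n\mathcal{R}_k(X,Y)$ with norm $\|f\|_{\mathcal{R}(X,Y)}=\sum_{k=1}^n\|f\|_{\mathcal{R}_k(X,Y)}$. $A\hookrightarrow B$ denotes a continuous embedding: $A\subset B$ and $\|f\|_B\le C\|f\|_A$ for all $f\in A$. *)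

theory Defs
  imports "HOL-Probability.Essential_Supremum" "HOL-Analysis.Analysis"
begin

section \<open>Rearrangements\<close>

text \<open>Non-negative functions take values in \<^typ>\<open>ennreal\<close>; a real function \<open>f\<close> enters through \<open>|f|\<close>.\<close>

definition absf :: "('a \<Rightarrow> real) \<Rightarrow> 'a \<Rightarrow> ennreal" where
  "absf f = (\<lambda>x. ennreal \<bar>f x\<bar>)"

definition distr_fun :: "'a measure \<Rightarrow> ('a \<Rightarrow> ennreal) \<Rightarrow> ennreal \<Rightarrow> ennreal" where
  "distr_fun M g s = emeasure M {x \<in> space M. s < g x}"

definition rearr :: "'a measure \<Rightarrow> ('a \<Rightarrow> ennreal) \<Rightarrow> real \<Rightarrow> ennreal" where
  "rearr M g t = Inf {s. distr_fun M g s \<le> ennreal t}"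

definition rearr_avg :: "'a measure \<Rightarrow> ('a \<Rightarrow> ennreal) \<Rightarrow> real \<Rightarrow> ennreal" where
  "rearr_avg M g t = ennreal (1 / t) * (\<integral>\<^sup>+s\<in>{0..t}. rearr M g s \<partial>lborel)"


section \<open>Rearrangement invariant spaces\<close>

text \<open>Only the values of \<open>\<rho>\<close> on measurable functions are constrained.\<close>

definition banach_function_norm :: "'a measure \<Rightarrow> (('a \<Rightarrow> ennreal) \<Rightarrow> ennreal) \<Rightarrow> bool" where
  "banach_function_norm M \<rho> \<longleftrightarrow>
     (\<forall>f\<in>borel_measurable M. \<rho> f = 0 \<longleftrightarrow> (AE x in M. f x = 0)) \<and>
     (\<forall>f\<in>borel_measurable M. \<forall>g\<in>borel_measurable M. \<rho> (\<lambda>x. f x + g x) \<le> \<rho> f + \<rho> g) \<and>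
     (\<forall>f\<in>borel_measurable M. \<forall>a::real. 0 \<le> a \<longrightarrow> \<rho> (\<lambda>x. ennreal a * f x) = ennreal a * \<rho> f) \<and>
     (\<forall>f\<in>borel_measurable M. \<forall>g\<in>borel_measurable M. (AE x in M. g x \<le> f x) \<longrightarrow> \<rho> g \<le> \<rho> f) \<and>
     (\<forall>F. \<forall>f\<in>borel_measurable M. (\<forall>j::nat. F j \<in> borel_measurable M) \<longrightarrow>
        (AE x in M. incseq (\<lambda>j. F j x) \<and> (SUP j. F j x) = f x) \<longrightarrow>
        incseq (\<lambda>j. \<rho> (F j)) \<and> (SUP j. \<rho> (F j)) = \<rho> f) \<and>
     \<rho> (\<lambda>_. 1) < \<infinity> \<and>
     (\<exists>C::real. \<forall>f\<in>borel_measurable M. (\<integral>\<^sup>+x. f x \<partial>M) \<le> ennreal C * \<rho> f)"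

definition ri_norm :: "'a measure \<Rightarrow> (('a \<Rightarrow> ennreal) \<Rightarrow> ennreal) \<Rightarrow> bool" where
  "ri_norm M \<rho> \<longleftrightarrow> banach_function_norm M \<rho> \<and>
     (\<forall>f\<in>borel_measurable M. \<forall>g\<in>borel_measurable M.
        (\<forall>t\<ge>0. distr_fun M (absf f) (ennreal t) = distr_fun M (absf g) (ennreal t)) \<longrightarrow>
        \<rho> (absf f) = \<rho> (absf g))"

definition fspace :: "'a measure \<Rightarrow> (('a \<Rightarrow> ennreal) \<Rightarrow> ennreal) \<Rightarrow> ('a \<Rightarrow> real) set" where
  "fspace M \<rho> = {f \<in> borel_measurable M. \<rho> (absf f) < \<infinity>}"

definition fnorm :: "(('a \<Rightarrow> ennreal) \<Rightarrow> ennreal) \<Rightarrow> ('a \<Rightarrow> real) \<Rightarrow> ennreal" where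
  "fnorm \<rho> f = \<rho> (absf f)"

definition embeds ::
  "'a set \<Rightarrow> ('a \<Rightarrow> ennreal) \<Rightarrow> 'a set \<Rightarrow> ('a \<Rightarrow> ennreal) \<Rightarrow> bool" where
  "embeds A nA B nB \<longleftrightarrow> A \<subseteq> B \<and> (\<exists>C::real. \<forall>f\<in>A. nB f \<le> ennreal C * nA f)"

abbreviation unit_interval :: "real measure" where
  "unit_interval \<equiv> lebesgue_on {0<..<1}"

text \<open>The norm of the Luxemburg representation space \<open>X\<close>-bar on \<open>(0,1)\<close>. On a non-atomic
  probability space it exists, and it is unique on measurable functions, since every measurable
  function on \<open>(0,1)\<close> is equimeasurable with one on the given space.\<close>

definition luxemburg ::
  "'a measure \<Rightarrow> (('a \<Rightarrow> ennreal) \<Rightarrow> ennreal) \<Rightarrow> (real \<Rightarrow> ennreal) \<Rightarrow> ennreal" where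
  "luxemburg M \<rho> = (SOME r. ri_norm unit_interval r \<and>
     (\<forall>f\<in>borel_measurable M. fnorm \<rho> f = r (rearr M (absf f))))"

definition dilation :: "real \<Rightarrow> (real \<Rightarrow> real) \<Rightarrow> real \<Rightarrow> real" where
  "dilation t f s = (if 0 \<le> s \<and> s \<le> min 1 t then f (s / t) else 0)"

text \<open>Operator norm of the dilation operator on the space with norm \<open>r\<close>; it is at most
  \<open>max 1 t\<close>, and at least \<open>1\<close> for \<open>t > 1\<close>, so the passage to the reals and
  the infimum in the Boyd index below are harmless.\<close>

definition dilation_norm :: "((real \<Rightarrow> ennreal) \<Rightarrow> ennreal) \<Rightarrow> real \<Rightarrow> ennreal" where
  "dilation_norm r t =
     (SUP f \<in> {f \<in> borel_measurable unit_interval. fnorm r f \<le> 1}. fnorm r (dilation t f))"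

definition upper_boyd :: "'a measure \<Rightarrow> (('a \<Rightarrow> ennreal) \<Rightarrow> ennreal) \<Rightarrow> real" where
  "upper_boyd M \<rho> = (INF t\<in>{1<..}. ln (enn2real (dilation_norm (luxemburg M \<rho>) t)) / ln t)"


section \<open>Function spaces on cubes\<close>

text \<open>Points of \<open>I\<^sup>m\<close> are extensional functions on \<open>{..<m}\<close>, so coordinates are numbered from \<open>0\<close>.
  The completion makes the measurable functions the Lebesgue measurable ones.\<close>

definition cube :: "nat \<Rightarrow> real set \<Rightarrow> (nat \<Rightarrow> real) measure" where
  "cube m I = completion (\<Pi>\<^sub>M i\<in>{..<m}. restrict_space lborel I)"

definition open_cube :: "nat \<Rightarrow> real set \<Rightarrow> (nat \<Rightarrow> real) set" where
  "open_cube m I = (\<Pi>\<^sub>E i\<in>{..<m}. interior I)"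

definition partial :: "nat \<Rightarrow> ((nat \<Rightarrow> real) \<Rightarrow> real) \<Rightarrow> (nat \<Rightarrow> real) \<Rightarrow> real" where
  "partial i \<phi> x = deriv (\<lambda>t. \<phi> (x(i := t))) (x i)"

text \<open>\<open>C\<^sup>\<infinity>\<close>: all iterated partial derivatives exist and are continuous. The product topology
  on \<^typ>\<open>nat \<Rightarrow> real\<close> induces the Euclidean topology on the extensional functions.\<close>

definition smooth_on_cube :: "nat \<Rightarrow> real set \<Rightarrow> ((nat \<Rightarrow> real) \<Rightarrow> real) \<Rightarrow> bool" where
  "smooth_on_cube n I \<phi> \<longleftrightarrow> (\<forall>is. set is \<subseteq> {..<n} \<longrightarrow>
     continuous_on (open_cube n I) (foldr partial is \<phi>) \<and>
     (\<forall>i<n. \<forall>x\<in>open_cube n I.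
        (\<lambda>t. foldr partial is \<phi> (x(i := t))) differentiable (at (x i))))"

definition test_functions :: "nat \<Rightarrow> real set \<Rightarrow> ((nat \<Rightarrow> real) \<Rightarrow> real) set" where
  "test_functions n I = {\<phi>. smooth_on_cube n I \<phi> \<and>
     (\<exists>K. compact K \<and> K \<subseteq> open_cube n I \<and> (\<forall>x. x \<notin> K \<longrightarrow> \<phi> x = 0))}"

definition loc_integrable :: "nat \<Rightarrow> real set \<Rightarrow> ((nat \<Rightarrow> real) \<Rightarrow> real) \<Rightarrow> bool" where
  "loc_integrable n I v \<longleftrightarrow> v \<in> borel_measurable (cube n I) \<and>
     (\<forall>K. compact K \<and> K \<subseteq> open_cube n I \<longrightarrow> set_integrable (cube n I) K v)"

definition is_weak_gradient ::
  "nat \<Rightarrow> real set \<Rightarrow> ((nat \<Rightarrow> real) \<Rightarrow> real) \<Rightarrow> (nat \<Rightarrow> (nat \<Rightarrow> real) \<Rightarrow> real) \<Rightarrow> bool" where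
  "is_weak_gradient n I u v \<longleftrightarrow> loc_integrable n I u \<and>
     (\<forall>i<n. loc_integrable n I (v i) \<and>
        (\<forall>\<phi>\<in>test_functions n I.
           (\<integral>x. u x * partial i \<phi> x \<partial>cube n I) = - (\<integral>x. v i x * \<phi> x \<partial>cube n I)))"

text \<open>The weak gradient is unique up to null sets, so the choice does not affect the norms below.\<close>

definition weak_gradient ::
  "nat \<Rightarrow> real set \<Rightarrow> ((nat \<Rightarrow> real) \<Rightarrow> real) \<Rightarrow> nat \<Rightarrow> (nat \<Rightarrow> real) \<Rightarrow> real" where
  "weak_gradient n I u = (SOME v. is_weak_gradient n I u v)"

definition grad_length ::
  "nat \<Rightarrow> real set \<Rightarrow> ((nat \<Rightarrow> real) \<Rightarrow> real) \<Rightarrow> (nat \<Rightarrow> real) \<Rightarrow> real" where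
  "grad_length n I u x = sqrt (\<Sum>i<n. (weak_gradient n I u i x)\<^sup>2)"

definition sobolev ::
  "nat \<Rightarrow> real set \<Rightarrow> (((nat \<Rightarrow> real) \<Rightarrow> ennreal) \<Rightarrow> ennreal) \<Rightarrow> ((nat \<Rightarrow> real) \<Rightarrow> real) set" where
  "sobolev n I \<rho> = {u \<in> fspace (cube n I) \<rho>.
     (\<exists>v. is_weak_gradient n I u v) \<and> grad_length n I u \<in> fspace (cube n I) \<rho>}"

definition sobolev_norm ::
  "nat \<Rightarrow> real set \<Rightarrow> (((nat \<Rightarrow> real) \<Rightarrow> ennreal) \<Rightarrow> ennreal) \<Rightarrow> ((nat \<Rightarrow> real) \<Rightarrow> real) \<Rightarrow> ennreal"
  where
  "sobolev_norm n I \<rho> u = fnorm \<rho> u + fnorm \<rho> (grad_length n I u)"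

definition insert_coord :: "nat \<Rightarrow> (nat \<Rightarrow> real) \<Rightarrow> real \<Rightarrow> nat \<Rightarrow> real" where
  "insert_coord k y t = (\<lambda>i. if i < k then y i else if i = k then t else y (i - 1))"

text \<open>\<open>X\<close> is a norm on functions on \<open>I\<^bsup>n-1\<^esup>\<close>, \<open>Y\<close> one on functions on \<open>I\<close>, and the
  argument \<open>y\<close> of \<open>\<psi>\<^sub>k\<close> is the point with its \<open>k\<close>-th coordinate removed.\<close>

definition psi ::
  "nat \<Rightarrow> ((nat \<Rightarrow> real) \<Rightarrow> real) \<Rightarrow> ((real \<Rightarrow> ennreal) \<Rightarrow> ennreal) \<Rightarrow> (nat \<Rightarrow> real) \<Rightarrow> ennreal" where
  "psi k f Y y = fnorm Y (\<lambda>t. f (insert_coord k y t))"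

definition mixed_norm_k ::
  "nat \<Rightarrow> (((nat \<Rightarrow> real) \<Rightarrow> ennreal) \<Rightarrow> ennreal) \<Rightarrow> ((real \<Rightarrow> ennreal) \<Rightarrow> ennreal) \<Rightarrow>
   ((nat \<Rightarrow> real) \<Rightarrow> real) \<Rightarrow> ennreal" where
  "mixed_norm_k k X Y f = X (psi k f Y)"

definition mixed_space ::
  "nat \<Rightarrow> real set \<Rightarrow> (((nat \<Rightarrow> real) \<Rightarrow> ennreal) \<Rightarrow> ennreal) \<Rightarrow> ((real \<Rightarrow> ennreal) \<Rightarrow> ennreal) \<Rightarrow>
   ((nat \<Rightarrow> real) \<Rightarrow> real) set" where
  "mixed_space n I X Y =
     {f \<in> borel_measurable (cube n I). \<forall>k<n. mixed_norm_k k X Y f < \<infinity>}"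

definition mixed_norm ::
  "nat \<Rightarrow> (((nat \<Rightarrow> real) \<Rightarrow> ennreal) \<Rightarrow> ennreal) \<Rightarrow> ((real \<Rightarrow> ennreal) \<Rightarrow> ennreal) \<Rightarrow>
   ((nat \<Rightarrow> real) \<Rightarrow> real) \<Rightarrow> ennreal" where
  "mixed_norm n X Y f = (\<Sum>k<n. mixed_norm_k k X Y f)"

definition Linf :: "real set \<Rightarrow> (real \<Rightarrow> ennreal) \<Rightarrow> ennreal" where
  "Linf I = esssup (lebesgue_on I)"

definition ZR_norm ::
  "nat \<Rightarrow> real set \<Rightarrow> (((nat \<Rightarrow> real) \<Rightarrow> ennreal) \<Rightarrow> ennreal) \<Rightarrow>
   ((nat \<Rightarrow> real) \<Rightarrow> ennreal) \<Rightarrow> ennreal" where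
  "ZR_norm n I X f =
     (let n' = real n / (real n - 1) in
      luxemburg (cube (n - 1) I) X
        (\<lambda>t. \<integral>\<^sup>+s\<in>{t powr n'..1}. rearr_avg (cube n I) f s * ennreal (s powr (- 1 / n')) \<partial>lborel))"

end

theory Submission
  imports Defs "HOL-Probability.Probability_Measure" "HOL-Probability.Distributions"
begin

text \<open>
Write \<open>p = n / (n - 1)\<close>, let \<open>\<rho>\<close> be the norm of the representation space of \<open>X\<close> on the unit
interval, and let \<open>T \<phi> t\<close> be the integral of \<open>\<phi> s * s powr (-1/p)\<close> over \<open>t powr p \<le> s \<le> 1\<close>
(\<open>tail_integral\<close>). The norm of the domain space is \<open>\<rho> (T (rearr_avg f))\<close>.

It is a norm because the averaged rearrangement is subadditive: up to the factor \<open>1 / t\<close> it is the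
K-functional between \<open>L\<^sup>1\<close> and \<open>L\<^sup>\<infinity>\<close> (\<open>integral_rearr_eq_K_fun\<close>), an infimum over truncation
levels. The norm \<open>\<rho>\<close> is obtained by composing with the measure preserving map
\<open>x \<mapsto> (2 * dist x)\<^sup>m\<close> from the cube to the unit interval, where \<open>dist\<close> is the sup-distance from the
centre (\<open>luxemburg_exists\<close>, \<open>cube_to_interval_measure_preserving\<close>).

For the embedding, let \<open>g = \<bar>u\<bar> + \<bar>\<nabla>u\<bar>\<close>. On almost every line in direction \<open>k\<close>, the value
of \<open>\<bar>u\<bar>\<close> at a point exceeds the mean of \<open>\<bar>u\<bar>\<close> over the dyadic interval of length \<open>1 / 2 ^ j\<close> around it by at most
the integral of \<open>g\<close> over that interval (\<open>weak_derivative_le_avg\<close>). Doing this in all directions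
compares \<open>\<bar>u\<bar>\<close> with its means over dyadic cubes, and these means grow from one scale to the next by
at most a multiple of \<open>1 / 2 ^ i\<close> times the averaged rearrangement of \<open>g\<close> at the volume of the
cubes (\<open>avgs_le_cube_bound\<close>). The sum over the scales is a discrete form of \<open>T (rearr_avg g)\<close>. What
remains is \<open>1 / 2 ^ j\<close> times a mean over a single dyadic interval; truncating and integrating it
over the whole line bounds it uniformly on the line, and Markov's inequality bounds the
rearrangement of the result in the other variables (\<open>rearr_sup_lines_le\<close>). With \<open>j\<close> adapted to \<open>t\<close> one gets the
pointwise estimate \<open>rearr_sup_lines_le_tail_integral\<close>, and the norm \<open>\<rho>\<close> of it is the embedding.

For the optimality, suppose that the embedding holds for \<open>Z\<close>, and let \<open>\<phi>\<close> be the rearrangement of a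
bounded \<open>g\<close>. The function \<open>u x = \<integral> q > dist x. 2 * n * \<phi> ((2 * q)\<^sup>n)\<close> and its gradient are both
dominated by \<open>2 * n * \<phi> ((2 * dist x)\<^sup>n)\<close>, which is equimeasurable with \<open>2 * n * \<phi>\<close>; so the Sobolev
norm of \<open>u\<close> is at most a multiple of \<open>Z g\<close>. The substitution \<open>s = (2 * q)\<^sup>n\<close> shows that the
supremum of \<open>u\<close> along the line over a point \<open>y\<close> of the smaller cube is \<open>T \<phi>\<close> at the image of \<open>y\<close>,
so \<open>\<rho> (T \<phi>)\<close> is bounded by \<open>Z g\<close> (\<open>tail_integral_le_of_embeds\<close>). Finally \<open>T (rearr_avg g)\<close>
is dominated by the average of \<open>T \<phi>\<close> over initial intervals (\<open>tail_integral_average_le\<close>), and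
averaging is bounded in \<open>\<rho>\<close> on decreasing functions because the upper Boyd index is less
than one (\<open>hardy_bounded\<close>). Unbounded functions follow by the Fatou property.
\<close>


section \<open>Distribution functions and rearrangements\<close>

lemma distr_fun_antimono:
  assumes [measurable]: "f \<in> borel_measurable M" and "s \<le> s'"
  shows "distr_fun M f s' \<le> distr_fun M f s"
  unfolding distr_fun_def using assms(2) by (intro emeasure_mono) auto

text \<open>The infimum in the definition of the rearrangement is attained, because distribution
  functions are continuous from the right.\<close>

lemma rearr_le_iff:
  assumes [measurable]: "f \<in> borel_measurable M"
  shows "rearr M f t \<le> s \<longleftrightarrow> distr_fun M f s \<le> ennreal t"
proof
  assume "distr_fun M f s \<le> ennreal t"
  then show "rearr M f t \<le> s" unfolding rearr_def by (intro Inf_lower) auto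
next
  assume le: "rearr M f t \<le> s"
  show "distr_fun M f s \<le> ennreal t"
  proof (cases "s = top")
    case True then show ?thesis by (simp add: distr_fun_def)
  next
    case False
    define e where "e k = s + ennreal (inverse (real (Suc k)))" for k
    have lim: "e \<longlonglongrightarrow> s"
      unfolding e_def using tendsto_add[OF tendsto_const tendsto_ennrealI[OF LIMSEQ_inverse_real_of_nat], of s]
      by simp
    have gt: "s < e k" for k
      using False ennreal_add_left_cancel_less[of s 0 "ennreal (inverse (real (Suc k)))"]
      by (simp add: e_def less_top)
    have inc: "incseq (\<lambda>k. {x \<in> space M. e k < f x})"
    proof (rule incseq_SucI)
      fix k
      have "e (Suc k) \<le> e k" unfolding e_def
        by (intro add_left_mono ennreal_leI le_imp_inverse_le) auto
      then show "{x \<in> space M. e k < f x} \<subseteq> {x \<in> space M. e (Suc k) < f x}" by auto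
    qed
    have "\<exists>k. e k < y" if "s < y" for y
      using order_tendstoD(2)[OF lim that] by (auto simp: eventually_sequentially)
    then have un: "{x \<in> space M. s < f x} = (\<Union>k. {x \<in> space M. e k < f x})"
      using gt by (auto intro: less_trans)
    have "distr_fun M f s = (SUP k. distr_fun M f (e k))"
      unfolding distr_fun_def un by (rule SUP_emeasure_incseq[symmetric]) (use inc in auto)
    also have "\<dots> \<le> ennreal t"
    proof (rule SUP_least)
      fix k
      have "Inf {s. distr_fun M f s \<le> ennreal t} < e k"
        using le gt[of k] unfolding rearr_def by (rule le_less_trans)
      then obtain s' where "distr_fun M f s' \<le> ennreal t" "s' < e k"
        unfolding Inf_less_iff by auto
      then show "distr_fun M f (e k) \<le> ennreal t"
        using distr_fun_antimono[OF assms, of s' "e k"] by (meson less_imp_le order_trans)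
    qed
    finally show ?thesis .
  qed
qed

lemma rearr_antimono: "t \<le> t' \<Longrightarrow> rearr M f t' \<le> rearr M f t"
  unfolding rearr_def by (intro Inf_superset_mono) (auto intro: order_trans ennreal_leI)

lemma borel_measurable_antimono_ennreal:
  fixes f :: "real \<Rightarrow> ennreal"
  assumes "antimono f" shows "f \<in> borel_measurable borel"
proof (rule borel_measurableI_greater)
  fix y
  have "is_interval {x. y < f x}"
    using antimonoD[OF assms] by (auto simp: is_interval_1 dest: less_le_trans)
  then show "{x \<in> space borel. y < f x} \<in> sets borel"
    by (simp add: real_interval_borel_measurable)
qed

lemma measurable_rearr[measurable]: "rearr M f \<in> borel_measurable borel"
  by (intro borel_measurable_antimono_ennreal antimonoI rearr_antimono)

lemma emeasure_unit_interval:
  "A \<in> sets borel \<Longrightarrow> emeasure unit_interval (A \<inter> {0<..<1}) = emeasure lborel (A \<inter> {0<..<1})"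
  by (subst emeasure_restrict_space) auto

lemma distr_fun_unit_interval:
  assumes [measurable]: "f \<in> borel_measurable borel"
  shows "distr_fun unit_interval f s = emeasure lborel ({x. s < f x} \<inter> {0<..<1})"
proof -
  have "{x \<in> space unit_interval. s < f x} = {x. s < f x} \<inter> {0<..<1}" by auto
  then show ?thesis by (simp add: distr_fun_def emeasure_unit_interval)
qed

lemma emeasure_lborel_initial:
  assumes "d \<le> 1" shows "emeasure lborel ({t. ennreal t < d} \<inter> {0<..<1}) = d"
proof -
  have d: "d = ennreal (enn2real d)" using assms by (metis ennreal_enn2real ennreal_one_less_top le_less_trans)
  have "enn2real d \<le> 1" using enn2real_mono[of d 1] assms by (simp add: enn2real_mono) 
(* *)
  then have "{t. ennreal t < d} \<inter> {0<..<1} = {0<..<enn2real d}"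
    by (subst d) (auto simp: ennreal_less_iff)
  then show ?thesis using d by simp
qed

text \<open>The rearrangement is a function on the unit interval with the same distribution: by
  \<open>rearr_le_iff\<close> its superlevel sets are the initial intervals of the right length.\<close>

lemma distr_fun_rearr:
  assumes [measurable]: "f \<in> borel_measurable M" and "emeasure M (space M) \<le> 1"
  shows "distr_fun unit_interval (rearr M f) s = distr_fun M f s"
proof -
  have "s < rearr M f t \<longleftrightarrow> ennreal t < distr_fun M f s" for t
    unfolding not_le[symmetric] rearr_le_iff[OF assms(1)] ..
  then have "{t. s < rearr M f t} = {t. ennreal t < distr_fun M f s}" by simp
  moreover have "distr_fun M f s \<le> 1"
    unfolding distr_fun_def by (rule order_trans[OF emeasure_space assms(2)])
  ultimately show ?thesis
    by (simp add: distr_fun_unit_interval emeasure_lborel_initial)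
qed

lemma sets_borel_greaterThan:
  "sets borel = sigma_sets UNIV (insert UNIV (range greaterThan :: 'a::{linorder_topology, second_countable_topology} set set))"
proof -
  have "sigma_sets UNIV (insert UNIV (range greaterThan :: 'a set set)) = sigma_sets UNIV (range greaterThan)"
    by (intro sigma_sets_eqI) (auto intro: sigma_sets_top sigma_sets.Basic)
  then show ?thesis by (simp add: borel_Ioi)
qed

text \<open>The half-lines generate the Borel sets, so the distribution function determines the
  whole image measure.\<close>

lemma distr_eq_of_equimeasurable:
  fixes f g :: "_ \<Rightarrow> ennreal"
  assumes [measurable]: "f \<in> borel_measurable M" "g \<in> borel_measurable N"
    and "finite_measure M" "emeasure M (space M) = emeasure N (space N)"
    and eq: "\<And>s. distr_fun M f s = distr_fun N g s"
  shows "distr M borel f = distr N borel g"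
proof (rule measure_eqI_generator_eq[where E = "insert UNIV (range greaterThan)" and \<Omega> = UNIV and A = "\<lambda>_. UNIV"])
  show "Int_stable (insert UNIV (range greaterThan :: ennreal set set))"
  proof -
    have "{a<..} \<inter> {b<..} = {max a b<..}" for a b :: ennreal by auto
    then show ?thesis by (auto simp: Int_stable_def simp del: greaterThan_Int_greaterThan)
  qed
  fix X :: "ennreal set" assume "X \<in> insert UNIV (range greaterThan)"
  then show "emeasure (distr M borel f) X = emeasure (distr N borel g) X"
    using assms(4) eq
    by (auto simp: emeasure_distr distr_fun_def vimage_def Int_def conj_commute)
next
  show "emeasure (distr M borel f) UNIV \<noteq> \<infinity>"
    using assms(3) by (simp add: emeasure_distr finite_measure.emeasure_finite)
qed (simp_all add: sets_borel_greaterThan)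

lemma nn_integral_equimeasurable:
  fixes f g :: "_ \<Rightarrow> ennreal"
  assumes [measurable]: "f \<in> borel_measurable M" "g \<in> borel_measurable N" "h \<in> borel_measurable borel"
    and "finite_measure M" "emeasure M (space M) = emeasure N (space N)"
    and "\<And>s. distr_fun M f s = distr_fun N g s"
  shows "(\<integral>\<^sup>+x. h (f x) \<partial>M) = (\<integral>\<^sup>+x. h (g x) \<partial>N)"
proof -
  have "(\<integral>\<^sup>+x. h (f x) \<partial>M) = (\<integral>\<^sup>+y. h y \<partial>distr M borel f)" by (simp add: nn_integral_distr)
  also have "\<dots> = (\<integral>\<^sup>+x. h (g x) \<partial>N)"
    unfolding distr_eq_of_equimeasurable[OF assms(1,2,4-6)] by (simp add: nn_integral_distr)
  finally show ?thesis .
qed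

lemma prob_space_unit_interval: "prob_space unit_interval"
  by (rule prob_spaceI) (simp add: emeasure_restrict_space)

lemma nn_integral_unit_interval:
  assumes "f \<in> borel_measurable borel"
  shows "(\<integral>\<^sup>+x. f x \<partial>unit_interval) = (\<integral>\<^sup>+x\<in>{0<..<1}. f x \<partial>lborel)"
  using assms by (simp add: nn_integral_restrict_space nn_integral_completion)

lemma nn_integral_rearr:
  fixes f :: "_ \<Rightarrow> ennreal"
  assumes [measurable]: "f \<in> borel_measurable M" "h \<in> borel_measurable borel" and "prob_space M"
  shows "(\<integral>\<^sup>+x. h (f x) \<partial>M) = (\<integral>\<^sup>+s\<in>{0<..<1}. h (rearr M f s) \<partial>lborel)"
proof -
  interpret prob_space M by fact
  interpret U: prob_space unit_interval by (rule prob_space_unit_interval)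
  have "(\<integral>\<^sup>+x. h (f x) \<partial>M) = (\<integral>\<^sup>+x. h (rearr M f x) \<partial>unit_interval)"
    using U.emeasure_space_1 emeasure_space_1
    by (intro nn_integral_equimeasurable)
       (auto simp: distr_fun_rearr finite_measure_axioms intro!: measurable_restrict_space1 measurable_completion)
  then show ?thesis by (simp add: nn_integral_unit_interval)
qed


section \<open>The K-functional formula for the averaged rearrangement\<close>

text \<open>The K-functional between \<open>L\<^sup>1\<close> and \<open>L\<^sup>\<infinity>\<close>: the optimal splittings of \<open>f\<close> are those into
  the truncation of \<open>f\<close> at a level \<open>c\<close> and the excess over \<open>c\<close>.\<close>

definition K_fun :: "'a measure \<Rightarrow> ('a \<Rightarrow> ennreal) \<Rightarrow> real \<Rightarrow> ennreal" where
  "K_fun M f t = (INF c. ennreal t * c + (\<integral>\<^sup>+x. f x - c \<partial>M))"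

lemma K_fun_le: "K_fun M f t \<le> ennreal t * c + (\<integral>\<^sup>+x. f x - c \<partial>M)"
  unfolding K_fun_def by (rule INF_lower) simp

lemma K_fun_mono_t:
  assumes "t \<le> t'" shows "K_fun M f t \<le> K_fun M f t'"
  unfolding K_fun_def[of M f t']
proof (rule INF_greatest)
  fix c
  have "ennreal t * c \<le> ennreal t' * c" by (rule mult_right_mono[OF ennreal_leI[OF assms]]) simp
  then show "K_fun M f t \<le> ennreal t' * c + (\<integral>\<^sup>+x. f x - c \<partial>M)"
    by (rule order_trans[OF K_fun_le[of M f t c] add_right_mono])
qed

lemma K_fun_le_integral: "K_fun M f t \<le> (\<integral>\<^sup>+x. f x \<partial>M)"
  using K_fun_le[of M f t 0] by simp

lemma ennreal_le_add_diff: "a \<le> c + (a - (c::ennreal))"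
proof (cases "a \<le> c")
  case True
  also have "c \<le> c + (a - c)" by simp
  finally show ?thesis .
qed (simp add: add_diff_inverse_ennreal)

lemma ennreal_add_diff_add_le: "(a + b) - (c + d) \<le> (a - c) + (b - (d::ennreal))"
proof -
  have "a + b \<le> (c + (a - c)) + (d + (b - d))" by (intro add_mono ennreal_le_add_diff)
  then show ?thesis by (auto simp: ennreal_minus_le_iff ac_simps)
qed

lemma le_INF_add_ennreal:
  fixes f :: "'i \<Rightarrow> ennreal"
  assumes "\<And>i. z \<le> f i + c" shows "z \<le> (INF i. f i) + c"
proof (cases "c = top")
  case False
  have "z - c \<le> (INF i. f i)"
    using assms False by (intro INF_greatest) (auto simp: ennreal_minus_le_iff add.commute)
  with False show ?thesis by (auto simp: ennreal_minus_le_iff add.commute)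
qed simp

lemma le_INF_mult_ennreal:
  fixes f :: "'i \<Rightarrow> ennreal"
  assumes "0 < a" "\<And>i. z \<le> ennreal a * f i" shows "z \<le> ennreal a * (INF i. f i)"
proof -
  have *: "ennreal (1/a) * (ennreal a * y) = y" "ennreal a * (ennreal (1/a) * y) = y" for y
    using assms(1) by (simp_all add: mult.assoc[symmetric] ennreal_mult[symmetric])
  have "ennreal (1/a) * z \<le> f i" for i
    using mult_left_mono[OF assms(2), of "ennreal (1/a)"] by (simp add: *)
  then have "ennreal a * (ennreal (1/a) * z) \<le> ennreal a * (INF i. f i)"
    by (intro mult_left_mono INF_greatest) auto
  then show ?thesis by (simp add: *)
qed

lemma K_fun_add:
  assumes [measurable]: "f \<in> borel_measurable M" "g \<in> borel_measurable M"
  shows "K_fun M (\<lambda>x. f x + g x) t \<le> K_fun M f t + K_fun M g t"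
proof -
  have "K_fun M (\<lambda>x. f x + g x) t
      \<le> (ennreal t * c + (\<integral>\<^sup>+x. f x - c \<partial>M)) + (ennreal t * d + (\<integral>\<^sup>+x. g x - d \<partial>M))" for c d
  proof -
    have "(\<integral>\<^sup>+x. (f x + g x) - (c + d) \<partial>M) \<le> (\<integral>\<^sup>+x. (f x - c) + (g x - d) \<partial>M)"
      by (intro nn_integral_mono ennreal_add_diff_add_le)
    also have "\<dots> = (\<integral>\<^sup>+x. f x - c \<partial>M) + (\<integral>\<^sup>+x. g x - d \<partial>M)"
      by (rule nn_integral_add) auto
    finally have "K_fun M (\<lambda>x. f x + g x) t \<le> ennreal t * (c + d) + ((\<integral>\<^sup>+x. f x - c \<partial>M) + (\<integral>\<^sup>+x. g x - d \<partial>M))"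
      by (rule order_trans[OF K_fun_le[of _ _ _ "c + d"] add_left_mono])
    then show ?thesis by (simp add: distrib_left ac_simps)
  qed
  then have "K_fun M (\<lambda>x. f x + g x) t \<le> K_fun M f t + (ennreal t * d + (\<integral>\<^sup>+x. g x - d \<partial>M))" for d
    unfolding K_fun_def[of M f] by (rule le_INF_add_ennreal)
  then show ?thesis
    unfolding K_fun_def[of M g] add.commute[of "K_fun M f t"] by (rule le_INF_add_ennreal)
qed

text \<open>\<open>K_fun\<close> is the integral of the rearrangement over an initial interval: truncating at the
  level \<open>c\<close> costs at most \<open>t * c\<close> on an interval of length \<open>t\<close>, with equality for the level
  \<open>c = rearr M f t\<close>. The infimum on the other side is visibly subadditive in \<open>f\<close>.\<close>

lemma integral_rearr_eq_K_fun:
  assumes [measurable]: "f \<in> borel_measurable M" and "prob_space M" and t: "0 < t" "t \<le> 1"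
  shows "(\<integral>\<^sup>+s\<in>{0..t}. rearr M f s \<partial>lborel) = K_fun M f t"
proof (rule antisym)
  let ?r = "rearr M f"
  have pos: "AE s in lborel. s \<noteq> (0::real) \<and> s \<noteq> 1" 
    using AE_lborel_singleton[of "0::real"] AE_lborel_singleton[of "1::real"] by eventually_elim auto
  have eq: "(\<integral>\<^sup>+x. f x - c \<partial>M) = (\<integral>\<^sup>+s\<in>{0<..<1}. (?r s - c) \<partial>lborel)" for c
    using nn_integral_rearr[OF assms(1) _ assms(2), of "\<lambda>y. y - c"] by simp
  have const: "(\<integral>\<^sup>+s\<in>{0..t}. c \<partial>lborel) = ennreal t * c" for c
    using t by (simp add: nn_integral_cmult_indicator mult.commute)
  show "(\<integral>\<^sup>+s\<in>{0..t}. ?r s \<partial>lborel) \<le> K_fun M f t"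
    unfolding K_fun_def
  proof (rule INF_greatest)
    fix c
    have "(\<integral>\<^sup>+s\<in>{0..t}. ?r s \<partial>lborel) \<le> (\<integral>\<^sup>+s. c * indicator {0..t} s + (?r s - c) * indicator {0<..<1} s \<partial>lborel)"
      using t by (intro nn_integral_mono_AE eventually_mono[OF pos])
        (auto simp: indicator_def intro: ennreal_le_add_diff)
    also have "\<dots> = ennreal t * c + (\<integral>\<^sup>+x. f x - c \<partial>M)"
      by (subst nn_integral_add) (auto simp: const eq)
    finally show "(\<integral>\<^sup>+s\<in>{0..t}. ?r s \<partial>lborel) \<le> ennreal t * c + (\<integral>\<^sup>+x. f x - c \<partial>M)" .
  qed
  let ?c = "?r t"
  show "K_fun M f t \<le> (\<integral>\<^sup>+s\<in>{0..t}. ?r s \<partial>lborel)"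
  proof (cases "?c = top")
    case True
    have "(\<integral>\<^sup>+s\<in>{0..t}. ?c \<partial>lborel) \<le> (\<integral>\<^sup>+s\<in>{0..t}. ?r s \<partial>lborel)"
      by (intro nn_integral_mono) (auto simp: indicator_def intro: rearr_antimono)
    then show ?thesis using True t by (simp add: const ennreal_mult_top top_unique)
  next
    case fin: False
  have "K_fun M f t \<le> ennreal t * ?c + (\<integral>\<^sup>+x. f x - ?c \<partial>M)" by (rule K_fun_le)
  also have "\<dots> = (\<integral>\<^sup>+s. ?c * indicator {0..t} s + (?r s - ?c) * indicator {0<..<1} s \<partial>lborel)"
    by (subst nn_integral_add) (auto simp: const eq)
  also have "\<dots> \<le> (\<integral>\<^sup>+s\<in>{0..t}. ?r s \<partial>lborel)"
  proof (rule nn_integral_mono)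
    fix s :: real
    show "?c * indicator {0..t} s + (?r s - ?c) * indicator {0<..<1} s \<le> ?r s * indicator {0..t} s"
    proof (cases "s \<le> t")
      case True
      then have "?c \<le> ?r s" by (rule rearr_antimono)
      with True show ?thesis by (auto simp: indicator_def add_diff_inverse_ennreal)
    next
      case False
      then have "?r s \<le> ?c" by (intro rearr_antimono) simp
      with False fin show ?thesis
        by (auto simp: indicator_def diff_eq_0_iff_ennreal top.not_eq_extremum dest: le_less_trans)
    qed
  qed
  finally show "K_fun M f t \<le> (\<integral>\<^sup>+s\<in>{0..t}. ?r s \<partial>lborel)" .
  qed
qed

lemma rearr_avg_eq_K_fun:
  assumes "f \<in> borel_measurable M" "prob_space M" "0 < t" "t \<le> 1"
  shows "rearr_avg M f t = ennreal (1 / t) * K_fun M f t"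
  unfolding rearr_avg_def by (simp add: integral_rearr_eq_K_fun[OF assms])

text \<open>Rearrangement is not subadditive, but its average is: the truncation levels of the two
  summands may be added.\<close>

lemma rearr_avg_add:
  assumes [measurable]: "f \<in> borel_measurable M" "g \<in> borel_measurable M"
    and M: "prob_space M" and t: "0 < t" "t \<le> 1"
  shows "rearr_avg M (\<lambda>x. f x + g x) t \<le> rearr_avg M f t + rearr_avg M g t"
  using K_fun_add[OF assms(1,2), of t]
  by (simp add: rearr_avg_eq_K_fun[OF _ M t] distrib_left[symmetric] mult_left_mono)

lemma rearr_avg_antimono:
  assumes [measurable]: "f \<in> borel_measurable M" and M: "prob_space M" and t: "0 < t" "t \<le> t'" "t' \<le> 1"
  shows "rearr_avg M f t' \<le> rearr_avg M f t"
proof -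
  have "ennreal (1/t') * K_fun M f t' \<le> ennreal (1/t) * (ennreal t * c + (\<integral>\<^sup>+x. f x - c \<partial>M))" for c
  proof -
    have "ennreal (1/t') * K_fun M f t' \<le> ennreal (1/t') * (ennreal t' * c + (\<integral>\<^sup>+x. f x - c \<partial>M))"
      by (intro mult_left_mono K_fun_le) auto
    also have "\<dots> = c + ennreal (1/t') * (\<integral>\<^sup>+x. f x - c \<partial>M)"
      using t by (simp add: distrib_left mult.assoc[symmetric] ennreal_mult[symmetric])
    also have "\<dots> \<le> c + ennreal (1/t) * (\<integral>\<^sup>+x. f x - c \<partial>M)"
      using t by (intro add_left_mono mult_right_mono ennreal_leI) (auto simp: frac_le)
    also have "\<dots> = ennreal (1/t) * (ennreal t * c + (\<integral>\<^sup>+x. f x - c \<partial>M))"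
      using t by (simp add: distrib_left mult.assoc[symmetric] ennreal_mult[symmetric])
    finally show ?thesis .
  qed
  then have "ennreal (1/t') * K_fun M f t' \<le> ennreal (1/t) * K_fun M f t"
    unfolding K_fun_def[of M f t] using t by (intro le_INF_mult_ennreal) auto
  then show ?thesis using t by (simp add: rearr_avg_eq_K_fun[OF _ M])
qed

lemma distr_fun_cmult:
  assumes "0 < a" shows "distr_fun M (\<lambda>x. ennreal a * f x) s = distr_fun M f (ennreal (1/a) * s)"
proof -
  have "s < ennreal a * y \<longleftrightarrow> ennreal (1/a) * s < y" for y
  proof -
    have "ennreal (1/a) * (ennreal a * y) = y"
      using assms by (simp add: mult.assoc[symmetric] ennreal_mult[symmetric])
    moreover have "ennreal a * (ennreal (1/a) * s) = s"
      using assms by (simp add: mult.assoc[symmetric] ennreal_mult[symmetric])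
    moreover have "0 < ennreal a" "ennreal a < top" "0 < ennreal (1/a)" "ennreal (1/a) < top" using assms by auto
    ultimately show ?thesis by (metis ennreal_mult_strict_left_mono)
  qed
  then show ?thesis by (simp add: distr_fun_def)
qed

lemma rearr_cmult:
  assumes [measurable]: "f \<in> borel_measurable M" and "0 < a"
  shows "rearr M (\<lambda>x. ennreal a * f x) t = ennreal a * rearr M f t"
proof -
  have "rearr M (\<lambda>x. ennreal a * f x) t \<le> s \<longleftrightarrow> ennreal a * rearr M f t \<le> s" for s
  proof -
    have "rearr M (\<lambda>x. ennreal a * f x) t \<le> s \<longleftrightarrow> rearr M f t \<le> ennreal (1/a) * s"
      using assms(2) by (simp add: rearr_le_iff distr_fun_cmult)
    also have "\<dots> \<longleftrightarrow> ennreal a * rearr M f t \<le> s"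
    proof -
      have "ennreal (1/a) * (ennreal a * y) = y" "ennreal a * (ennreal (1/a) * y) = y" for y
        using assms by (simp_all add: mult.assoc[symmetric] ennreal_mult[symmetric])
      then show ?thesis by (metis mult_left_mono zero_le)
    qed
    finally show ?thesis .
  qed
  then show ?thesis by (meson antisym order_refl)
qed

lemma rearr_mono_AE:
  assumes [measurable]: "f \<in> borel_measurable M" "g \<in> borel_measurable M" and "AE x in M. f x \<le> g x"
  shows "rearr M f t \<le> rearr M g t"
proof -
  have "distr_fun M f s \<le> distr_fun M g s" for s
    unfolding distr_fun_def using assms(3) by (intro emeasure_mono_AE) (auto elim!: eventually_mono)
  then show ?thesis using rearr_le_iff[OF assms(1)] rearr_le_iff[OF assms(2)] by (meson order_refl order_trans)
qed

lemma rearr_SUP: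
  assumes [measurable]: "f \<in> borel_measurable M" "\<And>j::nat. F j \<in> borel_measurable M"
    and ae: "AE x in M. incseq (\<lambda>j. F j x) \<and> (SUP j. F j x) = f x"
  shows "incseq (\<lambda>j. rearr M (F j) t)" "(SUP j. rearr M (F j) t) = rearr M f t"
proof -
  show "incseq (\<lambda>j. rearr M (F j) t)"
  proof (rule incseq_SucI)
    fix j show "rearr M (F j) t \<le> rearr M (F (Suc j)) t"
      by (rule rearr_mono_AE) (use ae in \<open>auto elim!: eventually_mono intro: incseq_SucD\<close>)
  qed
  have distr: "(SUP j. distr_fun M (F j) s) = distr_fun M f s" for s
  proof -
    have 1: "distr_fun M g s = (\<integral>\<^sup>+x. indicator {y. s < y} (g x) \<partial>M)" if [measurable]: "g \<in> borel_measurable M" for g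
    proof -
      have "(\<integral>\<^sup>+x. indicator {y. s < y} (g x) \<partial>M) = (\<integral>\<^sup>+x. indicator {x\<in>space M. s < g x} x \<partial>M)"
        by (intro nn_integral_cong) (auto simp: indicator_def)
      then show ?thesis by (simp add: distr_fun_def)
    qed
    have "(\<integral>\<^sup>+x. indicator {y. s < y} (f x) \<partial>M) = (\<integral>\<^sup>+x. (SUP j. indicator {y. s < y} (F j x)) \<partial>M)"
      using ae
    proof (intro nn_integral_cong_AE, eventually_elim)
      case (elim x)
      then have "s < f x \<longleftrightarrow> (\<exists>j. s < F j x)" by (metis less_SUP_iff UNIV_I)
      then show ?case by (auto simp: indicator_def intro!: antisym SUP_upper2 SUP_least)
    qed
    also have "\<dots> = (SUP j. \<integral>\<^sup>+x. indicator {y. s < y} (F j x) \<partial>M)"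
      using ae by (intro nn_integral_monotone_convergence_SUP_AE)
        (auto elim!: eventually_mono simp: indicator_def dest: incseq_SucD less_le_trans)
    finally show ?thesis unfolding 1[OF assms(1)] 1[OF assms(2)] by (rule sym)
  qed
  have "(SUP j. rearr M (F j) t) \<le> s \<longleftrightarrow> rearr M f t \<le> s" for s
    by (simp add: SUP_le_iff rearr_le_iff distr[symmetric])
  then show "(SUP j. rearr M (F j) t) = rearr M f t" by (meson antisym order_refl)
qed

lemma rearr_cong_distr_fun:
  "(\<And>s. distr_fun M f s = distr_fun N g s) \<Longrightarrow> rearr M f t = rearr N g t"
  by (simp add: rearr_def)


section \<open>Rearrangement invariant norms\<close>

context
  fixes M :: "'a measure" and \<rho>
  assumes bfn: "banach_function_norm M \<rho>"
begin

lemma bfn_eq_0_iff: "f \<in> borel_measurable M \<Longrightarrow> \<rho> f = 0 \<longleftrightarrow> (AE x in M. f x = 0)"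
  using bfn by (auto simp: banach_function_norm_def)

lemma bfn_add: "f \<in> borel_measurable M \<Longrightarrow> g \<in> borel_measurable M \<Longrightarrow> \<rho> (\<lambda>x. f x + g x) \<le> \<rho> f + \<rho> g"
  using bfn by (auto simp: banach_function_norm_def)

lemma bfn_cmult: "f \<in> borel_measurable M \<Longrightarrow> 0 \<le> a \<Longrightarrow> \<rho> (\<lambda>x. ennreal a * f x) = ennreal a * \<rho> f"
  using bfn by (auto simp: banach_function_norm_def)

lemma bfn_mono:
  "f \<in> borel_measurable M \<Longrightarrow> g \<in> borel_measurable M \<Longrightarrow> (AE x in M. f x \<le> g x) \<Longrightarrow> \<rho> f \<le> \<rho> g"
  using bfn by (auto simp: banach_function_norm_def)

lemma bfn_Fatou:
  assumes "f \<in> borel_measurable M" "\<And>j::nat. F j \<in> borel_measurable M"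
    "AE x in M. incseq (\<lambda>j. F j x) \<and> (SUP j. F j x) = f x"
  shows "incseq (\<lambda>j. \<rho> (F j))" "(SUP j. \<rho> (F j)) = \<rho> f"
  using bfn assms unfolding banach_function_norm_def by blast+

lemma bfn_one: "\<rho> (\<lambda>_. 1) < \<infinity>"
  using bfn by (auto simp: banach_function_norm_def)

lemma bfn_integral:
  obtains C where "0 < C" "\<And>f. f \<in> borel_measurable M \<Longrightarrow> (\<integral>\<^sup>+x. f x \<partial>M) \<le> ennreal C * \<rho> f"
proof -
  obtain C :: real where C: "\<forall>f\<in>borel_measurable M. (\<integral>\<^sup>+x. f x \<partial>M) \<le> ennreal C * \<rho> f"
    using bfn by (auto simp: banach_function_norm_def)
  show thesis
  proof
    show "0 < max C 1" by simp
    fix f :: "'a \<Rightarrow> ennreal" assume "f \<in> borel_measurable M"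
    then have "(\<integral>\<^sup>+x. f x \<partial>M) \<le> ennreal C * \<rho> f" using C by auto
    also have "\<dots> \<le> ennreal (max C 1) * \<rho> f" by (intro mult_right_mono ennreal_leI) auto
    finally show "(\<integral>\<^sup>+x. f x \<partial>M) \<le> ennreal (max C 1) * \<rho> f" .
  qed
qed

lemma bfn_cong_AE:
  assumes "f \<in> borel_measurable M" "g \<in> borel_measurable M" "AE x in M. f x = g x"
  shows "\<rho> f = \<rho> g"
  using assms by (intro antisym bfn_mono) (auto elim!: eventually_mono)

lemma bfn_const:
  assumes "0 \<le> a" shows "\<rho> (\<lambda>_. ennreal a) = ennreal a * \<rho> (\<lambda>_. 1)"
  using bfn_cmult[of "\<lambda>_. 1" a] assms by simp

lemma bfn_sum:
  assumes "finite A" "\<And>i. i \<in> A \<Longrightarrow> f i \<in> borel_measurable M"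
  shows "\<rho> (\<lambda>x. \<Sum>i\<in>A. f i x) \<le> (\<Sum>i\<in>A. \<rho> (f i))"
  using assms
proof (induction A rule: finite_induct)
  case empty
  then show ?case using bfn_eq_0_iff[of "\<lambda>_. 0"] by simp
next
  case (insert i A)
  then have "\<rho> (\<lambda>x. f i x + (\<Sum>i\<in>A. f i x)) \<le> \<rho> (f i) + \<rho> (\<lambda>x. \<Sum>i\<in>A. f i x)"
    by (intro bfn_add) auto
  also have "\<dots> \<le> \<rho> (f i) + (\<Sum>i\<in>A. \<rho> (f i))" using insert by (intro add_left_mono) auto
  finally show ?case using insert by simp
qed

lemma bfn_suminf:
  fixes f :: "nat \<Rightarrow> 'a \<Rightarrow> ennreal"
  assumes [measurable]: "\<And>i. f i \<in> borel_measurable M"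
  shows "\<rho> (\<lambda>x. \<Sum>i. f i x) \<le> (\<Sum>i. \<rho> (f i))"
proof -
  have "(SUP k. \<rho> (\<lambda>x. \<Sum>i<k. f i x)) = \<rho> (\<lambda>x. \<Sum>i. f i x)"
    by (rule bfn_Fatou(2)) (auto simp: suminf_eq_SUP[symmetric] intro!: incseq_SucI)
  moreover have "(SUP k. \<rho> (\<lambda>x. \<Sum>i<k. f i x)) \<le> (\<Sum>i. \<rho> (f i))"
  proof (rule SUP_least)
    fix k
    have "\<rho> (\<lambda>x. \<Sum>i<k. f i x) \<le> (\<Sum>i<k. \<rho> (f i))" by (rule bfn_sum) auto
    also have "\<dots> \<le> (\<Sum>i. \<rho> (f i))" by (rule sum_le_suminf) auto
    finally show "\<rho> (\<lambda>x. \<Sum>i<k. f i x) \<le> (\<Sum>i. \<rho> (f i))" .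
  qed
  ultimately show ?thesis by simp
qed

lemma bfn_finite_AE:
  assumes [measurable]: "f \<in> borel_measurable M" and "\<rho> f < \<infinity>"
  shows "(\<integral>\<^sup>+x. f x \<partial>M) < \<infinity>" "AE x in M. f x < \<infinity>"
proof -
  obtain C where C: "0 < C" "\<And>f. f \<in> borel_measurable M \<Longrightarrow> (\<integral>\<^sup>+x. f x \<partial>M) \<le> ennreal C * \<rho> f"
    using bfn_integral by blast
  have "ennreal C * \<rho> f < \<infinity>" using assms(2) by (simp add: ennreal_mult_less_top)
  then show *: "(\<integral>\<^sup>+x. f x \<partial>M) < \<infinity>" using C(2)[OF assms(1)] by (rule le_less_trans[rotated])
  then show "AE x in M. f x < \<infinity>"
    using nn_integral_PInf_AE[OF assms(1)] by (auto simp: top.not_eq_extremum)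
qed

end

lemma ri_norm_bfn: "ri_norm M \<rho> \<Longrightarrow> banach_function_norm M \<rho>"
  by (simp add: ri_norm_def)

lemma absf_enn2real: "f x < top \<Longrightarrow> absf (\<lambda>x. enn2real (f x)) x = f x"
  by (simp add: absf_def)

lemma measurable_absf[measurable]: "f \<in> borel_measurable M \<Longrightarrow> absf f \<in> borel_measurable M"
  unfolding absf_def by measurable

lemma distr_fun_cong_AE:
  assumes [measurable]: "f \<in> borel_measurable M" "g \<in> borel_measurable M" and "AE x in M. f x = g x"
  shows "distr_fun M f s = distr_fun M g s"
  unfolding distr_fun_def by (rule emeasure_eq_AE) (use assms(3) in \<open>auto elim!: eventually_mono\<close>)

text \<open>Rearrangement invariance extends to functions with infinite values: if those are taken on a
  set of positive measure, then the integral, and with it the norm, is infinite.\<close>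

lemma ri_norm_equimeasurable:
  assumes ri: "ri_norm M \<rho>" and M: "prob_space M"
    and [measurable]: "f \<in> borel_measurable M" "g \<in> borel_measurable M"
    and eq: "\<And>s. distr_fun M f s = distr_fun M g s"
  shows "\<rho> f = \<rho> g"
proof -
  interpret prob_space M by fact
  have bfn: "banach_function_norm M \<rho>" using ri by (rule ri_norm_bfn)
  have int: "(\<integral>\<^sup>+x. h (f x) \<partial>M) = (\<integral>\<^sup>+x. h (g x) \<partial>M)" if "h \<in> borel_measurable borel" for h
    by (rule nn_integral_equimeasurable) (use eq that in \<open>auto simp: finite_measure_axioms\<close>)
  have fin: "(\<integral>\<^sup>+x. indicator {top} (k x) \<partial>M) = 0 \<longleftrightarrow> (AE x in M. k x < top)"
    if [measurable]: "k \<in> borel_measurable M" for k :: "_ \<Rightarrow> ennreal"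
  proof -
    have "(\<integral>\<^sup>+x. indicator {top} (k x) \<partial>M) = 0 \<longleftrightarrow> (AE x in M. indicator {top} (k x) = (0::ennreal))"
      by (intro nn_integral_0_iff_AE measurable_compose[OF that borel_measurable_indicator]) simp
    also have "\<dots> \<longleftrightarrow> (AE x in M. k x < top)"
      by (rule AE_cong) (simp add: indicator_def less_top[symmetric])
    finally show ?thesis .
  qed
  show ?thesis
  proof (cases "AE x in M. f x < top")
    case True
    moreover have "AE x in M. g x < top"
      using True fin[of f] fin[of g] int[of "indicator {top}"] by auto
    moreover have *: "AE x in M. absf (\<lambda>x. enn2real (k x)) x = k x" if "AE x in M. k x < top" for k
      using that by (auto elim!: eventually_mono simp: absf_enn2real)
    ultimately have ae: "AE x in M. absf (\<lambda>x. enn2real (f x)) x = f x" "AE x in M. absf (\<lambda>x. enn2real (g x)) x = g x"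
      by blast+
    have "\<rho> (absf (\<lambda>x. enn2real (f x))) = \<rho> (absf (\<lambda>x. enn2real (g x)))"
      using ri distr_fun_cong_AE[OF _ _ ae(1)] distr_fun_cong_AE[OF _ _ ae(2)] eq
      unfolding ri_norm_def by auto
    then show ?thesis
      using bfn_cong_AE[OF bfn _ _ ae(1)] bfn_cong_AE[OF bfn _ _ ae(2)] by simp
  next
    case False
    then have "\<not> (AE x in M. g x < top)"
      using fin[of f] fin[of g] int[of "indicator {top}"] by auto
    with False have "\<not> \<rho> f < \<infinity>" "\<not> \<rho> g < \<infinity>" using bfn_finite_AE(2)[OF bfn] by fastforce+
    then show ?thesis by (simp add: less_top[symmetric])
  qed
qed

lemma measurable_unit_interval: "f \<in> borel_measurable borel \<Longrightarrow> f \<in> borel_measurable unit_interval"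
  by (rule measurable_restrict_space1) (simp add: measurable_completion)

lemma measurable_rearr_unit_interval[simp, measurable]: "rearr M f \<in> borel_measurable unit_interval"
  by (rule measurable_unit_interval) simp

lemma ri_norm_unit_interval_rearr:
  assumes "ri_norm unit_interval r" and [measurable]: "f \<in> borel_measurable unit_interval"
  shows "r (rearr unit_interval f) = r f"
proof (rule ri_norm_equimeasurable[OF assms(1) prob_space_unit_interval _ assms(2)])
  show "distr_fun unit_interval (rearr unit_interval f) s = distr_fun unit_interval f s" for s
    using prob_space.emeasure_space_1[OF prob_space_unit_interval] by (intro distr_fun_rearr assms(2)) simp
qed simp

lemma ri_norm_unit_interval_mono:
  assumes "ri_norm unit_interval r"
    and [measurable]: "f \<in> borel_measurable unit_interval" "g \<in> borel_measurable unit_interval"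
    and "\<And>s. distr_fun unit_interval f s \<le> distr_fun unit_interval g s"
  shows "r f \<le> r g"
proof -
  have "rearr unit_interval f t \<le> rearr unit_interval g t" for t
    using rearr_le_iff[OF assms(2)] rearr_le_iff[OF assms(3)] assms(4) by (meson order_refl order_trans)
  then have "r (rearr unit_interval f) \<le> r (rearr unit_interval g)"
    by (intro bfn_mono[OF ri_norm_bfn[OF assms(1)]]) simp_all
  then show ?thesis using assms by (simp add: ri_norm_unit_interval_rearr)
qed


section \<open>The Luxemburg representation\<close>

text \<open>The norm of \<open>g\<close> on the unit interval is the norm \<open>X\<close> of \<open>g \<circ> \<sigma>\<close>. It represents \<open>X\<close>,
  since \<open>rearr M f \<circ> \<sigma>\<close> is equimeasurable with \<open>f\<close>.\<close>

lemma luxemburg_exists: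
  assumes ri: "ri_norm M X" and M: "prob_space M"
    and \<sigma>: "\<sigma> \<in> measurable M unit_interval" "distr M unit_interval \<sigma> = unit_interval"
  shows "\<exists>r. ri_norm unit_interval r \<and> (\<forall>f\<in>borel_measurable M. fnorm X f = r (rearr M (absf f)))"
proof -
  interpret prob_space M by fact
  note bfn = ri_norm_bfn[OF ri]
  note [measurable] = \<sigma>(1)
  define r where "r g = X (\<lambda>x. g (\<sigma> x))" for g
  have comp[measurable]: "(\<lambda>x. g (\<sigma> x)) \<in> borel_measurable M" if "g \<in> borel_measurable unit_interval" for g :: "real \<Rightarrow> ennreal"
    using that by measurable
  have AE: "(AE y in unit_interval. P y) \<Longrightarrow> (AE x in M. P (\<sigma> x))" for P
    using AE_distrD[OF \<sigma>(1), of P] unfolding \<sigma>(2) by blast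
  have AE': "(AE y in unit_interval. g y = 0) \<longleftrightarrow> (AE x in M. g (\<sigma> x) = 0)"
    if [measurable]: "g \<in> borel_measurable unit_interval" for g :: "real \<Rightarrow> ennreal"
  proof -
    have "(AE y in distr M unit_interval \<sigma>. g y = 0) \<longleftrightarrow> (AE x in M. g (\<sigma> x) = 0)"
      by (rule AE_distr_iff[OF \<sigma>(1)]) measurable
    then show ?thesis unfolding \<sigma>(2) .
  qed
  have int: "(\<integral>\<^sup>+x. g x \<partial>unit_interval) = (\<integral>\<^sup>+x. g (\<sigma> x) \<partial>M)"
    if [measurable]: "g \<in> borel_measurable unit_interval" for g :: "real \<Rightarrow> ennreal"
  proof -
    have "(\<integral>\<^sup>+x. g x \<partial>distr M unit_interval \<sigma>) = (\<integral>\<^sup>+x. g (\<sigma> x) \<partial>M)"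
      by (rule nn_integral_distr) measurable
    then show ?thesis unfolding \<sigma>(2) .
  qed
  have distr: "distr_fun M (\<lambda>x. g (\<sigma> x)) s = distr_fun unit_interval g s"
    if [measurable]: "g \<in> borel_measurable unit_interval" for g s
  proof -
    have "distr_fun unit_interval g s = emeasure (distr M unit_interval \<sigma>) {x \<in> space unit_interval. s < g x}"
      unfolding distr_fun_def \<sigma>(2) ..
    also have "\<dots> = emeasure M (\<sigma> -` {x \<in> space unit_interval. s < g x} \<inter> space M)"
      by (rule emeasure_distr) measurable
    also have "\<sigma> -` {x \<in> space unit_interval. s < g x} \<inter> space M = {x \<in> space M. s < g (\<sigma> x)}"
      using measurable_space[OF \<sigma>(1)] by auto
    finally show ?thesis by (simp add: distr_fun_def)
  qed
  obtain C where C: "0 < C" "\<And>f. f \<in> borel_measurable M \<Longrightarrow> (\<integral>\<^sup>+x. f x \<partial>M) \<le> ennreal C * X f"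
    using bfn_integral[OF bfn] by blast
  have "banach_function_norm unit_interval r"
    unfolding banach_function_norm_def
  proof (intro conjI ballI allI impI)
    show "\<exists>C. \<forall>f\<in>borel_measurable unit_interval. (\<integral>\<^sup>+x. f x \<partial>unit_interval) \<le> ennreal C * r f"
      using C by (intro exI[of _ C] ballI) (auto simp: int r_def comp)
    show "r (\<lambda>_. 1) < \<infinity>" using bfn_one[OF bfn] by (simp add: r_def)
  next
    fix f :: "real \<Rightarrow> ennreal" assume "f \<in> borel_measurable unit_interval"
    then show "r f = 0 \<longleftrightarrow> (AE x in unit_interval. f x = 0)" unfolding r_def
      by (subst bfn_eq_0_iff[OF bfn]) (auto simp: AE')
  next
    fix f g :: "real \<Rightarrow> ennreal" assume "f \<in> borel_measurable unit_interval" "g \<in> borel_measurable unit_interval"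
    then show "r (\<lambda>x. f x + g x) \<le> r f + r g" unfolding r_def by (intro bfn_add[OF bfn] comp)
  next
    fix f :: "real \<Rightarrow> ennreal" and a :: real assume "f \<in> borel_measurable unit_interval" "0 \<le> a"
    then show "r (\<lambda>x. ennreal a * f x) = ennreal a * r f" unfolding r_def by (intro bfn_cmult[OF bfn] comp)
  next
    fix f g :: "real \<Rightarrow> ennreal" assume "f \<in> borel_measurable unit_interval" "g \<in> borel_measurable unit_interval"
      "AE x in unit_interval. g x \<le> f x"
    then show "r g \<le> r f" unfolding r_def by (intro bfn_mono[OF bfn] comp AE)
  next
    fix F :: "nat \<Rightarrow> real \<Rightarrow> ennreal" and f
    assume *: "f \<in> borel_measurable unit_interval" "\<forall>j. F j \<in> borel_measurable unit_interval"
      "AE x in unit_interval. incseq (\<lambda>j. F j x) \<and> (SUP j. F j x) = f x"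
    show "incseq (\<lambda>j. r (F j))" unfolding r_def
      by (rule bfn_Fatou(1)[OF bfn comp[OF *(1)] comp AE[OF *(3)]]) (use *(2) in auto)
    show "(SUP j. r (F j)) = r f" unfolding r_def
      by (rule bfn_Fatou(2)[OF bfn comp[OF *(1)] comp AE[OF *(3)]]) (use *(2) in auto)
  qed
  moreover have "r (absf f) = r (absf g)"
    if [measurable]: "f \<in> borel_measurable unit_interval" "g \<in> borel_measurable unit_interval"
      and eq: "\<And>t. 0 \<le> t \<Longrightarrow> distr_fun unit_interval (absf f) (ennreal t) = distr_fun unit_interval (absf g) (ennreal t)" for f g
  proof -
    have "distr_fun unit_interval (absf f) s = distr_fun unit_interval (absf g) s" for s
      using eq by (cases s) (auto simp: distr_fun_def)
    then show ?thesis unfolding r_def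
      by (intro ri_norm_equimeasurable[OF ri M]) (auto simp: distr)
  qed
  ultimately have "ri_norm unit_interval r" unfolding ri_norm_def by blast
  moreover have "fnorm X f = r (rearr M (absf f))" if [measurable]: "f \<in> borel_measurable M" for f
  proof -
    show ?thesis unfolding fnorm_def r_def
      by (rule ri_norm_equimeasurable[OF ri M]) (auto simp: distr distr_fun_rearr emeasure_space_1)
  qed
  ultimately show ?thesis by blast
qed

lemma luxemburg_ri_norm:
  assumes "ri_norm M X" "prob_space M"
    and "\<sigma> \<in> measurable M unit_interval" "distr M unit_interval \<sigma> = unit_interval"
  shows "ri_norm unit_interval (luxemburg M X)"
  unfolding luxemburg_def by (rule someI2_ex[OF luxemburg_exists[OF assms]]) blast

lemma luxemburg_represents:
  assumes ri: "ri_norm M X" "prob_space M"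
    and \<sigma>: "\<sigma> \<in> measurable M unit_interval" "distr M unit_interval \<sigma> = unit_interval"
    and [measurable]: "f \<in> borel_measurable M" and fin: "AE x in M. f x < \<infinity>"
  shows "X f = luxemburg M X (rearr M f)"
proof -
  have rep: "fnorm X g = luxemburg M X (rearr M (absf g))" if "g \<in> borel_measurable M" for g
    unfolding luxemburg_def by (rule someI2_ex[OF luxemburg_exists[OF assms(1-4)]]) (use that in blast)
  have ae: "AE x in M. absf (\<lambda>x. enn2real (f x)) x = f x"
    using fin by (auto elim!: eventually_mono simp: absf_enn2real)
  have "rearr M (absf (\<lambda>x. enn2real (f x))) = rearr M f"
    by (intro ext rearr_cong_distr_fun distr_fun_cong_AE[OF _ _ ae]) auto
  then show ?thesis
    using rep[of "\<lambda>x. enn2real (f x)"] bfn_cong_AE[OF ri_norm_bfn[OF ri(1)] _ _ ae] by (simp add: fnorm_def)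
qed


section \<open>Dilations and the Hardy operator\<close>

lemma borel_measurable_mono_ennreal:
  fixes f :: "real \<Rightarrow> ennreal"
  assumes "mono f" shows "f \<in> borel_measurable borel"
proof (rule borel_measurableI_greater)
  fix y
  have "is_interval {x. y < f x}"
    using monoD[OF assms] by (auto simp: is_interval_1 dest: less_le_trans)
  then show "{x \<in> space borel. y < f x} \<in> sets borel"
    by (simp add: real_interval_borel_measurable)
qed

lemma distr_fun_unit_interval_lebesgue:
  assumes "g \<in> borel_measurable unit_interval"
  shows "distr_fun unit_interval g s = (\<integral>\<^sup>+x. indicator {x\<in>{0<..<1}. s < g x} x \<partial>lebesgue)"
    and "{x\<in>{0<..<1}. s < g x} \<in> sets lebesgue"
proof -
  have "{x\<in>space unit_interval. s < g x} \<in> sets unit_interval" using assms by measurable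
  then show *: "{x\<in>{0<..<1}. s < g x} \<in> sets lebesgue"
    by (simp add: sets_restrict_space_iff)
  have "distr_fun unit_interval g s = emeasure lebesgue {x\<in>{0<..<1}. s < g x}"
    unfolding distr_fun_def by (subst emeasure_restrict_space) auto
  then show "distr_fun unit_interval g s = (\<integral>\<^sup>+x. indicator {x\<in>{0<..<1}. s < g x} x \<partial>lebesgue)"
    using * by simp
qed

lemma dilation_unit_interval: "1 < t \<Longrightarrow> 0 < x \<Longrightarrow> x < 1 \<Longrightarrow> dilation t f x = f (x / t)"
  by (simp add: dilation_def)

lemma measurable_dilation:
  assumes "f \<in> borel_measurable unit_interval" "1 < t"
  shows "dilation t f \<in> borel_measurable unit_interval"
proof -
  have "(\<lambda>x. if x \<in> {0<..<1} then f x else 0) \<in> borel_measurable lebesgue"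
    using assms(1) by (subst borel_measurable_if) auto
  from measurable_compose[OF lebesgue_measurable_scaling[of "1/t"] this]
  have "(\<lambda>x. if (1/t) *\<^sub>R x \<in> {0<..<1} then f ((1/t) *\<^sub>R x) else 0) \<in> borel_measurable unit_interval"
    by (rule measurable_restrict_space1)
  also have "?this \<longleftrightarrow> ?thesis"
    using assms(2) by (intro measurable_cong) (auto simp: dilation_unit_interval divide_less_eq)
  finally show ?thesis .
qed

lemma distr_fun_dilation:
  assumes "f \<in> borel_measurable unit_interval" "1 < t"
  shows "distr_fun unit_interval (absf (dilation t f)) s \<le> ennreal t * distr_fun unit_interval (absf f) s"
proof -
  let ?A = "{x\<in>{0<..<1}. s < absf (dilation t f) x}" and ?B = "{x\<in>{0<..<1}. s < absf f x}"
  have A: "?A \<in> sets lebesgue"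
    by (intro distr_fun_unit_interval_lebesgue(2) measurable_absf measurable_dilation assms)
  have "distr_fun unit_interval (absf (dilation t f)) s = (\<integral>\<^sup>+x. indicator ?A x \<partial>lebesgue)"
    by (intro distr_fun_unit_interval_lebesgue(1) measurable_absf measurable_dilation assms)
  also have "\<dots> = ennreal \<bar>t\<bar> * (\<integral>\<^sup>+x. indicator ?A (0 + t * x) \<partial>lebesgue)"
    using A assms(2) by (intro nn_integral_real_affine_lebesgue) auto
  also have "\<dots> \<le> ennreal t * (\<integral>\<^sup>+x. indicator ?B x \<partial>lebesgue)"
  proof (intro mult_mono nn_integral_mono)
    fix x :: real
    show "indicator ?A (0 + t * x) \<le> (indicator ?B x :: ennreal)"
    proof (cases "0 + t * x \<in> ?A")
      case True
      then have tx: "0 < t * x" "t * x < 1" by auto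
      from tx(1) assms(2) have "0 < x" by (simp add: zero_less_mult_iff)
      moreover have "x < 1"
      proof -
        have "x \<le> t * x" using assms(2) \<open>0 < x\<close> by (simp add: mult_le_cancel_right1)
        with tx(2) show ?thesis by linarith
      qed
      moreover have "absf (dilation t f) (t * x) = absf f x"
        using dilation_unit_interval[OF assms(2) tx(1) tx(2), of f] assms(2) by (simp add: absf_def)
      ultimately show ?thesis using True by simp
    qed simp
  qed (use assms(2) in auto)
  also have "(\<integral>\<^sup>+x. indicator ?B x \<partial>lebesgue) = distr_fun unit_interval (absf f) s"
    by (intro distr_fun_unit_interval_lebesgue(1)[symmetric] measurable_absf assms)
  finally show ?thesis .
qed

text \<open>A function whose distribution function is at most \<open>N\<close> times that of \<open>f\<close> is equimeasurable
  with a sum of \<open>N\<close> functions, each of which is distributed below \<open>f\<close>: put \<open>N\<close> copies of it,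
  each compressed by the factor \<open>N\<close>, next to each other.\<close>

lemma ri_norm_le_of_distr_fun_le:
  assumes ri: "ri_norm unit_interval r" and N: "0 < (N::nat)"
    and f: "f \<in> borel_measurable unit_interval" and g: "g \<in> borel_measurable unit_interval"
    and le: "\<And>s. distr_fun unit_interval g s \<le> of_nat N * distr_fun unit_interval f s"
  shows "r g \<le> of_nat N * r f"
proof -
  note bfn = ri_norm_bfn[OF ri]
  define G where "G = rearr unit_interval g"
  have [measurable]: "G \<in> borel_measurable borel" by (simp add: G_def)
  define p where "p i x = indicator {0<..<1} (real N * x - real i) * G (real N * x - real i)" for i :: nat and x
  have p[measurable]: "p i \<in> borel_measurable borel" for i unfolding p_def by measurable
  have supp: "0 < real N * x - real i \<and> real N * x - real i < 1" if "s < p i x" for i x s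
    by (rule ccontr) (use that in \<open>auto simp: p_def\<close>)
  have sub: "0 < x \<and> x < 1" if "i < N" "0 < real N * x - real i" "real N * x - real i < 1" for i x
  proof -
    have "real i + 1 \<le> real N" using that(1) by linarith
    moreover have "0 < real N * x" using that(2) by linarith
    moreover have "real N * x < real N * 1" using calculation that by linarith
    ultimately show ?thesis using N by (auto simp: zero_less_mult_iff)
  qed
  let ?S = "\<lambda>s i. {x. s < p i x} \<inter> {0<..<1}"
  have dp: "of_nat N * distr_fun unit_interval (p i) s = distr_fun unit_interval g s" if "i < N" for i s
  proof -
    let ?A = "{x. s < G x} \<inter> {0<..<1}"
    have "?S s i = {x. - real i + real N * x \<in> ?A}"
      using sub[OF that] by (auto simp: p_def indicator_def)
    then have "distr_fun unit_interval (p i) s = emeasure lborel {x. - real i + real N * x \<in> ?A}"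
      by (simp add: distr_fun_unit_interval)
    also have "\<dots> = (\<integral>\<^sup>+x. indicator ?A (- real i + real N * x) \<partial>lborel)"
    proof -
      have "(\<integral>\<^sup>+x. indicator ?A (- real i + real N * x) \<partial>lborel) = (\<integral>\<^sup>+x. indicator {x. - real i + real N * x \<in> ?A} x \<partial>lborel)"
        by (intro nn_integral_cong) (simp add: indicator_def)
      also have "\<dots> = emeasure lborel {x. - real i + real N * x \<in> ?A}" by (rule nn_integral_indicator) measurable
      finally show ?thesis by simp
    qed
    finally have "ennreal \<bar>real N\<bar> * distr_fun unit_interval (p i) s = (\<integral>\<^sup>+x. indicator ?A x \<partial>lborel)"
      using N nn_integral_real_affine[of "indicator ?A" "real N" "- real i"] by simp
    also have "\<dots> = distr_fun unit_interval G s" by (simp add: distr_fun_unit_interval)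
    also have "\<dots> = distr_fun unit_interval g s"
      unfolding G_def using prob_space.emeasure_space_1[OF prob_space_unit_interval] by (intro distr_fun_rearr g) simp
    finally show ?thesis by (simp add: ennreal_of_nat_eq_real_of_nat)
  qed
  have "r g \<le> r (\<lambda>x. \<Sum>i<N. p i x)"
  proof (rule ri_norm_unit_interval_mono[OF ri g])
    show m: "(\<lambda>x. \<Sum>i<N. p i x) \<in> borel_measurable unit_interval" by (rule measurable_unit_interval) measurable
    fix s
    have disj: "disjoint_family_on (?S s) {..<N}"
      unfolding disjoint_family_on_def
    proof (intro ballI impI)
      fix i j :: nat assume "i \<noteq> j"
      have "i = j" if "x \<in> ?S s i" "x \<in> ?S s j" for x
      proof -
        have "0 < real N * x - real i" "real N * x - real i < 1" "0 < real N * x - real j" "real N * x - real j < 1"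
          using that supp by auto
        then show ?thesis by linarith
      qed
      with \<open>i \<noteq> j\<close> show "?S s i \<inter> ?S s j = {}" by blast
    qed
    have "distr_fun unit_interval g s = (\<Sum>i<N. distr_fun unit_interval (p i) s)"
    proof -
      have "ennreal (real N) * (\<Sum>i<N. distr_fun unit_interval (p i) s) = ennreal (real N) * distr_fun unit_interval g s"
        using dp by (simp add: sum_distrib_left ennreal_of_nat_eq_real_of_nat)
      then show ?thesis using N by (simp add: ennreal_mult_cancel_left)
    qed
    also have "\<dots> = (\<Sum>i<N. emeasure lborel (?S s i))" by (simp add: distr_fun_unit_interval)
    also have "\<dots> = emeasure lborel (\<Union>i<N. ?S s i)"
      by (rule sum_emeasure[OF _ disj]) auto
    also have "\<dots> \<le> emeasure lborel ({x. s < (\<Sum>i<N. p i x)} \<inter> {0<..<1})"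
    proof (rule emeasure_mono)
      have "p i x \<le> (\<Sum>i<N. p i x)" if "i < N" for i x using that by (intro member_le_sum) auto
      then show "(\<Union>i<N. ?S s i) \<subseteq> {x. s < (\<Sum>i<N. p i x)} \<inter> {0<..<1}"
        by (auto elim: less_le_trans)
    qed simp
    also have "\<dots> = distr_fun unit_interval (\<lambda>x. \<Sum>i<N. p i x) s"
      by (subst distr_fun_unit_interval) auto
    finally show "distr_fun unit_interval g s \<le> distr_fun unit_interval (\<lambda>x. \<Sum>i<N. p i x) s" .
  qed
  also have "\<dots> \<le> (\<Sum>i<N. r (p i))"
    by (rule bfn_sum[OF bfn]) (auto intro: measurable_unit_interval)
  also have "\<dots> \<le> (\<Sum>i<N. r f)"
  proof (intro sum_mono ri_norm_unit_interval_mono[OF ri _ f])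
    fix i s assume "i \<in> {..<N}"
    then have "of_nat N * distr_fun unit_interval (p i) s \<le> of_nat N * distr_fun unit_interval f s"
      using dp le by simp
    then show "distr_fun unit_interval (p i) s \<le> distr_fun unit_interval f s"
      using N by (simp add: ennreal_of_nat_eq_real_of_nat ennreal_mult_le_mult_iff)
  qed (auto intro: measurable_unit_interval)
  finally show ?thesis by simp
qed

text \<open>Dilation by \<open>t\<close> multiplies the distribution function by at most \<open>t\<close>, so
  \<open>ri_norm_le_of_distr_fun_le\<close> applies with an integer that is at least \<open>t\<close>.\<close>

lemma dilation_norm_finite:
  assumes ri: "ri_norm unit_interval r" and t: "1 < t"
  shows "dilation_norm r t < \<infinity>"
proof -
  define N where "N = nat \<lceil>t\<rceil>"
  have N: "t \<le> real N" "0 < N" using t by (auto simp: N_def)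
  have "dilation_norm r t \<le> of_nat N"
    unfolding dilation_norm_def
  proof (rule SUP_least, clarify)
    fix f :: "real \<Rightarrow> real" assume f: "f \<in> borel_measurable unit_interval" and le: "fnorm r f \<le> 1"
    have "distr_fun unit_interval (absf (dilation t f)) s \<le> of_nat N * distr_fun unit_interval (absf f) s" for s
    proof -
      have "ennreal t * distr_fun unit_interval (absf f) s \<le> ennreal (real N) * distr_fun unit_interval (absf f) s"
        using N by (intro mult_right_mono ennreal_leI) auto
      then show ?thesis using distr_fun_dilation[OF f t, of s] by (simp add: ennreal_of_nat_eq_real_of_nat)
    qed
    then have "fnorm r (dilation t f) \<le> of_nat N * fnorm r f"
      unfolding fnorm_def by (intro ri_norm_le_of_distr_fun_le[OF ri N(2)] measurable_absf measurable_dilation f t)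
    also have "\<dots> \<le> of_nat N * 1" using le by (intro mult_left_mono) auto
    finally show "fnorm r (dilation t f) \<le> of_nat N" by simp
  qed
  then show ?thesis by (metis ennreal_of_nat_neq_top infinity_ennreal_def le_less_trans less_top)
qed

lemma fnorm_dilation_le:
  assumes ri: "ri_norm unit_interval r" and t: "1 < t" and h: "dilation_norm r t \<le> ennreal h" "0 \<le> h"
    and f: "f \<in> borel_measurable unit_interval" and a: "fnorm r f \<le> ennreal a" "0 < a"
  shows "fnorm r (dilation t f) \<le> ennreal (h * a)"
proof -
  note bfn = ri_norm_bfn[OF ri]
  have scale: "fnorm r (\<lambda>x. g x / a) = ennreal (1/a) * fnorm r g" if "g \<in> borel_measurable unit_interval" for g
  proof -
    have "absf (\<lambda>x. g x / a) = (\<lambda>x. ennreal (1/a) * absf g x)"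
      using a(2) by (auto simp: absf_def ennreal_mult[symmetric] fun_eq_iff)
    then show ?thesis unfolding fnorm_def using a(2) by (simp add: bfn_cmult[OF bfn measurable_absf[OF that]])
  qed
  have "ennreal (1/a) * fnorm r f \<le> ennreal (1/a) * ennreal a" using a by (intro mult_left_mono) auto
  then have "fnorm r (\<lambda>x. f x / a) \<le> 1" using a(2) by (simp add: scale[OF f] ennreal_mult[symmetric])
  moreover have "(\<lambda>x. f x / a) \<in> borel_measurable unit_interval" using f by measurable
  ultimately have "fnorm r (dilation t (\<lambda>x. f x / a)) \<le> dilation_norm r t"
    unfolding dilation_norm_def by (intro SUP_upper) auto
  also have "dilation t (\<lambda>x. f x / a) = (\<lambda>x. dilation t f x / a)" by (auto simp: dilation_def fun_eq_iff)
  finally have "ennreal (1/a) * fnorm r (dilation t f) \<le> ennreal h"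
    using h(1) by (simp add: scale[OF measurable_dilation[OF f t]])
  then have "ennreal a * (ennreal (1/a) * fnorm r (dilation t f)) \<le> ennreal a * ennreal h"
    by (intro mult_left_mono) auto
  then show ?thesis using a(2) h(2) by (simp add: mult.assoc[symmetric] ennreal_mult[symmetric] mult.commute)
qed

text \<open>This is how the Boyd index is used: an infimum below one means that some dilation by
  \<open>t\<close> has norm less than \<open>t\<close>.\<close>

lemma upper_boyd_less_1E:
  assumes "upper_boyd M X < 1" and ri: "ri_norm unit_interval (luxemburg M X)"
  obtains t h where "1 < t" "0 < h" "h < t" "dilation_norm (luxemburg M X) t \<le> ennreal h"
proof -
  let ?D = "dilation_norm (luxemburg M X)"
  have "\<exists>y\<in>(\<lambda>t. ln (enn2real (?D t)) / ln t) ` {1<..}. y < 1"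
    by (rule cInf_lessD) (use assms(1) in \<open>auto simp: upper_boyd_def\<close>)
  then obtain t where t: "1 < t" "ln (enn2real (?D t)) / ln t < 1" by auto
  have fin: "?D t < \<infinity>" by (rule dilation_norm_finite[OF ri t(1)])
  have lt: "enn2real (?D t) < t"
  proof (cases "enn2real (?D t) = 0")
    case False
    then have "0 < enn2real (?D t)" by (simp add: order_less_le)
    moreover have "ln (enn2real (?D t)) < ln t" using t by (simp add: divide_less_eq)
    ultimately show ?thesis using t(1) by simp
  qed (use t in simp)
  show thesis
  \<comment> \<open>the maximum with one makes the bound positive\<close>
  proof (rule that[of t "max 1 (enn2real (?D t))"])
    have "?D t = ennreal (enn2real (?D t))" using fin by simp
    also have "\<dots> \<le> ennreal (max 1 (enn2real (?D t)))" by (intro ennreal_leI) auto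
    finally show "?D t \<le> ennreal (max 1 (enn2real (?D t)))" .
  qed (use t lt in auto)
qed

text \<open>The average over \<open>(0, x)\<close> of a decreasing function is dominated by a geometric series of
  its dilates, obtained by cutting \<open>(0, x)\<close> at the points \<open>x / t ^ j\<close>.\<close>

lemma average_le_dilates:
  fixes \<phi> :: "real \<Rightarrow> ennreal"
  assumes anti: "\<And>x y. 0 < x \<Longrightarrow> x \<le> y \<Longrightarrow> \<phi> y \<le> \<phi> x" and t: "1 < t" and x: "0 < x"
  shows "ennreal (1 / x) * (\<integral>\<^sup>+y\<in>{0..x}. \<phi> y \<partial>lborel) \<le> (\<Sum>j. ennreal (1 / t ^ j) * \<phi> (x / t ^ Suc j))"
proof -
  let ?I = "\<lambda>j. {x / t ^ Suc j<..x / t ^ j}"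
  have "\<phi> y * indicator {0..x} y \<le> (\<Sum>j. \<phi> (x / t ^ Suc j) * indicator (?I j) y)" if "y \<noteq> 0" for y
  proof (cases "y \<in> {0..x}")
    case True
    with that have y: "0 < y" "y \<le> x" by auto
    define k where "k = (LEAST k. x / y < t ^ k)"
    have k: "x / y < t ^ k" unfolding k_def using real_arch_pow[OF t, of "x/y"] by (rule LeastI_ex)
    have "k \<noteq> 0"
    proof
      assume "k = 0"
      with k have "x / y < 1" by simp
      with y show False by (simp add: divide_less_eq)
    qed
    then obtain j where j: "k = Suc j" by (cases k) auto
    have "t ^ j \<le> x / y" using not_less_Least[of j "\<lambda>k. x / y < t ^ k"] j by (simp add: k_def not_less)
    then have "y \<in> ?I j" using k y t by (auto simp: j field_simps)
    then have "\<phi> y \<le> \<phi> (x / t ^ Suc j) * indicator (?I j) y"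
      using anti[of "x / t ^ Suc j" y] x t by simp
    also have "\<dots> = (\<Sum>i\<in>{j}. \<phi> (x / t ^ Suc i) * indicator (?I i) y)"
      by (subst sum.insert) auto
    also have "\<dots> \<le> (\<Sum>j. \<phi> (x / t ^ Suc j) * indicator (?I j) y)"
      by (rule sum_le_suminf) auto
    finally show ?thesis using True by simp
  qed simp
  then have "(\<integral>\<^sup>+y\<in>{0..x}. \<phi> y \<partial>lborel) \<le> (\<integral>\<^sup>+y. (\<Sum>j. \<phi> (x / t ^ Suc j) * indicator (?I j) y) \<partial>lborel)"
    by (intro nn_integral_mono_AE eventually_mono[OF AE_lborel_singleton[of "0::real"]]) auto
  also have "\<dots> = (\<Sum>j. \<integral>\<^sup>+y. \<phi> (x / t ^ Suc j) * indicator (?I j) y \<partial>lborel)"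
    by (rule nn_integral_suminf) auto
  also have "\<dots> \<le> (\<Sum>j. ennreal x * (ennreal (1 / t ^ j) * \<phi> (x / t ^ Suc j)))"
  proof (intro suminf_le allI)
    fix j
    have pos: "0 < t ^ j" "0 < t ^ Suc j" using t by auto
    have "x / t ^ Suc j \<le> x / t ^ j" using t x by (intro divide_left_mono power_increasing) auto
    then have "(\<integral>\<^sup>+y. \<phi> (x / t ^ Suc j) * indicator (?I j) y \<partial>lborel) = \<phi> (x / t ^ Suc j) * ennreal (x / t ^ j - x / t ^ Suc j)"
      by (simp add: nn_integral_cmult_indicator)
    also have "\<dots> \<le> \<phi> (x / t ^ Suc j) * ennreal (x * (1 / t ^ j))"
      using x pos by (intro mult_left_mono ennreal_leI) auto
    also have "\<dots> = ennreal x * (ennreal (1 / t ^ j) * \<phi> (x / t ^ Suc j))"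
    proof -
      have "ennreal (x * (1 / t ^ j)) = ennreal x * ennreal (1 / t ^ j)"
        by (rule ennreal_mult) (use x pos in auto)
      then show ?thesis by (simp only: ac_simps)
    qed
    finally show "(\<integral>\<^sup>+y. \<phi> (x / t ^ Suc j) * indicator (?I j) y \<partial>lborel) \<le> ennreal x * (ennreal (1 / t ^ j) * \<phi> (x / t ^ Suc j))" .
  qed auto
  also have "\<dots> = ennreal x * (\<Sum>j. ennreal (1 / t ^ j) * \<phi> (x / t ^ Suc j))"
    by (rule ennreal_suminf_cmult)
  finally have "ennreal (1 / x) * (\<integral>\<^sup>+y\<in>{0..x}. \<phi> y \<partial>lborel) \<le> ennreal (1 / x) * (ennreal x * (\<Sum>j. ennreal (1 / t ^ j) * \<phi> (x / t ^ Suc j)))"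
    by (rule mult_left_mono) simp
  then show ?thesis using x by (simp add: mult.assoc[symmetric] ennreal_mult[symmetric])
qed

text \<open>In \<open>average_le_dilates\<close> the \<open>j\<close>-th dilate has norm at most \<open>h ^ Suc j\<close> times that of
  \<open>\<phi>\<close> and the weight \<open>1 / t ^ j\<close>, so the norms form a geometric series with ratio \<open>h / t < 1\<close>.\<close>

lemma hardy_bounded:
  assumes ri: "ri_norm unit_interval r" and t: "1 < t" and h: "0 < h" "h < t" "dilation_norm r t \<le> ennreal h"
  shows "\<exists>C>0. \<forall>\<phi> \<in> borel_measurable borel. (\<forall>x y. 0 < x \<longrightarrow> x \<le> y \<longrightarrow> \<phi> y \<le> \<phi> x) \<longrightarrow>
    r (\<lambda>x. ennreal (1 / x) * (\<integral>\<^sup>+y\<in>{0..x}. \<phi> y \<partial>lborel)) \<le> ennreal C * r \<phi>"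
proof -
  note bfn = ri_norm_bfn[OF ri]
  \<comment> \<open>the sum of \<open>h * (h / t) ^ j\<close> over all \<open>j\<close>\<close>
  define C where "C = h / (1 - h / t)"
  have C: "0 < C" using h t by (auto simp: C_def)
  show ?thesis
  proof (intro exI[of _ C] conjI C ballI impI)
    fix \<phi> :: "real \<Rightarrow> ennreal"
    assume [measurable]: "\<phi> \<in> borel_measurable borel"
      and anti: "\<forall>x y. 0 < x \<longrightarrow> x \<le> y \<longrightarrow> \<phi> y \<le> \<phi> x"
    let ?P = "\<lambda>x. ennreal (1 / x) * (\<integral>\<^sup>+y\<in>{0..x}. \<phi> y \<partial>lborel)"
    have mU: "\<phi> \<in> borel_measurable unit_interval" by (rule measurable_unit_interval) simp
    have main: "r ?P \<le> ennreal C * ennreal a" if a: "r \<phi> \<le> ennreal a" "0 < a" for a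
    proof -
      have "r \<phi> < \<infinity>" using a(1) by (simp add: le_less_trans)
      from bfn_finite_AE(2)[OF bfn mU this] have ae: "AE x in unit_interval. \<phi> x < \<infinity>" .
      have fin: "\<phi> x < top" if x: "0 < x" for x
      proof (rule ccontr)
        assume "\<not> \<phi> x < top"
        then have "\<phi> y = top" if "0 < y" "y \<le> x" for y using anti that by (metis less_top top_unique)
        then have "AE y in unit_interval. \<not> (0 < y \<and> y \<le> x)" using ae by (auto elim!: eventually_mono)
        then have "emeasure unit_interval {y\<in>space unit_interval. \<not> \<not> (0 < y \<and> y \<le> x)} = 0"
          by (subst (asm) AE_iff_measurable[OF _ refl]) (auto simp: sets_restrict_space_iff)
        moreover have "{y\<in>space unit_interval. \<not> \<not> (0 < y \<and> y \<le> x)} = {..x} \<inter> {0<..<1}" by auto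
        ultimately have "emeasure lborel ({..x} \<inter> {0<..<1}) = 0" by (simp add: emeasure_unit_interval)
        moreover have "{0<..<min x 1} \<subseteq> {..x} \<inter> {0<..<1}" by auto
        then have "emeasure lborel {0<..<min x 1} \<le> emeasure lborel ({..x} \<inter> {0<..<1})" by (intro emeasure_mono) auto
        ultimately show False using x by auto
      qed
      define f where "f j x = enn2real (\<phi> (x / t ^ j))" for j x
      have f: "absf (f j) x = \<phi> (x / t ^ j)" if "0 < x" for j x
        using fin[of "x / t ^ j"] that t by (simp add: f_def absf_def)
      have fm[measurable]: "f j \<in> borel_measurable unit_interval" for j
        unfolding f_def by (intro measurable_restrict_space1 measurable_completion) measurable
      have cong: "r u = r v" if "u \<in> borel_measurable unit_interval" "v \<in> borel_measurable unit_interval"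
        "\<And>x. 0 < x \<Longrightarrow> x < 1 \<Longrightarrow> u x = v x" for u v
        using that by (intro bfn_cong_AE[OF bfn]) (auto intro!: AE_I2)
      have bound: "fnorm r (f j) \<le> ennreal (h ^ j * a)" for j
      proof (induction j)
        case 0
        have "fnorm r (f 0) = r \<phi>" unfolding fnorm_def using f[of _ 0] by (intro cong mU) auto
        then show ?case using a by simp
      next
        case (Suc j)
        have "fnorm r (f (Suc j)) = fnorm r (dilation t (f j))"
          unfolding fnorm_def
        proof (intro cong measurable_absf fm measurable_dilation t)
          fix x :: real assume "0 < x" "x < 1"
          then show "absf (f (Suc j)) x = absf (dilation t (f j)) x"
            using t by (simp add: absf_def dilation_unit_interval f_def field_simps)
        qed
        also have "\<dots> \<le> ennreal (h * (h ^ j * a))"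
          by (rule fnorm_dilation_le[OF ri t h(3) _ fm Suc.IH]) (use h a in auto)
        finally show ?case by (simp add: ac_simps)
      qed
      have "r ?P \<le> r (\<lambda>x. \<Sum>j. ennreal (1 / t ^ j) * absf (f (Suc j)) x)"
      proof (rule bfn_mono[OF bfn])
        show "?P \<in> borel_measurable unit_interval"
        proof (rule measurable_unit_interval)
          have [measurable]: "(\<lambda>x. \<integral>\<^sup>+y\<in>{0..x}. \<phi> y \<partial>lborel) \<in> borel_measurable borel"
            by (rule borel_measurable_mono_ennreal) (auto intro!: monoI nn_integral_mono simp: indicator_def)
          show "?P \<in> borel_measurable borel" by measurable
        qed
        show "AE x in unit_interval. ?P x \<le> (\<Sum>j. ennreal (1 / t ^ j) * absf (f (Suc j)) x)"
        proof (rule AE_I2)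
          fix x :: real assume "x \<in> space unit_interval"
          then have "0 < x" by simp
          then show "?P x \<le> (\<Sum>j. ennreal (1 / t ^ j) * absf (f (Suc j)) x)"
            using average_le_dilates[of \<phi> t x] anti t by (simp add: f)
        qed
      qed measurable
      also have "\<dots> \<le> (\<Sum>j. r (\<lambda>x. ennreal (1 / t ^ j) * absf (f (Suc j)) x))"
        by (rule bfn_suminf[OF bfn]) measurable
      also have "\<dots> \<le> (\<Sum>j. ennreal (h * a * (h / t) ^ j))"
      proof (intro suminf_le allI)
        fix j
        have "r (\<lambda>x. ennreal (1 / t ^ j) * absf (f (Suc j)) x) = ennreal (1 / t ^ j) * r (absf (f (Suc j)))"
          using t by (intro bfn_cmult[OF bfn]) auto
        also have "\<dots> \<le> ennreal (1 / t ^ j) * ennreal (h ^ Suc j * a)"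
          using bound[of "Suc j"] unfolding fnorm_def by (rule mult_left_mono) simp
        also have "\<dots> = ennreal (h * a * (h / t) ^ j)"
          using t h a by (simp add: ennreal_mult[symmetric] power_divide mult_ac)
        finally show "r (\<lambda>x. ennreal (1 / t ^ j) * absf (f (Suc j)) x) \<le> ennreal (h * a * (h / t) ^ j)" .
      qed auto
      also have "\<dots> = ennreal (\<Sum>j. h * a * (h / t) ^ j)"
        using h t a by (intro suminf_ennreal2 summable_mult summable_geometric) auto
      also have "(\<Sum>j. h * a * (h / t) ^ j) = C * a"
        using h t by (simp add: suminf_mult suminf_geometric summable_geometric C_def)
      finally show ?thesis using C a by (simp add: ennreal_mult)
    qed
    show "r ?P \<le> ennreal C * r \<phi>"
    proof (cases "r \<phi> = top")
      case True then show ?thesis using C by (simp add: ennreal_mult_top)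
    next
      case False
      show ?thesis
      proof (rule ennreal_le_epsilon)
        fix e :: real assume e: "0 < e"
        have "r \<phi> = ennreal (enn2real (r \<phi>))" using False by (simp add: less_top)
        then have "r \<phi> \<le> ennreal (enn2real (r \<phi>) + e / C)"
          using e C by (metis add_increasing2 divide_nonneg_pos ennreal_leI less_eq_real_def order_refl add.commute le_add_same_cancel1)
        then have "r ?P \<le> ennreal C * ennreal (enn2real (r \<phi>) + e / C)"
          by (rule main) (use e C in \<open>auto intro: add_nonneg_pos\<close>)
        also have "\<dots> = ennreal C * ennreal (enn2real (r \<phi>)) + ennreal e"
          using e C by (simp add: ennreal_mult[symmetric] ennreal_plus[symmetric] distrib_left del: ennreal_plus)
        also have "ennreal (enn2real (r \<phi>)) = r \<phi>" using False by (simp add: less_top)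
        finally show "r ?P \<le> ennreal C * r \<phi> + ennreal e" .
      qed
    qed
  qed
qed


section \<open>The optimal domain norm\<close>

text \<open>For \<open>p = n / (n - 1)\<close> and the averaged rearrangement \<open>\<phi>\<close> of \<open>f\<close>, this is the function whose
  norm defines the optimal domain space.\<close>

definition tail_integral :: "real \<Rightarrow> (real \<Rightarrow> ennreal) \<Rightarrow> real \<Rightarrow> ennreal" where
  "tail_integral p \<phi> t = (\<integral>\<^sup>+s\<in>{t powr p..1}. \<phi> s * ennreal (s powr (- 1 / p)) \<partial>lborel)"

lemma measurable_rearr_avg[measurable]: "rearr_avg M f \<in> borel_measurable borel"
proof -
  have [measurable]: "(\<lambda>x. \<integral>\<^sup>+y\<in>{0..x}. rearr M f y \<partial>lborel) \<in> borel_measurable borel"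
    by (rule borel_measurable_mono_ennreal) (auto intro!: monoI nn_integral_mono simp: indicator_def)
  show ?thesis unfolding rearr_avg_def[abs_def] by measurable
qed

lemma measurable_tail_integral[measurable]: "tail_integral p \<phi> \<in> borel_measurable borel"
proof -
  have [measurable]: "(\<lambda>a. \<integral>\<^sup>+s\<in>{a..1}. \<phi> s * ennreal (s powr (- 1 / p)) \<partial>lborel) \<in> borel_measurable borel"
    by (rule borel_measurable_antimono_ennreal) (auto intro!: antimonoI nn_integral_mono simp: indicator_def)
  show ?thesis unfolding tail_integral_def[abs_def] by measurable
qed

lemma tail_integral_antimono:
  assumes "0 < x" "x \<le> y" "0 \<le> p" shows "tail_integral p \<phi> y \<le> tail_integral p \<phi> x"
  unfolding tail_integral_def
proof (rule nn_integral_mono)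
  fix s
  have "x powr p \<le> y powr p" using assms by (intro powr_mono2) auto
  then show "\<phi> s * ennreal (s powr (- 1 / p)) * indicator {y powr p..1} s
      \<le> \<phi> s * ennreal (s powr (- 1 / p)) * indicator {x powr p..1} s"
    by (auto simp: indicator_def)
qed

lemma tail_integral_mono:
  assumes "0 < t" "\<And>s. 0 < s \<Longrightarrow> s \<le> 1 \<Longrightarrow> \<phi> s \<le> \<psi> s"
  shows "tail_integral p \<phi> t \<le> tail_integral p \<psi> t"
  unfolding tail_integral_def
proof (rule nn_integral_mono)
  fix s
  show "\<phi> s * ennreal (s powr (- 1 / p)) * indicator {t powr p..1} s
      \<le> \<psi> s * ennreal (s powr (- 1 / p)) * indicator {t powr p..1} s"
  proof (cases "s \<in> {t powr p..1}")
    case True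
    then have "t powr p \<le> s" "s \<le> 1" by auto
    moreover have "0 < t powr p" using assms(1) by simp
    ultimately have "0 < s" "s \<le> 1" by linarith+
    then show ?thesis using True assms(2) by (auto intro: mult_right_mono)
  qed simp
qed

lemma tail_integral_cong:
  assumes "0 < t" "\<And>s. 0 < s \<Longrightarrow> s \<le> 1 \<Longrightarrow> \<phi> s = \<psi> s"
  shows "tail_integral p \<phi> t = tail_integral p \<psi> t"
  using assms by (intro antisym tail_integral_mono) auto

lemma tail_integral_add:
  assumes [measurable]: "\<phi> \<in> borel_measurable borel" "\<psi> \<in> borel_measurable borel"
  shows "tail_integral p (\<lambda>s. \<phi> s + \<psi> s) t = tail_integral p \<phi> t + tail_integral p \<psi> t"
  unfolding tail_integral_def by (subst nn_integral_add[symmetric]) (auto simp: distrib_right)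

lemma tail_integral_cmult:
  assumes [measurable]: "\<phi> \<in> borel_measurable borel"
  shows "tail_integral p (\<lambda>s. c * \<phi> s) t = c * tail_integral p \<phi> t"
  unfolding tail_integral_def by (subst nn_integral_cmult[symmetric]) (auto simp: mult.assoc)

lemma nn_integral_powr_from_0:
  assumes "1 < p"
  shows "(\<integral>\<^sup>+s\<in>{0..1}. ennreal (s powr (- 1 / p)) \<partial>lborel) = ennreal (1 / (1 - 1 / p))"
proof -
  have "((\<lambda>s. s powr (- 1 / p)) has_integral (1 / (1 - 1 / p))) {0..1::real}"
    using has_integral_powr_from_0[of "- 1 / p" 1] assms by (simp add: field_simps)
  from nn_integral_has_integral_lebesgue[OF _ this]
  have "(\<integral>\<^sup>+s. ennreal (indicator {0..1} s * s powr (- 1 / p)) \<partial>lborel) = ennreal (1 / (1 - 1 / p))" by simp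
  also have "(\<integral>\<^sup>+s. ennreal (indicator {0..1} s * s powr (- 1 / p)) \<partial>lborel) = (\<integral>\<^sup>+s\<in>{0..1}. ennreal (s powr (- 1 / p)) \<partial>lborel)"
    by (intro nn_integral_cong) (auto simp: indicator_def)
  finally show ?thesis .
qed

lemma tail_integral_const_le:
  assumes "1 < p"
  shows "tail_integral p (\<lambda>_. 1) t \<le> ennreal (1 / (1 - 1 / p))"
proof -
  have "tail_integral p (\<lambda>_. 1) t \<le> (\<integral>\<^sup>+s\<in>{0..1}. ennreal (s powr (- 1 / p)) \<partial>lborel)"
    unfolding tail_integral_def
    by (intro nn_integral_mono) (auto simp: indicator_def intro: order_trans[OF powr_ge_zero])
  then show ?thesis unfolding nn_integral_powr_from_0[OF assms] .
qed

lemma integral_le_rearr_avg: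
  assumes [measurable]: "f \<in> borel_measurable M" and M: "prob_space M" and s: "0 < s" "s \<le> 1"
  shows "(\<integral>\<^sup>+x. f x \<partial>M) \<le> rearr_avg M f s"
proof -
  interpret prob_space M by fact
  have "(\<integral>\<^sup>+x. f x \<partial>M) \<le> K_fun M f 1"
    unfolding K_fun_def
  proof (rule INF_greatest)
    fix c
    have "(\<integral>\<^sup>+x. f x \<partial>M) \<le> (\<integral>\<^sup>+x. c + (f x - c) \<partial>M)" by (intro nn_integral_mono ennreal_le_add_diff)
    also have "\<dots> = ennreal 1 * c + (\<integral>\<^sup>+x. f x - c \<partial>M)"
      by (subst nn_integral_add) (auto simp: emeasure_space_1)
    finally show "(\<integral>\<^sup>+x. f x \<partial>M) \<le> ennreal 1 * c + (\<integral>\<^sup>+x. f x - c \<partial>M)" .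
  qed
  also have "\<dots> = rearr_avg M f 1" using rearr_avg_eq_K_fun[OF assms(1) M, of 1] by simp
  also have "\<dots> \<le> rearr_avg M f s" using s by (intro rearr_avg_antimono assms) auto
  finally show ?thesis .
qed

lemma rearr_avg_cmult:
  assumes [measurable]: "f \<in> borel_measurable M" and "0 < a"
  shows "rearr_avg M (\<lambda>x. ennreal a * f x) s = ennreal a * rearr_avg M f s"
  unfolding rearr_avg_def rearr_cmult[OF assms] mult.assoc
  by (subst nn_integral_cmult) (auto simp: ac_simps)

lemma rearr_avg_mono_AE:
  assumes "f \<in> borel_measurable M" "g \<in> borel_measurable M" "AE x in M. f x \<le> g x"
  shows "rearr_avg M f s \<le> rearr_avg M g s"
  unfolding rearr_avg_def
  by (intro mult_left_mono nn_integral_mono mult_right_mono rearr_mono_AE assms) auto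

lemma rearr_avg_SUP:
  assumes "f \<in> borel_measurable M" "\<And>j::nat. F j \<in> borel_measurable M"
    and "AE x in M. incseq (\<lambda>j. F j x) \<and> (SUP j. F j x) = f x"
  shows "incseq (\<lambda>j. rearr_avg M (F j) s)" "(SUP j. rearr_avg M (F j) s) = rearr_avg M f s"
proof -
  note inc = rearr_SUP(1)[OF assms] and sup = rearr_SUP(2)[OF assms]
  show "incseq (\<lambda>j. rearr_avg M (F j) s)"
    unfolding rearr_avg_def
    by (intro incseq_SucI mult_left_mono nn_integral_mono mult_right_mono incseq_SucD[OF inc]) auto
  have "(SUP j. rearr_avg M (F j) s) = ennreal (1 / s) * (SUP j. \<integral>\<^sup>+t\<in>{0..s}. rearr M (F j) t \<partial>lborel)"
    unfolding rearr_avg_def by (rule SUP_mult_left_ennreal[symmetric])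
  also have "(SUP j. \<integral>\<^sup>+t\<in>{0..s}. rearr M (F j) t \<partial>lborel) = (\<integral>\<^sup>+t. (SUP j. rearr M (F j) t * indicator {0..s} t) \<partial>lborel)"
    by (rule nn_integral_monotone_convergence_SUP[symmetric])
      (auto simp: incseq_def le_fun_def intro!: mult_right_mono incseqD[OF inc])
  also have "\<dots> = (\<integral>\<^sup>+t\<in>{0..s}. rearr M f t \<partial>lborel)"
    by (intro nn_integral_cong) (simp only: SUP_mult_right_ennreal[symmetric] sup)
  finally show "(SUP j. rearr_avg M (F j) s) = rearr_avg M f s" by (simp add: rearr_avg_def)
qed

lemma tail_integral_SUP:
  assumes [measurable]: "\<And>j::nat. F j \<in> borel_measurable borel" and inc: "\<And>s. incseq (\<lambda>j. F j s)"
  shows "incseq (\<lambda>j. tail_integral p (F j) t)"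
    "(SUP j. tail_integral p (F j) t) = tail_integral p (\<lambda>s. SUP j. F j s) t"
proof -
  show "incseq (\<lambda>j. tail_integral p (F j) t)" unfolding tail_integral_def
    by (intro incseq_SucI nn_integral_mono mult_right_mono incseq_SucD[OF inc]) auto
  have "(SUP j. tail_integral p (F j) t) = (\<integral>\<^sup>+s. (SUP j. F j s * ennreal (s powr (- 1 / p)) * indicator {t powr p..1} s) \<partial>lborel)"
    unfolding tail_integral_def
    by (rule nn_integral_monotone_convergence_SUP[symmetric])
      (auto simp: incseq_def le_fun_def intro!: mult_right_mono incseqD[OF inc])
  then show "(SUP j. tail_integral p (F j) t) = tail_integral p (\<lambda>s. SUP j. F j s) t"
    unfolding tail_integral_def by (simp only: SUP_mult_right_ennreal[symmetric])
qed

lemma integral_le_tail_integral: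
  assumes "f \<in> borel_measurable M" "prob_space M" and t: "0 < t" "t \<le> 1/2" and p: "1 < p"
  shows "ennreal (1 - (1/2) powr p) * (\<integral>\<^sup>+x. f x \<partial>M) \<le> tail_integral p (rearr_avg M f) t"
proof -
  let ?J = "\<integral>\<^sup>+x. f x \<partial>M"
  have le: "t powr p \<le> (1/2) powr p" using t p by (intro powr_mono2) auto
  have lt: "(1/2) powr p < (1::real)" using p powr_less_mono'[of "1/2" 0 p] by simp
  have "ennreal (1 - (1/2) powr p) * ?J = (\<integral>\<^sup>+s. ?J * indicator {(1/2) powr p..1} s \<partial>lborel)"
    using lt by (simp add: nn_integral_cmult_indicator mult.commute)
  also have "\<dots> \<le> tail_integral p (rearr_avg M f) t"
    unfolding tail_integral_def
  proof (rule nn_integral_mono)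
    fix s
    show "?J * indicator {(1/2) powr p..1} s \<le> rearr_avg M f s * ennreal (s powr (- 1 / p)) * indicator {t powr p..1} s"
    proof (cases "s \<in> {(1/2) powr p..1}")
      case True
      then have "(1/2) powr p \<le> s" "s \<le> 1" by auto
      moreover have "0 < (1/2::real) powr p" by simp
      ultimately have s: "0 < s" "s \<le> 1" "t powr p \<le> s" using le by linarith+
      have "1 \<le> s powr (- 1 / p)"
        using powr_mono'[of "-1/p" 0 s] s p by simp
      then have "?J * 1 \<le> rearr_avg M f s * ennreal (s powr (- 1 / p))"
        by (intro mult_mono integral_le_rearr_avg assms s) auto
      then show ?thesis using True s by simp
    qed simp
  qed
  finally show ?thesis .
qed

text \<open>The triangle inequality and the Fatou property are inherited from the averaged
  rearrangement. Constants have finite norm because \<open>s powr (-1/p)\<close> is integrable at zero, and the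
  norm dominates the integral because the averaged rearrangement does so at every point.\<close>

lemma ri_norm_tail_integral:
  assumes M: "prob_space M" and ri: "ri_norm unit_interval r" and p: "1 < p"
  shows "ri_norm M (\<lambda>f. r (tail_integral p (rearr_avg M f)))"
proof -
  interpret prob_space M by fact
  note bfn = ri_norm_bfn[OF ri]
  have mU[measurable]: "tail_integral p \<phi> \<in> borel_measurable unit_interval" for \<phi>
    by (rule measurable_unit_interval) simp
  have rmono: "r u \<le> r v" if "u \<in> borel_measurable unit_interval" "v \<in> borel_measurable unit_interval"
    "\<And>x. 0 < x \<Longrightarrow> x < 1 \<Longrightarrow> u x \<le> v x" for u v
    using that by (intro bfn_mono[OF bfn]) (auto intro!: AE_I2)
  have emhalf: "emeasure unit_interval {0<..1/2::real} = ennreal (1/2)"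
  proof -
    have "{0<..1/2::real} = {..1/2} \<inter> {0<..<1}" by auto
    then have "emeasure unit_interval {0<..1/2::real} = emeasure lborel {0<..1/2::real}"
      using emeasure_unit_interval[of "{..1/2}"] by simp
    then show ?thesis by simp
  qed
  have half_sets: "{0<..1/2::real} \<in> sets unit_interval"
    by (subst sets_restrict_space_iff) auto
  define k where "k = 1 - (1/2::real) powr p"
  have k: "0 < k" using p powr_less_mono'[of "1/2" 0 p] by (simp add: k_def)
  have L1: "ennreal (k / 2) * (\<integral>\<^sup>+x. f x \<partial>M) \<le> (\<integral>\<^sup>+t. tail_integral p (rearr_avg M f) t \<partial>unit_interval)"
    if "f \<in> borel_measurable M" for f
  proof -
    have "ennreal (k / 2) * (\<integral>\<^sup>+x. f x \<partial>M) = (\<integral>\<^sup>+t. ennreal k * (\<integral>\<^sup>+x. f x \<partial>M) * indicator {0<..1/2} t \<partial>unit_interval)"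
    proof -
      have k2: "ennreal (k / 2) = ennreal k * ennreal (1 / 2)"
        using k ennreal_mult[of k "1/2"] by simp
      show ?thesis unfolding nn_integral_cmult_indicator[OF half_sets] emhalf k2 by (simp only: ac_simps)
    qed
    also have "\<dots> \<le> (\<integral>\<^sup>+t. tail_integral p (rearr_avg M f) t \<partial>unit_interval)"
      using integral_le_tail_integral[OF that M _ _ p] by (intro nn_integral_mono) (auto simp: indicator_def k_def)
    finally show ?thesis .
  qed
  have zero: "r (tail_integral p (rearr_avg M f)) = 0" if f[measurable]: "f \<in> borel_measurable M" and ae: "AE x in M. f x = 0" for f
  proof -
    have "(\<integral>\<^sup>+x. f x \<partial>M) = 0" using ae by (subst nn_integral_0_iff_AE) auto
    then have "rearr_avg M f s = 0" if "0 < s" "s \<le> 1" for s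
      using rearr_avg_eq_K_fun[OF f M that] K_fun_le_integral[of M f s] by simp
    then have "tail_integral p (rearr_avg M f) t = 0" if "0 < t" for t
      using tail_integral_cong[OF that, of "rearr_avg M f" "\<lambda>_. 0" p] by (simp add: tail_integral_def)
    then show ?thesis by (subst bfn_eq_0_iff[OF bfn mU]) (auto intro!: AE_I2)
  qed
  let ?Z = "\<lambda>f. r (tail_integral p (rearr_avg M f))"
  have "banach_function_norm M ?Z"
    unfolding banach_function_norm_def
  proof (intro conjI ballI allI impI)
    fix f :: "'a \<Rightarrow> ennreal" assume f[measurable]: "f \<in> borel_measurable M"
    show "?Z f = 0 \<longleftrightarrow> (AE x in M. f x = 0)"
    proof
      assume "?Z f = 0"
      then have "AE t in unit_interval. tail_integral p (rearr_avg M f) t = 0"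
        by (simp add: bfn_eq_0_iff[OF bfn mU])
      then have "(\<integral>\<^sup>+t. tail_integral p (rearr_avg M f) t \<partial>unit_interval) = 0"
        by (subst nn_integral_0_iff_AE[OF mU])
      then have "(\<integral>\<^sup>+x. f x \<partial>M) = 0" using L1[OF f] k by simp
      then show "AE x in M. f x = 0" by (subst (asm) nn_integral_0_iff_AE) auto
    qed (rule zero[OF f])
    fix a :: real assume a: "0 \<le> a"
    show "?Z (\<lambda>x. ennreal a * f x) = ennreal a * ?Z f"
    proof (cases "a = 0")
      case True then show ?thesis using zero[of "\<lambda>_. 0"] by simp
    next
      case False
      with a have eq: "rearr_avg M (\<lambda>x. ennreal a * f x) = (\<lambda>s. ennreal a * rearr_avg M f s)"
        by (intro ext rearr_avg_cmult) auto
      have "tail_integral p (rearr_avg M (\<lambda>x. ennreal a * f x)) = (\<lambda>t. ennreal a * tail_integral p (rearr_avg M f) t)"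
        unfolding eq by (intro ext tail_integral_cmult measurable_rearr_avg)
      then show ?thesis using a by (simp add: bfn_cmult[OF bfn mU])
    qed
  next
    fix f g :: "'a \<Rightarrow> ennreal" assume f[measurable]: "f \<in> borel_measurable M" and g[measurable]: "g \<in> borel_measurable M"
    have "?Z (\<lambda>x. f x + g x) \<le> r (\<lambda>t. tail_integral p (rearr_avg M f) t + tail_integral p (rearr_avg M g) t)"
      unfolding tail_integral_add[OF measurable_rearr_avg measurable_rearr_avg, symmetric]
      by (intro rmono mU tail_integral_mono rearr_avg_add f g M)
    also have "\<dots> \<le> ?Z f + ?Z g" by (rule bfn_add[OF bfn mU mU])
    finally show "?Z (\<lambda>x. f x + g x) \<le> ?Z f + ?Z g" .
  next
    fix f g :: "'a \<Rightarrow> ennreal" assume f[measurable]: "f \<in> borel_measurable M" and g[measurable]: "g \<in> borel_measurable M"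
      and "AE x in M. g x \<le> f x"
    then show "?Z g \<le> ?Z f" by (intro rmono mU tail_integral_mono rearr_avg_mono_AE)
  next
    fix F :: "nat \<Rightarrow> 'a \<Rightarrow> ennreal" and f :: "'a \<Rightarrow> ennreal"
    assume *: "f \<in> borel_measurable M" "\<forall>j. F j \<in> borel_measurable M"
      "AE x in M. incseq (\<lambda>j. F j x) \<and> (SUP j. F j x) = f x"
    note A = rearr_avg_SUP[OF *(1) spec[OF *(2)] *(3)]
    note T = tail_integral_SUP[OF measurable_rearr_avg A(1)]
    have ae: "AE t in unit_interval. incseq (\<lambda>j. tail_integral p (rearr_avg M (F j)) t) \<and>
        (SUP j. tail_integral p (rearr_avg M (F j)) t) = tail_integral p (rearr_avg M f) t"
      using T by (auto simp: A(2) intro!: AE_I2)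
    show "incseq (\<lambda>j. ?Z (F j))" by (rule bfn_Fatou(1)[OF bfn mU mU ae])
    show "(SUP j. ?Z (F j)) = ?Z f" by (rule bfn_Fatou(2)[OF bfn mU mU ae])
  next
    have "rearr_avg M (\<lambda>_. 1) s \<le> 1" if "0 < s" "s \<le> 1" for s
    proof -
      have "rearr_avg M (\<lambda>_. 1) s \<le> ennreal (1/s) * (ennreal s * 1 + (\<integral>\<^sup>+x. 1 - 1 \<partial>M))"
        unfolding rearr_avg_eq_K_fun[OF borel_measurable_const M that] by (intro mult_left_mono K_fun_le) auto
      then show ?thesis using that by (simp add: ennreal_mult[symmetric])
    qed
    then have "?Z (\<lambda>_. 1) \<le> r (\<lambda>_. ennreal (1 / (1 - 1 / p)))"
      by (intro rmono mU order_trans[OF tail_integral_mono tail_integral_const_le[OF p]]) auto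
    also have "\<dots> = ennreal (1 / (1 - 1 / p)) * r (\<lambda>_. 1)"
      using p by (intro bfn_const[OF bfn]) auto
    also have "\<dots> < \<infinity>" using bfn_one[OF bfn] by (simp add: ennreal_mult_less_top)
    finally show "?Z (\<lambda>_. 1) < \<infinity>" .
  next
    obtain C where C: "0 < C" "\<And>f. f \<in> borel_measurable unit_interval \<Longrightarrow> (\<integral>\<^sup>+x. f x \<partial>unit_interval) \<le> ennreal C * r f"
      using bfn_integral[OF bfn] by blast
    show "\<exists>C. \<forall>f\<in>borel_measurable M. (\<integral>\<^sup>+x. f x \<partial>M) \<le> ennreal C * ?Z f"
    proof (intro exI[of _ "2 / k * C"] ballI)
      fix f :: "'a \<Rightarrow> ennreal" assume f: "f \<in> borel_measurable M"
      have "(\<integral>\<^sup>+x. f x \<partial>M) = ennreal (2 / k) * (ennreal (k / 2) * (\<integral>\<^sup>+x. f x \<partial>M))"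
        using k by (simp add: mult.assoc[symmetric] ennreal_mult[symmetric])
      also have "\<dots> \<le> ennreal (2 / k) * (ennreal C * ?Z f)"
        by (intro mult_left_mono order_trans[OF L1[OF f] C(2)[OF mU]]) simp
      also have "\<dots> = ennreal (2 / k * C) * ?Z f"
        using k C by (simp only: ennreal_mult less_imp_le divide_nonneg_nonneg zero_le_numeral mult.assoc)
      finally show "(\<integral>\<^sup>+x. f x \<partial>M) \<le> ennreal (2 / k * C) * ?Z f" .
    qed
  qed
  moreover have "?Z (absf f) = ?Z (absf g)"
    if eq: "\<And>t. 0 \<le> t \<Longrightarrow> distr_fun M (absf f) (ennreal t) = distr_fun M (absf g) (ennreal t)" for f g
  proof -
    have "distr_fun M (absf f) s = distr_fun M (absf g) s" for s
      using eq by (cases s) (auto simp: distr_fun_def)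
    then have "rearr M (absf f) = rearr M (absf g)" by (intro ext rearr_cong_distr_fun)
    then show ?thesis by (simp add: rearr_avg_def[abs_def])
  qed
  ultimately show ?thesis unfolding ri_norm_def by blast
qed

text \<open>Both sides are integrals of \<open>\<phi>\<close> against a kernel, and by Tonelli's theorem the kernels
  compare: \<open>\<integral> s \<ge> max r (t powr p). s powr (-1 - 1/p) \<le> p * max r (t powr p) powr (-1/p)\<close> on the
  left, and exactly \<open>p * max r (t powr p) powr (-1/p)\<close> on the right.\<close>

lemma tail_integral_average_le:
  fixes \<phi> :: "real \<Rightarrow> ennreal"
  assumes [measurable]: "\<phi> \<in> borel_measurable borel" and t: "0 < t" "t < 1" and p: "1 < p"
  shows "tail_integral p (\<lambda>s. ennreal (1 / s) * (\<integral>\<^sup>+r\<in>{0..s}. \<phi> r \<partial>lborel)) t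
    \<le> ennreal p * (ennreal (1 / t) * (\<integral>\<^sup>+x\<in>{0..t}. tail_integral p \<phi> x \<partial>lborel))"
proof -
  define T where "T = t powr p"
  have T: "0 < T" using t by (simp add: T_def)
  let ?k1 = "\<lambda>r. \<integral>\<^sup>+s. ennreal (1 / s * s powr (- 1 / p)) * (if 0 \<le> r \<and> r \<le> s \<and> T \<le> s \<and> s \<le> 1 then 1 else 0) \<partial>lborel"
  let ?k2 = "\<lambda>r. \<integral>\<^sup>+x. ennreal (r powr (- 1 / p)) * (if 0 \<le> x \<and> x \<le> t \<and> x powr p \<le> r \<and> r \<le> 1 then 1 else 0) \<partial>lborel"
  have "tail_integral p (\<lambda>s. ennreal (1 / s) * (\<integral>\<^sup>+r\<in>{0..s}. \<phi> r \<partial>lborel)) t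
      = (\<integral>\<^sup>+s. (\<integral>\<^sup>+r. \<phi> r * (ennreal (1 / s * s powr (- 1 / p)) * (if 0 \<le> r \<and> r \<le> s \<and> T \<le> s \<and> s \<le> 1 then 1 else 0)) \<partial>lborel) \<partial>lborel)"
    unfolding tail_integral_def
  proof (intro nn_integral_cong)
    fix s :: real
    show "ennreal (1 / s) * (\<integral>\<^sup>+r\<in>{0..s}. \<phi> r \<partial>lborel) * ennreal (s powr (- 1 / p)) * indicator {t powr p..1} s
      = (\<integral>\<^sup>+r. \<phi> r * (ennreal (1 / s * s powr (- 1 / p)) * (if 0 \<le> r \<and> r \<le> s \<and> T \<le> s \<and> s \<le> 1 then 1 else 0)) \<partial>lborel)"
    proof (cases "T \<le> s \<and> s \<le> 1")
      case True
      then have "0 < s" using T by simp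
      have "(\<integral>\<^sup>+r. \<phi> r * (ennreal (1 / s * s powr (- 1 / p)) * (if 0 \<le> r \<and> r \<le> s \<and> T \<le> s \<and> s \<le> 1 then 1 else 0)) \<partial>lborel)
        = (\<integral>\<^sup>+r. ennreal (1 / s * s powr (- 1 / p)) * (\<phi> r * indicator {0..s} r) \<partial>lborel)"
        using True by (intro nn_integral_cong) (auto simp: indicator_def mult.commute)
      also have "\<dots> = ennreal (1 / s * s powr (- 1 / p)) * (\<integral>\<^sup>+r\<in>{0..s}. \<phi> r \<partial>lborel)"
        by (rule nn_integral_cmult) measurable
      finally have eq: "(\<integral>\<^sup>+r. \<phi> r * (ennreal (1 / s * s powr (- 1 / p)) * (if 0 \<le> r \<and> r \<le> s \<and> T \<le> s \<and> s \<le> 1 then 1 else 0)) \<partial>lborel)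
        = ennreal (1 / s * s powr (- 1 / p)) * (\<integral>\<^sup>+r\<in>{0..s}. \<phi> r \<partial>lborel)" .
      have sp: "ennreal (1 / s * s powr (- 1 / p)) = ennreal (1 / s) * ennreal (s powr (- 1 / p))"
        using \<open>0 < s\<close> by (intro ennreal_mult) auto
      have ind: "indicator {t powr p..1} s = (1::ennreal)" using True by (simp add: T_def)
      show ?thesis unfolding eq ind unfolding sp by (simp only: mult_1_right mult_1_left ac_simps)
    qed (auto simp: T_def)
  qed
  also have "\<dots> = (\<integral>\<^sup>+r. (\<integral>\<^sup>+s. \<phi> r * (ennreal (1 / s * s powr (- 1 / p)) * (if 0 \<le> r \<and> r \<le> s \<and> T \<le> s \<and> s \<le> 1 then 1 else 0)) \<partial>lborel) \<partial>lborel)"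
    by (rule lborel_pair.Fubini') measurable
  also have "\<dots> = (\<integral>\<^sup>+r. \<phi> r * ?k1 r \<partial>lborel)"
    by (intro nn_integral_cong nn_integral_cmult) measurable
  also have "\<dots> \<le> (\<integral>\<^sup>+r. \<phi> r * (ennreal p * (ennreal (1 / t) * ?k2 r)) \<partial>lborel)"
  proof (intro nn_integral_mono_AE eventually_mono[OF AE_lborel_singleton[of "0::real"]] mult_left_mono)
    fix r :: real assume r0: "r \<noteq> 0"
    show "?k1 r \<le> ennreal p * (ennreal (1 / t) * ?k2 r)"
    proof (cases "0 < r \<and> r \<le> 1")
      case False
      then have "?k1 r = (\<integral>\<^sup>+s. 0 \<partial>(lborel::real measure))" using r0
        by (intro nn_integral_cong) auto
      then show ?thesis by simp
    next
      case True
      define m where "m = max r T"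
      have T1: "T \<le> 1" unfolding T_def using t p by (intro powr_le1) auto
      have m: "0 < m" "m \<le> 1" using True T T1 by (auto simp: m_def)
      have "?k1 r = (\<integral>\<^sup>+s. ennreal (1 / s * s powr (- 1 / p)) * indicator {m..1} s \<partial>lborel)"
        using True by (intro nn_integral_cong) (auto simp: m_def indicator_def)
      also have "\<dots> = ennreal (- p * 1 powr (- 1 / p) - (- p * m powr (- 1 / p)))"
      proof (rule nn_integral_FTC_Icc)
        fix s assume s: "s \<in> {m..1}"
        then have "0 < s" using m by simp
        have "((\<lambda>s. - p * s powr (- 1 / p)) has_real_derivative - p * ((- 1 / p) * s powr (- 1 / p - 1))) (at s)"
          using \<open>0 < s\<close> by (intro DERIV_cmult DERIV_powr has_real_derivative_powr)
        also have "- p * ((- 1 / p) * s powr (- 1 / p - 1)) = 1 / s * s powr (- 1 / p)"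
          using p \<open>0 < s\<close> powr_diff[of s "- 1 / p" 1] by simp
        finally show "((\<lambda>s. - p * s powr (- 1 / p)) has_real_derivative 1 / s * s powr (- 1 / p)) (at s)" .
        show "0 \<le> 1 / s * s powr (- 1 / p)" using \<open>0 < s\<close> by simp
      qed (use m in auto)
      also have "\<dots> \<le> ennreal (p * m powr (- 1 / p))" using p by (intro ennreal_leI) simp
      also have "\<dots> = ennreal p * ennreal (m powr (- 1 / p))" using p by (intro ennreal_mult) auto
      also have "ennreal (m powr (- 1 / p)) \<le> ennreal (1 / t) * ?k2 r"
      proof -
        define v where "v = min t (r powr (1 / p))"
        have v: "0 \<le> v" using t by (simp add: v_def)
        have "ennreal (r powr (- 1 / p) * v) = ennreal (r powr (- 1 / p)) * ennreal v" using v by (intro ennreal_mult) auto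
        also have "\<dots> = (\<integral>\<^sup>+x. ennreal (r powr (- 1 / p)) * indicator {0..v} x \<partial>lborel)"
          using v by (simp add: nn_integral_cmult_indicator)
        also have "\<dots> \<le> ?k2 r"
        proof (intro nn_integral_mono mult_left_mono)
          fix x :: real
          have "x powr p \<le> r" if x: "0 \<le> x" "x \<le> v"
          proof -
            have "x powr p \<le> (r powr (1 / p)) powr p" using x p by (intro powr_mono2) (auto simp: v_def)
            also have "\<dots> = r" using True p by (simp add: powr_powr)
            finally show ?thesis .
          qed
          then show "indicator {0..v} x \<le> (if 0 \<le> x \<and> x \<le> t \<and> x powr p \<le> r \<and> r \<le> 1 then 1 else (0::ennreal))"
            using True by (auto simp: indicator_def v_def)
        qed simp
        finally have "ennreal (1 / t) * ennreal (r powr (- 1 / p) * v) \<le> ennreal (1 / t) * ?k2 r"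
          by (rule mult_left_mono) simp
        moreover have "m powr (- 1 / p) = 1 / t * (r powr (- 1 / p) * v)"
        proof (cases "T \<le> r")
          case *: True
          have "t = T powr (1 / p)" using t p by (simp add: T_def powr_powr)
          also have "\<dots> \<le> r powr (1 / p)" using * T p by (intro powr_mono2) auto
          finally have "v = t" by (simp add: v_def)
          then show ?thesis using * t by (simp add: m_def)
        next
          case *: False
          have "r powr (1 / p) \<le> T powr (1 / p)" using * True p by (intro powr_mono2) auto
          also have "\<dots> = t" using t p by (simp add: T_def powr_powr)
          finally have "v = r powr (1 / p)" by (simp add: v_def)
          then have "r powr (- 1 / p) * v = 1" using True by (simp add: powr_add[symmetric])
          moreover have "m powr (- 1 / p) = 1 / t"
            using * t p by (simp add: m_def T_def powr_powr powr_minus_divide)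
          ultimately show ?thesis by simp
        qed
        ultimately show ?thesis using t v by (simp add: ennreal_mult[symmetric])
      qed
      finally show ?thesis by (simp add: mult_left_mono)
    qed
  qed simp
  also have "\<dots> = (\<integral>\<^sup>+r. ennreal p * (ennreal (1 / t) * (\<phi> r * ?k2 r)) \<partial>lborel)"
    by (simp add: ac_simps)
  also have "\<dots> = ennreal p * (ennreal (1 / t) * (\<integral>\<^sup>+r. \<phi> r * ?k2 r \<partial>lborel))"
    by (subst nn_integral_cmult, measurable)+
  also have "(\<integral>\<^sup>+r. \<phi> r * ?k2 r \<partial>lborel)
      = (\<integral>\<^sup>+r. (\<integral>\<^sup>+x. \<phi> r * (ennreal (r powr (- 1 / p)) * (if 0 \<le> x \<and> x \<le> t \<and> x powr p \<le> r \<and> r \<le> 1 then 1 else 0)) \<partial>lborel) \<partial>lborel)"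
    by (intro nn_integral_cong nn_integral_cmult[symmetric]) measurable
  also have "\<dots> = (\<integral>\<^sup>+x. (\<integral>\<^sup>+r. \<phi> r * (ennreal (r powr (- 1 / p)) * (if 0 \<le> x \<and> x \<le> t \<and> x powr p \<le> r \<and> r \<le> 1 then 1 else 0)) \<partial>lborel) \<partial>lborel)"
    by (rule lborel_pair.Fubini') measurable
  also have "\<dots> = (\<integral>\<^sup>+x\<in>{0..t}. tail_integral p \<phi> x \<partial>lborel)"
    unfolding tail_integral_def
  proof (intro nn_integral_cong)
    fix x :: real
    have "(\<integral>\<^sup>+r. \<phi> r * (ennreal (r powr (- 1 / p)) * (if 0 \<le> x \<and> x \<le> t \<and> x powr p \<le> r \<and> r \<le> 1 then 1 else 0)) \<partial>lborel)
      = (\<integral>\<^sup>+r. \<phi> r * ennreal (r powr (- 1 / p)) * indicator {x powr p..1} r * indicator {0..t} x \<partial>lborel)"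
      by (intro nn_integral_cong) (auto simp: indicator_def)
    also have "\<dots> = (\<integral>\<^sup>+r\<in>{x powr p..1}. \<phi> r * ennreal (r powr (- 1 / p)) \<partial>lborel) * indicator {0..t} x"
      by (rule nn_integral_multc) measurable
    finally show "(\<integral>\<^sup>+r. \<phi> r * (ennreal (r powr (- 1 / p)) * (if 0 \<le> x \<and> x \<le> t \<and> x powr p \<le> r \<and> r \<le> 1 then 1 else 0)) \<partial>lborel)
      = (\<integral>\<^sup>+r\<in>{x powr p..1}. \<phi> r * ennreal (r powr (- 1 / p)) \<partial>lborel) * indicator {0..t} x" .
  qed
  finally show ?thesis .
qed


section \<open>Unit cubes\<close>

text \<open>Iterated integrals and sections of measurable functions call for the product measure
  itself rather than its completion; every function measurable for the completion agrees almost
  everywhere with one measurable for the product.\<close>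

definition pcube :: "nat \<Rightarrow> real set \<Rightarrow> (nat \<Rightarrow> real) measure" where
  "pcube m I = (\<Pi>\<^sub>M i\<in>{..<m}. restrict_space lborel I)"

lemma cube_eq_completion: "cube m I = completion (pcube m I)"
  by (simp add: cube_def pcube_def)

lemma unit_length_interval_bounds:
  assumes "is_interval (I :: real set)" "emeasure lborel I = 1"
  obtains a where "{a<..<a + 1} \<subseteq> I" "I \<subseteq> {a..a + 1}"
proof -
  have ne: "I \<noteq> {}" using assms(2) by auto
  have le: "y - x \<le> 1" if "x \<in> I" "y \<in> I" for x y
  proof (cases "x \<le> y")
    case True
    have "{x..y} \<subseteq> I" using mem_is_interval_1_I[OF assms(1) that] by auto
    then have "emeasure lborel {x..y} \<le> emeasure lborel I"
      by (intro emeasure_mono) (auto intro: real_interval_borel_measurable assms(1))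
    then have "ennreal (y - x) \<le> 1" using True assms(2) by simp
    then show ?thesis by simp
  qed simp
  obtain z where z: "z \<in> I" using ne by auto
  have bd: "bdd_below I" using le[OF _ z] by (intro bdd_belowI[of _ "z - 1"]) force
  have ba: "bdd_above I" using le[OF z] by (intro bdd_aboveI[of _ "z + 1"]) force
  define a b where "a = Inf I" and "b = Sup I"
  have sub: "I \<subseteq> {a..b}" using bd ba by (auto simp: a_def b_def cInf_lower cSup_upper)
  have ab: "a \<le> b" using sub z by auto
  have sup: "{a<..<b} \<subseteq> I"
  proof
    fix x assume "x \<in> {a<..<b}"
    then have "Inf I < x" "x < Sup I" by (simp_all add: a_def b_def)
    then obtain u v where "u \<in> I" "u < x" "v \<in> I" "x < v"
      unfolding cInf_less_iff[OF ne bd] less_cSup_iff[OF ne ba] by blast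
    then show "x \<in> I" using mem_is_interval_1_I[OF assms(1), of u v x] by simp
  qed
  have I: "I \<in> sets lborel" using real_interval_borel_measurable[OF assms(1)] by simp
  have "emeasure lborel I \<le> emeasure lborel {a..b}" by (rule emeasure_mono[OF sub]) simp
  then have "1 \<le> ennreal (b - a)" using ab assms(2) by simp
  moreover have "emeasure lborel {a<..<b} \<le> emeasure lborel I" by (rule emeasure_mono[OF sup I])
  then have "ennreal (b - a) \<le> 1" using ab assms(2) by simp
  ultimately have "b = a + 1" by (simp add: ennreal_ge_1)
  with sub sup show thesis by (intro that[of a]) auto
qed

text \<open>The left end point is the parameter; whether the end points belong to \<open>I\<close> is left open.\<close>

locale unit_length =
  fixes I :: "real set" and a :: real
  assumes sup: "{a<..<a + 1} \<subseteq> I" and sub: "I \<subseteq> {a..a + 1}"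
begin

abbreviation "L \<equiv> restrict_space lborel I"

lemma I_eq: "I = {a<..<a + 1} \<union> (I \<inter> {a, a + 1})"
  using sup sub by force

lemma I_borel[simp, measurable]: "I \<in> sets borel"
  by (subst I_eq) (intro sets.Un borel_open finite_imp_closed borel_closed; auto)

lemma interior_I: "interior I = {a<..<a + 1}"
proof
  show "{a<..<a + 1} \<subseteq> interior I" using sup by (simp add: interior_maximal)
  show "interior I \<subseteq> {a<..<a + 1}" using interior_mono[OF sub] by simp
qed

lemma space_L: "space L = I" by (simp add: space_restrict_space)

lemma sets_L: "A \<in> sets L \<longleftrightarrow> A \<subseteq> I \<and> A \<in> sets borel"
  by (subst sets_restrict_space_iff) auto

lemma measurable_L[simp]: "f \<in> borel_measurable borel \<Longrightarrow> f \<in> borel_measurable L"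
  by (rule measurable_restrict_space1) simp

lemma AE_lborel_I: "AE s in lborel. s \<in> I \<longleftrightarrow> s \<in> {a<..<a + 1}"
  using AE_lborel_singleton[of a] AE_lborel_singleton[of "a + 1"]
  by eventually_elim (subst I_eq, auto)

lemma nn_integral_L: "f \<in> borel_measurable borel \<Longrightarrow> (\<integral>\<^sup>+s. f s \<partial>L) = (\<integral>\<^sup>+s\<in>{a<..<a + 1}. f s \<partial>lborel)"
  by (subst nn_integral_restrict_space)
    (auto intro!: nn_integral_cong_AE eventually_mono[OF AE_lborel_I] simp: indicator_def)

lemma emeasure_L: "A \<in> sets borel \<Longrightarrow> emeasure L (A \<inter> I) = emeasure lborel (A \<inter> {a<..<a + 1})"
  by (subst emeasure_restrict_space) (auto intro!: emeasure_eq_AE eventually_mono[OF AE_lborel_I])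

lemma prob_space_L: "prob_space L"
proof (rule prob_spaceI)
  show "emeasure L (space L) = 1" using emeasure_L[of UNIV] by (simp add: space_L)
qed

sublocale L: prob_space L by (rule prob_space_L)
sublocale PL: product_prob_space "\<lambda>_::nat. L" UNIV by standard

lemma AE_L: "AE s in L. a < s \<and> s < a + 1"
  unfolding AE_restrict_space_iff[of I lborel, simplified]
  using AE_lborel_I by eventually_elim auto

sublocale N: prob_space "pcube m I" for m
  unfolding pcube_def by (rule prob_space_PiM) (rule prob_space_L)

lemma prob_space_cube: "prob_space (cube m I)"
proof (rule prob_spaceI)
  show "emeasure (cube m I) (space (cube m I)) = 1"
    using N.emeasure_space_1[of m] by (simp add: cube_eq_completion)
qed

lemma space_pcube: "space (pcube m I) = ({..<m} \<rightarrow>\<^sub>E I)"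
  by (simp add: pcube_def space_PiM space_L)

lemma sets_PiE_pcube: "(\<And>i. i < m \<Longrightarrow> A i \<in> sets L) \<Longrightarrow> Pi\<^sub>E {..<m} A \<in> sets (pcube m I)"
  unfolding pcube_def by (rule sets_PiM_I_finite) auto

lemma emeasure_PiE_pcube:
  "(\<And>i. i < m \<Longrightarrow> A i \<in> sets L) \<Longrightarrow> emeasure (pcube m I) (Pi\<^sub>E {..<m} A) = (\<Prod>i<m. emeasure L (A i))"
  unfolding pcube_def by (rule PL.emeasure_PiM) auto

lemma pcube_eqI:
  "sets P = sets (pcube m I) \<Longrightarrow> (\<And>A. (\<And>i. i < m \<Longrightarrow> A i \<in> sets L) \<Longrightarrow>
    emeasure P (Pi\<^sub>E {..<m} A) = (\<Prod>i<m. emeasure L (A i))) \<Longrightarrow> P = pcube m I"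
  unfolding pcube_def by (rule PL.PiM_eqI) auto

lemma measurable_component_pcube[measurable]: "i < m \<Longrightarrow> (\<lambda>x. x i) \<in> measurable (pcube m I) L"
  unfolding pcube_def by simp

lemma measurable_component_pcube_borel: "i < m \<Longrightarrow> (\<lambda>x. x i) \<in> borel_measurable (pcube m I)"
  using measurable_compose[OF measurable_component_pcube, of i m "\<lambda>x. x" borel] by simp

lemma emeasure_pair_L:
  "A \<in> sets (pcube m I) \<Longrightarrow> B \<in> sets L \<Longrightarrow> emeasure (pcube m I \<Otimes>\<^sub>M L) (A \<times> B) = emeasure (pcube m I) A * emeasure L B"
  by (rule L.emeasure_pair_measure_Times)

text \<open>Resampling a coordinate turns an integral over the cube into an iterated integral with the
  integral along a line inside, while the outer integral remains over the same cube. This avoids a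
  change of dimension where only a direction matters.\<close>

lemma measurable_resample[measurable]:
  assumes "k < m" shows "(\<lambda>(x, r). x(k := r)) \<in> measurable (pcube m I \<Otimes>\<^sub>M L) (pcube m I)"
proof -
  have "insert k {..<m} = {..<m}" using assms by auto
  then show ?thesis using measurable_add_dim[of k "{..<m}" "\<lambda>_. L"] by (simp add: pcube_def)
qed

lemma distr_resample:
  assumes k: "k < m"
  shows "distr (pcube m I \<Otimes>\<^sub>M L) (pcube m I) (\<lambda>(x, r). x(k := r)) = pcube m I"
proof (rule pcube_eqI)
  fix A assume A: "\<And>i. i < m \<Longrightarrow> A i \<in> sets L"
  let ?f = "\<lambda>(x, r). x(k := r)"
  have AI: "A i \<subseteq> I" if "i < m" for i using A[OF that] by (simp add: sets_L)
  have "?f -` Pi\<^sub>E {..<m} A \<inter> space (pcube m I \<Otimes>\<^sub>M L) = Pi\<^sub>E {..<m} (A(k := I)) \<times> A k"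
    using k AI by (fastforce simp: space_pair_measure space_pcube space_L PiE_iff extensional_def split: if_splits)
  then have "emeasure (distr (pcube m I \<Otimes>\<^sub>M L) (pcube m I) ?f) (Pi\<^sub>E {..<m} A)
      = emeasure (pcube m I \<Otimes>\<^sub>M L) (Pi\<^sub>E {..<m} (A(k := I)) \<times> A k)"
    by (subst emeasure_distr[OF measurable_resample[OF k] sets_PiE_pcube]) (use A in auto)
  also have "\<dots> = (\<Prod>i<m. emeasure L ((A(k := I)) i)) * emeasure L (A k)"
  proof -
    have "\<And>i. i < m \<Longrightarrow> (A(k := I)) i \<in> sets L" using A by (auto simp: sets_L)
    then show ?thesis using A k by (simp only: emeasure_pair_L sets_PiE_pcube emeasure_PiE_pcube)
  qed
  also have "\<dots> = (\<Prod>i<m. emeasure L (A i))"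
  proof -
    have "emeasure L I = 1" using L.emeasure_space_1 by (simp add: space_L)
    then show ?thesis using k by (simp add: prod.remove[of "{..<m}" k] mult.commute)
  qed
  finally show "emeasure (distr (pcube m I \<Otimes>\<^sub>M L) (pcube m I) ?f) (Pi\<^sub>E {..<m} A) = (\<Prod>i<m. emeasure L (A i))" .
qed simp

lemma insert_coord_space:
  assumes "k \<le> m" "y \<in> {..<m} \<rightarrow>\<^sub>E I" "t \<in> I"
  shows "insert_coord k y t \<in> {..<Suc m} \<rightarrow>\<^sub>E I"
proof (rule PiE_I)
  fix i assume "i \<in> {..<Suc m}"
  then show "insert_coord k y t i \<in> I" using assms by (auto simp: insert_coord_def PiE_iff)
next
  fix i assume "i \<notin> {..<Suc m}"
  then show "insert_coord k y t i = undefined" using assms by (auto simp: insert_coord_def PiE_iff extensional_def)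
qed

lemma measurable_insert_coord[measurable]:
  assumes "k \<le> m" shows "(\<lambda>(y, t). insert_coord k y t) \<in> measurable (pcube m I \<Otimes>\<^sub>M L) (pcube (Suc m) I)"
proof -
  have A: "(\<lambda>p. insert_coord k (fst p) (snd p) i) \<in> measurable (pcube m I \<Otimes>\<^sub>M L) L" if i: "i \<in> {..<Suc m}" for i
  proof -
    consider "i < k" | "i = k" | "k < i" by linarith
    then show ?thesis
      using i assms by cases (auto simp: insert_coord_def intro!: measurable_compose[OF measurable_fst measurable_component_pcube])
  qed
  have B: "(\<lambda>p i. insert_coord k (fst p) (snd p) i) \<in> space (pcube m I \<Otimes>\<^sub>M L) \<rightarrow> (\<Pi>\<^sub>E i\<in>{..<Suc m}. space L)"
  proof (intro funcsetI)
    fix p assume "p \<in> space (pcube m I \<Otimes>\<^sub>M L)"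
    then have "fst p \<in> {..<m} \<rightarrow>\<^sub>E I" "snd p \<in> I"
      unfolding space_pair_measure space_pcube space_L mem_Times_iff by simp_all
    from insert_coord_space[OF assms this] show "insert_coord k (fst p) (snd p) \<in> (\<Pi>\<^sub>E i\<in>{..<Suc m}. space L)"
      by (simp only: space_L)
  qed
  from measurable_PiM_single'[of "{..<Suc m}" "\<lambda>i p. insert_coord k (fst p) (snd p) i" "pcube m I \<Otimes>\<^sub>M L" "\<lambda>_. L", OF A B]
  show ?thesis by (simp add: pcube_def[of "Suc m"] case_prod_beta')
qed

lemma distr_insert_coord:
  assumes k: "k \<le> m"
  shows "distr (pcube m I \<Otimes>\<^sub>M L) (pcube (Suc m) I) (\<lambda>(y, t). insert_coord k y t) = pcube (Suc m) I"
proof (rule pcube_eqI)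
  fix A assume A: "\<And>i. i < Suc m \<Longrightarrow> A i \<in> sets L"
  let ?f = "\<lambda>(y, t). insert_coord k y t"
  define s where "s i = (if i < k then i else Suc i)" for i
  have AI: "A i \<subseteq> I" if "i < Suc m" for i using A[OF that] by (simp add: sets_L)
  have As: "A (s i) \<in> sets L" if "i < m" for i using A that by (auto simp: s_def)
  have ins: "insert_coord k y t (s i) = y i" "insert_coord k y t k = t" for y t i
    by (auto simp: insert_coord_def s_def)
  have cover: "i = k \<or> (\<exists>j<m. i = s j)" if "i < Suc m" for i
  proof (cases "i < k")
    case True then show ?thesis using k by (auto simp: s_def intro!: exI[of _ i])
  next
    case False
    then show ?thesis using k that
      by (cases "i = k") (auto simp: s_def intro!: exI[of _ "i - 1"])
  qed
  have "?f -` Pi\<^sub>E {..<Suc m} A \<inter> space (pcube m I \<Otimes>\<^sub>M L) = Pi\<^sub>E {..<m} (\<lambda>i. A (s i)) \<times> A k"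
  proof (intro set_eqI iffI)
    fix p assume p: "p \<in> ?f -` Pi\<^sub>E {..<Suc m} A \<inter> space (pcube m I \<Otimes>\<^sub>M L)"
    obtain y t where [simp]: "p = (y, t)" by (cases p)
    have y: "y \<in> {..<m} \<rightarrow>\<^sub>E I" and *: "\<And>i. i < Suc m \<Longrightarrow> insert_coord k y t i \<in> A i"
      using p by (auto simp: space_pair_measure space_pcube)
    have "y i \<in> A (s i)" if "i < m" for i
      using *[of "s i"] that by (simp add: ins) (auto simp: s_def split: if_splits)
    moreover have "t \<in> A k" using *[of k] k by (simp add: ins)
    ultimately show "p \<in> Pi\<^sub>E {..<m} (\<lambda>i. A (s i)) \<times> A k" using y by (auto simp: PiE_iff)
  next
    fix p assume p: "p \<in> Pi\<^sub>E {..<m} (\<lambda>i. A (s i)) \<times> A k"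
    obtain y t where [simp]: "p = (y, t)" by (cases p)
    have y: "y \<in> {..<m} \<rightarrow>\<^sub>E I" "t \<in> I" using p As AI[of k] k by (auto simp: PiE_iff sets_L)
    have "insert_coord k y t i \<in> A i" if "i < Suc m" for i
      using cover[OF that] p ins by (auto simp: PiE_iff)
    then show "p \<in> ?f -` Pi\<^sub>E {..<Suc m} A \<inter> space (pcube m I \<Otimes>\<^sub>M L)"
      using insert_coord_space[OF k y] y by (auto simp: space_pair_measure space_pcube space_L PiE_iff)
  qed
  then have "emeasure (distr (pcube m I \<Otimes>\<^sub>M L) (pcube (Suc m) I) ?f) (Pi\<^sub>E {..<Suc m} A)
      = emeasure (pcube m I \<Otimes>\<^sub>M L) (Pi\<^sub>E {..<m} (\<lambda>i. A (s i)) \<times> A k)"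
    by (subst emeasure_distr[OF measurable_insert_coord[OF k] sets_PiE_pcube]) (use A in auto)
  also have "\<dots> = (\<Prod>i<m. emeasure L (A (s i))) * emeasure L (A k)"
    using emeasure_pair_L[OF sets_PiE_pcube[OF As] A[of k]] emeasure_PiE_pcube[OF As] k by simp
  also have "(\<Prod>i<m. emeasure L (A (s i))) = (\<Prod>i\<in>{..<Suc m} - {k}. emeasure L (A i))"
    by (rule prod.reindex_bij_witness[where i = "\<lambda>j. if j < k then j else j - 1" and j = s])
      (use k in \<open>auto simp: s_def split: if_splits\<close>)
  also have "\<dots> * emeasure L (A k) = (\<Prod>i<Suc m. emeasure L (A i))"
    using k by (subst prod.remove[of "{..<Suc m}" k]) (auto simp: mult.commute)
  finally show "emeasure (distr (pcube m I \<Otimes>\<^sub>M L) (pcube (Suc m) I) ?f) (Pi\<^sub>E {..<Suc m} A) = (\<Prod>i<Suc m. emeasure L (A i))" .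
qed simp

lemma nn_integral_resample:
  fixes f :: "(nat \<Rightarrow> real) \<Rightarrow> ennreal"
  assumes "k < m" and [measurable]: "f \<in> borel_measurable (pcube m I)"
  shows "(\<integral>\<^sup>+x. f x \<partial>pcube m I) = (\<integral>\<^sup>+x. (\<integral>\<^sup>+r. f (x(k := r)) \<partial>L) \<partial>pcube m I)"
proof -
  note [measurable] = measurable_resample[OF assms(1)]
  have "(\<integral>\<^sup>+x. f x \<partial>pcube m I) = (\<integral>\<^sup>+p. f (case p of (x, r) \<Rightarrow> x(k := r)) \<partial>(pcube m I \<Otimes>\<^sub>M L))"
    by (subst (1) distr_resample[OF assms(1), symmetric]) (rule nn_integral_distr; measurable)
  also have "\<dots> = (\<integral>\<^sup>+x. (\<integral>\<^sup>+r. f (case (x, r) of (x, r) \<Rightarrow> x(k := r)) \<partial>L) \<partial>pcube m I)"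
    by (rule L.nn_integral_fst[symmetric]) measurable
  finally show ?thesis by simp
qed

lemma nn_integral_insert_coord:
  fixes f :: "(nat \<Rightarrow> real) \<Rightarrow> ennreal"
  assumes "k \<le> m" and [measurable]: "f \<in> borel_measurable (pcube (Suc m) I)"
  shows "(\<integral>\<^sup>+x. f x \<partial>pcube (Suc m) I) = (\<integral>\<^sup>+y. (\<integral>\<^sup>+t. f (insert_coord k y t) \<partial>L) \<partial>pcube m I)"
proof -
  note [measurable] = measurable_insert_coord[OF assms(1)]
  have "(\<integral>\<^sup>+x. f x \<partial>pcube (Suc m) I) = (\<integral>\<^sup>+p. f (case p of (y, t) \<Rightarrow> insert_coord k y t) \<partial>(pcube m I \<Otimes>\<^sub>M L))"
    by (subst (1) distr_insert_coord[OF assms(1), symmetric]) (rule nn_integral_distr; measurable)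
  also have "\<dots> = (\<integral>\<^sup>+x. (\<integral>\<^sup>+r. f (case (x, r) of (y, t) \<Rightarrow> insert_coord k y t) \<partial>L) \<partial>pcube m I)"
    by (rule L.nn_integral_fst[symmetric]) measurable
  finally show ?thesis by simp
qed

lemma sigma_finite_pair: "pair_sigma_finite (pcube m I) L"
  by (rule pair_sigma_finite.intro) (rule N.sigma_finite_measure_axioms, rule L.sigma_finite_measure_axioms)

lemma AE_resample:
  assumes "k < m" "AE x in pcube m I. P x"
  shows "AE x in pcube m I. AE r in L. P (x(k := r))"
proof -
  interpret P: pair_sigma_finite "pcube m I" L by (rule sigma_finite_pair)
  have "AE x in distr (pcube m I \<Otimes>\<^sub>M L) (pcube m I) (\<lambda>(x, r). x(k := r)). P x"
    unfolding distr_resample[OF assms(1)] by fact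
  from AE_distrD[OF measurable_resample[OF assms(1)] this]
  have "AE p in pcube m I \<Otimes>\<^sub>M L. P (case p of (x, r) \<Rightarrow> x(k := r))" .
  from P.AE_pair[OF this] show ?thesis by simp
qed

lemma AE_insert_coord:
  assumes "k \<le> m" "AE x in pcube (Suc m) I. P x"
  shows "AE y in pcube m I. AE t in L. P (insert_coord k y t)"
proof -
  interpret P: pair_sigma_finite "pcube m I" L by (rule sigma_finite_pair)
  have "AE x in distr (pcube m I \<Otimes>\<^sub>M L) (pcube (Suc m) I) (\<lambda>(y, t). insert_coord k y t). P x"
    unfolding distr_insert_coord[OF assms(1)] by fact
  from AE_distrD[OF measurable_insert_coord[OF assms(1)] this]
  have "AE p in pcube m I \<Otimes>\<^sub>M L. P (case p of (y, t) \<Rightarrow> insert_coord k y t)" .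
  from P.AE_pair[OF this] show ?thesis by simp
qed

lemma integrable_resample:
  fixes f :: "(nat \<Rightarrow> real) \<Rightarrow> real"
  assumes "k < m" "integrable (pcube m I) f"
  shows "integrable (pcube m I \<Otimes>\<^sub>M L) (\<lambda>(x, r). f (x(k := r)))"
    and "AE x in pcube m I. integrable L (\<lambda>r. f (x(k := r)))"
    and "integrable (pcube m I) (\<lambda>x. \<integral>r. f (x(k := r)) \<partial>L)"
    and "(\<integral>x. f x \<partial>pcube m I) = (\<integral>x. (\<integral>r. f (x(k := r)) \<partial>L) \<partial>pcube m I)"
proof -
  interpret P: pair_sigma_finite "pcube m I" L by (rule sigma_finite_pair)
  note [measurable] = measurable_resample[OF assms(1)] borel_measurable_integrable[OF assms(2)]
  have "integrable (distr (pcube m I \<Otimes>\<^sub>M L) (pcube m I) (\<lambda>(x, r). x(k := r))) f"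
    unfolding distr_resample[OF assms(1)] by fact
  then have "integrable (pcube m I \<Otimes>\<^sub>M L) (\<lambda>p. f (case p of (x, r) \<Rightarrow> x(k := r)))"
    by (subst (asm) integrable_distr_eq) auto
  then show 1: "integrable (pcube m I \<Otimes>\<^sub>M L) (\<lambda>(x, r). f (x(k := r)))" by (simp add: case_prod_beta')
  from P.AE_integrable_fst'[OF 1] show "AE x in pcube m I. integrable L (\<lambda>r. f (x(k := r)))" by simp
  from P.integrable_fst'[OF 1] show "integrable (pcube m I) (\<lambda>x. \<integral>r. f (x(k := r)) \<partial>L)" by simp
  have "(\<integral>x. f x \<partial>pcube m I) = (\<integral>p. f (case p of (x, r) \<Rightarrow> x(k := r)) \<partial>(pcube m I \<Otimes>\<^sub>M L))"
    by (subst (1) distr_resample[OF assms(1), symmetric]) (rule integral_distr; measurable)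
  also have "\<dots> = (\<integral>x. (\<integral>r. f (x(k := r)) \<partial>L) \<partial>pcube m I)"
    using P.integral_fst'[OF 1] by (simp add: case_prod_beta')
  finally show "(\<integral>x. f x \<partial>pcube m I) = (\<integral>x. (\<integral>r. f (x(k := r)) \<partial>L) \<partial>pcube m I)" .
qed


subsection \<open>A measure preserving map from the cube to the unit interval\<close>

definition center_dist :: "nat \<Rightarrow> (nat \<Rightarrow> real) \<Rightarrow> real" where
  "center_dist m x = Max ((\<lambda>i. \<bar>x i - (a + 1/2)\<bar>) ` {..<m})"

text \<open>The sup-balls around the centre have volume \<open>(2 * r) ^ m\<close>. The value \<open>1/2\<close> on a null set
  keeps the map inside the open unit interval.\<close>

definition cube_to_interval :: "nat \<Rightarrow> (nat \<Rightarrow> real) \<Rightarrow> real" where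
  "cube_to_interval m x = (let s = (2 * center_dist m x) ^ m in if 0 < s \<and> s < 1 then s else 1/2)"

lemma center_dist_le_iff: "0 < m \<Longrightarrow> center_dist m x \<le> r \<longleftrightarrow> (\<forall>i<m. \<bar>x i - (a + 1/2)\<bar> \<le> r)"
  unfolding center_dist_def by (subst Max_le_iff) auto

lemma measurable_center_dist[measurable]: "center_dist m \<in> borel_measurable (pcube m I)"
  unfolding center_dist_def[abs_def]
  by (intro borel_measurable_Max borel_measurable_abs borel_measurable_diff measurable_component_pcube_borel) auto

lemma center_dist_nonneg: "0 < m \<Longrightarrow> 0 \<le> center_dist m x"
  unfolding center_dist_def by (subst Max_ge_iff) auto

lemma emeasure_center_dist_le:
  assumes "0 < m" "0 \<le> r" "r \<le> 1/2"
  shows "emeasure (pcube m I) {x \<in> space (pcube m I). center_dist m x \<le> r} = ennreal ((2 * r) ^ m)"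
proof -
  have "{x \<in> space (pcube m I). center_dist m x \<le> r} = Pi\<^sub>E {..<m} (\<lambda>_. {a + 1/2 - r..a + 1/2 + r} \<inter> I)"
  proof -
    have "\<bar>y - (a + 1/2)\<bar> \<le> r \<longleftrightarrow> y \<in> {a + 1/2 - r..a + 1/2 + r}" for y by (auto simp: abs_le_iff)
    then show ?thesis unfolding space_pcube center_dist_le_iff[OF assms(1)]
      by (simp only: PiE_iff set_eq_iff mem_Collect_eq lessThan_iff Ball_def Int_iff) blast
  qed
  then have "emeasure (pcube m I) {x \<in> space (pcube m I). center_dist m x \<le> r} = (\<Prod>i<m. emeasure L ({a + 1/2 - r..a + 1/2 + r} \<inter> I))"
    by (simp add: emeasure_PiE_pcube sets_L)
  also have "emeasure L ({a + 1/2 - r..a + 1/2 + r} \<inter> I) = ennreal (2 * r)"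
  proof -
    have "emeasure L ({a + 1/2 - r..a + 1/2 + r} \<inter> I) = emeasure lborel ({a + 1/2 - r..a + 1/2 + r} \<inter> {a<..<a + 1})"
      by (rule emeasure_L) simp
    also have "\<dots> = emeasure lborel {a + 1/2 - r..a + 1/2 + r}"
    proof (rule emeasure_eq_AE)
      show "AE x in lborel. x \<in> {a + 1/2 - r..a + 1/2 + r} \<inter> {a<..<a + 1} \<longleftrightarrow> x \<in> {a + 1/2 - r..a + 1/2 + r}"
        using AE_lborel_singleton[of a] AE_lborel_singleton[of "a + 1"]
      proof eventually_elim
        case (elim x)
        then show ?case using assms(2,3) unfolding Int_iff atLeastAtMost_iff greaterThanLessThan_iff by linarith
      qed
    qed auto
    also have "\<dots> = ennreal (2 * r)" using assms by simp
    finally show ?thesis .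
  qed
  finally show ?thesis using assms by (simp add: prod_ennreal ennreal_power)
qed

lemma AE_pcube_interior: "AE x in pcube m I. \<forall>i<m. a < x i \<and> x i < a + 1"
proof (unfold AE_all_countable, rule allI)
  fix i
  show "AE x in pcube m I. i < m \<longrightarrow> a < x i \<and> x i < a + 1"
  proof (cases "i < m")
    case True
    have "AE x in Pi\<^sub>M {..<m} (\<lambda>_. L). a < x i \<and> x i < a + 1"
      by (rule AE_PiM_component) (use True AE_L prob_space_L in auto)
    then show ?thesis unfolding pcube_def by (rule eventually_mono) simp
  qed simp
qed

lemma AE_center_dist:
  assumes "0 < m" shows "AE x in pcube m I. 0 < center_dist m x \<and> center_dist m x < 1/2"
proof -
  have "AE x in pcube m I. \<not> center_dist m x \<le> 0"
    using emeasure_center_dist_le[OF assms, of 0] assms by (subst AE_iff_measurable[OF _ refl]) auto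
  moreover have "AE x in pcube m I. center_dist m x < 1/2"
  proof -
    from AE_pcube_interior have "AE x in pcube m I. \<forall>i<m. a < x i \<and> x i < a + 1" .
    then show ?thesis
    proof eventually_elim
      case (elim x)
      have "\<bar>y - (a + 1/2)\<bar> < 1/2" if "a < y" "y < a + 1" for y
        using that unfolding abs_less_iff by linarith
      then show ?case unfolding center_dist_def using assms elim by (subst Max_less_iff) auto
    qed
  qed
  ultimately show ?thesis by eventually_elim auto
qed

lemma measurable_cube_to_interval: "cube_to_interval m \<in> borel_measurable (pcube m I)"
  unfolding cube_to_interval_def[abs_def] Let_def by measurable

lemma AE_cube_to_interval:
  assumes "0 < m"
  shows "AE x in pcube m I. cube_to_interval m x = (2 * center_dist m x) ^ m \<and> 0 < center_dist m x \<and> center_dist m x < 1/2"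
  using AE_center_dist[OF assms]
proof eventually_elim
  case (elim x)
  then have "(2 * center_dist m x) ^ m < 1" using assms power_Suc_less_one[of "2 * center_dist m x" "m - 1"] by simp
  then show ?case using elim by (auto simp: cube_to_interval_def Let_def)
qed

lemma emeasure_cube_to_interval:
  assumes m: "0 < m" and B: "B \<in> sets borel"
  shows "emeasure (pcube m I) (cube_to_interval m -` B \<inter> space (pcube m I)) = emeasure lborel (B \<inter> {0<..<1})"
proof -
  note [measurable] = measurable_cube_to_interval[of m]
  have cdf: "measure (pcube m I) {x \<in> space (pcube m I). cube_to_interval m x \<le> t} = (t - 0) / (1 - 0)" if t: "0 \<le> t" "t \<le> 1" for t
  proof -
    define q where "q = root m t / 2"
    have q: "0 \<le> q" "q \<le> 1/2" "(2 * q) ^ m = t" using m t by (auto simp: q_def real_root_le_1_iff)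
    have iff: "y ^ m \<le> t \<longleftrightarrow> y / 2 \<le> q" if "0 \<le> y" for y
      unfolding q(3)[symmetric] using power_mono_iff[of y "2 * q" m] that q m by auto
    have "emeasure (pcube m I) {x \<in> space (pcube m I). cube_to_interval m x \<le> t}
        = emeasure (pcube m I) {x \<in> space (pcube m I). center_dist m x \<le> q}"
    proof (rule emeasure_eq_AE)
      show "AE x in pcube m I. x \<in> {x \<in> space (pcube m I). cube_to_interval m x \<le> t}
          \<longleftrightarrow> x \<in> {x \<in> space (pcube m I). center_dist m x \<le> q}"
        using AE_cube_to_interval[OF m]
      proof eventually_elim
        case (elim x)
        then show ?case using iff[of "2 * center_dist m x"] by simp
      qed
    qed measurable
    also have "\<dots> = ennreal t" using emeasure_center_dist_le[OF m q(1,2)] q(3) by simp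
    finally show ?thesis using t by (simp add: measure_def)
  qed
  have "distributed (pcube m I) lborel (cube_to_interval m) (\<lambda>x. indicator {0..1} x / measure lborel {0..1::real})"
    by (rule N.uniform_distrI_borel_atLeastAtMost) (use cdf in auto)
  then have "distr (pcube m I) lborel (cube_to_interval m) = density lborel (\<lambda>x. indicator {0..1::real} x)"
    by (simp add: distributed_distr_eq_density ennreal_indicator)
  then have "emeasure (distr (pcube m I) lborel (cube_to_interval m)) B = emeasure lborel (B \<inter> {0..1})"
  proof -
    assume *: "distr (pcube m I) lborel (cube_to_interval m) = density lborel (\<lambda>x. indicator {0..1::real} x)"
    have "emeasure (density lborel (\<lambda>x. indicator {0..1::real} x)) B = (\<integral>\<^sup>+x. indicator {0..1} x * indicator B x \<partial>lborel)"
      using B by (intro emeasure_density) auto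
    also have "\<dots> = (\<integral>\<^sup>+x. indicator (B \<inter> {0..1}) x \<partial>lborel)"
      by (intro nn_integral_cong) (auto simp: indicator_def)
    also have "\<dots> = emeasure lborel (B \<inter> {0..1})" using B by (intro nn_integral_indicator) auto
    finally show ?thesis unfolding * .
  qed
  also have "emeasure (distr (pcube m I) lborel (cube_to_interval m)) B = emeasure (pcube m I) (cube_to_interval m -` B \<inter> space (pcube m I))"
    using B by (intro emeasure_distr) auto
  also have "emeasure lborel (B \<inter> {0..1}) = emeasure lborel (B \<inter> {0<..<1})"
    using AE_lborel_singleton[of "0::real"] AE_lborel_singleton[of "1::real"] B
    by (intro emeasure_eq_AE) (auto elim!: eventually_elim2)
  finally show ?thesis .
qed

lemma cube_to_interval_range: "cube_to_interval m x \<in> {0<..<1}"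
  by (auto simp: cube_to_interval_def Let_def)

lemma cube_to_interval_preimage:
  assumes m: "0 < m" and S: "S \<in> sets unit_interval"
  shows "cube_to_interval m -` S \<inter> space (cube m I) \<in> sets (cube m I) \<and>
    emeasure (cube m I) (cube_to_interval m -` S \<inter> space (cube m I)) = emeasure unit_interval S"
proof -
  have S': "S \<in> sets lebesgue" "S \<subseteq> {0<..<1}" using S by (auto simp: sets_restrict_space_iff)
  obtain B N1 N2 where B: "S = B \<union> N1" "N1 \<subseteq> N2" "N2 \<in> null_sets lborel" "B \<in> sets lborel"
    using sets_completionE[OF S'(1)] by blast
  let ?pre = "\<lambda>A. cube_to_interval m -` A \<inter> space (pcube m I)"
  have B': "?pre B \<in> sets (pcube m I)" "?pre N2 \<in> sets (pcube m I)"
    using B(3,4) by (auto intro!: measurable_sets[OF measurable_cube_to_interval])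
  have "emeasure lborel (N2 \<inter> {0<..<1}) = 0"
    using B(3) null_set_Int2[of N2 lborel "{0<..<1}"] by auto
  then have N2: "?pre N2 \<in> null_sets (pcube m I)"
    using B' emeasure_cube_to_interval[OF m, of N2] B(3) by (auto simp: null_sets_def)
  have pre: "?pre S = ?pre B \<union> ?pre N1" unfolding B(1) by auto
  have mem: "?pre S \<in> sets (cube m I)"
    unfolding cube_eq_completion by (rule sets_completionI[OF pre _ N2 B'(1)]) (use B(2) in auto)
  have "emeasure (cube m I) (?pre S) = emeasure (cube m I) (?pre B)"
  proof (rule emeasure_eq_AE)
    show "AE x in cube m I. x \<in> ?pre S \<longleftrightarrow> x \<in> ?pre B"
      unfolding cube_eq_completion AE_completion_iff
      using AE_not_in[OF N2] by eventually_elim (use B(1,2) in auto)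
    show "?pre B \<in> sets (cube m I)" using B' by (simp add: cube_eq_completion)
  qed (rule mem)
  also have "\<dots> = emeasure lborel (B \<inter> {0<..<1})"
    using emeasure_cube_to_interval[OF m, of B] B(4) B' by (simp add: cube_eq_completion)
  also have "B \<inter> {0<..<1} = B" using S'(2) B(1) by auto
  also have "emeasure lborel B = emeasure lebesgue B" using B(4) by simp
  also have "\<dots> = emeasure lebesgue S"
  proof (rule emeasure_eq_AE)
    show "AE x in lebesgue. x \<in> B \<longleftrightarrow> x \<in> S"
      unfolding AE_completion_iff using AE_not_in[OF B(3)] by eventually_elim (use B(1,2) in auto)
  qed (use B(4) S' in auto)
  also have "\<dots> = emeasure unit_interval S" using S' by (subst emeasure_restrict_space) auto
  finally show ?thesis using mem by (simp add: cube_eq_completion)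
qed

lemma cube_to_interval_measure_preserving:
  assumes m: "0 < m"
  shows "cube_to_interval m \<in> measurable (cube m I) unit_interval"
    and "distr (cube m I) unit_interval (cube_to_interval m) = unit_interval"
proof -
  show mm: "cube_to_interval m \<in> measurable (cube m I) unit_interval"
    using cube_to_interval_range cube_to_interval_preimage[OF m] by (intro measurableI) auto
  show "distr (cube m I) unit_interval (cube_to_interval m) = unit_interval"
    using cube_to_interval_preimage[OF m] by (intro measure_eqI) (auto simp: emeasure_distr[OF mm])
qed

end


section \<open>Smooth functions of one variable with compact support\<close>

text \<open>A coinductive form of infinite differentiability: to show that a function is smooth it is
  enough to exhibit a family of functions that contains it and is closed under differentiation.\<close>

definition smooth_real :: "(real \<Rightarrow> real) \<Rightarrow> bool" where
  "smooth_real f \<longleftrightarrow> (\<exists>S. f \<in> S \<and> (\<forall>g\<in>S. \<exists>g'\<in>S. \<forall>x. (g has_real_derivative g' x) (at x)))"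

lemma smooth_real_closedI:
  "(\<And>g. g \<in> S \<Longrightarrow> \<exists>g'\<in>S. \<forall>x. (g has_real_derivative g' x) (at x)) \<Longrightarrow> f \<in> S \<Longrightarrow> smooth_real f"
  unfolding smooth_real_def by (intro exI[of _ S]) simp

lemma smooth_real_deriv:
  assumes "smooth_real f"
  shows "smooth_real (deriv f)" "(f has_real_derivative deriv f x) (at x)"
proof -
  obtain S where S: "f \<in> S" "\<forall>g\<in>S. \<exists>g'\<in>S. \<forall>x. (g has_real_derivative g' x) (at x)"
    using assms by (auto simp: smooth_real_def)
  then obtain f' where f': "f' \<in> S" "\<And>x. (f has_real_derivative f' x) (at x)" by blast
  then have "deriv f = f'" by (auto intro!: ext DERIV_imp_deriv)
  then show "smooth_real (deriv f)" "(f has_real_derivative deriv f x) (at x)"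
    using f' S by (auto simp: smooth_real_def)
qed

lemma smooth_realI:
  assumes "smooth_real g" "\<And>x. (f has_real_derivative g x) (at x)"
  shows "smooth_real f"
proof -
  obtain S where "g \<in> S" "\<forall>g\<in>S. \<exists>g'\<in>S. \<forall>x. (g has_real_derivative g' x) (at x)"
    using assms(1) by (auto simp: smooth_real_def)
  then show ?thesis unfolding smooth_real_def using assms(2) by (intro exI[of _ "insert f S"]) blast
qed

lemma smooth_real_continuous: "smooth_real f \<Longrightarrow> continuous_on S f"
  using smooth_real_deriv(2)[of f] by (auto intro: continuous_at_imp_continuous_on DERIV_isCont)

lemma smooth_real_measurable: "smooth_real f \<Longrightarrow> f \<in> borel_measurable borel"
  by (intro borel_measurable_continuous_onI smooth_real_continuous)

lemma smooth_real_linear: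
  assumes "smooth_real f" "smooth_real g"
  shows "smooth_real (\<lambda>x. c * f x + d * g x)"
proof -
  obtain S where S: "f \<in> S" "\<forall>g\<in>S. \<exists>g'\<in>S. \<forall>x. (g has_real_derivative g' x) (at x)"
    using assms(1) by (auto simp: smooth_real_def)
  obtain T where T: "g \<in> T" "\<forall>g\<in>T. \<exists>g'\<in>T. \<forall>x. (g has_real_derivative g' x) (at x)"
    using assms(2) by (auto simp: smooth_real_def)
  let ?R = "{\<lambda>x. c * u x + d * v x | u v. u \<in> S \<and> v \<in> T}"
  have "\<exists>h'\<in>?R. \<forall>x. (h has_real_derivative h' x) (at x)" if h0: "h \<in> ?R" for h
  proof -
    obtain u v where h: "h = (\<lambda>x. c * u x + d * v x)" "u \<in> S" "v \<in> T" using h0 by blast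
    obtain u' v' where "u' \<in> S" "\<forall>x. (u has_real_derivative u' x) (at x)" "v' \<in> T" "\<forall>x. (v has_real_derivative v' x) (at x)"
      using S(2) T(2) h(2,3) by blast
    then show ?thesis unfolding h(1)
      by (intro bexI[of _ "\<lambda>x. c * u' x + d * v' x"]) (auto intro!: derivative_eq_intros)
  qed
  moreover have "(\<lambda>x. c * f x + d * g x) \<in> ?R" using S T by auto
  ultimately show ?thesis by (rule smooth_real_closedI)
qed

inductive_set product_sums :: "(real \<Rightarrow> real) set \<Rightarrow> (real \<Rightarrow> real) set \<Rightarrow> (real \<Rightarrow> real) set" for S T where
  product: "u \<in> S \<Longrightarrow> v \<in> T \<Longrightarrow> (\<lambda>x. u x * v x) \<in> product_sums S T"
| add: "f \<in> product_sums S T \<Longrightarrow> g \<in> product_sums S T \<Longrightarrow> (\<lambda>x. f x + g x) \<in> product_sums S T"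

lemma smooth_real_mult:
  assumes "smooth_real f" "smooth_real g"
  shows "smooth_real (\<lambda>x. f x * g x)"
proof -
  obtain S where S: "f \<in> S" "\<forall>g\<in>S. \<exists>g'\<in>S. \<forall>x. (g has_real_derivative g' x) (at x)"
    using assms(1) by (auto simp: smooth_real_def)
  obtain T where T: "g \<in> T" "\<forall>g\<in>T. \<exists>g'\<in>T. \<forall>x. (g has_real_derivative g' x) (at x)"
    using assms(2) by (auto simp: smooth_real_def)
  have "\<exists>h'\<in>product_sums S T. \<forall>x. (h has_real_derivative h' x) (at x)" if "h \<in> product_sums S T" for h
    using that
  proof induction
    case (product u v)
    obtain u' v' where uv: "u' \<in> S" "\<forall>x. (u has_real_derivative u' x) (at x)" "v' \<in> T" "\<forall>x. (v has_real_derivative v' x) (at x)"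
      using S(2) T(2) product by blast
    show ?case
    proof (intro bexI[of _ "\<lambda>x. u' x * v x + u x * v' x"] allI)
      fix x show "((\<lambda>x. u x * v x) has_real_derivative u' x * v x + u x * v' x) (at x)"
        using uv by (auto intro!: derivative_eq_intros)
    qed (intro product_sums.intros uv product)
  next
    case (add f g)
    then obtain f' g' where "f' \<in> product_sums S T" "\<forall>x. (f has_real_derivative f' x) (at x)"
      "g' \<in> product_sums S T" "\<forall>x. (g has_real_derivative g' x) (at x)" by blast
    then show ?case
      by (intro bexI[of _ "\<lambda>x. f' x + g' x"]) (auto intro!: derivative_eq_intros product_sums.add)
  qed
  moreover have "(\<lambda>x. f x * g x) \<in> product_sums S T" using S T by (intro product_sums.product)
  ultimately show ?thesis by (rule smooth_real_closedI)
qed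

lemma smooth_real_affine:
  assumes "smooth_real f" shows "smooth_real (\<lambda>x. f (c * x + d))"
proof -
  obtain S where S: "f \<in> S" "\<forall>g\<in>S. \<exists>g'\<in>S. \<forall>x. (g has_real_derivative g' x) (at x)"
    using assms(1) by (auto simp: smooth_real_def)
  let ?R = "{\<lambda>x. k * u (c * x + d) | k u. u \<in> S}"
  have "\<exists>h'\<in>?R. \<forall>x. (h has_real_derivative h' x) (at x)" if h0: "h \<in> ?R" for h
  proof -
    obtain k u where h: "h = (\<lambda>x. k * u (c * x + d))" "u \<in> S" using h0 by blast
    obtain u' where u': "u' \<in> S" "\<And>x. (u has_real_derivative u' x) (at x)" using S(2) h(2) by blast
    show ?thesis
    proof (rule bexI)
      show "\<forall>x. (h has_real_derivative (k * c) * u' (c * x + d)) (at x)"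
      proof
        fix x
        have "((\<lambda>x. u (c * x + d)) has_real_derivative u' (c * x + d) * c) (at x)"
          by (rule DERIV_chain2[OF u'(2)]) (auto intro!: derivative_eq_intros)
        from DERIV_cmult[OF this, of k] show "(h has_real_derivative (k * c) * u' (c * x + d)) (at x)"
          unfolding h(1) by (simp add: mult_ac)
      qed
      show "(\<lambda>x. (k * c) * u' (c * x + d)) \<in> ?R" using u'(1) by blast
    qed
  qed
  moreover have "(\<lambda>x. f (c * x + d)) \<in> ?R" using S by (auto intro!: exI[of _ 1] exI[of _ f])
  ultimately show ?thesis by (rule smooth_real_closedI)
qed

definition exp_cutoff :: "real \<Rightarrow> real" where
  "exp_cutoff x = (if 0 < x then exp (- 1 / x) else 0)"

lemma poly_times_exp_tendsto_0: "((\<lambda>y. y ^ k * (poly p y * exp (- y))) \<longlongrightarrow> (0::real)) at_top"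
proof (induction p arbitrary: k)
  case 0 then show ?case by simp
next
  case (pCons b p)
  have "((\<lambda>y. b * (y ^ k / exp y) + y ^ Suc k * (poly p y * exp (- y))) \<longlongrightarrow> b * 0 + 0) at_top"
    by (intro tendsto_intros tendsto_power_div_exp_0 pCons.IH)
  then show ?case by (simp add: exp_minus field_simps)
qed

text \<open>The family closed under differentiation consists of the functions that vanish for
  \<open>x \<le> 0\<close> and equal \<open>poly p (1 / x) * exp (- 1 / x)\<close> for \<open>x > 0\<close>.\<close>

lemma smooth_exp_cutoff: "smooth_real exp_cutoff"
proof -
  define h where "h p x = (if 0 < x then poly p (1 / x) * exp (- 1 / x) else 0)" for p :: "real poly" and x :: real
  have der: "(h p has_real_derivative h ([:0, 0, 1:] * (p - pderiv p)) x) (at x)" for p x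
  proof -
    consider "0 < x" | "x < 0" | "x = 0" by linarith
    then show ?thesis
    proof cases
      case 1
      have "((\<lambda>x. poly p (1 / x) * exp (- 1 / x)) has_real_derivative
          poly p (1 / x) * (exp (- 1 / x) * (1 / x\<^sup>2)) + (poly (pderiv p) (1 / x) * (- 1 / x\<^sup>2)) * exp (- 1 / x)) (at x)"
        using 1 by (auto intro!: derivative_eq_intros DERIV_chain'[OF _ poly_DERIV, of "\<lambda>x. 1 / x"] simp: power2_eq_square)
      also have "poly p (1 / x) * (exp (- 1 / x) * (1 / x\<^sup>2)) + (poly (pderiv p) (1 / x) * (- 1 / x\<^sup>2)) * exp (- 1 / x) = h ([:0, 0, 1:] * (p - pderiv p)) x"
        using 1 by (simp add: h_def power2_eq_square field_simps)
      finally show ?thesis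
        by (rule has_field_derivative_transform_within_open[of _ _ _ "{0<..}"]) (use 1 in \<open>auto simp: h_def\<close>)
    next
      case 2
      have "((\<lambda>x. 0) has_real_derivative 0) (at x)" by simp
      then have "(h p has_real_derivative 0) (at x)"
        by (rule has_field_derivative_transform_within_open[of _ _ _ "{..<0}"]) (use 2 in \<open>auto simp: h_def\<close>)
      then show ?thesis using 2 by (simp add: h_def)
    next
      case 3
      have "((\<lambda>y. h p y / y) \<longlongrightarrow> 0) (at 0)"
      proof (rule filterlim_split_at)
        show "((\<lambda>y. h p y / y) \<longlongrightarrow> 0) (at_left 0)"
          by (rule tendsto_eventually) (auto simp: eventually_at_filter h_def)
        show "((\<lambda>y. h p y / y) \<longlongrightarrow> 0) (at_right 0)"
        proof (subst filterlim_at_right_to_top)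
          have "eventually (\<lambda>y. y ^ 1 * (poly p y * exp (- y)) = h p (inverse y) / inverse y) at_top"
            using eventually_gt_at_top[of "0::real"] by eventually_elim (simp add: h_def field_simps)
          then show "((\<lambda>y. h p (inverse y) / inverse y) \<longlongrightarrow> 0) at_top"
            by (rule Lim_transform_eventually[OF poly_times_exp_tendsto_0])
        qed
      qed
      then show ?thesis using 3 by (simp add: has_field_derivative_iff h_def)
    qed
  qed
  have "exp_cutoff = h 1" by (auto simp: exp_cutoff_def h_def fun_eq_iff)
  then show ?thesis unfolding smooth_real_def using der by (intro exI[of _ "range h"]) auto
qed

text \<open>As \<open>k\<close> grows, the bumps converge boundedly to the indicator of the open interval from \<open>c\<close>
  to \<open>d\<close>. The arguments are written out as affine functions to match \<open>smooth_real_affine\<close>.\<close>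

definition bump :: "nat \<Rightarrow> real \<Rightarrow> real \<Rightarrow> real \<Rightarrow> real" where
  "bump k c d x = exp_cutoff (real (Suc k) * x + - real (Suc k) * c) * exp_cutoff (- real (Suc k) * x + real (Suc k) * d)"

lemma smooth_bump: "smooth_real (bump k c d)"
  unfolding bump_def[abs_def] by (intro smooth_real_mult smooth_real_affine smooth_exp_cutoff)

lemma exp_cutoff_bounds: "0 \<le> exp_cutoff x" "exp_cutoff x \<le> 1"
  by (auto simp: exp_cutoff_def)

lemma bump_bounds: "0 \<le> bump k c d x" "bump k c d x \<le> 1"
  unfolding bump_def by (auto intro!: mult_nonneg_nonneg mult_le_one exp_cutoff_bounds)

lemma bump_eq: "bump k c d x = exp_cutoff (real (Suc k) * (x - c)) * exp_cutoff (real (Suc k) * (d - x))"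
  unfolding bump_def by (simp add: algebra_simps)

lemma bump_eq_0: "x \<notin> {c<..<d} \<Longrightarrow> bump k c d x = 0"
  unfolding bump_eq exp_cutoff_def by (auto simp: zero_less_mult_iff)

lemma bump_pos: "x \<in> {c<..<d} \<Longrightarrow> 0 < bump k c d x"
  unfolding bump_eq exp_cutoff_def by (auto simp: zero_less_mult_iff)

lemma bump_tendsto: "(\<lambda>k. bump k c d x) \<longlonglongrightarrow> indicator {c<..<d} x"
proof (cases "x \<in> {c<..<d}")
  case True
  have *: "(\<lambda>k. exp_cutoff (real (Suc k) * y)) \<longlonglongrightarrow> 1" if "0 < y" for y
  proof -
    have "(\<lambda>k. exp (- (1 / y) * inverse (real (Suc k)))) \<longlonglongrightarrow> exp (- (1 / y) * 0)"
      by (intro tendsto_intros LIMSEQ_inverse_real_of_nat)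
    moreover have "exp (- (1 / y) * inverse (real (Suc k))) = exp_cutoff (real (Suc k) * y)" for k
    proof -
      have "0 < real (Suc k) * y" using that by simp
      moreover have "- (1 / y) * inverse (real (Suc k)) = - 1 / (real (Suc k) * y)" by (simp add: divide_inverse)
      ultimately show ?thesis by (simp only: exp_cutoff_def if_True)
    qed
    ultimately show ?thesis by simp
  qed
  have "(\<lambda>k. bump k c d x) \<longlonglongrightarrow> 1 * 1"
    unfolding bump_eq using True by (intro tendsto_mult *) auto
  then show ?thesis using True by simp
qed (simp add: bump_eq_0)


section \<open>Test functions and the fundamental lemma of the calculus of variations\<close>

text \<open>Products of functions of one variable. The value zero off the extensional functions is
  forced, because test functions vanish outside a compact subset of the cube.\<close>

definition tensor :: "nat \<Rightarrow> (nat \<Rightarrow> real \<Rightarrow> real) \<Rightarrow> (nat \<Rightarrow> real) \<Rightarrow> real" where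
  "tensor n \<eta> x = (if x \<in> extensional {..<n} then \<Prod>i<n. \<eta> i (x i) else 0)"

context unit_length
begin

definition test_real :: "(real \<Rightarrow> real) \<Rightarrow> bool" where
  "test_real \<eta> \<longleftrightarrow> smooth_real \<eta> \<and> (\<exists>u v. a < u \<and> u < v \<and> v < a + 1 \<and> (\<forall>x. x \<notin> {u..v} \<longrightarrow> \<eta> x = 0))"

lemma test_bump: "a < c \<Longrightarrow> c < d \<Longrightarrow> d < a + 1 \<Longrightarrow> test_real (bump k c d)"
  unfolding test_real_def by (intro conjI smooth_bump exI[of _ c] exI[of _ d] allI impI bump_eq_0) auto

lemma tensor_fun_upd_derivative:
  assumes "i < n" "smooth_real (\<eta> i)" "x \<in> extensional {..<n}"
  shows "((\<lambda>t. tensor n \<eta> (x(i := t))) has_real_derivative tensor n (\<eta>(i := deriv (\<eta> i))) (x(i := s))) (at s)"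
proof -
  have ext: "x(i := t) \<in> extensional {..<n}" for t using assms by (auto simp: extensional_def)
  have eq: "tensor n \<eta> (x(i := t)) = \<eta> i t * (\<Prod>j\<in>{..<n} - {i}. \<eta> j (x j))" for t
    using assms ext by (simp add: tensor_def prod.remove[of "{..<n}" i])
  have eq': "tensor n (\<eta>(i := deriv (\<eta> i))) (x(i := s)) = deriv (\<eta> i) s * (\<Prod>j\<in>{..<n} - {i}. \<eta> j (x j))"
    using assms ext by (simp add: tensor_def prod.remove[of "{..<n}" i])
  show ?thesis unfolding eq eq' by (intro DERIV_cmult_right smooth_real_deriv assms)
qed

lemma partial_tensor:
  assumes "i < n" "smooth_real (\<eta> i)"
  shows "partial i (tensor n \<eta>) = tensor n (\<eta>(i := deriv (\<eta> i)))"
proof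
  fix x
  show "partial i (tensor n \<eta>) x = tensor n (\<eta>(i := deriv (\<eta> i))) x"
  proof (cases "x \<in> extensional {..<n}")
    case True
    then show ?thesis unfolding partial_def
      using tensor_fun_upd_derivative[where n = n and i = i and \<eta> = \<eta> and x = x and s = "x i", OF assms True] by (simp add: DERIV_imp_deriv)
  next
    case False
    then have "x(i := t) \<notin> extensional {..<n}" for t using assms by (auto simp: extensional_def)
    then show ?thesis using False by (simp add: partial_def tensor_def)
  qed
qed

lemma foldr_partial_tensor:
  assumes "set is \<subseteq> {..<n}" "\<And>i. i < n \<Longrightarrow> smooth_real (\<eta> i)"
  shows "\<exists>\<eta>'. (\<forall>i<n. smooth_real (\<eta>' i)) \<and> foldr partial is (tensor n \<eta>) = tensor n \<eta>'"
  using assms(1)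
proof (induction "is")
  case Nil then show ?case using assms(2) by auto
next
  case (Cons i "is")
  then obtain \<eta>' where \<eta>': "\<forall>i<n. smooth_real (\<eta>' i)" "foldr partial is (tensor n \<eta>) = tensor n \<eta>'" by auto
  then have "foldr partial (i # is) (tensor n \<eta>) = tensor n (\<eta>'(i := deriv (\<eta>' i)))"
    using Cons.prems by (simp add: partial_tensor)
  moreover have "\<forall>j<n. smooth_real ((\<eta>'(i := deriv (\<eta>' i))) j)"
    using \<eta>'(1) Cons.prems by (auto intro: smooth_real_deriv)
  ultimately show ?case by blast
qed

lemma open_cube_extensional: "open_cube n I \<subseteq> extensional {..<n}"
  by (auto simp: open_cube_def PiE_def)

lemma smooth_on_cube_tensor:
  assumes "\<And>i. i < n \<Longrightarrow> smooth_real (\<eta> i)"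
  shows "smooth_on_cube n I (tensor n \<eta>)"
  unfolding smooth_on_cube_def
proof (intro allI impI)
  fix "is" assume "set is \<subseteq> {..<n}"
  from foldr_partial_tensor[where n = n and \<eta> = \<eta>, OF this assms] obtain \<eta>' where
    \<eta>': "\<And>i. i < n \<Longrightarrow> smooth_real (\<eta>' i)" "foldr partial is (tensor n \<eta>) = tensor n \<eta>'" by blast
  have "continuous_on (open_cube n I) (\<lambda>x. \<Prod>i<n. \<eta>' i (x i))"
    by (intro continuous_on_prod continuous_on_compose2[OF smooth_real_continuous[OF \<eta>'(1)], where t = UNIV]
        continuous_on_subset[OF continuous_on_product_coordinates]) auto
  also have "?this \<longleftrightarrow> continuous_on (open_cube n I) (tensor n \<eta>')"
    using open_cube_extensional by (intro continuous_on_cong) (auto simp: tensor_def)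
  finally show "continuous_on (open_cube n I) (foldr partial is (tensor n \<eta>)) \<and>
      (\<forall>i<n. \<forall>x\<in>open_cube n I. (\<lambda>t. foldr partial is (tensor n \<eta>) (x(i := t))) differentiable at (x i))"
    unfolding \<eta>'(2) using tensor_fun_upd_derivative \<eta>'(1) open_cube_extensional
    by (auto simp: real_differentiable_def) blast
qed

lemma compact_box: "compact (Pi\<^sub>E {..<n} (\<lambda>i. {u i..v i :: real}))"
proof -
  have eq: "Pi\<^sub>E {..<n} (\<lambda>i. {u i..v i}) = Pi\<^sub>E UNIV (\<lambda>i. if i < n then {u i..v i} else {undefined})"
    by (auto simp: PiE_iff extensional_def split: if_splits)
  have "compactin (product_topology (\<lambda>_. euclidean) UNIV) (Pi\<^sub>E UNIV (\<lambda>i. if i < n then {u i..v i} else {undefined}))"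
    unfolding compactin_PiE by auto
  then show ?thesis unfolding eq euclidean_product_topology compactin_euclidean_iff .
qed

lemma tensor_test_function:
  assumes "\<And>i. i < n \<Longrightarrow> test_real (\<eta> i)"
  shows "tensor n \<eta> \<in> test_functions n I"
proof -
  have "\<forall>i. \<exists>u v. i < n \<longrightarrow> a < u \<and> u < v \<and> v < a + 1 \<and> (\<forall>x. x \<notin> {u..v} \<longrightarrow> \<eta> i x = 0)"
    using assms unfolding test_real_def by blast
  then obtain u v where uv: "\<And>i. i < n \<Longrightarrow> a < u i \<and> u i < v i \<and> v i < a + 1 \<and> (\<forall>x. x \<notin> {u i..v i} \<longrightarrow> \<eta> i x = 0)"
    by metis
  let ?K = "Pi\<^sub>E {..<n} (\<lambda>i. {u i..v i})"
  have "?K \<subseteq> open_cube n I"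
    unfolding open_cube_def interior_I using uv by (intro PiE_mono) force
  moreover have "tensor n \<eta> x = 0" if xK: "x \<notin> ?K" for x
  proof (cases "x \<in> extensional {..<n}")
    case True
    then obtain i where "i < n" "x i \<notin> {u i..v i}" using xK by (auto simp: PiE_iff)
    then have "\<eta> i (x i) = 0" using uv by blast
    then have "(\<Prod>i<n. \<eta> i (x i)) = 0" using \<open>i < n\<close> by (intro prod_zero) auto
    then show ?thesis by (simp add: tensor_def)
  qed (simp add: tensor_def)
  ultimately show ?thesis unfolding test_functions_def
    using smooth_on_cube_tensor[of n \<eta>] assms compact_box[of n u v] by (auto simp: test_real_def)
qed

lemma tensor_pcube: "x \<in> space (pcube n I) \<Longrightarrow> tensor n \<eta> x = (\<Prod>i<n. \<eta> i (x i))"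
  by (simp add: tensor_def space_pcube PiE_iff)

lemma measurable_component_compose:
  "f \<in> borel_measurable borel \<Longrightarrow> i < n \<Longrightarrow> (\<lambda>x. f (x i)) \<in> borel_measurable (pcube n I)"
  by (rule measurable_compose[OF measurable_component_pcube_borel])

lemma measurable_tensor:
  assumes "\<And>i. i < n \<Longrightarrow> \<eta> i \<in> borel_measurable borel"
  shows "tensor n \<eta> \<in> borel_measurable (pcube n I)"
proof -
  have "(\<lambda>x. \<Prod>i<n. \<eta> i (x i)) \<in> borel_measurable (pcube n I)"
    by (intro borel_measurable_prod measurable_component_compose assms) auto
  also have "?this \<longleftrightarrow> ?thesis" by (intro measurable_cong) (simp add: tensor_pcube)
  finally show ?thesis .
qed

lemma box_eq: "{x \<in> space (pcube n I). \<forall>i<n. x i \<in> A i} = Pi\<^sub>E {..<n} (\<lambda>i. A i \<inter> I)"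
  unfolding space_pcube by (simp only: PiE_iff set_eq_iff mem_Collect_eq lessThan_iff Ball_def Int_iff) blast

lemma sets_box:
  "(\<And>i. i < n \<Longrightarrow> A i \<in> sets borel) \<Longrightarrow> {x \<in> space (pcube n I). \<forall>i<n. x i \<in> A i} \<in> sets (pcube n I)"
  unfolding box_eq by (intro sets_PiE_pcube) (simp add: sets_L)

lemma borel_sigma_sets_Ioo_pairs: "sets borel = sigma_sets UNIV (range (\<lambda>(c, d). {c<..<d::real}))"
proof -
  have "range (\<lambda>(c, d). {c<..<d::real}) = range (\<lambda>(c, d). box c d)" by (simp add: box_real)
  then show ?thesis by (simp add: borel_eq_box)
qed

text \<open>Two finite measures on the cube which agree on products of open intervals are equal: replace
  the intervals by general Borel sets one coordinate at a time.\<close>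

lemma pcube_measure_eqI:
  assumes P: "sets P = sets (pcube n I)" "finite_measure P" and Q: "sets Q = sets (pcube n I)" "finite_measure Q"
    and eq: "\<And>c d. emeasure P {x \<in> space (pcube n I). \<forall>i<n. x i \<in> {c i<..<d i}} = emeasure Q {x \<in> space (pcube n I). \<forall>i<n. x i \<in> {c i<..<d i}}"
  shows "P = Q"
proof -
  let ?Box = "\<lambda>A. {x \<in> space (pcube n I). \<forall>i<n. x i \<in> A i}"
  note box = sets_box
  have "emeasure P (?Box A) = emeasure Q (?Box A)"
    if "j \<le> n" "\<And>i. i < j \<Longrightarrow> A i \<in> sets borel" "\<And>i. j \<le> i \<Longrightarrow> i < n \<Longrightarrow> \<exists>c d. A i = {c<..<d}" for j A
    using that
  proof (induction j arbitrary: A)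
    case 0
    then have "\<forall>i. \<exists>c d. i < n \<longrightarrow> A i = {c<..<d}" by blast
    then obtain c d where "\<And>i. i < n \<Longrightarrow> A i = {c i<..<d i}" by metis
    then have "?Box A = ?Box (\<lambda>i. {c i<..<d i})" by auto
    then show ?case using eq[of c d] by simp
  next
    case (Suc j)
    have Ab: "A i \<in> sets borel" if "i < n" for i
      using Suc.prems(2)[of i] Suc.prems(3)[of i] that by (cases "i < Suc j") auto
    let ?\<mu> = "\<lambda>R. distr (density R (indicator (?Box (A(j := UNIV))))) borel (\<lambda>x. x j)"
    have \<mu>: "emeasure (?\<mu> R) B = emeasure R (?Box (A(j := B)))"
      if R: "sets R = sets (pcube n I)" and B: "B \<in> sets borel" for R B
    proof -
      have sp: "space R = space (pcube n I)" using R by (rule sets_eq_imp_space_eq)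
      have bU: "?Box (A(j := UNIV)) \<in> sets R" unfolding R by (rule box) (auto simp: Ab)
      have m: "(\<lambda>x. x j) \<in> borel_measurable (density R (indicator (?Box (A(j := UNIV)))))"
        using measurable_component_pcube_borel[of j n] Suc.prems(1) by (simp add: measurable_cong_sets[OF R refl])
      have "emeasure (?\<mu> R) B = emeasure (density R (indicator (?Box (A(j := UNIV))))) ((\<lambda>x. x j) -` B \<inter> space R)"
        by (subst emeasure_distr[OF m B]) simp
      also have "\<dots> = (\<integral>\<^sup>+x. indicator (?Box (A(j := UNIV))) x * indicator ((\<lambda>x. x j) -` B \<inter> space R) x \<partial>R)"
        using measurable_sets[OF m B] by (intro emeasure_density borel_measurable_indicator bU) simp
      also have "\<dots> = (\<integral>\<^sup>+x. indicator (?Box (A(j := B))) x \<partial>R)"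
      proof (intro nn_integral_cong)
        fix x assume x: "x \<in> space R"
        have "(\<forall>i<n. x i \<in> (A(j := B)) i) \<longleftrightarrow> (\<forall>i<n. x i \<in> (A(j := UNIV)) i) \<and> x j \<in> B"
          using Suc.prems(1) by (metis fun_upd_apply UNIV_I Suc_le_eq)
        then have "x \<in> ?Box (A(j := B)) \<longleftrightarrow> x \<in> ?Box (A(j := UNIV)) \<and> x \<in> (\<lambda>x. x j) -` B \<inter> space R"
          using x unfolding sp mem_Collect_eq Int_iff vimage_eq by blast
        then show "indicator (?Box (A(j := UNIV))) x * indicator ((\<lambda>x. x j) -` B \<inter> space R) x = (indicator (?Box (A(j := B))) x :: ennreal)"
          unfolding indicator_def by (cases "x \<in> ?Box (A(j := UNIV))"; cases "x \<in> (\<lambda>x. x j) -` B \<inter> space R") simp_all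
      qed
      also have "\<dots> = emeasure R (?Box (A(j := B)))"
        by (rule nn_integral_indicator) (unfold R, rule box, use Ab B in auto)
      finally show ?thesis .
    qed
    have "?\<mu> P = ?\<mu> Q"
    proof (rule measure_eqI_generator_eq[where E = "range (\<lambda>(c, d). {c<..<d::real})" and \<Omega> = UNIV and A = "\<lambda>k::nat. {- real k<..<real k}"])
      show "Int_stable (range (\<lambda>(c, d). {c<..<d::real}))"
        by (auto simp: Int_stable_def intro!: image_eqI[where x = "(max _ _, min _ _)"])
      show "sets (?\<mu> P) = sigma_sets UNIV (range (\<lambda>(c, d). {c<..<d::real}))"
        "sets (?\<mu> Q) = sigma_sets UNIV (range (\<lambda>(c, d). {c<..<d::real}))"
        by (simp_all add: borel_sigma_sets_Ioo_pairs)
      show "(\<Union>k::nat. {- real k<..<real k}) = UNIV"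
      proof (intro set_eqI iffI UNIV_I)
        fix x :: real
        obtain k :: nat where "\<bar>x\<bar> < real k" using reals_Archimedean2 by blast
        then show "x \<in> (\<Union>k::nat. {- real k<..<real k})" by (auto intro!: exI[of _ k])
      qed
      show "emeasure (?\<mu> P) {- real k<..<real k} \<noteq> \<infinity>" for k
        by (subst \<mu>[OF P(1)]) (use finite_measure.emeasure_finite[OF P(2)] in simp_all)
      fix X assume "X \<in> range (\<lambda>(c, d). {c<..<d::real})"
      then obtain c d where X: "X = {c<..<d}" by auto
      have "emeasure P (?Box (A(j := X))) = emeasure Q (?Box (A(j := X)))"
        using Suc.prems X by (intro Suc.IH) (auto simp: le_Suc_eq Suc_le_eq order_less_le)
      moreover have XB: "X \<in> sets borel" using X by simp
      ultimately show "emeasure (?\<mu> P) X = emeasure (?\<mu> Q) X" unfolding \<mu>[OF P(1) XB] \<mu>[OF Q(1) XB] by simp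
    qed (auto simp: image_subset_iff)
    then have "emeasure (?\<mu> P) (A j) = emeasure (?\<mu> Q) (A j)" by simp
    then show ?case using \<mu>[OF P(1), of "A j"] \<mu>[OF Q(1), of "A j"] Ab[of j] Suc.prems(1) by simp
  qed
  from this[of n] have all: "emeasure P (?Box A) = emeasure Q (?Box A)" if "\<And>i. i < n \<Longrightarrow> A i \<in> sets borel" for A
    using that by auto
  show ?thesis
  proof (rule measure_eqI_PiM_finite[where I = "{..<n}" and M = "\<lambda>_. L" and A = "\<lambda>_. space (pcube n I)"])
    show "sets P = sets (Pi\<^sub>M {..<n} (\<lambda>_. L))" "sets Q = sets (Pi\<^sub>M {..<n} (\<lambda>_. L))"
      using P(1) Q(1) by (simp_all add: pcube_def)
    fix A assume A: "\<And>i. i \<in> {..<n} \<Longrightarrow> A i \<in> sets L"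
    have "Pi\<^sub>E {..<n} A = ?Box A" unfolding box_eq using A by (intro PiE_cong) (auto simp: sets_L)
    then show "emeasure P (Pi\<^sub>E {..<n} A) = emeasure Q (Pi\<^sub>E {..<n} A)" using all[of A] A by (simp add: sets_L)
  next
    show "range (\<lambda>_. space (pcube n I)) \<subseteq> prod_algebra {..<n} (\<lambda>_. L)"
      using prod_algebraI_finite[of "{..<n}" "\<lambda>_. I" "\<lambda>_. L"] by (auto simp: space_pcube sets_L)
    show "(\<Union>i::nat. space (pcube n I)) = space (Pi\<^sub>M {..<n} (\<lambda>_. L))" by (simp add: pcube_def)
    show "emeasure P (space (pcube n I)) \<noteq> \<infinity>" using finite_measure.emeasure_finite[OF P(2)] by simp
  qed simp
qed

text \<open>Products of bumps converge to indicators of boxes, so the integral of \<open>w\<close> over every box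
  vanishes. On a slightly smaller cube the positive and the negative part of \<open>w\<close> are then densities
  of two measures that agree on boxes, and hence everywhere.\<close>

lemma fundamental_lemma:
  fixes w :: "(nat \<Rightarrow> real) \<Rightarrow> real"
  assumes w: "w \<in> borel_measurable (pcube n I)"
    and loc: "\<And>u v. a < u \<Longrightarrow> u < v \<Longrightarrow> v < a + 1 \<Longrightarrow>
        integrable (pcube n I) (\<lambda>x. w x * indicator (Pi\<^sub>E {..<n} (\<lambda>_. {u..v})) x)"
    and test: "\<And>\<eta>. (\<And>i. i < n \<Longrightarrow> test_real (\<eta> i)) \<Longrightarrow> (\<integral>x. w x * tensor n \<eta> x \<partial>pcube n I) = 0"
  shows "AE x in pcube n I. w x = 0"
proof -
  note [measurable] = w
  have *: "AE x in pcube n I. (\<forall>i<n. x i \<in> {u<..<v}) \<longrightarrow> w x = 0" if uv: "a < u" "u < v" "v < a + 1" for u v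
  proof -
    define K where "K = {x \<in> space (pcube n I). \<forall>i<n. x i \<in> {u<..<v}}"
    have KE: "K \<subseteq> Pi\<^sub>E {..<n} (\<lambda>_. {u..v})" unfolding K_def box_eq by (intro PiE_mono) auto
    have Ks[measurable]: "K \<in> sets (pcube n I)"
      unfolding K_def by (rule sets_box) simp
    define W where "W x = w x * indicator K x" for x
    have Wm[measurable]: "W \<in> borel_measurable (pcube n I)" unfolding W_def[abs_def] by measurable
    have intg: "integrable (pcube n I) (\<lambda>x. \<bar>w x\<bar> * indicator (Pi\<^sub>E {..<n} (\<lambda>_. {u..v})) x)"
      using integrable_abs[OF loc[OF uv]] by (simp add: abs_mult)
    have W: "integrable (pcube n I) W"
      by (rule Bochner_Integration.integrable_bound[OF intg Wm]) (use KE in \<open>auto simp: W_def indicator_def\<close>)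
    have sub0: "(\<integral>x. W x * indicator {x \<in> space (pcube n I). \<forall>i<n. x i \<in> {c i<..<d i}} x \<partial>pcube n I) = 0" for c d
    proof -
      define c' d' where "c' i = max (c i) u" and "d' i = min (d i) v" for i
      have lim0: "(\<lambda>k. \<integral>x. w x * tensor n (\<lambda>i. bump k (c' i) (d' i)) x \<partial>pcube n I) \<longlonglongrightarrow>
          (\<integral>x. W x * indicator {x \<in> space (pcube n I). \<forall>i<n. x i \<in> {c i<..<d i}} x \<partial>pcube n I)"
      proof (rule integral_dominated_convergence[OF _ _ intg])
        show "(\<lambda>x. W x * indicator {x \<in> space (pcube n I). \<forall>i<n. x i \<in> {c i<..<d i}} x) \<in> borel_measurable (pcube n I)"
          by (intro borel_measurable_times Wm borel_measurable_indicator sets_box) simp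
        show "(\<lambda>x. w x * tensor n (\<lambda>i. bump k (c' i) (d' i)) x) \<in> borel_measurable (pcube n I)" for k
          by (intro borel_measurable_times w measurable_tensor smooth_real_measurable smooth_bump)
        show "AE x in pcube n I. (\<lambda>k. w x * tensor n (\<lambda>i. bump k (c' i) (d' i)) x) \<longlonglongrightarrow>
          W x * indicator {x \<in> space (pcube n I). \<forall>i<n. x i \<in> {c i<..<d i}} x"
        proof (rule AE_I2)
          fix x assume x: "x \<in> space (pcube n I)"
          have "(\<lambda>k. w x * (\<Prod>i<n. bump k (c' i) (d' i) (x i))) \<longlonglongrightarrow> w x * (\<Prod>i<n. indicator {c' i<..<d' i} (x i))"
            by (intro tendsto_mult tendsto_const tendsto_prod bump_tendsto)
          also have "(\<Prod>i<n. indicator {c' i<..<d' i} (x i)) = (indicator K x * indicator {x \<in> space (pcube n I). \<forall>i<n. x i \<in> {c i<..<d i}} x :: real)"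
          proof (cases "\<forall>i<n. x i \<in> {c' i<..<d' i}")
            case True
            then show ?thesis using x by (simp add: K_def c'_def d'_def)
          next
            case False
            then obtain i where i: "i < n" "x i \<notin> {c' i<..<d' i}" by blast
            then have "(\<Prod>i<n. indicator {c' i<..<d' i} (x i) :: real) = 0" by (intro prod_zero) (auto intro!: bexI[of _ i])
            moreover have "\<not> (x \<in> K \<and> x \<in> {x \<in> space (pcube n I). \<forall>i<n. x i \<in> {c i<..<d i}})"
              using i by (auto simp: K_def c'_def d'_def)
            ultimately show ?thesis by (auto simp: indicator_def)
          qed
          finally show "(\<lambda>k. w x * tensor n (\<lambda>i. bump k (c' i) (d' i)) x) \<longlonglongrightarrow>
            W x * indicator {x \<in> space (pcube n I). \<forall>i<n. x i \<in> {c i<..<d i}} x"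
            using x by (simp add: tensor_pcube W_def mult.assoc)
        qed
        fix k
        show "AE x in pcube n I. norm (w x * tensor n (\<lambda>i. bump k (c' i) (d' i)) x) \<le> \<bar>w x\<bar> * indicator (Pi\<^sub>E {..<n} (\<lambda>_. {u..v})) x"
        proof (rule AE_I2)
          fix x assume x: "x \<in> space (pcube n I)"
          have "\<bar>\<Prod>i<n. bump k (c' i) (d' i) (x i)\<bar> \<le> indicator (Pi\<^sub>E {..<n} (\<lambda>_. {u..v})) x"
          proof (cases "x \<in> Pi\<^sub>E {..<n} (\<lambda>_. {u..v})")
            case True
            then show ?thesis by (simp add: abs_prod prod_le_1 bump_bounds)
          next
            case False
            then obtain i where i: "i < n" "x i \<notin> {u..v}" using x by (auto simp: PiE_iff space_pcube)
            then have "bump k (c' i) (d' i) (x i) = 0" by (intro bump_eq_0) (auto simp: c'_def d'_def)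
            then have z: "(\<Prod>i<n. bump k (c' i) (d' i) (x i)) = 0" using i by (intro prod_zero) auto
            show ?thesis unfolding z by simp
          qed
          then show "norm (w x * tensor n (\<lambda>i. bump k (c' i) (d' i)) x) \<le> \<bar>w x\<bar> * indicator (Pi\<^sub>E {..<n} (\<lambda>_. {u..v})) x"
            using x by (simp add: tensor_pcube abs_mult mult_left_mono)
        qed
      qed
      have "(\<integral>x. w x * tensor n (\<lambda>i. bump k (c' i) (d' i)) x \<partial>pcube n I) = 0" for k
      proof (cases "\<forall>i<n. c' i < d' i")
        case True
        then show ?thesis using uv by (intro test test_bump) (auto simp: c'_def d'_def)
      next
        case False
        then obtain i where i: "i < n" "\<not> c' i < d' i" by blast
        have z0: "w x * tensor n (\<lambda>i. bump k (c' i) (d' i)) x = 0" if "x \<in> space (pcube n I)" for x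
        proof -
          have "bump k (c' i) (d' i) (x i) = 0" using i by (intro bump_eq_0) auto
          then have "(\<Prod>i<n. bump k (c' i) (d' i) (x i)) = 0" using i by (intro prod_zero) auto
          then show ?thesis using that by (simp add: tensor_pcube)
        qed
        show ?thesis using Bochner_Integration.integral_cong[OF refl z0] by simp
      qed
      with lim0 show ?thesis by (simp add: LIMSEQ_const_iff)
    qed
    have fin: "finite_measure (density (pcube n I) (\<lambda>x. ennreal (W x)))" "finite_measure (density (pcube n I) (\<lambda>x. ennreal (- W x)))"
      using integrableD[OF W]
      by (auto intro!: finite_measureI simp: emeasure_density real_integrable_def cong: nn_integral_cong_simp)
    have "density (pcube n I) (\<lambda>x. ennreal (W x)) = density (pcube n I) (\<lambda>x. ennreal (- W x))"
    proof (rule pcube_measure_eqI[OF _ fin(1) _ fin(2)])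
      fix c d
      let ?B = "{x \<in> space (pcube n I). \<forall>i<n. x i \<in> {c i<..<d i}}"
      have B[measurable]: "?B \<in> sets (pcube n I)" by (rule sets_box) simp
      let ?h = "\<lambda>x. W x * indicator ?B x"
      have h: "integrable (pcube n I) ?h" by (rule integrable_real_mult_indicator[OF B W])
      have e1: "emeasure (density (pcube n I) (\<lambda>x. ennreal (W x))) ?B = (\<integral>\<^sup>+x. ennreal (?h x) \<partial>pcube n I)"
        by (subst emeasure_density[OF _ B], measurable, intro nn_integral_cong) (simp split: split_indicator)
      have e2: "emeasure (density (pcube n I) (\<lambda>x. ennreal (- W x))) ?B = (\<integral>\<^sup>+x. ennreal (- ?h x) \<partial>pcube n I)"
        by (subst emeasure_density[OF _ B], measurable, intro nn_integral_cong) (simp split: split_indicator)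
      have "enn2real (\<integral>\<^sup>+x. ennreal (?h x) \<partial>pcube n I) = enn2real (\<integral>\<^sup>+x. ennreal (- ?h x) \<partial>pcube n I)"
        using real_lebesgue_integral_def[OF h] sub0[of c d] by simp
      then show "emeasure (density (pcube n I) (\<lambda>x. ennreal (W x))) ?B = emeasure (density (pcube n I) (\<lambda>x. ennreal (- W x))) ?B"
      proof -
        assume *: "enn2real (\<integral>\<^sup>+x. ennreal (?h x) \<partial>pcube n I) = enn2real (\<integral>\<^sup>+x. ennreal (- ?h x) \<partial>pcube n I)"
        have "(\<integral>\<^sup>+x. ennreal (?h x) \<partial>pcube n I) < top" "(\<integral>\<^sup>+x. ennreal (- ?h x) \<partial>pcube n I) < top"
          using h unfolding real_integrable_def less_top infinity_ennreal_def by blast+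
        then show ?thesis unfolding e1 e2 using arg_cong[OF *, of ennreal] by (simp only: ennreal_enn2real)
      qed
    qed auto
    then have "AE x in pcube n I. ennreal (W x) = ennreal (- W x)"
      by (subst (asm) N.density_unique_iff) auto
    then show ?thesis using AE_space
    proof eventually_elim
      case (elim x)
      then have "W x = 0" by (cases "0 \<le> W x") (auto simp: ennreal_neg)
      then show ?case using elim by (auto simp: W_def K_def)
    qed
  qed
  have "AE x in pcube n I. \<forall>k::nat. (\<forall>i<n. x i \<in> {a + 1 / real (k + 3)<..<a + 1 - 1 / real (k + 3)}) \<longrightarrow> w x = 0"
    unfolding AE_all_countable
  proof
    fix k :: nat
    have "1 / real (k + 3) \<le> 1 / 3" by (intro divide_left_mono) auto
    moreover have "0 < 1 / real (k + 3)" by simp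
    ultimately have "a + 1 / real (k + 3) < a + 1 - 1 / real (k + 3)" "a < a + 1 / real (k + 3)" "a + 1 - 1 / real (k + 3) < a + 1" by linarith+
    then show "AE x in pcube n I. (\<forall>i<n. x i \<in> {a + 1 / real (k + 3)<..<a + 1 - 1 / real (k + 3)}) \<longrightarrow> w x = 0"
      by (intro *)
  qed
  moreover have "AE x in pcube n I. \<forall>i<n. a < x i \<and> x i < a + 1" by (rule AE_pcube_interior)
  ultimately show ?thesis
  proof eventually_elim
    case (elim x)
    have "eventually (\<lambda>k::nat. \<forall>i\<in>{..<n}. 1 / real (k + 3) < x i - a \<and> 1 / real (k + 3) < a + 1 - x i) sequentially"
    proof (rule eventually_ball_finite)
      show "\<forall>i\<in>{..<n}. \<forall>\<^sub>F k::nat in sequentially. 1 / real (k + 3) < x i - a \<and> 1 / real (k + 3) < a + 1 - x i"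
      proof
        fix i assume "i \<in> {..<n}"
        then have "0 < x i - a" "0 < a + 1 - x i" using elim(2) by auto
        moreover have "(\<lambda>k. 1 / real (k + 3)) \<longlonglongrightarrow> 0"
          using LIMSEQ_ignore_initial_segment[OF lim_inverse_n', of 3] by simp
        ultimately show "\<forall>\<^sub>F k::nat in sequentially. 1 / real (k + 3) < x i - a \<and> 1 / real (k + 3) < a + 1 - x i"
          by (intro eventually_conj order_tendstoD(2))
      qed
    qed simp
    then obtain k :: nat where "\<forall>i<n. 1 / real (k + 3) < x i - a \<and> 1 / real (k + 3) < a + 1 - x i"
      by (auto simp: eventually_sequentially)
    then have "\<forall>i<n. x i \<in> {a + 1 / real (k + 3)<..<a + 1 - 1 / real (k + 3)}" by fastforce
    then show ?case using elim(1) by blast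
  qed
qed

end


section \<open>Weak derivatives along lines\<close>

context unit_length
begin

lemma test_real_smooth: "test_real \<eta> \<Longrightarrow> smooth_real \<eta>"
  by (simp add: test_real_def)

lemma test_real_measurable: "test_real \<eta> \<Longrightarrow> \<eta> \<in> borel_measurable borel"
  by (intro smooth_real_measurable test_real_smooth)

lemma test_real_bounded:
  assumes "test_real \<eta>" obtains B where "0 \<le> B" "\<And>x. \<bar>\<eta> x\<bar> \<le> B"
proof -
  obtain u v where uv: "\<forall>x. x \<notin> {u..v} \<longrightarrow> \<eta> x = 0" using assms by (auto simp: test_real_def)
  have "compact (\<eta> ` {u..v})"
    by (intro compact_continuous_image smooth_real_continuous test_real_smooth assms) simp
  then have "bounded (\<eta> ` {u..v})" by (rule compact_imp_bounded)
  then obtain B where B: "\<forall>y\<in>\<eta> ` {u..v}. \<bar>y\<bar> \<le> B"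
    by (auto simp: bounded_iff)
  show thesis
  proof (rule that[of "max B 0"])
    fix x show "\<bar>\<eta> x\<bar> \<le> max B 0"
      using B uv by (cases "x \<in> {u..v}") (auto simp: max.coboundedI1)
  qed simp
qed

lemma test_antiderivative:
  assumes "test_real \<theta>"
  obtains G C u v where "\<And>x. (G has_real_derivative \<theta> x) (at x)" "a < u" "u < v" "v < a + 1"
    "\<And>x. x \<le> u \<Longrightarrow> G x = 0" "\<And>x. v \<le> x \<Longrightarrow> G x = C"
proof -
  obtain u v where uv: "a < u" "u < v" "v < a + 1" and z: "\<And>x. x \<notin> {u..v} \<Longrightarrow> \<theta> x = 0"
    using assms by (auto simp: test_real_def)
  have cont: "continuous_on S \<theta>" for S by (intro smooth_real_continuous test_real_smooth assms)
  define G where "G x = integral {a - 1..x} \<theta>" for x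
  have 0: "G x = 0" if "x \<le> u" for x
  proof -
    have "G x = integral {a - 1..x} (\<lambda>_. 0)"
      unfolding G_def
    proof (rule integral_spike[of "{u}"])
      show "0 = \<theta> y" if "y \<in> {a - 1..x} - {u}" for y using z[of y] that \<open>x \<le> u\<close> by auto
    qed simp
    then show ?thesis by simp
  qed
  have C: "G x = G v" if "v \<le> x" for x
  proof -
    have "G x = integral {a - 1..v} \<theta> + integral {v..x} \<theta>"
      unfolding G_def using uv that
      by (intro Henstock_Kurzweil_Integration.integral_combine[symmetric] integrable_continuous_real cont) auto
    also have "integral {v..x} \<theta> = integral {v..x} (\<lambda>_. 0)"
    proof (rule integral_spike[of "{v}"])
      show "0 = \<theta> y" if "y \<in> {v..x} - {v}" for y using z[of y] that by auto
    qed simp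
    finally show ?thesis by (simp add: G_def)
  qed
  have der: "(G has_real_derivative \<theta> x) (at x)" for x
  proof (cases "x < u")
    case True
    have "((\<lambda>_. 0) has_real_derivative 0) (at x)" by simp
    then have "(G has_real_derivative 0) (at x)"
      by (rule has_field_derivative_transform_within_open[of _ _ _ "{..<u}"]) (use True 0 in auto)
    then show ?thesis using z[of x] True by simp
  next
    case False
    then have x: "a - 1 < x" "x < x + 1" using uv by auto
    have "(G has_real_derivative \<theta> x) (at x within {a - 1..x + 1})"
      unfolding G_def using x by (intro integral_has_real_derivative cont) auto
    then show ?thesis using x by (simp add: at_within_Icc_at)
  qed
  show thesis by (rule that[of G u v "G v"]) (rule der uv(1) uv(2) uv(3) | erule 0 | erule C)+
qed

lemma integral_L_greaterThan:
  assumes der: "\<And>x. (G has_real_derivative g x) (at x)" and g: "continuous_on UNIV g" and r: "a \<le> r" "r \<le> a + 1"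
  shows "(\<integral>s. (if r < s then g s else 0) \<partial>L) = G (a + 1) - G r"
proof -
  have [measurable]: "g \<in> borel_measurable borel" using g by (rule borel_measurable_continuous_onI)
  have "(\<integral>s. (if r < s then g s else 0) \<partial>L) = (\<integral>s. indicator I s *\<^sub>R (if r < s then g s else 0) \<partial>lborel)"
    by (subst integral_restrict_space) auto
  also have "\<dots> = (\<integral>s. indicator {r..a + 1} s *\<^sub>R g s \<partial>lborel)"
  proof (rule integral_cong_AE)
    show "AE s in lborel. indicator I s *\<^sub>R (if r < s then g s else 0) = indicator {r..a + 1} s *\<^sub>R g s"
      using AE_lborel_I AE_lborel_singleton[of r] AE_lborel_singleton[of "a + 1"]
      by eventually_elim (use r in \<open>auto simp: indicator_def\<close>)
  qed auto
  also have "\<dots> = G (a + 1) - G r"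
  proof (rule integral_FTC_atLeastAtMost)
    show "(G has_vector_derivative g x) (at x within {r..a + 1})" for x
      using der[of x] has_real_derivative_iff_has_vector_derivative has_vector_derivative_at_within by blast
    show "continuous_on {r..a + 1} g" using g continuous_on_subset by blast
  qed fact
  finally show ?thesis .
qed

lemma integrable_mult_bounded:
  fixes f g :: "'b \<Rightarrow> real"
  assumes "integrable M f" "g \<in> borel_measurable M" "\<And>x. x \<in> space M \<Longrightarrow> \<bar>g x\<bar> \<le> B"
  shows "integrable M (\<lambda>x. f x * g x)"
proof (rule Bochner_Integration.integrable_bound[of M "\<lambda>x. \<bar>f x\<bar> * B"])
  show "integrable M (\<lambda>x. \<bar>f x\<bar> * B)" using assms(1) by simp
  show "(\<lambda>x. f x * g x) \<in> borel_measurable M" using assms(1,2) by auto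
  show "AE x in M. norm (f x * g x) \<le> norm (\<bar>f x\<bar> * B)"
  proof (rule AE_I2)
    fix x assume "x \<in> space M"
    then have "\<bar>g x\<bar> \<le> \<bar>B\<bar>" using assms(3)[of x] by linarith
    then show "norm (f x * g x) \<le> norm (\<bar>f x\<bar> * B)" by (simp add: abs_mult mult_left_mono)
  qed
qed

lemma Fubini_triangle:
  fixes f g :: "real \<Rightarrow> real"
  assumes g: "integrable L g" and f: "f \<in> borel_measurable borel" "\<And>s. \<bar>f s\<bar> \<le> B"
  shows "(\<integral>s. f s * (\<integral>r. (if r < s then g r else 0) \<partial>L) \<partial>L) = (\<integral>r. g r * (\<integral>s. (if r < s then f s else 0) \<partial>L) \<partial>L)"
proof -
  interpret LL: pair_sigma_finite L L ..
  have [measurable]: "g \<in> borel_measurable L" "f \<in> borel_measurable L" using g f by auto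
  have idm[measurable]: "(\<lambda>x. x) \<in> borel_measurable L" by simp
  have B: "0 \<le> B" using f(2)[of 0] by linarith
  have gp: "integrable (L \<Otimes>\<^sub>M L) (\<lambda>p. g (snd p))"
  proof (rule LL.Fubini_integrable)
    show "integrable L (\<lambda>x. \<integral>y. norm (g (snd (x, y))) \<partial>L)" by simp
    show "AE x in L. integrable L (\<lambda>y. g (snd (x, y)))" using g by simp
  qed measurable
  have int: "integrable (L \<Otimes>\<^sub>M L) (\<lambda>(s, r). f s * (if r < s then g r else 0))"
  proof (rule Bochner_Integration.integrable_bound[of _ "\<lambda>p. B * g (snd p)"])
    show "integrable (L \<Otimes>\<^sub>M L) (\<lambda>p. B * g (snd p))" using gp by simp
    show "(\<lambda>(s, r). f s * (if r < s then g r else 0)) \<in> borel_measurable (L \<Otimes>\<^sub>M L)"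
      unfolding case_prod_beta' by measurable
    show "AE p in L \<Otimes>\<^sub>M L. norm (case p of (s, r) \<Rightarrow> f s * (if r < s then g r else 0)) \<le> norm (B * g (snd p))"
      using f(2) B by (auto simp: abs_mult intro!: AE_I2 mult_mono)
  qed
  have "(\<integral>s. f s * (\<integral>r. (if r < s then g r else 0) \<partial>L) \<partial>L) = (\<integral>s. (\<integral>r. f s * (if r < s then g r else 0) \<partial>L) \<partial>L)"
    by simp
  also have "\<dots> = (\<integral>r. (\<integral>s. f s * (if r < s then g r else 0) \<partial>L) \<partial>L)"
    using LL.Fubini_integral[OF int] by simp
  also have "\<dots> = (\<integral>r. g r * (\<integral>s. (if r < s then f s else 0) \<partial>L) \<partial>L)"
  proof (rule Bochner_Integration.integral_cong[OF refl])
    fix r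
    have "(\<integral>s. f s * (if r < s then g r else 0) \<partial>L) = (\<integral>s. g r * (if r < s then f s else 0) \<partial>L)"
      by (rule Bochner_Integration.integral_cong) auto
    then show "(\<integral>s. f s * (if r < s then g r else 0) \<partial>L) = g r * (\<integral>s. (if r < s then f s else 0) \<partial>L)" by simp
  qed
  finally show ?thesis .
qed

text \<open>A function \<open>u\<close> with weak derivative \<open>v\<close> in the direction \<open>k\<close> differs from the primitive
  \<open>V\<close> of \<open>v\<close> along the lines in that direction by a function which is constant on these lines.
  Since \<open>u - V\<close> has weak derivative zero, testing with \<open>\<theta>\<close> gives the same as testing with
  the multiple of a fixed bump \<open>\<theta>\<^sub>0\<close> that has the same integral as \<open>\<theta>\<close>: the
  difference is the derivative of a test function. So \<open>u - V\<close> equals its average along the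
  lines with respect to \<open>\<theta>\<^sub>0\<close>.\<close>

lemma weak_derivative_primitive:
  fixes u v :: "(nat \<Rightarrow> real) \<Rightarrow> real"
  assumes k: "k < n" and u: "integrable (pcube n I) u" and v: "integrable (pcube n I) v"
    and weak: "\<And>\<eta>. (\<And>i. i < n \<Longrightarrow> test_real (\<eta> i)) \<Longrightarrow>
      (\<integral>x. u x * tensor n (\<eta>(k := deriv (\<eta> k))) x \<partial>pcube n I) = - (\<integral>x. v x * tensor n \<eta> x \<partial>pcube n I)"
  shows "\<exists>c. (\<forall>x r. c (x(k := r)) = c x) \<and>
    (AE x in pcube n I. u x = c x + (\<integral>r. (if r < x k then v (x(k := r)) else 0) \<partial>L))"
proof -
  let ?N = "pcube n I"
  define V where "V x = (\<integral>r. (if r < x k then v (x(k := r)) else 0) \<partial>L)" for x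
  have Vk: "V (x(k := s)) = (\<integral>r. (if r < s then v (x(k := r)) else 0) \<partial>L)" for x s
    unfolding V_def fun_upd_upd fun_upd_same ..
  note [measurable] = borel_measurable_integrable[OF u] borel_measurable_integrable[OF v] measurable_resample[OF k]
  have idm[measurable]: "(\<lambda>x. x) \<in> borel_measurable L" by simp
  have km[measurable]: "(\<lambda>x. x k) \<in> borel_measurable ?N" by (rule measurable_component_pcube_borel[OF k])
  have vres[measurable]: "(\<lambda>p. v ((fst p)(k := snd p))) \<in> borel_measurable (?N \<Otimes>\<^sub>M L)"
    using measurable_compose[OF measurable_resample[OF k] borel_measurable_integrable[OF v]] by (simp add: case_prod_beta')
  have Vm: "V \<in> borel_measurable ?N"
    unfolding V_def[abs_def] by (rule L.borel_measurable_lebesgue_integral) (unfold case_prod_beta', measurable)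
  have V: "integrable ?N V"
  proof (rule Bochner_Integration.integrable_bound[of _ "\<lambda>x. \<integral>r. \<bar>v (x(k := r))\<bar> \<partial>L"])
    show "integrable ?N (\<lambda>x. \<integral>r. \<bar>v (x(k := r))\<bar> \<partial>L)"
      using integrable_resample(3)[OF k integrable_abs[OF v]] .
    show "AE x in ?N. norm (V x) \<le> norm (\<integral>r. \<bar>v (x(k := r))\<bar> \<partial>L)"
      using integrable_resample(2)[OF k v]
    proof eventually_elim
      case (elim x)
      have "\<bar>V x\<bar> \<le> (\<integral>r. \<bar>if r < x k then v (x(k := r)) else 0\<bar> \<partial>L)" unfolding V_def by (rule integral_abs_bound)
      also have "\<dots> \<le> (\<integral>r. \<bar>v (x(k := r))\<bar> \<partial>L)"
        using elim by (intro integral_mono_AE' AE_I2) auto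
      finally show ?case by (simp add: integral_nonneg)
    qed
  qed (rule Vm)
  define W where "W x = u x - V x" for x
  have W: "integrable ?N W" unfolding W_def[abs_def] using u V by simp
  \<comment> \<open>any test function with nonzero integral would do\<close>
  define \<theta>0 where "\<theta>0 = bump 0 (a + 1/4) (a + 3/4)"
  have t0: "test_real \<theta>0" unfolding \<theta>0_def by (rule test_bump) auto
  obtain G0 C0 u0 v0 where G0: "\<And>x. (G0 has_real_derivative \<theta>0 x) (at x)" "a < u0" "u0 < v0" "v0 < a + 1"
    "\<And>x. x \<le> u0 \<Longrightarrow> G0 x = 0" "\<And>x. v0 \<le> x \<Longrightarrow> G0 x = C0"
    by (rule test_antiderivative[OF t0]) (rule that)
  have mono: "G0 x \<le> G0 y" if "x \<le> y" for x y
    by (rule DERIV_nonneg_imp_nondecreasing[OF that]) (use G0(1) bump_bounds in \<open>force simp: \<theta>0_def\<close>)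
  have "a + 1/4 < a + 3/4" by simp
  then have "G0 (a + 1/4) < G0 (a + 3/4)"
  proof (rule DERIV_pos_imp_increasing_open)
    show "\<exists>y. (G0 has_real_derivative y) (at x) \<and> 0 < y" if "a + 1/4 < x" "x < a + 3/4" for x :: real
      using G0(1)[of x] bump_pos[of x "a + 1/4" "a + 3/4" 0] that unfolding \<theta>0_def by (intro exI[of _ "bump 0 (a + 1/4) (a + 3/4) x"]) simp
    show "continuous_on {a + 1/4..a + 3/4} G0"
      using G0(1) by (auto intro!: continuous_at_imp_continuous_on DERIV_isCont)
  qed
  then have C0: "0 < C0"
    using mono[of "min u0 (a + 1/4)" "a + 1/4"] mono[of "a + 3/4" "max v0 (a + 3/4)"]
      G0(5)[of "min u0 (a + 1/4)"] G0(6)[of "max v0 (a + 3/4)"] by simp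
  define c where "c x = (\<integral>s. W (x(k := s)) * \<theta>0 s \<partial>L) / C0" for x
  have ck: "c (x(k := r)) = c x" for x r by (simp add: c_def)
  obtain B0 where B0: "\<And>x. \<bar>\<theta>0 x\<bar> \<le> B0" using test_real_bounded[OF t0] by blast
  have W0: "integrable ?N (\<lambda>x. W x * \<theta>0 (x k))"
    by (rule integrable_mult_bounded[OF W measurable_component_compose[OF test_real_measurable[OF t0] k] B0])
  have ci: "integrable ?N c"
  proof -
    have "integrable ?N (\<lambda>x. (\<integral>s. W (x(k := s)) * \<theta>0 s \<partial>L) / C0)"
      using integrable_resample(3)[OF k W0] by simp
    then show ?thesis by (simp add: c_def[abs_def])
  qed
  have zero: "(\<integral>x. (W x - c x) * tensor n \<eta> x \<partial>?N) = 0" if \<eta>: "\<And>i. i < n \<Longrightarrow> test_real (\<eta> i)" for \<eta>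
  proof -
    define \<theta> where "\<theta> = \<eta> k"
    have t: "test_real \<theta>" using \<eta>[OF k] by (simp add: \<theta>_def)
    obtain G C u1 v1 where G: "\<And>x. (G has_real_derivative \<theta> x) (at x)" "a < u1" "u1 < v1" "v1 < a + 1"
      "\<And>x. x \<le> u1 \<Longrightarrow> G x = 0" "\<And>x. v1 \<le> x \<Longrightarrow> G x = C"
      by (rule test_antiderivative[OF t]) (rule that)
    define \<beta> where "\<beta> = C / C0"
    define \<Theta> where "\<Theta> x = G x - \<beta> * G0 x" for x
    define \<kappa> where "\<kappa> x = \<theta> x - \<beta> * \<theta>0 x" for x
    have der: "(\<Theta> has_real_derivative \<kappa> x) (at x)" for x
      unfolding \<Theta>_def[abs_def] \<kappa>_def using G(1)[of x] G0(1)[of x] by (auto intro!: derivative_eq_intros)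
    have s\<kappa>: "smooth_real \<kappa>"
      using smooth_real_linear[OF test_real_smooth[OF t] test_real_smooth[OF t0], of 1 "- \<beta>"] by (simp add: \<kappa>_def[abs_def])
    have \<Theta>0: "\<Theta> x = 0" if "x \<notin> {min u0 u1..max v0 v1}" for x
      using that G(5,6)[of x] G0(5,6)[of x] C0 by (auto simp: \<Theta>_def \<beta>_def)
    have t\<Theta>: "test_real \<Theta>"
    proof -
      have "smooth_real \<Theta>" by (rule smooth_realI[OF s\<kappa> der])
      moreover have "a < min u0 u1" "min u0 u1 < max v0 v1" "max v0 v1 < a + 1" using G(2-4) G0(2-4) by auto
      ultimately show ?thesis unfolding test_real_def using \<Theta>0 by blast
    qed
    have d\<Theta>: "deriv \<Theta> = \<kappa>" using der by (auto intro!: ext DERIV_imp_deriv)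
    define R where "R x = (\<Prod>i\<in>{..<n} - {k}. \<eta> i (x i))" for x :: "nat \<Rightarrow> real"
    have Rk: "R (x(k := r)) = R x" for x r unfolding R_def by (intro prod.cong) auto
    have tens: "tensor n (\<eta>(k := f)) x = f (x k) * R x" if "x \<in> space ?N" for f x
    proof -
      have "tensor n (\<eta>(k := f)) x = (\<Prod>i<n. (\<eta>(k := f)) i (x i))" using that by (rule tensor_pcube)
      also have "\<dots> = f (x k) * (\<Prod>i\<in>{..<n} - {k}. (\<eta>(k := f)) i (x i))"
        using k by (subst prod.remove[of "{..<n}" k]) auto
      also have "(\<Prod>i\<in>{..<n} - {k}. (\<eta>(k := f)) i (x i)) = R x" unfolding R_def by (intro prod.cong) auto
      finally show ?thesis .
    qed
    have Rm: "R \<in> borel_measurable ?N"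
      unfolding R_def[abs_def] using \<eta> by (intro borel_measurable_prod measurable_component_compose test_real_measurable) auto
    have "\<forall>i. \<exists>B. i < n \<longrightarrow> 0 \<le> B \<and> (\<forall>x. \<bar>\<eta> i x\<bar> \<le> B)"
      using \<eta> test_real_bounded by metis
    then obtain B where B: "\<And>i x. i < n \<Longrightarrow> 0 \<le> B i \<and> \<bar>\<eta> i x\<bar> \<le> B i" by metis
    have RB: "\<bar>R x\<bar> \<le> (\<Prod>i\<in>{..<n} - {k}. B i)" for x
      unfolding R_def abs_prod using B by (intro prod_mono) auto
    have prod_int: "integrable ?N (\<lambda>x. f x * (h (x k) * R x))"
      "(\<integral>x. f x * (h (x k) * R x) \<partial>?N) = (\<integral>x. R x * (\<integral>s. f (x(k := s)) * h s \<partial>L) \<partial>?N)"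
      if f: "integrable ?N f" and h: "h \<in> borel_measurable borel" "\<And>s. \<bar>h s\<bar> \<le> Bh" for f h Bh
    proof -
      have i1: "integrable ?N (\<lambda>x. f x * h (x k))"
        by (rule integrable_mult_bounded[OF f measurable_component_compose[OF h(1) k] h(2)])
      have "integrable ?N (\<lambda>x. (f x * h (x k)) * R x)" by (rule integrable_mult_bounded[OF i1 Rm RB])
      then show i2: "integrable ?N (\<lambda>x. f x * (h (x k) * R x))" by (simp add: mult.assoc)
      have "(\<integral>x. f x * (h (x k) * R x) \<partial>?N) = (\<integral>x. (\<integral>s. f (x(k := s)) * (h s * R x) \<partial>L) \<partial>?N)"
        using integrable_resample(4)[OF k i2] by (simp add: Rk)
      also have "\<dots> = (\<integral>x. R x * (\<integral>s. f (x(k := s)) * h s \<partial>L) \<partial>?N)"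
      proof (rule Bochner_Integration.integral_cong[OF refl])
        fix x
        have "(\<integral>s. f (x(k := s)) * (h s * R x) \<partial>L) = (\<integral>s. R x * (f (x(k := s)) * h s) \<partial>L)"
          by (rule Bochner_Integration.integral_cong) auto
        then show "(\<integral>s. f (x(k := s)) * (h s * R x) \<partial>L) = R x * (\<integral>s. f (x(k := s)) * h s \<partial>L)" by simp
      qed
      finally show "(\<integral>x. f x * (h (x k) * R x) \<partial>?N) = (\<integral>x. R x * (\<integral>s. f (x(k := s)) * h s \<partial>L) \<partial>?N)" .
    qed
    obtain Bt where Bt: "\<And>x. \<bar>\<theta> x\<bar> \<le> Bt" using test_real_bounded[OF t] by blast
    obtain BT where BT: "\<And>x. \<bar>\<Theta> x\<bar> \<le> BT" using test_real_bounded[OF t\<Theta>] by blast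
    have \<kappa>B: "\<bar>\<kappa> x\<bar> \<le> Bt + \<bar>\<beta>\<bar> * B0" for x
    proof -
      have "\<bar>\<kappa> x\<bar> \<le> \<bar>\<theta> x\<bar> + \<bar>\<beta> * \<theta>0 x\<bar>" unfolding \<kappa>_def by linarith
      also have "\<bar>\<beta> * \<theta>0 x\<bar> \<le> \<bar>\<beta>\<bar> * B0" unfolding abs_mult using B0 by (intro mult_left_mono) auto
      finally show ?thesis using Bt[of x] by linarith
    qed
    note m = test_real_measurable[OF t] test_real_measurable[OF t0] test_real_measurable[OF t\<Theta>] smooth_real_measurable[OF s\<kappa>]
    have "(\<integral>x. u x * (\<kappa> (x k) * R x) \<partial>?N) = - (\<integral>x. v x * (\<Theta> (x k) * R x) \<partial>?N)"
    proof -
      have "(\<integral>x. u x * tensor n (\<eta>(k := \<Theta>, k := deriv ((\<eta>(k := \<Theta>)) k))) x \<partial>?N) = - (\<integral>x. v x * tensor n (\<eta>(k := \<Theta>)) x \<partial>?N)"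
        by (rule weak) (use \<eta> t\<Theta> in auto)
      then show ?thesis by (simp add: d\<Theta> tens cong: Bochner_Integration.integral_cong)
    qed
    also have "(\<integral>x. v x * (\<Theta> (x k) * R x) \<partial>?N) = - (\<integral>x. V x * (\<kappa> (x k) * R x) \<partial>?N)"
    proof -
      have "(\<integral>x. V x * (\<kappa> (x k) * R x) \<partial>?N) = (\<integral>x. R x * (\<integral>s. V (x(k := s)) * \<kappa> s \<partial>L) \<partial>?N)"
        by (rule prod_int(2)[OF V m(4) \<kappa>B])
      also have "\<dots> = (\<integral>x. R x * - (\<integral>s. v (x(k := s)) * \<Theta> s \<partial>L) \<partial>?N)"
      proof (rule integral_cong_AE)
        have im: "(\<lambda>x. \<integral>s. f (x(k := s)) * h s \<partial>L) \<in> borel_measurable ?N" if f: "integrable ?N f" and h: "h \<in> borel_measurable borel" for f :: "(nat \<Rightarrow> real) \<Rightarrow> real" and h :: "real \<Rightarrow> real"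
        proof (rule L.borel_measurable_lebesgue_integral)
          have "(\<lambda>p. f ((fst p)(k := snd p))) \<in> borel_measurable (?N \<Otimes>\<^sub>M L)"
            using measurable_compose[OF measurable_resample[OF k] borel_measurable_integrable[OF f]] by (simp add: case_prod_beta')
          moreover have "(\<lambda>p. h (snd p)) \<in> borel_measurable (?N \<Otimes>\<^sub>M L)"
            by (rule measurable_compose[OF measurable_snd]) (simp add: h)
          ultimately show "(\<lambda>(x, s). f (x(k := s)) * h s) \<in> borel_measurable (?N \<Otimes>\<^sub>M L)"
            unfolding case_prod_beta' by (rule borel_measurable_times)
        qed
        show "(\<lambda>x. R x * (\<integral>s. V (x(k := s)) * \<kappa> s \<partial>L)) \<in> borel_measurable ?N"
          by (intro borel_measurable_times Rm im V m)
        show "(\<lambda>x. R x * - (\<integral>s. v (x(k := s)) * \<Theta> s \<partial>L)) \<in> borel_measurable ?N"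
          by (intro borel_measurable_times borel_measurable_uminus Rm im v m)
        show "AE x in ?N. R x * (\<integral>s. V (x(k := s)) * \<kappa> s \<partial>L) = R x * - (\<integral>s. v (x(k := s)) * \<Theta> s \<partial>L)"
          using integrable_resample(2)[OF k v]
        proof eventually_elim
          case (elim x)
          have "(\<integral>s. V (x(k := s)) * \<kappa> s \<partial>L) = (\<integral>s. \<kappa> s * (\<integral>r. (if r < s then v (x(k := r)) else 0) \<partial>L) \<partial>L)"
            by (simp add: Vk mult.commute)
          also have "\<dots> = (\<integral>r. v (x(k := r)) * (\<integral>s. (if r < s then \<kappa> s else 0) \<partial>L) \<partial>L)"
            by (rule Fubini_triangle[OF elim m(4) \<kappa>B])
          also have "\<dots> = (\<integral>r. - (v (x(k := r)) * \<Theta> r) \<partial>L)"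
          proof (rule Bochner_Integration.integral_cong[OF refl])
            fix r assume "r \<in> space L"
            then have r: "a \<le> r" "r \<le> a + 1" using sub by (auto simp: space_L)
            have "\<Theta> (a + 1) = 0" by (rule \<Theta>0) (use G G0 in auto)
            then show "v (x(k := r)) * (\<integral>s. (if r < s then \<kappa> s else 0) \<partial>L) = - (v (x(k := r)) * \<Theta> r)"
              using integral_L_greaterThan[OF der smooth_real_continuous[OF s\<kappa>] r] by simp
          qed
          finally show ?case by simp
        qed
      qed
      also have "\<dots> = - (\<integral>x. R x * (\<integral>s. v (x(k := s)) * \<Theta> s \<partial>L) \<partial>?N)" by simp
      also have "(\<integral>x. R x * (\<integral>s. v (x(k := s)) * \<Theta> s \<partial>L) \<partial>?N) = (\<integral>x. v x * (\<Theta> (x k) * R x) \<partial>?N)"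
        by (rule prod_int(2)[OF v m(3) BT, symmetric])
      finally show ?thesis by simp
    qed
    finally have "(\<integral>x. u x * (\<kappa> (x k) * R x) \<partial>?N) = (\<integral>x. V x * (\<kappa> (x k) * R x) \<partial>?N)" by simp
    then have "(\<integral>x. W x * (\<kappa> (x k) * R x) \<partial>?N) = 0"
      using prod_int(1)[OF u m(4) \<kappa>B] prod_int(1)[OF V m(4) \<kappa>B] by (simp add: W_def left_diff_distrib)
    moreover have "(\<integral>x. W x * (\<kappa> (x k) * R x) \<partial>?N) = (\<integral>x. W x * (\<theta> (x k) * R x) \<partial>?N) - \<beta> * (\<integral>x. W x * (\<theta>0 (x k) * R x) \<partial>?N)"
    proof -
      have "(\<integral>x. W x * (\<kappa> (x k) * R x) \<partial>?N) = (\<integral>x. W x * (\<theta> (x k) * R x) - \<beta> * (W x * (\<theta>0 (x k) * R x)) \<partial>?N)"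
        by (rule Bochner_Integration.integral_cong) (auto simp: \<kappa>_def algebra_simps)
      then show ?thesis using prod_int(1)[OF W m(1) Bt] prod_int(1)[OF W m(2) B0] by simp
    qed
    moreover have "\<beta> * (\<integral>x. W x * (\<theta>0 (x k) * R x) \<partial>?N) = C * (\<integral>x. R x * c x \<partial>?N)"
    proof -
      have "(\<integral>x. W x * (\<theta>0 (x k) * R x) \<partial>?N) = (\<integral>x. C0 * (R x * c x) \<partial>?N)"
        unfolding prod_int(2)[OF W m(2) B0] using C0 by (simp add: c_def)
      then show ?thesis using C0 by (simp add: \<beta>_def)
    qed
    moreover have "(\<integral>x. c x * (\<theta> (x k) * R x) \<partial>?N) = C * (\<integral>x. R x * c x \<partial>?N)"
    proof -
      have "(\<integral>s. \<theta> s \<partial>L) = (\<integral>s. (if a < s then \<theta> s else 0) \<partial>L)"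
        using AE_L test_real_measurable[OF t] by (intro integral_cong_AE) auto
      also have "\<dots> = C" using integral_L_greaterThan[OF G(1) smooth_real_continuous[OF test_real_smooth[OF t]], of a] G(2-6) by simp
      finally have C: "(\<integral>s. \<theta> s \<partial>L) = C" .
      have "(\<integral>x. c x * (\<theta> (x k) * R x) \<partial>?N) = (\<integral>x. R x * (\<integral>s. c (x(k := s)) * \<theta> s \<partial>L) \<partial>?N)"
        by (rule prod_int(2)[OF ci m(1) Bt])
      also have "\<dots> = (\<integral>x. C * (R x * c x) \<partial>?N)" by (simp add: ck C mult_ac)
      finally show ?thesis by simp
    qed
    ultimately have "(\<integral>x. W x * (\<theta> (x k) * R x) \<partial>?N) - (\<integral>x. c x * (\<theta> (x k) * R x) \<partial>?N) = 0" by simp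
    then have "(\<integral>x. (W x - c x) * (\<theta> (x k) * R x) \<partial>?N) = 0"
      using prod_int(1)[OF W m(1) Bt] prod_int(1)[OF ci m(1) Bt] by (simp add: left_diff_distrib)
    moreover have "tensor n \<eta> x = \<theta> (x k) * R x" if "x \<in> space ?N" for x
      using tens[OF that, of \<theta>] by (simp add: \<theta>_def)
    ultimately show ?thesis by (simp cong: Bochner_Integration.integral_cong)
  qed
  have Wc: "integrable ?N (\<lambda>x. W x - c x)" using W ci by simp
  have "AE x in ?N. W x - c x = 0"
  proof (rule fundamental_lemma[OF borel_measurable_integrable[OF Wc] _ zero])
    fix p q :: real assume "a < p" "p < q" "q < a + 1"
    have "Pi\<^sub>E {..<n} (\<lambda>_. {p..q}) \<inter> space ?N \<in> sets ?N"
    proof -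
      have "Pi\<^sub>E {..<n} (\<lambda>_. {p..q}) \<inter> space ?N = Pi\<^sub>E {..<n} (\<lambda>_. {p..q} \<inter> I)"
        unfolding space_pcube PiE_Int ..
      then show ?thesis by (auto intro!: sets_PiE_pcube simp: sets_L)
    qed
    then have "integrable ?N (\<lambda>x. (W x - c x) * indicator (Pi\<^sub>E {..<n} (\<lambda>_. {p..q}) \<inter> space ?N) x)"
      by (rule integrable_real_mult_indicator[OF _ Wc])
    then show "integrable ?N (\<lambda>x. (W x - c x) * indicator (Pi\<^sub>E {..<n} (\<lambda>_. {p..q})) x)"
      by (subst Bochner_Integration.integrable_cong[OF refl]) (auto simp: indicator_def)
  qed
  then have "AE x in ?N. u x = c x + V x" by eventually_elim (simp add: W_def)
  then show ?thesis using ck unfolding V_def by blast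
qed

end


section \<open>Averages over dyadic intervals\<close>

context unit_length
begin

text \<open>The two points lie in the same dyadic interval of length \<open>1 / 2 ^ j\<close>, counted
  from the left end point \<open>a\<close>.\<close>

definition same_block :: "nat \<Rightarrow> real \<Rightarrow> real \<Rightarrow> bool" where
  "same_block j s r \<longleftrightarrow> \<lfloor>(s - a) * 2 ^ j\<rfloor> = \<lfloor>(r - a) * 2 ^ j\<rfloor>"

lemma same_block_between:
  assumes "same_block j s r" "min s r \<le> q" "q \<le> max s r" shows "same_block j s q"
proof -
  have f: "\<lfloor>(x - a) * 2 ^ j\<rfloor> \<le> \<lfloor>(y - a) * 2 ^ j\<rfloor>" if "x \<le> y" for x y :: real
    by (rule floor_mono, rule mult_right_mono) (use that in auto)
  show ?thesis
  proof (cases "s \<le> r")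
    case True
    then show ?thesis using f[of s q] f[of q r] assms unfolding same_block_def by simp
  next
    case False
    then show ?thesis using f[of r q] f[of q s] assms unfolding same_block_def by simp
  qed
qed

lemma same_block_set:
  "{r. same_block j s r} = {a + of_int \<lfloor>(s - a) * 2 ^ j\<rfloor> / 2 ^ j..<a + (of_int \<lfloor>(s - a) * 2 ^ j\<rfloor> + 1) / 2 ^ j}"
proof -
  have "same_block j s r \<longleftrightarrow> of_int \<lfloor>(s - a) * 2 ^ j\<rfloor> \<le> (r - a) * 2 ^ j \<and> (r - a) * 2 ^ j < of_int \<lfloor>(s - a) * 2 ^ j\<rfloor> + 1" for r
    unfolding same_block_def eq_commute[of "\<lfloor>(s - a) * 2 ^ j\<rfloor>"] by (rule floor_eq_iff)
  moreover have "real_of_int i \<le> (r - a) * 2 ^ j \<longleftrightarrow> a + of_int i / 2 ^ j \<le> r"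
    "(r - a) * 2 ^ j < real_of_int i + 1 \<longleftrightarrow> r < a + (of_int i + 1) / 2 ^ j" for i r
    using pos_divide_le_eq[of "2 ^ j" "of_int i" "r - a"] pos_less_divide_eq[of "2 ^ j" "r - a" "of_int i + 1"] by auto
  ultimately show ?thesis unfolding set_eq_iff mem_Collect_eq atLeastLessThan_iff by blast
qed

lemma block_borel: "{r. same_block j s r} \<in> sets borel"
  unfolding same_block_set by simp

lemma emeasure_block_lborel: "emeasure lborel {r. same_block j s r} = ennreal (1 / 2 ^ j)"
  unfolding same_block_set by (subst emeasure_lborel_Ico) (auto simp: divide_right_mono add_divide_distrib)

lemma nn_integral_block_const_le:
  "(\<integral>\<^sup>+r. (if same_block j s r then c else 0) \<partial>L) \<le> ennreal (1 / 2 ^ j) * c"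
proof -
  have "(\<lambda>r. if same_block j s r then c else 0) = (\<lambda>r. c * indicator {r. same_block j s r} r)"
    by (auto simp: indicator_def)
  then have "(\<integral>\<^sup>+r. (if same_block j s r then c else 0) \<partial>L) = (\<integral>\<^sup>+r\<in>{a<..<a + 1}. (c * indicator {r. same_block j s r} r) \<partial>lborel)"
    using block_borel by (simp only:) (rule nn_integral_L, simp)
  also have "\<dots> \<le> (\<integral>\<^sup>+r. c * indicator {r. same_block j s r} r \<partial>lborel)"
    by (intro nn_integral_mono) (auto simp: indicator_def)
  also have "\<dots> = ennreal (1 / 2 ^ j) * c"
    using block_borel by (simp add: nn_integral_cmult_indicator emeasure_block_lborel mult.commute)
  finally show ?thesis .
qed

lemma nn_integral_block_const:
  assumes s: "a < s" "s < a + 1"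
  shows "(\<integral>\<^sup>+r. (if same_block j s r then c else 0) \<partial>L) = ennreal (1 / 2 ^ j) * c"
proof -
  let ?i = "\<lfloor>(s - a) * 2 ^ j\<rfloor>"
  have i0: "0 \<le> ?i" using s by (simp add: zero_le_floor)
  have "(s - a) * 2 ^ j < 1 * 2 ^ j" using s by (intro mult_strict_right_mono) auto
  then have "?i < 2 ^ j" by (simp add: floor_less_iff)
  then have "?i + 1 \<le> 2 ^ j" by simp
  then have "of_int (?i + 1) \<le> (of_int (2 ^ j) :: real)" by (simp only: of_int_le_iff)
  then have "(of_int ?i + 1) / 2 ^ j \<le> (1::real)" by (simp add: divide_le_eq)
  then have bl: "{r. same_block j s r} \<subseteq> {a..<a + 1}"
    unfolding same_block_set using i0 by (auto simp: divide_nonneg_pos intro: order_trans[of _ "a + of_int ?i / 2 ^ j"] less_le_trans[of _ "a + (of_int ?i + 1) / 2 ^ j"])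
  have "(\<lambda>r. if same_block j s r then c else 0) = (\<lambda>r. c * indicator {r. same_block j s r} r)"
    by (auto simp: indicator_def)
  then have "(\<integral>\<^sup>+r. (if same_block j s r then c else 0) \<partial>L) = (\<integral>\<^sup>+r\<in>{a<..<a + 1}. (c * indicator {r. same_block j s r} r) \<partial>lborel)"
    using block_borel by (simp only:) (rule nn_integral_L, simp)
  also have "\<dots> = (\<integral>\<^sup>+r. c * indicator {r. same_block j s r} r \<partial>lborel)"
  proof (intro nn_integral_cong_AE eventually_mono[OF AE_lborel_singleton[of a]])
    fix r :: real assume "r \<noteq> a"
    then show "c * indicator {r. same_block j s r} r * indicator {a<..<a + 1} r = c * indicator {r. same_block j s r} r"
      using bl by (cases "same_block j s r") (force simp: indicator_def)+
  qed
  also have "\<dots> = ennreal (1 / 2 ^ j) * c"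
    using block_borel by (simp add: nn_integral_cmult_indicator emeasure_block_lborel mult.commute)
  finally show ?thesis .
qed

definition avg :: "nat \<Rightarrow> nat \<Rightarrow> ((nat \<Rightarrow> real) \<Rightarrow> ennreal) \<Rightarrow> (nat \<Rightarrow> real) \<Rightarrow> ennreal" where
  "avg j k f x = (\<integral>\<^sup>+r. (if same_block j (x k) r then ennreal (2 ^ j) * f (x(k := r)) else 0) \<partial>L)"

lemma measurable_resample_compose:
  assumes "k < n" "f \<in> borel_measurable (pcube n I)"
  shows "(\<lambda>p. f ((fst p)(k := snd p))) \<in> borel_measurable (pcube n I \<Otimes>\<^sub>M L)"
  using measurable_compose[OF measurable_resample[OF assms(1)] assms(2)] by (simp add: case_prod_beta')

lemma measurable_same_block:
  assumes "f \<in> borel_measurable M" "g \<in> borel_measurable M"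
  shows "Measurable.pred M (\<lambda>p. same_block j (f p) (g p))"
proof -
  note [measurable] = assms
  show ?thesis unfolding same_block_def by measurable
qed

lemma measurable_snd_L: "(\<lambda>p. snd p) \<in> borel_measurable (M \<Otimes>\<^sub>M L)"
  by (rule measurable_compose[OF measurable_snd]) simp

lemma measurable_avg_kernel:
  assumes k: "k < n" and f: "f \<in> borel_measurable (pcube n I)"
  shows "(\<lambda>p. if same_block j (fst p k) (snd p) then ennreal (2 ^ j) * f ((fst p)(k := snd p)) else 0)
    \<in> borel_measurable (pcube n I \<Otimes>\<^sub>M L)"
proof -
  note [measurable] = measurable_resample_compose[OF k f]
  have fk: "(\<lambda>p. fst p k) \<in> borel_measurable (pcube n I \<Otimes>\<^sub>M L)"
    by (rule measurable_compose[OF measurable_fst measurable_component_pcube_borel[OF k]])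
  note [measurable] = measurable_same_block[OF fk measurable_snd_L]
  show ?thesis by measurable
qed

lemma measurable_avg:
  assumes "k < n" "f \<in> borel_measurable (pcube n I)"
  shows "avg j k f \<in> borel_measurable (pcube n I)"
  unfolding avg_def[abs_def]
  using L.borel_measurable_nn_integral[of "\<lambda>x r. if same_block j (x k) r then ennreal (2 ^ j) * f (x(k := r)) else 0" "pcube n I"]
    measurable_avg_kernel[OF assms, of j] by (simp add: case_prod_beta')

lemma measurable_line:
  assumes "k < n" "f \<in> borel_measurable (pcube n I)" "x \<in> space (pcube n I)"
  shows "(\<lambda>r. f (x(k := r))) \<in> borel_measurable L"
  using measurable_compose[OF measurable_Pair1' measurable_resample_compose[OF assms(1,2)]] assms(3) by simp

lemma measurable_line_block:
  assumes "k < n" "f \<in> borel_measurable (pcube n I)" "x \<in> space (pcube n I)"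
  shows "(\<lambda>r. if same_block j s r then c * f (x(k := r)) else (0::ennreal)) \<in> borel_measurable L"
proof -
  note [measurable] = measurable_line[OF assms]
  have idL: "(\<lambda>r. r) \<in> borel_measurable L" by simp
  note [measurable] = measurable_same_block[OF borel_measurable_const idL]
  show ?thesis by measurable
qed

lemma avg_mono: "(\<And>r. r \<in> I \<Longrightarrow> f (x(k := r)) \<le> g (x(k := r))) \<Longrightarrow> avg j k f x \<le> avg j k g x"
  unfolding avg_def by (intro nn_integral_mono) (auto simp: space_L intro!: mult_left_mono)

lemma avg_mono_AE:
  assumes "k < n" "AE x in pcube n I. f x \<le> g x"
  shows "AE x in pcube n I. avg j k f x \<le> avg j k g x"
  using AE_resample[OF assms]
proof eventually_elim
  case (elim x)
  then show ?case unfolding avg_def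
    by (intro nn_integral_mono_AE) (auto elim!: eventually_mono intro!: mult_left_mono)
qed

lemma avg_add:
  assumes "k < n" "f \<in> borel_measurable (pcube n I)" "g \<in> borel_measurable (pcube n I)" "x \<in> space (pcube n I)"
  shows "avg j k (\<lambda>x. f x + g x) x = avg j k f x + avg j k g x"
  unfolding avg_def
  by (subst nn_integral_add[OF measurable_line_block[OF assms(1,2,4)] measurable_line_block[OF assms(1,3,4)], symmetric])
    (auto intro!: nn_integral_cong simp: distrib_left)

lemma avg_cmult:
  assumes "k < n" "f \<in> borel_measurable (pcube n I)" "x \<in> space (pcube n I)"
  shows "avg j k (\<lambda>x. c * f x) x = c * avg j k f x"
  unfolding avg_def
  by (subst nn_integral_cmult[OF measurable_line_block[OF assms], symmetric])
    (auto intro!: nn_integral_cong simp: mult.left_commute)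

lemma avg_const_le: "avg j k (\<lambda>_. c) x \<le> c"
proof -
  have "avg j k (\<lambda>_. c) x \<le> ennreal (1 / 2 ^ j) * (ennreal (2 ^ j) * c)"
    unfolding avg_def by (rule nn_integral_block_const_le)
  also have "\<dots> = c" by (simp add: mult.assoc[symmetric] ennreal_mult[symmetric])
  finally show ?thesis .
qed

lemma integral_avg_le:
  assumes k: "k < n" and f: "f \<in> borel_measurable (pcube n I)"
  shows "(\<integral>\<^sup>+x. avg j k f x \<partial>pcube n I) \<le> (\<integral>\<^sup>+x. f x \<partial>pcube n I)"
proof -
  interpret LL: pair_sigma_finite L L ..
  have "(\<integral>\<^sup>+x. avg j k f x \<partial>pcube n I) = (\<integral>\<^sup>+x. (\<integral>\<^sup>+s. avg j k f (x(k := s)) \<partial>L) \<partial>pcube n I)"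
    by (rule nn_integral_resample[OF k measurable_avg[OF k f]])
  also have "\<dots> \<le> (\<integral>\<^sup>+x. (\<integral>\<^sup>+r. f (x(k := r)) \<partial>L) \<partial>pcube n I)"
  proof (rule nn_integral_mono)
    fix x assume x: "x \<in> space (pcube n I)"
    have idL: "(\<lambda>r. r) \<in> borel_measurable L" by simp
    have fr: "(\<lambda>p. f (x(k := snd p))) \<in> borel_measurable (L \<Otimes>\<^sub>M L)"
      by (rule measurable_compose[OF measurable_snd measurable_line[OF k f x]])
    have fs: "(\<lambda>p. fst p) \<in> borel_measurable (L \<Otimes>\<^sub>M L)"
      by (rule measurable_compose[OF measurable_fst]) simp
    have km: "(\<lambda>(s, r). if same_block j s r then ennreal (2 ^ j) * f (x(k := r)) else 0) \<in> borel_measurable (L \<Otimes>\<^sub>M L)"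
    proof -
      note [measurable] = fr measurable_same_block[OF fs measurable_snd_L]
      show ?thesis unfolding case_prod_beta' by measurable
    qed
    have "(\<integral>\<^sup>+s. avg j k f (x(k := s)) \<partial>L) = (\<integral>\<^sup>+s. (\<integral>\<^sup>+r. (if same_block j s r then ennreal (2 ^ j) * f (x(k := r)) else 0) \<partial>L) \<partial>L)"
      unfolding avg_def fun_upd_upd fun_upd_same ..
    also have "\<dots> = (\<integral>\<^sup>+r. (\<integral>\<^sup>+s. (if same_block j s r then ennreal (2 ^ j) * f (x(k := r)) else 0) \<partial>L) \<partial>L)"
      using LL.Fubini'[OF km] by simp
    also have "\<dots> \<le> (\<integral>\<^sup>+r. f (x(k := r)) \<partial>L)"
    proof (rule nn_integral_mono)
      fix r
      have "(\<integral>\<^sup>+s. (if same_block j s r then ennreal (2 ^ j) * f (x(k := r)) else 0) \<partial>L)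
        = (\<integral>\<^sup>+s. (if same_block j r s then ennreal (2 ^ j) * f (x(k := r)) else 0) \<partial>L)"
        by (intro nn_integral_cong) (auto simp: same_block_def)
      also have "\<dots> \<le> ennreal (1 / 2 ^ j) * (ennreal (2 ^ j) * f (x(k := r)))" by (rule nn_integral_block_const_le)
      also have "\<dots> = f (x(k := r))" by (simp add: mult.assoc[symmetric] ennreal_mult[symmetric])
      finally show "(\<integral>\<^sup>+s. (if same_block j s r then ennreal (2 ^ j) * f (x(k := r)) else 0) \<partial>L) \<le> f (x(k := r))" .
    qed
    finally show "(\<integral>\<^sup>+s. avg j k f (x(k := s)) \<partial>L) \<le> (\<integral>\<^sup>+r. f (x(k := r)) \<partial>L)" .
  qed
  also have "\<dots> = (\<integral>\<^sup>+x. f x \<partial>pcube n I)" by (rule nn_integral_resample[OF k f, symmetric])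
  finally show ?thesis .
qed

lemma avg_le_truncate:
  assumes k: "k < n" and f: "f \<in> borel_measurable (pcube n I)" and x: "x \<in> space (pcube n I)"
  shows "avg j k f x \<le> c + avg j k (\<lambda>x. f x - c) x"
proof -
  have "avg j k f x \<le> avg j k (\<lambda>x. c + (f x - c)) x" by (intro avg_mono ennreal_le_add_diff)
  also have "\<dots> = avg j k (\<lambda>_. c) x + avg j k (\<lambda>x. f x - c) x"
    by (rule avg_add[OF k _ _ x]) (use f in measurable)
  also have "\<dots> \<le> c + avg j k (\<lambda>x. f x - c) x" by (intro add_right_mono avg_const_le)
  finally show ?thesis .
qed

lemma K_fun_top: "0 < t \<Longrightarrow> ennreal t * top + b = top"
  by (simp add: ennreal_mult_top)

text \<open>Averaging contracts both \<open>L\<^sup>1\<close> and \<open>L\<^sup>\<infinity>\<close>, hence every K-functional between them. This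
  replaces any computation of rearrangements of averages.\<close>

lemma K_fun_avg_le:
  assumes k: "k < n" and f: "f \<in> borel_measurable (pcube n I)" and t: "0 < t"
  shows "K_fun (pcube n I) (avg j k f) t \<le> K_fun (pcube n I) f t"
  unfolding K_fun_def[of _ f]
proof (rule INF_greatest)
  fix c
  show "K_fun (pcube n I) (avg j k f) t \<le> ennreal t * c + (\<integral>\<^sup>+x. f x - c \<partial>pcube n I)"
  proof (cases "c = top")
    case True then show ?thesis unfolding True K_fun_top[OF t] by simp
  next
    case False
    have "K_fun (pcube n I) (avg j k f) t \<le> ennreal t * c + (\<integral>\<^sup>+x. avg j k f x - c \<partial>pcube n I)" by (rule K_fun_le)
    also have "(\<integral>\<^sup>+x. avg j k f x - c \<partial>pcube n I) \<le> (\<integral>\<^sup>+x. avg j k (\<lambda>x. f x - c) x \<partial>pcube n I)"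
      using avg_le_truncate[OF k f] False by (intro nn_integral_mono) (simp add: ennreal_minus_le_iff)
    also have "\<dots> \<le> (\<integral>\<^sup>+x. f x - c \<partial>pcube n I)" by (rule integral_avg_le[OF k]) (use f in measurable)
    finally show ?thesis by (simp add: add_left_mono)
  qed
qed

text \<open>The one-dimensional step: on a line in direction \<open>k\<close>, the value at a point is at most the
  mean of \<open>\<bar>u\<bar>\<close> over the dyadic interval around it plus the integral of \<open>\<bar>v\<bar>\<close> over that
  interval.\<close>

lemma weak_derivative_le_avg:
  fixes u v :: "(nat \<Rightarrow> real) \<Rightarrow> real"
  assumes k: "k < n" and u: "integrable (pcube n I) u" and v: "integrable (pcube n I) v"
    and weak: "\<And>\<eta>. (\<And>i. i < n \<Longrightarrow> test_real (\<eta> i)) \<Longrightarrow>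
      (\<integral>x. u x * tensor n (\<eta>(k := deriv (\<eta> k))) x \<partial>pcube n I) = - (\<integral>x. v x * tensor n \<eta> x \<partial>pcube n I)"
  shows "AE x in pcube n I. absf u x \<le> avg j k (absf u) x + ennreal (1 / 2 ^ j) * avg j k (absf v) x"
proof -
  obtain c where ck: "\<And>x r. c (x(k := r)) = c x"
    and rep: "AE x in pcube n I. u x = c x + (\<integral>r. (if r < x k then v (x(k := r)) else 0) \<partial>L)"
    using weak_derivative_primitive[OF k u v weak] by blast
  have um: "absf u \<in> borel_measurable (pcube n I)" "absf v \<in> borel_measurable (pcube n I)"
    using u v by (auto intro!: measurable_absf)
  have xk: "AE x in pcube n I. a < x k \<and> x k < a + 1"
    using AE_pcube_interior[of n] by eventually_elim (use k in auto)
  show ?thesis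
    using rep AE_resample[OF k rep] integrable_resample(2)[OF k v] xk AE_space
  proof eventually_elim
    case (elim x)
    define g where "g r = v (x(k := r))" for r
    define F where "F s = (\<integral>r. (if r < s then g r else 0) \<partial>L)" for s
    have g: "integrable L g" using elim(3) by (simp add: g_def[abs_def])
    note [measurable] = borel_measurable_integrable[OF g]
    have idL[measurable]: "(\<lambda>r. r) \<in> borel_measurable L" by simp
    have ux: "u x = c x + F (x k)" using elim(1) unfolding F_def g_def .
    have ur: "AE r in L. u (x(k := r)) = c x + F r"
    proof -
      have "(\<integral>q. (if q < (x(k := r)) k then v ((x(k := r))(k := q)) else 0) \<partial>L) = F r" for r
        unfolding F_def g_def fun_upd_upd fun_upd_same ..
      then show ?thesis using elim(2) by (simp add: ck)
    qed
    let ?J = "\<lambda>r. same_block j (x k) r"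
    have Jm[measurable]: "Measurable.pred L ?J" by (intro measurable_same_block borel_measurable_const idL)
    define D where "D = (\<integral>\<^sup>+q. (if ?J q then ennreal \<bar>g q\<bar> else 0) \<partial>L)"
    have gi: "integrable L (\<lambda>q. if q < s then g q else 0)" for s
      by (rule Bochner_Integration.integrable_bound[OF g]) (auto, measurable)
    have FD: "ennreal \<bar>F s - F r\<bar> \<le> D" if r: "?J r" and s: "s = x k" for s r
    proof -
      have "\<bar>F s - F r\<bar> \<le> (\<integral>q. \<bar>(if q < s then g q else 0) - (if q < r then g q else 0)\<bar> \<partial>L)"
        unfolding F_def Bochner_Integration.integral_diff[OF gi gi, symmetric] by (rule integral_abs_bound)
      also have "ennreal \<dots> = (\<integral>\<^sup>+q. ennreal \<bar>(if q < s then g q else 0) - (if q < r then g q else 0)\<bar> \<partial>L)"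
        using gi by (intro nn_integral_eq_integral[symmetric] integrable_abs Bochner_Integration.integrable_diff) auto
      also have "\<dots> \<le> D" unfolding D_def
      proof (rule nn_integral_mono)
        fix q
        show "ennreal \<bar>(if q < s then g q else 0) - (if q < r then g q else 0)\<bar> \<le> (if ?J q then ennreal \<bar>g q\<bar> else 0)"
        proof (cases "(q < s) = (q < r)")
          case False
          then have "?J q" using same_block_between[of j "x k" r q] r s by auto
          then show ?thesis using False by auto
        qed auto
      qed
      finally show ?thesis by (simp add: ennreal_leI)
    qed
    have D_avg: "D = ennreal (1 / 2 ^ j) * avg j k (absf v) x"
    proof -
      have "avg j k (absf v) x = (\<integral>\<^sup>+q. ennreal (2 ^ j) * (if ?J q then ennreal \<bar>g q\<bar> else 0) \<partial>L)"
        unfolding avg_def by (intro nn_integral_cong) (auto simp: absf_def g_def)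
      also have "\<dots> = ennreal (2 ^ j) * D" unfolding D_def by (rule nn_integral_cmult) measurable
      finally show ?thesis by (simp add: mult.assoc[symmetric] ennreal_mult[symmetric])
    qed
    have "absf u x = ennreal (1 / 2 ^ j) * (ennreal (2 ^ j) * absf u x)"
      by (simp add: mult.assoc[symmetric] ennreal_mult[symmetric])
    also have "\<dots> = (\<integral>\<^sup>+r. (if ?J r then ennreal (2 ^ j) * absf u x else 0) \<partial>L)"
      using nn_integral_block_const[of "x k" j "ennreal (2 ^ j) * absf u x"] elim(4) by simp
    also have "\<dots> \<le> (\<integral>\<^sup>+r. (if ?J r then ennreal (2 ^ j) * absf u (x(k := r)) else 0) + (if ?J r then ennreal (2 ^ j) * D else 0) \<partial>L)"
      using ur
    proof (intro nn_integral_mono_AE, eventually_elim)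
      case (elim r)
      show ?case
      proof (cases "?J r")
        case True
        have "\<bar>u x\<bar> \<le> \<bar>u (x(k := r))\<bar> + \<bar>F (x k) - F r\<bar>" using elim ux by linarith
        then have "absf u x \<le> absf u (x(k := r)) + ennreal \<bar>F (x k) - F r\<bar>"
          unfolding absf_def by (simp add: ennreal_plus[symmetric] ennreal_leI del: ennreal_plus)
        also have "\<dots> \<le> absf u (x(k := r)) + D" using FD[OF True] by (intro add_left_mono) auto
        finally show ?thesis using True by (simp add: distrib_left[symmetric] mult_left_mono)
      qed simp
    qed
    also have "\<dots> = avg j k (absf u) x + (\<integral>\<^sup>+r. (if ?J r then ennreal (2 ^ j) * D else 0) \<partial>L)"
      unfolding avg_def
      by (rule nn_integral_add[OF measurable_line_block[OF k um(1) elim(5)]]) measurable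
    also have "(\<integral>\<^sup>+r. (if ?J r then ennreal (2 ^ j) * D else 0) \<partial>L) \<le> ennreal (1 / 2 ^ j) * (ennreal (2 ^ j) * D)"
      by (rule nn_integral_block_const_le)
    also have "\<dots> = D" by (simp add: mult.assoc[symmetric] ennreal_mult[symmetric])
    finally show ?case by (simp add: D_avg add_left_mono)
  qed
qed


section \<open>Iterated averages over dyadic cubes\<close>

fun avgs :: "nat \<Rightarrow> nat \<Rightarrow> ((nat \<Rightarrow> real) \<Rightarrow> ennreal) \<Rightarrow> (nat \<Rightarrow> real) \<Rightarrow> ennreal" where
  "avgs j 0 f = f"
| "avgs j (Suc m) f = avgs j m (avg j m f)"

lemma measurable_avgs: "m \<le> n \<Longrightarrow> f \<in> borel_measurable (pcube n I) \<Longrightarrow> avgs j m f \<in> borel_measurable (pcube n I)"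
proof (induction m arbitrary: f)
  case (Suc m)
  then show ?case using measurable_avg[of m n f j] by simp
qed simp

lemma avgs_mono: "(\<And>x. f x \<le> g x) \<Longrightarrow> avgs j m f x \<le> avgs j m g x"
proof (induction m arbitrary: f g)
  case (Suc m)
  then show ?case using Suc.IH[of "avg j m f" "avg j m g"] avg_mono[of f _ m g j] by simp
qed simp

lemma avgs_mono_AE:
  "m \<le> n \<Longrightarrow> AE x in pcube n I. f x \<le> g x \<Longrightarrow> AE x in pcube n I. avgs j m f x \<le> avgs j m g x"
proof (induction m arbitrary: f g)
  case (Suc m)
  then show ?case using Suc.IH[of "avg j m f" "avg j m g"] avg_mono_AE[of m n f g j] by simp
qed simp

lemma avgs_cong_space:
  assumes "m \<le> n" "\<And>x. x \<in> space (pcube n I) \<Longrightarrow> f x = g x" "x \<in> space (pcube n I)"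
  shows "avgs j m f x = avgs j m g x"
  using assms
proof (induction m arbitrary: f g)
  case (Suc m)
  have eq: "avg j m f x = avg j m g x" if "x \<in> space (pcube n I)" for x
  proof -
    have upd: "x(m := r) \<in> space (pcube n I)" if "r \<in> I" for r
      using \<open>x \<in> space (pcube n I)\<close> that Suc.prems(1) by (auto simp: space_pcube PiE_iff extensional_def)
    have "f (x(m := r)) = g (x(m := r))" if "r \<in> space L" for r
      using that unfolding space_L by (rule Suc.prems(2)[OF upd])
    then show ?thesis unfolding avg_def by (intro nn_integral_cong) (simp only:)
  qed
  have "avgs j m (avg j m f) x = avgs j m (avg j m g) x"
    by (rule Suc.IH) (use Suc.prems(1,3) eq in simp_all)
  then show ?case by simp
qed simp

lemma avgs_add:
  assumes "m \<le> n" "f \<in> borel_measurable (pcube n I)" "g \<in> borel_measurable (pcube n I)" "x \<in> space (pcube n I)"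
  shows "avgs j m (\<lambda>x. f x + g x) x = avgs j m f x + avgs j m g x"
  using assms
proof (induction m arbitrary: f g)
  case (Suc m)
  have "avgs j (Suc m) (\<lambda>x. f x + g x) x = avgs j m (\<lambda>x. avg j m f x + avg j m g x) x"
    using Suc.prems unfolding avgs.simps by (intro avgs_cong_space[of m n] avg_add[of m n]) auto
  also have "\<dots> = avgs j (Suc m) f x + avgs j (Suc m) g x"
    using Suc.prems by (subst Suc.IH) (auto intro: measurable_avg)
  finally show ?case .
qed simp

lemma avgs_cmult:
  assumes "m \<le> n" "f \<in> borel_measurable (pcube n I)" "x \<in> space (pcube n I)"
  shows "avgs j m (\<lambda>x. c * f x) x = c * avgs j m f x"
  using assms
proof (induction m arbitrary: f)
  case (Suc m)
  have "avgs j (Suc m) (\<lambda>x. c * f x) x = avgs j m (\<lambda>x. c * avg j m f x) x"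
    using Suc.prems unfolding avgs.simps by (intro avgs_cong_space[of m n] avg_cmult[of m n]) auto
  also have "\<dots> = c * avgs j (Suc m) f x"
    using Suc.prems by (subst Suc.IH) (auto intro: measurable_avg)
  finally show ?case .
qed simp

lemma K_fun_avgs_le:
  "m \<le> n \<Longrightarrow> f \<in> borel_measurable (pcube n I) \<Longrightarrow> 0 < t \<Longrightarrow> K_fun (pcube n I) (avgs j m f) t \<le> K_fun (pcube n I) f t"
proof (induction m arbitrary: f)
  case (Suc m)
  have "K_fun (pcube n I) (avgs j (Suc m) f) t \<le> K_fun (pcube n I) (avg j m f) t"
    using Suc.prems Suc.IH[of "avg j m f"] measurable_avg[of m n f j] by simp
  also have "\<dots> \<le> K_fun (pcube n I) f t" using Suc.prems by (intro K_fun_avg_le) auto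
  finally show ?case .
qed simp

lemma avgs_le_const:
  "(\<And>x. f x \<le> c) \<Longrightarrow> avgs j m f x \<le> c"
proof (induction m arbitrary: f)
  case (Suc m)
  have "avg j m f x \<le> c" for x
    using avg_mono[of f x m "\<lambda>_. c" j] avg_const_le[of j m c x] Suc.prems by (meson order_trans)
  then show ?case using Suc.IH[of "avg j m f"] by simp
qed simp

lemma measurable_splice:
  assumes "m \<le> n" "x \<in> space (pcube n I)"
  shows "(\<lambda>y i. if i < m then y i else x i) \<in> measurable (pcube m I) (pcube n I)"
proof -
  have A: "(\<lambda>y. if i < m then y i else x i) \<in> measurable (pcube m I) L" if "i \<in> {..<n}" for i
    using assms that by (cases "i < m") (auto simp: space_pcube PiE_iff space_L)
  have B: "(\<lambda>y i. if i < m then y i else x i) \<in> space (pcube m I) \<rightarrow> (\<Pi>\<^sub>E i\<in>{..<n}. space L)"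
    using assms by (intro funcsetI) (auto simp: space_pcube space_L PiE_iff extensional_def)
  from measurable_PiM_single'[of "{..<n}" "\<lambda>i y. if i < m then y i else x i" "pcube m I" "\<lambda>_. L", OF A B]
  show ?thesis by (simp add: pcube_def[of n])
qed

text \<open>Averaging over dyadic cubes of side \<open>1 / 2 ^ j\<close> is bounded from \<open>L\<^sup>1\<close> to \<open>L\<^sup>\<infinity>\<close> with
  the inverse of their volume: dropping the restriction to the cube leaves an iterated integral.\<close>

lemma avgs_le_integral:
  assumes "m \<le> n" "f \<in> borel_measurable (pcube n I)" "x \<in> space (pcube n I)"
  shows "avgs j m f x \<le> ennreal (2 ^ (j * m)) * (\<integral>\<^sup>+y. f (\<lambda>i. if i < m then y i else x i) \<partial>pcube m I)"
  using assms
proof (induction m arbitrary: f)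
  case 0
  have "(\<integral>\<^sup>+y. f (\<lambda>i. if i < 0 then y i else x i) \<partial>pcube 0 I) = f x"
    using N.emeasure_space_1[of 0] by simp
  then show ?case by simp
next
  case (Suc m)
  have mn: "m < n" "m \<le> n" using Suc.prems(1) by auto
  have ins: "pcube (Suc m) I = Pi\<^sub>M (insert m {..<m}) (\<lambda>_. L)" by (simp add: pcube_def lessThan_Suc)
  have "avgs j (Suc m) f x \<le> ennreal (2 ^ (j * m)) * (\<integral>\<^sup>+y. avg j m f (\<lambda>i. if i < m then y i else x i) \<partial>pcube m I)"
    using Suc.IH[OF mn(2) measurable_avg[OF mn(1) Suc.prems(2)] Suc.prems(3)] by simp
  also have "\<dots> \<le> ennreal (2 ^ (j * m)) * (\<integral>\<^sup>+y. ennreal (2 ^ j) * (\<integral>\<^sup>+r. f (\<lambda>i. if i < Suc m then (y(m := r)) i else x i) \<partial>L) \<partial>pcube m I)"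
  proof (intro mult_left_mono nn_integral_mono)
    fix y assume y: "y \<in> space (pcube m I)"
    let ?z = "\<lambda>i. if i < m then y i else x i"
    have z: "?z \<in> space (pcube n I)"
      using measurable_space[OF measurable_splice[OF mn(2) Suc.prems(3)] y] .
    have eq: "?z(m := r) = (\<lambda>i. if i < Suc m then (y(m := r)) i else x i)" for r
      by (auto simp: fun_eq_iff less_Suc_eq)
    have "avg j m f ?z \<le> (\<integral>\<^sup>+r. ennreal (2 ^ j) * f (?z(m := r)) \<partial>L)"
      unfolding avg_def by (intro nn_integral_mono) auto
    also have "\<dots> = ennreal (2 ^ j) * (\<integral>\<^sup>+r. f (?z(m := r)) \<partial>L)"
      by (rule nn_integral_cmult[OF measurable_line[OF mn(1) Suc.prems(2) z]])
    finally show "avg j m f ?z \<le> ennreal (2 ^ j) * (\<integral>\<^sup>+r. f (\<lambda>i. if i < Suc m then (y(m := r)) i else x i) \<partial>L)"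
      by (simp only: eq)
  qed simp
  also have "\<dots> = ennreal (2 ^ (j * m)) * (ennreal (2 ^ j) * (\<integral>\<^sup>+y. (\<integral>\<^sup>+r. f (\<lambda>i. if i < Suc m then (y(m := r)) i else x i) \<partial>L) \<partial>pcube m I))"
  proof -
    have fm: "(\<lambda>z. f (\<lambda>i. if i < Suc m then z i else x i)) \<in> borel_measurable (pcube (Suc m) I)"
      by (rule measurable_compose[OF measurable_splice[OF Suc.prems(1,3)] Suc.prems(2)])
    have "(\<lambda>p. (fst p)(m := snd p)) \<in> measurable (pcube m I \<Otimes>\<^sub>M L) (pcube (Suc m) I)"
      using measurable_add_dim[of m "{..<m}" "\<lambda>_. L"] unfolding ins pcube_def[of m] case_prod_beta' .
    from measurable_compose[OF this fm]
    have "(\<lambda>y. \<integral>\<^sup>+r. f (\<lambda>i. if i < Suc m then (y(m := r)) i else x i) \<partial>L) \<in> borel_measurable (pcube m I)"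
      by (intro L.borel_measurable_nn_integral) (simp add: case_prod_beta')
    then show ?thesis by (subst nn_integral_cmult) auto
  qed
  also have "(\<integral>\<^sup>+y. (\<integral>\<^sup>+r. f (\<lambda>i. if i < Suc m then (y(m := r)) i else x i) \<partial>L) \<partial>pcube m I) = (\<integral>\<^sup>+z. f (\<lambda>i. if i < Suc m then z i else x i) \<partial>pcube (Suc m) I)"
  proof -
    have fm: "(\<lambda>z. f (\<lambda>i. if i < Suc m then z i else x i)) \<in> borel_measurable (pcube (Suc m) I)"
      by (rule measurable_compose[OF measurable_splice[OF Suc.prems(1,3)] Suc.prems(2)])
    then show ?thesis unfolding ins pcube_def[of m] by (subst PL.product_nn_integral_insert) auto
  qed
  finally show ?case
    by (simp add: mult.assoc[symmetric] ennreal_mult[symmetric] power_add[symmetric] add.commute)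
qed

lemma avgs_le_integral_cube:
  assumes "f \<in> borel_measurable (pcube n I)" "x \<in> space (pcube n I)"
  shows "avgs j n f x \<le> ennreal (2 ^ (j * n)) * (\<integral>\<^sup>+y. f y \<partial>pcube n I)"
proof -
  have "(\<lambda>i. if i < n then y i else x i) = y" if "y \<in> space (pcube n I)" for y
    using assms(2) that by (auto simp: space_pcube PiE_iff extensional_def fun_eq_iff)
  then have "(\<integral>\<^sup>+y. f (\<lambda>i. if i < n then y i else x i) \<partial>pcube n I) = (\<integral>\<^sup>+y. f y \<partial>pcube n I)"
    by (intro nn_integral_cong) simp
  then show ?thesis using avgs_le_integral[OF order_refl assms, of j] by simp
qed

end


section \<open>The rearrangement estimate behind the embedding\<close>

text \<open>By Markov's inequality \<open>T\<close> exceeds its integral divided by \<open>t\<close> only on a set of measure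
  at most \<open>t\<close>.\<close>

lemma rearr_le_Markov:
  assumes M: "prob_space M" and [measurable]: "\<psi> \<in> borel_measurable M" "T \<in> borel_measurable M"
    and le: "AE y in M. \<psi> y \<le> A + T y" and t: "0 < t"
  shows "rearr M \<psi> t \<le> A + ennreal (1 / t) * (\<integral>\<^sup>+y. T y \<partial>M)"
proof -
  define J where "J = (\<integral>\<^sup>+y. T y \<partial>M)"
  define b where "b = ennreal (1 / t) * J"
  have bJ: "ennreal t * b = J" using t by (simp add: b_def mult.assoc[symmetric] ennreal_mult[symmetric])
  have "distr_fun M \<psi> (A + b) \<le> ennreal t"
  proof (cases "b = top")
    case True then show ?thesis by (simp add: distr_fun_def)
  next
    case False
    have "distr_fun M \<psi> (A + b) \<le> emeasure M {y \<in> space M. b < T y}"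
      unfolding distr_fun_def
    proof (rule emeasure_mono_AE)
      show "AE y in M. y \<in> {y \<in> space M. A + b < \<psi> y} \<longrightarrow> y \<in> {y \<in> space M. b < T y}"
        using le
      proof eventually_elim
        case (elim y)
        show ?case
        proof
          assume y: "y \<in> {y \<in> space M. A + b < \<psi> y}"
          then have "A + b < \<psi> y" by simp
          also note elim
          finally have "A + b < A + T y" .
          then have "b < T y" by (meson add_left_mono not_le)
          then show "y \<in> {y \<in> space M. b < T y}" using y by simp
        qed
      qed
    qed measurable
    also have "\<dots> \<le> ennreal t"
    proof (cases "b = 0")
      case True
      then have "J = 0" using bJ by simp
      then have "AE y in M. T y = 0" unfolding J_def by (subst (asm) nn_integral_0_iff_AE) auto
      then have "emeasure M {y \<in> space M. b < T y} = 0"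
        using True by (intro emeasure_eq_0_AE) (auto elim!: eventually_mono)
      then show ?thesis by simp
    next
      case b0: False
      obtain \<beta> where \<beta>: "b = ennreal \<beta>" "0 < \<beta>"
        using False b0 by (cases b) (auto simp: order_less_le)
      have "b * emeasure M {y \<in> space M. b < T y} = (\<integral>\<^sup>+y. b * indicator {y \<in> space M. b < T y} y \<partial>M)"
        by (rule nn_integral_cmult_indicator[symmetric]) measurable
      also have "\<dots> \<le> J" unfolding J_def by (intro nn_integral_mono) (auto simp: indicator_def)
      also have "J = b * ennreal t" using bJ by (simp add: mult.commute)
      finally have "ennreal (1 / \<beta>) * (b * emeasure M {y \<in> space M. b < T y}) \<le> ennreal (1 / \<beta>) * (b * ennreal t)"
        by (rule mult_left_mono) simp
      moreover have "ennreal (1 / \<beta>) * (b * z) = z" for z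
        using \<beta> by (simp add: mult.assoc[symmetric] ennreal_mult[symmetric])
      ultimately show ?thesis by (simp only:)
    qed
    finally show ?thesis .
  qed
  then show ?thesis using rearr_le_iff[OF assms(2), of t "A + b"] by (simp add: b_def J_def)
qed

context unit_length
begin

text \<open>Replacing a function by its mean in one direction after the other produces one error term
  per direction; the earlier errors are averaged again, which leads to this sum.\<close>

definition avgs_sum :: "nat \<Rightarrow> nat \<Rightarrow> ((nat \<Rightarrow> real) \<Rightarrow> ennreal) \<Rightarrow> (nat \<Rightarrow> real) \<Rightarrow> ennreal" where
  "avgs_sum j m g x = (\<Sum>i<m. avgs j (Suc i) g x)"

lemma measurable_avgs_sum: "m \<le> n \<Longrightarrow> g \<in> borel_measurable (pcube n I) \<Longrightarrow> avgs_sum j m g \<in> borel_measurable (pcube n I)"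
  unfolding avgs_sum_def[abs_def] by (intro borel_measurable_sum measurable_avgs) auto

lemma K_fun_avgs_sum_le:
  assumes "m \<le> n" "g \<in> borel_measurable (pcube n I)" "0 < t"
  shows "K_fun (pcube n I) (avgs_sum j m g) t \<le> of_nat m * K_fun (pcube n I) g t"
  using assms(1)
proof (induction m)
  case 0
  have "avgs_sum j 0 g = (\<lambda>_. 0)" by (simp add: avgs_sum_def fun_eq_iff)
  then show ?case using K_fun_le_integral[of "pcube n I" "\<lambda>_. 0" t] by simp
next
  case (Suc m)
  have "K_fun (pcube n I) (\<lambda>x. avgs_sum j m g x + avgs j (Suc m) g x) t
      \<le> K_fun (pcube n I) (avgs_sum j m g) t + K_fun (pcube n I) (avgs j (Suc m) g) t"
    by (rule K_fun_add[OF measurable_avgs_sum measurable_avgs]) (use Suc.prems assms in auto)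
  also have "\<dots> \<le> of_nat m * K_fun (pcube n I) g t + K_fun (pcube n I) g t"
    using Suc assms by (intro add_mono K_fun_avgs_le) auto
  also have "\<dots> = of_nat (Suc m) * K_fun (pcube n I) g t" by (simp add: distrib_right add.commute)
  finally show ?case by (simp add: avgs_sum_def[abs_def])
qed

text \<open>Truncate \<open>h\<close> at a level \<open>c\<close>: the mean of the truncation is at most \<open>c\<close>, and the mean of
  the excess is its integral divided by the volume of the cube.\<close>

lemma avgs_le_K_fun:
  assumes h: "h \<in> borel_measurable (pcube n I)" and x: "x \<in> space (pcube n I)"
  shows "avgs j n h x \<le> ennreal (2 ^ (j * n)) * K_fun (pcube n I) h (1 / 2 ^ (j * n))"
  unfolding K_fun_def
proof (rule le_INF_mult_ennreal)
  fix c
  have hc: "(\<lambda>x. h x - c) \<in> borel_measurable (pcube n I)" using h by measurable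
  have "avgs j n h x \<le> avgs j n (\<lambda>x. c + (h x - c)) x" by (intro avgs_mono ennreal_le_add_diff)
  also have "\<dots> = avgs j n (\<lambda>_. c) x + avgs j n (\<lambda>x. h x - c) x"
    by (rule avgs_add[OF order_refl _ hc x]) simp
  also have "\<dots> \<le> c + ennreal (2 ^ (j * n)) * (\<integral>\<^sup>+x. h x - c \<partial>pcube n I)"
    by (intro add_mono avgs_le_const avgs_le_integral_cube hc x) simp
  also have "\<dots> = ennreal (2 ^ (j * n)) * (ennreal (1 / 2 ^ (j * n)) * c + (\<integral>\<^sup>+x. h x - c \<partial>pcube n I))"
    by (simp add: distrib_left mult.assoc[symmetric] ennreal_mult[symmetric])
  finally show "avgs j n h x \<le> ennreal (2 ^ (j * n)) * (ennreal (1 / 2 ^ (j * n)) * c + (\<integral>\<^sup>+x. h x - c \<partial>pcube n I))" .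
qed simp

end

text \<open>Tensor products suffice as test functions here. The estimates involve \<open>u\<close> and its gradient only
  through the majorant \<open>g\<close>.\<close>

locale weakly_differentiable = unit_length +
  fixes n :: nat and u :: "(nat \<Rightarrow> real) \<Rightarrow> real" and v :: "nat \<Rightarrow> (nat \<Rightarrow> real) \<Rightarrow> real"
    and g :: "(nat \<Rightarrow> real) \<Rightarrow> ennreal"
  assumes u: "integrable (pcube n I) u" and v: "\<And>k. k < n \<Longrightarrow> integrable (pcube n I) (v k)"
    and weak: "\<And>k \<eta>. k < n \<Longrightarrow> (\<And>i. i < n \<Longrightarrow> test_real (\<eta> i)) \<Longrightarrow>
      (\<integral>x. u x * tensor n (\<eta>(k := deriv (\<eta> k))) x \<partial>pcube n I) = - (\<integral>x. v k x * tensor n \<eta> x \<partial>pcube n I)"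
    and g: "g \<in> borel_measurable (pcube n I)"
    and u_le: "\<And>x. absf u x \<le> g x" and v_le: "\<And>k x. k < n \<Longrightarrow> absf (v k) x \<le> g x"
begin

abbreviation "N \<equiv> pcube n I"

lemma um: "absf u \<in> borel_measurable N"
  using u by (intro measurable_absf) auto

lemma le_avg: "k < n \<Longrightarrow> AE x in N. absf u x \<le> avg j k (absf u) x + ennreal (1 / 2 ^ j) * avg j k g x"
proof -
  assume k: "k < n"
  have "AE x in N. absf u x \<le> avg j k (absf u) x + ennreal (1 / 2 ^ j) * avg j k (absf (v k)) x"
    by (rule weak_derivative_le_avg[OF k u v[OF k] weak[OF k]])
  then show ?thesis
  proof eventually_elim
    case (elim x)
    also have "avg j k (absf u) x + ennreal (1 / 2 ^ j) * avg j k (absf (v k)) x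
        \<le> avg j k (absf u) x + ennreal (1 / 2 ^ j) * avg j k g x"
      by (intro add_left_mono mult_left_mono avg_mono v_le k) auto
    finally show ?case .
  qed
qed

lemma le_avgs: "m \<le> n \<Longrightarrow> AE x in N. absf u x \<le> avgs j m (absf u) x + ennreal (1 / 2 ^ j) * avgs_sum j m g x"
proof (induction m)
  case 0 then show ?case by (simp add: avgs_sum_def)
next
  case (Suc m)
  have m: "m < n" "m \<le> n" using Suc.prems by auto
  have "AE x in N. avgs j m (absf u) x \<le> avgs j m (\<lambda>x. avg j m (absf u) x + ennreal (1 / 2 ^ j) * avg j m g x) x"
    by (rule avgs_mono_AE[OF m(2) le_avg[OF m(1)]])
  with Suc.IH[OF m(2)] AE_space show ?case
  proof eventually_elim
    case (elim x)
    have mg: "(\<lambda>x. ennreal (1 / 2 ^ j) * avg j m g x) \<in> borel_measurable N"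
      using measurable_avg[OF m(1) g] by measurable
    have "avgs j m (\<lambda>x. avg j m (absf u) x + ennreal (1 / 2 ^ j) * avg j m g x) x
        = avgs j (Suc m) (absf u) x + ennreal (1 / 2 ^ j) * avgs j (Suc m) g x"
      using avgs_add[OF m(2) measurable_avg[OF m(1) um] mg elim(2), of j j]
        avgs_cmult[OF m(2) measurable_avg[OF m(1) g] elim(2), of j "ennreal (1 / 2 ^ j)" j] by simp
    with elim(3) have "avgs j m (absf u) x \<le> avgs j (Suc m) (absf u) x + ennreal (1 / 2 ^ j) * avgs j (Suc m) g x" by simp
    then have "avgs j m (absf u) x + ennreal (1 / 2 ^ j) * avgs_sum j m g x
      \<le> (avgs j (Suc m) (absf u) x + ennreal (1 / 2 ^ j) * avgs j (Suc m) g x) + ennreal (1 / 2 ^ j) * avgs_sum j m g x"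
      by (rule add_right_mono)
    also have "\<dots> = avgs j (Suc m) (absf u) x + ennreal (1 / 2 ^ j) * avgs_sum j (Suc m) g x"
      by (simp add: avgs_sum_def distrib_left ac_simps del: avgs.simps)
    finally show ?case using elim(1) by (rule order_trans[rotated])
  qed
qed

text \<open>A bound for the averages of \<open>\<bar>u\<bar>\<close> over the dyadic cubes of side \<open>1 / 2 ^ j\<close>; passing to
  cubes of half the size costs one more term of the sum.\<close>

definition cube_bound :: "nat \<Rightarrow> ennreal" where
  "cube_bound j = (\<integral>\<^sup>+x. absf u x \<partial>N) +
    (\<Sum>i<j. ennreal (1 / 2 ^ i) * (ennreal (2 ^ (Suc i * n)) * (of_nat n * K_fun N g (1 / 2 ^ (Suc i * n)))))"

text \<open>For the step from \<open>j\<close> to \<open>Suc j\<close>, the inequality \<open>le_avgs\<close> at scale \<open>j\<close> is averaged over the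
  cubes of side \<open>1 / 2 ^ Suc j\<close>.\<close>

lemma avgs_le_cube_bound: "AE x in N. avgs j n (absf u) x \<le> cube_bound j"
proof (induction j)
  case 0
  show ?case
    using avgs_le_integral_cube[OF um, of _ 0] by (intro AE_I2) (simp add: cube_bound_def)
next
  case (Suc j)
  have Hm: "(\<lambda>x. ennreal (1 / 2 ^ j) * avgs_sum j n g x) \<in> borel_measurable N"
    using measurable_avgs_sum[OF order_refl g] by measurable
  have "AE x in N. absf u x \<le> cube_bound j + ennreal (1 / 2 ^ j) * avgs_sum j n g x"
    using Suc le_avgs[OF order_refl, of j]
    by eventually_elim (meson add_right_mono order_trans)
  from avgs_mono_AE[OF order_refl this, of "Suc j"] AE_space show ?case
  proof eventually_elim
    case (elim x)
    note elim(1)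
    also have "avgs (Suc j) n (\<lambda>x. cube_bound j + ennreal (1 / 2 ^ j) * avgs_sum j n g x) x
        = avgs (Suc j) n (\<lambda>_. cube_bound j) x + ennreal (1 / 2 ^ j) * avgs (Suc j) n (avgs_sum j n g) x"
      using avgs_add[OF order_refl _ Hm elim(2), of "\<lambda>_. cube_bound j" "Suc j"]
        avgs_cmult[OF order_refl measurable_avgs_sum[OF order_refl g] elim(2), of "Suc j"] by simp
    also have "\<dots> \<le> cube_bound j + ennreal (1 / 2 ^ j) * (ennreal (2 ^ (Suc j * n)) * (of_nat n * K_fun N g (1 / 2 ^ (Suc j * n))))"
    proof (rule add_mono[OF avgs_le_const mult_left_mono])
      have "avgs (Suc j) n (avgs_sum j n g) x \<le> ennreal (2 ^ (Suc j * n)) * K_fun N (avgs_sum j n g) (1 / 2 ^ (Suc j * n))"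
        by (rule avgs_le_K_fun[OF measurable_avgs_sum[OF order_refl g] elim(2)])
      also have "\<dots> \<le> ennreal (2 ^ (Suc j * n)) * (of_nat n * K_fun N g (1 / 2 ^ (Suc j * n)))"
        by (intro mult_left_mono K_fun_avgs_sum_le g) auto
      finally show "avgs (Suc j) n (avgs_sum j n g) x \<le> ennreal (2 ^ (Suc j * n)) * (of_nat n * K_fun N g (1 / 2 ^ (Suc j * n)))" .
    qed auto
    also have "\<dots> = cube_bound (Suc j)" by (simp add: cube_bound_def add.assoc)
    finally show ?case .
  qed
qed

text \<open>At scale \<open>1 / 2 ^ j\<close> the error is a mean over one dyadic interval of a line. Truncation at
  the level \<open>c\<close> and extension of the integral of the excess to the whole line make the bound the same
  for all points of the line.\<close>

lemma le_line_integral: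
  assumes k: "k < n"
  shows "AE x in N. absf u x \<le> cube_bound j + ennreal (1 / 2 ^ j) * c +
    (\<integral>\<^sup>+r. (avgs_sum j n g (x(k := r)) + g (x(k := r))) - c \<partial>L)"
proof -
  define h where "h x = avgs_sum j n g x + g x" for x
  have Sm: "avgs_sum j n g \<in> borel_measurable N" by (rule measurable_avgs_sum[OF order_refl g])
  have hm: "h \<in> borel_measurable N" unfolding h_def[abs_def] using Sm g by measurable
  have Hm: "(\<lambda>x. ennreal (1 / 2 ^ j) * avgs_sum j n g x) \<in> borel_measurable N" using Sm by measurable
  have 1: "AE x in N. absf u x \<le> cube_bound j + ennreal (1 / 2 ^ j) * avgs_sum j n g x"
    using avgs_le_cube_bound[of j] le_avgs[OF order_refl, of j]
    by eventually_elim (meson add_right_mono order_trans)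
  show ?thesis
    using avg_mono_AE[OF k 1, of j] le_avg[OF k, of j] AE_space
  proof eventually_elim
    case (elim x)
    have "avg j k (\<lambda>x. cube_bound j + ennreal (1 / 2 ^ j) * avgs_sum j n g x) x
        = avg j k (\<lambda>_. cube_bound j) x + ennreal (1 / 2 ^ j) * avg j k (avgs_sum j n g) x"
      using avg_add[OF k _ Hm elim(3), of "\<lambda>_. cube_bound j" j] avg_cmult[OF k Sm elim(3), of j] by simp
    also have "\<dots> \<le> cube_bound j + ennreal (1 / 2 ^ j) * avg j k (avgs_sum j n g) x"
      by (intro add_right_mono avg_const_le)
    finally have "absf u x \<le> (cube_bound j + ennreal (1 / 2 ^ j) * avg j k (avgs_sum j n g) x) + ennreal (1 / 2 ^ j) * avg j k g x"
      using elim(1,2) by (meson add_right_mono order_trans)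
    also have "\<dots> = cube_bound j + ennreal (1 / 2 ^ j) * avg j k h x"
      unfolding h_def[abs_def] avg_add[OF k Sm g elim(3)] by (simp add: distrib_left add.assoc)
    also have "avg j k h x \<le> c + avg j k (\<lambda>x. h x - c) x" by (rule avg_le_truncate[OF k hm elim(3)])
    also have "avg j k (\<lambda>x. h x - c) x \<le> (\<integral>\<^sup>+r. ennreal (2 ^ j) * (h (x(k := r)) - c) \<partial>L)"
      unfolding avg_def by (intro nn_integral_mono) auto
    also have "\<dots> = ennreal (2 ^ j) * (\<integral>\<^sup>+r. h (x(k := r)) - c \<partial>L)"
    proof (rule nn_integral_cmult)
      show "(\<lambda>r. h (x(k := r)) - c) \<in> borel_measurable L" using measurable_line[OF k hm elim(3)] by measurable
    qed
    finally have "absf u x \<le> cube_bound j + ennreal (1 / 2 ^ j) * (c + ennreal (2 ^ j) * (\<integral>\<^sup>+r. h (x(k := r)) - c \<partial>L))"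
      by (simp add: add_left_mono mult_left_mono)
    also have "\<dots> = cube_bound j + ennreal (1 / 2 ^ j) * c + (\<integral>\<^sup>+r. h (x(k := r)) - c \<partial>L)"
      by (simp add: distrib_left mult.assoc[symmetric] ennreal_mult[symmetric] add.assoc)
    finally show ?case unfolding h_def .
  qed
qed

text \<open>\<open>\<psi>\<close> stands for the essential supremum of \<open>\<bar>u\<bar>\<close> along the lines in direction \<open>k\<close>. The bound of
  \<open>le_line_integral\<close> is constant on lines and becomes a K-functional after Markov's inequality and
  an infimum over the truncation level.\<close>

lemma rearr_sup_lines_le:
  assumes n: "n = Suc m" and k: "k < n" and t: "0 < t"
    and \<psi>m: "\<psi> \<in> borel_measurable (cube m I)"
    and \<psi>: "AE y in pcube m I. \<forall>b. (AE s in L. absf u (insert_coord k y s) \<le> b) \<longrightarrow> \<psi> y \<le> b"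
  shows "rearr (cube m I) \<psi> t \<le> cube_bound j + ennreal (1 / t) * (of_nat (Suc n) * K_fun N g (t / 2 ^ j))"
proof -
  define h where "h x = avgs_sum j n g x + g x" for x
  have Sm: "avgs_sum j n g \<in> borel_measurable N" by (rule measurable_avgs_sum[OF order_refl g])
  have hm: "h \<in> borel_measurable N" unfolding h_def[abs_def] using Sm g by measurable
  have km: "k \<le> m" using k n by simp
  have up: "(insert_coord k y s)(k := r) = insert_coord k y r" for y s r
    by (auto simp: insert_coord_def fun_eq_iff)
  have main: "rearr (cube m I) \<psi> t \<le> ennreal (1 / t) * (ennreal (t / 2 ^ j) * c + (\<integral>\<^sup>+x. h x - c \<partial>N)) + cube_bound j" for c
  proof -
    have hc: "(\<lambda>x. h x - c) \<in> borel_measurable (pcube (Suc m) I)"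
      unfolding n[symmetric] using hm by measurable
    define T where "T y = (\<integral>\<^sup>+r. h (insert_coord k y r) - c \<partial>L)" for y
    have Tm: "T \<in> borel_measurable (pcube m I)"
    proof -
      have "(\<lambda>(y, r). h (insert_coord k y r) - c) \<in> borel_measurable (pcube m I \<Otimes>\<^sub>M L)"
        using measurable_compose[OF measurable_insert_coord[OF km] hc] by (simp add: case_prod_beta')
      then show ?thesis unfolding T_def[abs_def] by (rule L.borel_measurable_nn_integral)
    qed
    have "AE y in pcube m I. \<psi> y \<le> (cube_bound j + ennreal (1 / 2 ^ j) * c) + T y"
    proof -
      have "AE x in pcube (Suc m) I. absf u x \<le> cube_bound j + ennreal (1 / 2 ^ j) * c + (\<integral>\<^sup>+r. h (x(k := r)) - c \<partial>L)"
        using le_line_integral[OF k, of j c] unfolding h_def n .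
      from AE_insert_coord[OF km this] \<psi> show ?thesis
      proof eventually_elim
        case (elim y)
        from elim(1) have "AE s in L. absf u (insert_coord k y s) \<le> cube_bound j + ennreal (1 / 2 ^ j) * c + T y"
          unfolding up T_def .
        with elim(2) show ?case by blast
      qed
    qed
    then have "rearr (cube m I) \<psi> t \<le> (cube_bound j + ennreal (1 / 2 ^ j) * c) + ennreal (1 / t) * (\<integral>\<^sup>+y. T y \<partial>cube m I)"
    proof (intro rearr_le_Markov[OF prob_space_cube \<psi>m _ _ t])
      assume *: "AE y in pcube m I. \<psi> y \<le> (cube_bound j + ennreal (1 / 2 ^ j) * c) + T y"
      show "T \<in> borel_measurable (cube m I)" unfolding cube_eq_completion by (rule measurable_completion[OF Tm])
      show "AE y in cube m I. \<psi> y \<le> (cube_bound j + ennreal (1 / 2 ^ j) * c) + T y"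
        unfolding cube_eq_completion AE_completion_iff by (rule *)
    qed
    also have "(\<integral>\<^sup>+y. T y \<partial>cube m I) = (\<integral>\<^sup>+x. h x - c \<partial>N)"
      unfolding cube_eq_completion nn_integral_completion T_def n
      using nn_integral_insert_coord[OF km hc] by simp
    also have "(cube_bound j + ennreal (1 / 2 ^ j) * c) + ennreal (1 / t) * (\<integral>\<^sup>+x. h x - c \<partial>N)
        = ennreal (1 / t) * (ennreal (t / 2 ^ j) * c + (\<integral>\<^sup>+x. h x - c \<partial>N)) + cube_bound j"
    proof -
      have "ennreal (1 / 2 ^ j) = ennreal (1 / t) * ennreal (t / 2 ^ j)" using t by (simp add: ennreal_mult[symmetric])
      then show ?thesis by (simp only: distrib_left ac_simps)
    qed
    finally show ?thesis .
  qed
  have "rearr (cube m I) \<psi> t \<le> (INF c. ennreal (1 / t) * (ennreal (t / 2 ^ j) * c + (\<integral>\<^sup>+x. h x - c \<partial>N))) + cube_bound j"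
    by (rule le_INF_add_ennreal[OF main])
  also have "(INF c. ennreal (1 / t) * (ennreal (t / 2 ^ j) * c + (\<integral>\<^sup>+x. h x - c \<partial>N))) \<le> ennreal (1 / t) * K_fun N h (t / 2 ^ j)"
    unfolding K_fun_def using t by (intro le_INF_mult_ennreal INF_lower) auto
  also have "K_fun N h (t / 2 ^ j) \<le> K_fun N (avgs_sum j n g) (t / 2 ^ j) + K_fun N g (t / 2 ^ j)"
    unfolding h_def[abs_def] by (rule K_fun_add[OF Sm g])
  also have "\<dots> \<le> of_nat n * K_fun N g (t / 2 ^ j) + K_fun N g (t / 2 ^ j)"
    using t by (intro add_right_mono K_fun_avgs_sum_le g) auto
  also have "\<dots> = of_nat (Suc n) * K_fun N g (t / 2 ^ j)" by (simp add: distrib_right add.commute)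
  finally show ?thesis by (simp add: add.commute add_left_mono mult_left_mono)
qed

text \<open>The terms of \<open>cube_bound\<close> for the scale \<open>1 / 2 ^ i\<close> compare with the part of the
  integral over \<open>[1 / 2 ^ (i * n), 1 / 2 ^ ((i - 1) * n)]\<close>.\<close>

definition scale_term :: "nat \<Rightarrow> ennreal" where
  "scale_term i = ennreal (1 / 2 ^ i) * rearr_avg N g (1 / 2 ^ (i * n))"

lemma rearr_avg_scale: "rearr_avg N g (1 / 2 ^ i) = ennreal (2 ^ i) * K_fun N g (1 / 2 ^ i)"
  using rearr_avg_eq_K_fun[OF g N.prob_space_axioms, of "1 / 2 ^ i"] by simp

lemma sum_scale_terms_le:
  assumes n: "n = Suc m" and m: "0 < m" and p: "p = real n / real m"
  shows "(\<Sum>i<j. scale_term (Suc i)) \<le> ennreal (2 ^ (n + m)) *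
    (\<integral>\<^sup>+s\<in>{1 / 2 ^ (j * n)..1}. rearr_avg N g s * ennreal (s powr (- 1 / p)) \<partial>lborel)"
proof (induction j)
  case 0 then show ?case by simp
next
  case (Suc j)
  define lo hi where "lo = 1 / (2::real) ^ (Suc j * n)" and "hi = 1 / (2::real) ^ (j * n)"
  let ?G = "\<lambda>s. rearr_avg N g s * ennreal (s powr (- 1 / p))"
  have lo: "0 < lo" and hi: "0 < hi" "hi \<le> 1" by (simp_all add: lo_def hi_def)
  have hl: "hi = 2 ^ n * lo" by (simp add: lo_def hi_def power_add)
  have p0: "0 < p" using n m p by simp
  have "2 * lo \<le> 2 ^ n * lo" using lo n by (intro mult_right_mono) auto
  then have len: "lo \<le> hi - lo" "lo \<le> hi" using lo by (auto simp: hl)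
  have hp: "hi powr (- 1 / p) = 2 ^ (j * m)"
  proof -
    have "hi = 2 powr (- real (j * n))" unfolding hi_def by (simp only: powr_minus_divide powr_realpow zero_less_numeral)
    then have "hi powr (- 1 / p) = 2 powr (real (j * n) / p)" by (simp add: powr_powr)
    also have "real (j * n) / p = real (j * m)" using n m by (simp add: p field_simps)
    finally show ?thesis by (simp only: powr_realpow zero_less_numeral)
  qed
  have ra: "ennreal (1 / 2 ^ n) * rearr_avg N g lo \<le> rearr_avg N g hi"
  proof -
    have "ennreal (1 / 2 ^ n) * rearr_avg N g lo = ennreal (1 / 2 ^ n) * (ennreal (1 / lo) * K_fun N g lo)"
      using lo len hi by (subst rearr_avg_eq_K_fun[OF g N.prob_space_axioms]) auto
    also have "\<dots> = ennreal (1 / hi) * K_fun N g lo"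
      using lo by (simp add: mult.assoc[symmetric] ennreal_mult[symmetric] hl)
    also have "\<dots> \<le> ennreal (1 / hi) * K_fun N g hi" by (intro mult_left_mono K_fun_mono_t len) auto
    finally show ?thesis using hi by (simp add: rearr_avg_eq_K_fun[OF g N.prob_space_axioms])
  qed
  define c where "c = ennreal (1 / 2 ^ n) * rearr_avg N g lo * ennreal (2 ^ (j * m))"
  have "c * ennreal lo \<le> c * ennreal (hi - lo)" using len by (intro mult_left_mono ennreal_leI) auto
  also have "\<dots> = (\<integral>\<^sup>+s. c * indicator {lo..<hi} s \<partial>lborel)"
    using len by (simp add: nn_integral_cmult_indicator)
  also have "\<dots> \<le> (\<integral>\<^sup>+s\<in>{lo..<hi}. ?G s \<partial>lborel)"
  proof (rule nn_integral_mono)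
    fix s
    show "c * indicator {lo..<hi} s \<le> ?G s * indicator {lo..<hi} s"
    proof (cases "s \<in> {lo..<hi}")
      case True
      then have s: "0 < s" "s \<le> hi" using lo by auto
      have "rearr_avg N g hi \<le> rearr_avg N g s" using s hi by (intro rearr_avg_antimono g N.prob_space_axioms) auto
      moreover have "hi powr (- 1 / p) \<le> s powr (- 1 / p)" using s p0 by (intro powr_mono2') auto
      then have "ennreal (2 ^ (j * m)) \<le> ennreal (s powr (- 1 / p))" unfolding hp by (rule ennreal_leI)
      ultimately show ?thesis using True ra unfolding c_def by (auto intro!: mult_mono intro: order_trans)
    qed simp
  qed
  finally have step: "c * ennreal lo \<le> (\<integral>\<^sup>+s\<in>{lo..<hi}. ?G s \<partial>lborel)" .
  have st: "scale_term (Suc j) = ennreal (2 ^ (n + m)) * (c * ennreal lo)"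
  proof -
    have "2 ^ (n + m) * (1 / 2 ^ n * 2 ^ (j * m) * lo) = 1 / (2::real) ^ Suc j"
    proof -
      have "(2::real) ^ (Suc j * n) = 2 ^ (j * m) * 2 ^ m * 2 ^ Suc j"
        unfolding power_add[symmetric] n by (simp add: algebra_simps)
      then show ?thesis by (simp add: lo_def power_add)
    qed
    then have "ennreal (1 / 2 ^ Suc j) = ennreal (2 ^ (n + m)) * (ennreal (1 / 2 ^ n) * ennreal (2 ^ (j * m)) * ennreal lo)"
      using lo by (simp add: ennreal_mult[symmetric])
    then show ?thesis unfolding scale_term_def c_def lo_def by (simp only: ac_simps)
  qed
  have "(\<Sum>i<Suc j. scale_term (Suc i)) \<le> ennreal (2 ^ (n + m)) * (\<integral>\<^sup>+s\<in>{hi..1}. ?G s \<partial>lborel) + ennreal (2 ^ (n + m)) * (\<integral>\<^sup>+s\<in>{lo..<hi}. ?G s \<partial>lborel)"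
    using Suc.IH step unfolding sum.lessThan_Suc st hi_def[symmetric] by (intro add_mono mult_left_mono) auto
  also have "\<dots> = ennreal (2 ^ (n + m)) * (\<integral>\<^sup>+s. ?G s * indicator {hi..1} s + ?G s * indicator {lo..<hi} s \<partial>lborel)"
    by (subst nn_integral_add) (auto simp: distrib_left)
  also have "(\<integral>\<^sup>+s. ?G s * indicator {hi..1} s + ?G s * indicator {lo..<hi} s \<partial>lborel) = (\<integral>\<^sup>+s\<in>{lo..1}. ?G s \<partial>lborel)"
    using len hi by (intro nn_integral_cong) (auto simp: indicator_def)
  finally show ?case unfolding lo_def .
qed

text \<open>The scale \<open>j\<close> is the last one with \<open>t \<le> 1 / 2 ^ (j * m)\<close>. Then \<open>t / 2 ^ j\<close> is comparable with
  the volume \<open>1 / 2 ^ (j * n)\<close> of the dyadic cubes of this scale, so that the last term in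
  \<open>rearr_sup_lines_le\<close> is comparable with the scale term at \<open>j\<close>, and the integral that bounds the
  preceding scale terms starts at or above \<open>t powr p\<close>.\<close>

lemma rearr_sup_lines_le_tail_integral:
  assumes n: "n = Suc m" and m: "0 < m" and k: "k < n" and t: "0 < t" "t < 1"
    and \<psi>m: "\<psi> \<in> borel_measurable (cube m I)"
    and \<psi>: "AE y in pcube m I. \<forall>b. (AE s in L. absf u (insert_coord k y s) \<le> b) \<longrightarrow> \<psi> y \<le> b"
  shows "rearr (cube m I) \<psi> t \<le> ennreal ((1 + 2 * real n + 2 ^ m * (real n + 1)) * 2 ^ (n + m)) *
    ((\<integral>\<^sup>+x. g x \<partial>N) + tail_integral (real n / real m) (rearr_avg N g) t)"
proof -
  define p where "p = real n / real m"
  define q where "q = 1 / (2::real) ^ m"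
  have q: "0 < q" "q < 1" using m by (auto simp: q_def)
  \<comment> \<open>\<open>i\<close> is positive since \<open>t < 1\<close>, and its predecessor is the required scale\<close>
  define i where "i = (LEAST i. q ^ i < t)"
  have i: "q ^ i < t" unfolding i_def using real_arch_pow_inv[OF t(1) q(2)] by (rule LeastI_ex)
  have "i \<noteq> 0" using i t by (intro notI) simp
  then obtain j where j: "i = Suc j" by (cases i) auto
  have tj: "t \<le> q ^ j" using not_less_Least[of j "\<lambda>i. q ^ i < t"] j by (simp add: i_def)
  have qj: "q ^ j / 2 ^ j = 1 / 2 ^ (j * n)"
    unfolding q_def n by (simp add: power_divide power_mult[symmetric] power_add mult.commute)
  let ?J = "\<integral>\<^sup>+x. g x \<partial>N"
  define S where "S = (\<Sum>i<j. scale_term (Suc i))"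
  define T where "T = tail_integral p (rearr_avg N g) t"
  have ST: "S \<le> ennreal (2 ^ (n + m)) * T"
  proof -
    have "t powr p \<le> (q ^ j) powr p" using t tj m by (intro powr_mono2) (auto simp: p_def)
    also have "(q ^ j) powr p = 1 / 2 ^ (j * n)"
    proof -
      have "q ^ j = 2 powr (- real (m * j))"
      proof -
        have "q ^ j = 1 / 2 ^ (m * j)" unfolding q_def by (simp add: power_divide power_mult[symmetric])
        then show ?thesis by (simp only: powr_minus_divide powr_realpow zero_less_numeral)
      qed
      then have "(q ^ j) powr p = 2 powr (- real (m * j) * p)" by (simp add: powr_powr)
      also have "- real (m * j) * p = - real (j * n)" using m by (simp add: p_def)
      also have "2 powr (- real (j * n)) = 1 / 2 ^ (j * n)" by (simp only: powr_minus_divide powr_realpow zero_less_numeral)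
      finally show ?thesis .
    qed
    finally have "{1 / 2 ^ (j * n)..1} \<subseteq> {t powr p..1}" by auto
    then have "(\<integral>\<^sup>+s\<in>{1 / 2 ^ (j * n)..1}. rearr_avg N g s * ennreal (s powr (- 1 / p)) \<partial>lborel) \<le> T"
      unfolding T_def tail_integral_def by (intro nn_integral_mono) (auto simp: indicator_def)
    then show ?thesis
      unfolding S_def using sum_scale_terms_le[OF n m p_def, of j] by (meson mult_left_mono order_trans zero_le)
  qed
  have cb: "cube_bound j \<le> ?J + ennreal (2 * real n) * S"
  proof -
    have "ennreal (1 / 2 ^ i) * (ennreal (2 ^ (Suc i * n)) * (of_nat n * K_fun N g (1 / 2 ^ (Suc i * n)))) = ennreal (2 * real n) * scale_term (Suc i)" for i
    proof -
      have "ennreal (1 / 2 ^ i) * of_nat n = ennreal (2 * real n) * ennreal (1 / 2 ^ Suc i)"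
        by (simp add: ennreal_of_nat_eq_real_of_nat ennreal_mult[symmetric])
      then show ?thesis unfolding scale_term_def rearr_avg_scale by (metis (no_types) mult.assoc mult.commute)
    qed
    then have "cube_bound j = (\<integral>\<^sup>+x. absf u x \<partial>N) + ennreal (2 * real n) * S"
      unfolding cube_bound_def S_def sum_distrib_left by simp
    also have "\<dots> \<le> ?J + ennreal (2 * real n) * S" by (intro add_right_mono nn_integral_mono u_le)
    finally show ?thesis .
  qed
  have Aj: "scale_term j \<le> ?J + S"
  proof (cases j)
    case 0
    have "scale_term 0 = K_fun N g 1" using rearr_avg_scale[of 0] by (simp add: scale_term_def)
    also have "\<dots> \<le> ?J" by (rule K_fun_le_integral)
    finally show ?thesis using 0 by (simp add: S_def)
  next
    case (Suc j')
    have "scale_term (Suc j') \<le> S" unfolding S_def Suc by (intro member_le_sum[of j' _ "\<lambda>i. scale_term (Suc i)"]) auto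
    also have "S \<le> ?J + S" by simp
    finally show ?thesis using Suc by simp
  qed
  have "rearr (cube m I) \<psi> t \<le> cube_bound j + ennreal (1 / t) * (of_nat (Suc n) * K_fun N g (t / 2 ^ j))"
    by (rule rearr_sup_lines_le[OF n k t(1) \<psi>m \<psi>])
  also have "ennreal (1 / t) * (of_nat (Suc n) * K_fun N g (t / 2 ^ j)) \<le> ennreal (2 ^ m * (real n + 1)) * scale_term j"
  proof -
    have "t / 2 ^ j \<le> 1 / 2 ^ (j * n)" unfolding qj[symmetric] using tj by (intro divide_right_mono) auto
    then have "K_fun N g (t / 2 ^ j) \<le> K_fun N g (1 / 2 ^ (j * n))" by (rule K_fun_mono_t)
    moreover have "1 / t \<le> 1 / q ^ Suc j" using i j q t by (intro divide_left_mono) auto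
    ultimately have "ennreal (1 / t) * (of_nat (Suc n) * K_fun N g (t / 2 ^ j)) \<le> ennreal (1 / q ^ Suc j) * (of_nat (Suc n) * K_fun N g (1 / 2 ^ (j * n)))"
      by (intro mult_mono ennreal_leI) auto
    also have "\<dots> = ennreal (2 ^ m * (real n + 1)) * scale_term j"
    proof -
      have "1 / q ^ Suc j * real (Suc n) = 2 ^ m * (real n + 1) * (1 / 2 ^ j * 2 ^ (j * n))"
      proof -
        have "q ^ j = 2 ^ j / 2 ^ (j * n)" using qj by (simp add: field_simps)
        then show ?thesis by (simp add: q_def)
      qed
      then have "ennreal (1 / q ^ Suc j) * of_nat (Suc n) = ennreal (2 ^ m * (real n + 1)) * (ennreal (1 / 2 ^ j) * ennreal (2 ^ (j * n)))"
        unfolding ennreal_of_nat_eq_real_of_nat using q by (simp add: ennreal_mult[symmetric] del: of_nat_Suc power_Suc)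
      then show ?thesis unfolding scale_term_def rearr_avg_scale by (metis (no_types) mult.assoc)
    qed
    finally show ?thesis .
  qed
  also have "cube_bound j + ennreal (2 ^ m * (real n + 1)) * scale_term j
      \<le> (?J + ennreal (2 * real n) * S) + ennreal (2 ^ m * (real n + 1)) * (?J + S)"
    by (intro add_mono cb mult_left_mono Aj) auto
  also have "\<dots> \<le> ennreal (1 + 2 * real n + 2 ^ m * (real n + 1)) * (?J + S)"
  proof -
    have "?J + ennreal (2 * real n) * S \<le> ennreal 1 * (?J + S) + ennreal (2 * real n) * (?J + S)"
      by (intro add_mono mult_left_mono) auto
    then show ?thesis by (simp add: ennreal_plus distrib_right add_right_mono)
  qed
  also have "?J + S \<le> ennreal (2 ^ (n + m)) * (?J + T)"
  proof -
    have "ennreal 1 * ?J \<le> ennreal (2 ^ (n + m)) * ?J" by (intro mult_right_mono ennreal_leI) auto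
    then show ?thesis using ST by (simp add: distrib_left add_mono)
  qed
  finally show ?thesis
    unfolding T_def p_def by (simp add: ennreal_mult mult.assoc mult_left_mono)
qed

end


section \<open>Essential suprema along lines\<close>

lemma measurable_complete_AE:
  fixes f g :: "'a \<Rightarrow> 'b::topological_space"
  assumes M: "complete_measure M" and f: "f \<in> borel_measurable M" and ae: "AE x in M. f x = g x"
  shows "g \<in> borel_measurable M"
proof (rule measurableI)
  interpret complete_measure M by fact
  fix A assume A: "A \<in> sets (borel :: 'b measure)"
  obtain D where D: "{x \<in> space M. \<not> f x = g x} \<subseteq> D" "D \<in> null_sets M"
    using ae unfolding eventually_ae_filter by blast
  have fA: "f -` A \<inter> space M \<in> sets M" using f A by (rule measurable_sets)
  have "g -` A \<inter> D \<inter> space M \<in> sets M" by (rule complete[OF _ D(2)]) auto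
  moreover have "g -` A \<inter> space M = (f -` A \<inter> space M - D) \<union> (g -` A \<inter> D \<inter> space M)" using D(1) by auto
  ultimately show "g -` A \<inter> space M \<in> sets M" using fA D(2) by (metis null_setsD2 sets.Diff sets.Un)
qed simp

text \<open>If \<open>f\<close> is infinite on a set of positive measure, then so is its rearrangement, and both
  norms are infinite.\<close>

lemma luxemburg_represents':
  assumes ri: "ri_norm M X" "prob_space M"
    and \<sigma>: "\<sigma> \<in> measurable M unit_interval" "distr M unit_interval \<sigma> = unit_interval"
    and f[measurable]: "f \<in> borel_measurable M"
  shows "X f = luxemburg M X (rearr M f)"
proof (cases "AE x in M. f x < \<infinity>")
  case True
  show ?thesis by (rule luxemburg_represents[OF assms True])
next
  case False
  interpret prob_space M by (rule ri(2))
  interpret U: prob_space unit_interval by (rule prob_space_unit_interval)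
  have r: "ri_norm unit_interval (luxemburg M X)" by (rule luxemburg_ri_norm[OF ri \<sigma>])
  have fin: "(\<integral>\<^sup>+x. indicator {top} (k x) \<partial>N) = 0 \<longleftrightarrow> (AE x in N. k x < \<infinity>)"
    if k: "k \<in> borel_measurable N" for k :: "'b \<Rightarrow> ennreal" and N
  proof -
    have "(\<integral>\<^sup>+x. indicator {top} (k x) \<partial>N) = 0 \<longleftrightarrow> (AE x in N. indicator {top} (k x) = (0::ennreal))"
      by (intro nn_integral_0_iff_AE measurable_compose[OF k borel_measurable_indicator]) simp
    also have "\<dots> \<longleftrightarrow> (AE x in N. k x < \<infinity>)"
      by (rule AE_cong) (simp add: indicator_def less_top[symmetric])
    finally show ?thesis .
  qed
  have "(\<integral>\<^sup>+x. indicator {top} (f x) \<partial>M) = (\<integral>\<^sup>+x. indicator {top} (rearr M f x) \<partial>unit_interval)"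
    by (rule nn_integral_equimeasurable)
       (auto simp: finite_measure_axioms emeasure_space_1 U.emeasure_space_1[simplified] distr_fun_rearr)
  then have "\<not> (AE x in unit_interval. rearr M f x < \<infinity>)"
    using False fin[OF measurable_rearr_unit_interval, of M f] unfolding fin[OF f, symmetric] by simp
  then have "\<not> luxemburg M X (rearr M f) < \<infinity>"
    using bfn_finite_AE(2)[OF ri_norm_bfn[OF r] measurable_rearr_unit_interval] by blast
  moreover have "\<not> X f < \<infinity>" using bfn_finite_AE(2)[OF ri_norm_bfn[OF ri(1)] f] False by blast
  ultimately show ?thesis by (simp add: less_top[symmetric])
qed

lemma distr_fun_completion:
  assumes "g \<in> borel_measurable M" shows "distr_fun (completion M) g s = distr_fun M g s"
proof -
  have "{x \<in> space M. s < g x} \<in> sets M" using assms by measurable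
  then show ?thesis by (simp add: distr_fun_def)
qed

lemma rearr_avg_completion:
  assumes "g \<in> borel_measurable M" shows "rearr_avg (completion M) g = rearr_avg M g"
proof -
  have "rearr (completion M) g = rearr M g"
    by (intro ext rearr_cong_distr_fun distr_fun_completion assms)
  then show ?thesis by (simp add: rearr_avg_def[abs_def])
qed

context unit_length
begin

lemma complete_cube: "complete_measure (cube m I)"
  unfolding cube_eq_completion by (rule completion.complete_measure_axioms)

lemma complete_lebesgue_on: "complete_measure (lebesgue_on I)"
proof
  fix A B assume "B \<subseteq> A" "A \<in> null_sets (lebesgue_on I)"
  then have "A \<subseteq> I" "A \<in> null_sets lebesgue" by (auto simp: null_sets_restrict_space)
  then have "B \<subseteq> I" "B \<in> sets lebesgue"
    using \<open>B \<subseteq> A\<close> completion.complete[of B A lborel] by auto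
  then show "B \<in> sets (lebesgue_on I)" by (simp add: sets_restrict_space_iff)
qed

lemma AE_lebesgue_on_iff: "(AE s in lebesgue_on I. P s) \<longleftrightarrow> (AE s in L. P s)"
  by (simp add: AE_restrict_space_iff AE_completion_iff)

lemma measurable_lebesgue_on_L:
  fixes f :: "real \<Rightarrow> 'b::topological_space"
  shows "f \<in> borel_measurable L \<Longrightarrow> f \<in> borel_measurable (lebesgue_on I)"
proof -
  assume f: "f \<in> borel_measurable L"
  show ?thesis
  proof (rule measurableI)
    fix A assume "A \<in> sets (borel :: 'b measure)"
    then have "f -` A \<inter> space L \<in> sets L" by (rule measurable_sets[OF f])
    then show "f -` A \<inter> space (lebesgue_on I) \<in> sets (lebesgue_on I)"
      by (auto simp: sets_L sets_restrict_space_iff space_L)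
  qed simp
qed

lemma Linf_eq:
  assumes f: "f \<in> borel_measurable L" and ae: "AE s in L. f s = h s"
  shows "Linf I h = Inf {z. AE s in L. f s \<le> z}"
proof -
  have "h \<in> borel_measurable (lebesgue_on I)"
    by (rule measurable_complete_AE[OF complete_lebesgue_on measurable_lebesgue_on_L[OF f]]) (simp add: AE_lebesgue_on_iff ae)
  then have hm: "h \<in> borel_measurable (lebesgue_on I)" .
  have "Linf I h = Inf {z. AE s in L. h s \<le> z}"
    unfolding Linf_def esssup_eq_AE[OF hm] AE_lebesgue_on_iff by simp
  moreover have "(AE s in L. h s \<le> z) \<longleftrightarrow> (AE s in L. f s \<le> z)" for z
    using ae by (auto elim: eventually_elim2)
  ultimately show ?thesis by simp
qed

lemma AE_le_Inf: "AE s in L. f s \<le> Inf {z. AE s in L. f s \<le> (z::ennreal)}"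
proof -
  let ?Z = "{z. AE s in L. f s \<le> z}"
  have "top \<in> ?Z" by simp
  then have "?Z \<noteq> {}" by blast
  then obtain F :: "nat \<Rightarrow> ennreal" where F: "range F \<subseteq> ?Z" "Inf ?Z = (INF i. F i)"
    using ennreal_Inf_countable_INF[of ?Z] by auto
  have "AE s in L. \<forall>i. f s \<le> F i" unfolding AE_all_countable using F(1) by auto
  then show ?thesis unfolding F(2) by eventually_elim (auto intro: INF_greatest)
qed

text \<open>For a Borel representative, the supremum along a line is at most \<open>b\<close> if and only if
  the part of the line with values above \<open>b\<close> has measure zero, and this measure depends measurably on
  the line.\<close>

lemma psi_Linf:
  assumes n: "n = Suc m" and k: "k < n" and u0: "u0 \<in> borel_measurable (pcube n I)"
    and ae: "AE x in pcube n I. f x = u0 x"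
  shows "psi k f (Linf I) \<in> borel_measurable (cube m I)"
    and "AE y in pcube m I. \<forall>b. (AE s in L. absf u0 (insert_coord k y s) \<le> b) \<longleftrightarrow> psi k f (Linf I) y \<le> b"
proof -
  have km: "k \<le> m" using n k by simp
  define \<psi> where "\<psi> y = Inf {z. AE s in L. absf u0 (insert_coord k y s) \<le> z}" for y
  have um: "(\<lambda>p. absf u0 (insert_coord k (fst p) (snd p))) \<in> borel_measurable (pcube m I \<Otimes>\<^sub>M L)"
    using measurable_compose[OF measurable_insert_coord[OF km] measurable_absf[OF u0[unfolded n]]] by (simp add: case_prod_beta')
  have le_iff: "\<psi> y \<le> b \<longleftrightarrow> (AE s in L. absf u0 (insert_coord k y s) \<le> b)" for y b
  proof
    assume "\<psi> y \<le> b"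
    with AE_le_Inf[of "\<lambda>s. absf u0 (insert_coord k y s)"] show "AE s in L. absf u0 (insert_coord k y s) \<le> b"
      unfolding \<psi>_def by (auto elim!: eventually_mono intro: order_trans)
  qed (auto simp: \<psi>_def intro: Inf_lower)
  have sec: "(\<lambda>s. absf u0 (insert_coord k y s)) \<in> borel_measurable L" if "y \<in> space (pcube m I)" for y
    using measurable_compose[OF measurable_Pair1'[OF that] um] by simp
  have "\<psi> \<in> borel_measurable (pcube m I)"
  proof (rule borel_measurableI_le)
    fix b
    let ?h = "\<lambda>y. \<integral>\<^sup>+s. (if absf u0 (insert_coord k y s) \<le> b then 0 else 1) \<partial>L"
    have "?h \<in> borel_measurable (pcube m I)"
    proof (rule L.borel_measurable_nn_integral)
      note [measurable] = um
      show "(\<lambda>(y, s). if absf u0 (insert_coord k y s) \<le> b then 0 else (1::ennreal)) \<in> borel_measurable (pcube m I \<Otimes>\<^sub>M L)"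
        unfolding case_prod_beta' by measurable
    qed
    then have "{y \<in> space (pcube m I). ?h y = 0} \<in> sets (pcube m I)" by measurable
    also have "{y \<in> space (pcube m I). ?h y = 0} = {y \<in> space (pcube m I). \<psi> y \<le> b}"
    proof (intro Collect_cong conj_cong refl)
      fix y assume y: "y \<in> space (pcube m I)"
      note [measurable] = sec[OF y]
      have "?h y = 0 \<longleftrightarrow> (AE s in L. (if absf u0 (insert_coord k y s) \<le> b then 0 else 1) = (0::ennreal))"
        by (rule nn_integral_0_iff_AE) measurable
      also have "\<dots> \<longleftrightarrow> \<psi> y \<le> b" unfolding le_iff by (intro AE_cong) auto
      finally show "?h y = 0 \<longleftrightarrow> \<psi> y \<le> b" .
    qed
    finally show "{y \<in> space (pcube m I). \<psi> y \<le> b} \<in> sets (pcube m I)" .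
  qed
  then have \<psi>m: "\<psi> \<in> borel_measurable (cube m I)" unfolding cube_eq_completion by (rule measurable_completion)
  have "AE x in pcube (Suc m) I. u0 x = f x" using ae unfolding n by eventually_elim simp
  from AE_insert_coord[OF km this] AE_space
  have eq: "AE y in pcube m I. \<psi> y = psi k f (Linf I) y"
  proof eventually_elim
    case (elim y)
    from elim(1) have "AE s in L. absf u0 (insert_coord k y s) = absf (\<lambda>t. f (insert_coord k y t)) s"
      by eventually_elim (simp add: absf_def)
    from Linf_eq[OF sec[OF elim(2)] this] show ?case by (simp add: psi_def fnorm_def \<psi>_def)
  qed
  show "psi k f (Linf I) \<in> borel_measurable (cube m I)"
    by (rule measurable_complete_AE[OF complete_cube \<psi>m]) (unfold cube_eq_completion AE_completion_iff, rule eq)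
  show "AE y in pcube m I. \<forall>b. (AE s in L. absf u0 (insert_coord k y s) \<le> b) \<longleftrightarrow> psi k f (Linf I) y \<le> b"
    using eq by eventually_elim (simp add: le_iff[symmetric])
qed


section \<open>The Sobolev embedding\<close>

lemma integral_cube_eq:
  fixes h h' :: "(nat \<Rightarrow> real) \<Rightarrow> real"
  assumes h: "h \<in> borel_measurable (cube n I)" and h': "h' \<in> borel_measurable (pcube n I)" and ae: "AE x in pcube n I. h x = h' x"
  shows "(\<integral>x. h x \<partial>cube n I) = (\<integral>x. h' x \<partial>pcube n I)"
proof -
  have "(\<integral>x. h x \<partial>cube n I) = (\<integral>x. h' x \<partial>cube n I)"
    using h measurable_completion[OF h'] ae unfolding cube_eq_completion by (intro integral_cong_AE) (auto simp only: AE_completion_iff)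
  then show ?thesis using h' by (simp add: cube_eq_completion integral_completion)
qed

lemma borel_representative:
  fixes f :: "(nat \<Rightarrow> real) \<Rightarrow> real"
  assumes "f \<in> borel_measurable (cube n I)"
  obtains f0 where "f0 \<in> borel_measurable (pcube n I)" "AE x in pcube n I. f x = f0 x"
  using completion_ex_borel_measurable_real[of f "pcube n I"] assms unfolding cube_eq_completion by blast

lemma ZR_norm_eq:
  "n = Suc m \<Longrightarrow> ZR_norm n I X f = luxemburg (cube m I) X (tail_integral (real n / real m) (rearr_avg (cube n I) f))"
  by (simp add: ZR_norm_def tail_integral_def[abs_def] Let_def)

lemma ri_norm_luxemburg: "0 < m \<Longrightarrow> ri_norm (cube m I) X \<Longrightarrow> ri_norm unit_interval (luxemburg (cube m I) X)"
  by (rule luxemburg_ri_norm[OF _ prob_space_cube cube_to_interval_measure_preserving])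

lemma ri_norm_ZR_norm:
  assumes n: "n = Suc m" and m: "0 < m" and X: "ri_norm (cube m I) X"
  shows "ri_norm (cube n I) (ZR_norm n I X)"
proof -
  have "ri_norm (cube n I) (\<lambda>f. luxemburg (cube m I) X (tail_integral (real n / real m) (rearr_avg (cube n I) f)))"
    using n m by (intro ri_norm_tail_integral prob_space_cube ri_norm_luxemburg X) auto
  then show ?thesis unfolding ZR_norm_eq[OF n, symmetric] .
qed

text \<open>The majorant \<open>g\<close> is the sum of \<open>\<bar>u\<bar>\<close> and \<open>\<bar>\<nabla>u\<bar>\<close> for Borel representatives. The integral of
  \<open>g\<close> in the pointwise estimate is absorbed since the norm dominates the integral.\<close>

lemma mixed_norm_k_le:
  assumes n: "n = Suc m" and m: "0 < m" and X: "ri_norm (cube m I) X"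
  shows "\<exists>C\<ge>0. \<forall>f\<in>sobolev n I (ZR_norm n I X). \<forall>k<n.
    mixed_norm_k k X (Linf I) f \<le> ennreal C * sobolev_norm n I (ZR_norm n I X) f"
proof -
  define Z where "Z = ZR_norm n I X"
  define r where "r = luxemburg (cube m I) X"
  define p where "p = real n / real m"
  note Zri = ri_norm_ZR_norm[OF n m X, folded Z_def]
  note Z = ri_norm_bfn[OF Zri]
  have rri: "ri_norm unit_interval r" unfolding r_def by (rule ri_norm_luxemburg[OF m X])
  note r = ri_norm_bfn[OF rri]
  have Z_eq: "Z f = r (tail_integral p (rearr_avg (cube n I) f))" for f
    unfolding Z_def r_def p_def by (rule ZR_norm_eq[OF n])
  obtain C1 where C1: "0 < C1" "\<And>f. f \<in> borel_measurable (cube n I) \<Longrightarrow> (\<integral>\<^sup>+x. f x \<partial>cube n I) \<le> ennreal C1 * Z f"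
    using bfn_integral[OF Z] by blast
  define r1 where "r1 = enn2real (r (\<lambda>_. 1))"
  have r1: "r (\<lambda>_. 1) = ennreal r1" "0 \<le> r1" using bfn_one[OF r] by (auto simp: r1_def)
  define K where "K = (1 + 2 * real n + 2 ^ m * (real n + 1)) * 2 ^ (n + m)"
  have K: "0 \<le> K" by (simp add: K_def)
  show ?thesis
    unfolding Z_def[symmetric]
  proof (intro exI[of _ "K * (C1 * r1 + 1)"] conjI ballI allI impI)
    show "0 \<le> K * (C1 * r1 + 1)" using K C1 r1 by simp
    fix f k assume f: "f \<in> sobolev n I Z" and k: "k < n"
    define v where "v = weak_gradient n I f"
    have fm: "f \<in> borel_measurable (cube n I)" and Zf: "Z (absf f) < \<infinity>"
      and grm: "grad_length n I f \<in> borel_measurable (cube n I)" and Zg: "Z (absf (grad_length n I f)) < \<infinity>"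
      and ex: "\<exists>v. is_weak_gradient n I f v"
      using f by (auto simp: sobolev_def fspace_def)
    have wg: "is_weak_gradient n I f v" unfolding v_def weak_gradient_def by (rule someI_ex[OF ex])
    have vm: "v i \<in> borel_measurable (cube n I)" if "i < n" for i
      using wg that by (auto simp: is_weak_gradient_def loc_integrable_def)
    obtain u0 where u0: "u0 \<in> borel_measurable (pcube n I)" "AE x in pcube n I. f x = u0 x"
      using borel_representative[OF fm] .
    have "\<forall>i. \<exists>w. i < n \<longrightarrow> w \<in> borel_measurable (pcube n I) \<and> (AE x in pcube n I. v i x = w x)"
      using vm borel_representative by metis
    then obtain w where w: "\<And>i. i < n \<Longrightarrow> w i \<in> borel_measurable (pcube n I)" "\<And>i. i < n \<Longrightarrow> AE x in pcube n I. v i x = w i x"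
      by metis
    define q where "q x = sqrt (\<Sum>i<n. (w i x)\<^sup>2)" for x
    have qm: "q \<in> borel_measurable (pcube n I)"
      unfolding q_def[abs_def] by (intro measurable_compose[OF _ borel_measurable_sqrt] borel_measurable_sum borel_measurable_power w(1)) simp
    have q_eq: "AE x in pcube n I. grad_length n I f x = q x"
    proof -
      have "AE x in pcube n I. \<forall>i\<in>{..<n}. v i x = w i x" using w(2) by (intro AE_finite_allI) auto
      then show ?thesis by eventually_elim (simp add: grad_length_def q_def v_def)
    qed
    define g where "g x = absf u0 x + absf q x" for x
    have gm: "g \<in> borel_measurable (pcube n I)" unfolding g_def[abs_def] using u0(1) qm by measurable
    have gm': "g \<in> borel_measurable (cube n I)" unfolding cube_eq_completion by (rule measurable_completion[OF gm])
    have "Z g = Z (\<lambda>x. absf f x + absf (grad_length n I f) x)"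
    proof (rule bfn_cong_AE[OF Z gm'])
      show "(\<lambda>x. absf f x + absf (grad_length n I f) x) \<in> borel_measurable (cube n I)" using fm grm by measurable
      show "AE x in cube n I. g x = absf f x + absf (grad_length n I f) x"
        unfolding cube_eq_completion AE_completion_iff using u0(2) q_eq
        by eventually_elim (simp add: g_def absf_def)
    qed
    also have "\<dots> \<le> Z (absf f) + Z (absf (grad_length n I f))" using fm grm by (intro bfn_add[OF Z] measurable_absf)
    finally have Zg_le: "Z g \<le> sobolev_norm n I Z f" by (simp add: sobolev_norm_def fnorm_def)
    have Zg_fin: "Z g < \<infinity>"
    proof -
      have "sobolev_norm n I Z f < \<infinity>" using Zf Zg by (simp add: sobolev_norm_def fnorm_def)
      then show ?thesis by (rule le_less_trans[OF Zg_le])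
    qed
    have J_eq: "(\<integral>\<^sup>+x. g x \<partial>cube n I) = (\<integral>\<^sup>+x. g x \<partial>pcube n I)"
      by (simp add: cube_eq_completion nn_integral_completion)
    have J_le: "(\<integral>\<^sup>+x. g x \<partial>pcube n I) \<le> ennreal C1 * Z g" using C1(2)[OF gm'] J_eq by simp
    have J_fin: "(\<integral>\<^sup>+x. g x \<partial>pcube n I) < \<infinity>" using bfn_finite_AE(1)[where \<rho> = Z and f = g, OF Z gm' Zg_fin] J_eq by simp
    have absg: "integrable (pcube n I) h" if h: "h \<in> borel_measurable (pcube n I)" "\<And>x. absf h x \<le> g x" for h
    proof (rule integrableI_bounded[OF h(1)])
      have "(\<integral>\<^sup>+x. ennreal (norm (h x)) \<partial>pcube n I) \<le> (\<integral>\<^sup>+x. g x \<partial>pcube n I)"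
        using h(2) by (intro nn_integral_mono) (simp add: absf_def)
      then show "(\<integral>\<^sup>+x. ennreal (norm (h x)) \<partial>pcube n I) < \<infinity>" using J_fin by (rule le_less_trans)
    qed
    have ug: "absf u0 x \<le> g x" for x by (simp add: g_def)
    have wg': "absf (w i) x \<le> g x" if "i < n" for i x
    proof -
      have "(w i x)\<^sup>2 \<le> (\<Sum>i<n. (w i x)\<^sup>2)" using that by (intro member_le_sum) auto
      then have "\<bar>w i x\<bar> \<le> q x" unfolding q_def by (intro real_le_rsqrt) simp
      then have "absf (w i) x \<le> absf q x" unfolding absf_def by (intro ennreal_leI) simp
      also have "\<dots> \<le> g x" by (simp add: g_def)
      finally show ?thesis .
    qed
    interpret WD: weakly_differentiable I a n u0 w g
    proof
      show "integrable (pcube n I) u0" by (rule absg[OF u0(1) ug])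
      show "integrable (pcube n I) (w i)" if "i < n" for i by (rule absg[OF w(1)[OF that] wg'[OF that]])
      fix i \<eta> assume i: "i < n" and \<eta>: "\<And>i. i < n \<Longrightarrow> test_real (\<eta> i)"
      have t1: "tensor n \<eta> \<in> borel_measurable (pcube n I)"
        by (intro measurable_tensor test_real_measurable \<eta>)
      have t2: "tensor n (\<eta>(i := deriv (\<eta> i))) \<in> borel_measurable (pcube n I)"
      proof (rule measurable_tensor)
        fix j assume "j < n"
        then show "(\<eta>(i := deriv (\<eta> i))) j \<in> borel_measurable borel"
          using \<eta>[of j] \<eta>[OF i] smooth_real_measurable smooth_real_deriv(1) test_real_smooth by auto
      qed
      have "(\<integral>x. f x * partial i (tensor n \<eta>) x \<partial>cube n I) = - (\<integral>x. v i x * tensor n \<eta> x \<partial>cube n I)"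
        using wg i tensor_test_function[of n \<eta>] \<eta> unfolding is_weak_gradient_def by blast
      also have "(\<integral>x. f x * partial i (tensor n \<eta>) x \<partial>cube n I) = (\<integral>x. u0 x * tensor n (\<eta>(i := deriv (\<eta> i))) x \<partial>pcube n I)"
        unfolding partial_tensor[where \<eta> = \<eta>, OF i test_real_smooth[OF \<eta>[OF i]]]
      proof (rule integral_cube_eq)
        show "(\<lambda>x. f x * tensor n (\<eta>(i := deriv (\<eta> i))) x) \<in> borel_measurable (cube n I)"
          using fm measurable_completion[OF t2] unfolding cube_eq_completion by (rule borel_measurable_times)
        show "(\<lambda>x. u0 x * tensor n (\<eta>(i := deriv (\<eta> i))) x) \<in> borel_measurable (pcube n I)"
          using u0(1) t2 by (rule borel_measurable_times)
        show "AE x in pcube n I. f x * tensor n (\<eta>(i := deriv (\<eta> i))) x = u0 x * tensor n (\<eta>(i := deriv (\<eta> i))) x"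
          using u0(2) by eventually_elim simp
      qed
      also have "(\<integral>x. v i x * tensor n \<eta> x \<partial>cube n I) = (\<integral>x. w i x * tensor n \<eta> x \<partial>pcube n I)"
      proof (rule integral_cube_eq)
        show "(\<lambda>x. v i x * tensor n \<eta> x) \<in> borel_measurable (cube n I)"
          using vm[OF i] measurable_completion[OF t1] unfolding cube_eq_completion by (rule borel_measurable_times)
        show "(\<lambda>x. w i x * tensor n \<eta> x) \<in> borel_measurable (pcube n I)"
          using w(1)[OF i] t1 by (rule borel_measurable_times)
        show "AE x in pcube n I. v i x * tensor n \<eta> x = w i x * tensor n \<eta> x"
          using w(2)[OF i] by eventually_elim simp
      qed
      finally show "(\<integral>x. u0 x * tensor n (\<eta>(i := deriv (\<eta> i))) x \<partial>pcube n I) = - (\<integral>x. w i x * tensor n \<eta> x \<partial>pcube n I)" .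
    next
      show "g \<in> borel_measurable (pcube n I)" by (rule gm)
    qed (rule ug, rule wg')
    define \<psi> where "\<psi> = psi k f (Linf I)"
    note psi = psi_Linf[OF n k u0, folded \<psi>_def]
    have \<psi>: "AE y in pcube m I. \<forall>b. (AE s in L. absf u0 (insert_coord k y s) \<le> b) \<longrightarrow> \<psi> y \<le> b"
      using psi(2) by eventually_elim blast
    have mU: "tail_integral p (rearr_avg (cube n I) g) \<in> borel_measurable unit_interval"
      by (rule measurable_unit_interval) simp
    define J where "J = enn2real (\<integral>\<^sup>+x. g x \<partial>pcube n I)"
    have J: "(\<integral>\<^sup>+x. g x \<partial>pcube n I) = ennreal J" "0 \<le> J" using J_fin by (auto simp: J_def)
    have "X \<psi> = r (rearr (cube m I) \<psi>)"
      unfolding r_def by (rule luxemburg_represents'[OF X prob_space_cube cube_to_interval_measure_preserving[OF m] psi(1)])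
    also have "\<dots> \<le> r (\<lambda>t. ennreal K * (ennreal J + tail_integral p (rearr_avg (cube n I) g) t))"
    proof (rule bfn_mono[OF r])
      show "(\<lambda>t. ennreal K * (ennreal J + tail_integral p (rearr_avg (cube n I) g) t)) \<in> borel_measurable unit_interval"
        using mU by measurable
      show "AE t in unit_interval. rearr (cube m I) \<psi> t \<le> ennreal K * (ennreal J + tail_integral p (rearr_avg (cube n I) g) t)"
      proof (rule AE_I2)
        fix t :: real assume "t \<in> space unit_interval"
        then have t: "0 < t" "t < 1" by auto
        show "rearr (cube m I) \<psi> t \<le> ennreal K * (ennreal J + tail_integral p (rearr_avg (cube n I) g) t)"
          using WD.rearr_sup_lines_le_tail_integral[OF n m k t psi(1) \<psi>]
          unfolding K_def J(1) p_def cube_eq_completion[of n] rearr_avg_completion[OF gm] .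
      qed
    qed simp
    also have "\<dots> = ennreal K * r (\<lambda>t. ennreal J + tail_integral p (rearr_avg (cube n I) g) t)"
      using mU K by (intro bfn_cmult[OF r]) auto
    also have "r (\<lambda>t. ennreal J + tail_integral p (rearr_avg (cube n I) g) t) \<le> r (\<lambda>_. ennreal J) + r (tail_integral p (rearr_avg (cube n I) g))"
      using mU by (intro bfn_add[OF r]) auto
    also have "\<dots> = ennreal J * ennreal r1 + Z g"
      unfolding bfn_const[OF r J(2)] r1(1) Z_eq ..
    also have "ennreal J \<le> ennreal C1 * Z g" using J_le J(1) by simp
    finally have "X \<psi> \<le> ennreal K * (ennreal C1 * Z g * ennreal r1 + Z g)"
      by (simp add: mult_left_mono add_right_mono mult_right_mono)
    also have "\<dots> = ennreal (K * (C1 * r1 + 1)) * Z g"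
    proof -
      have "ennreal (K * (C1 * r1 + 1)) = ennreal K * (ennreal C1 * ennreal r1 + 1)"
        using K C1 r1(2) by (simp add: ennreal_mult ennreal_plus)
      then show ?thesis by (simp only: distrib_left distrib_right mult_1_left mult_1_right ac_simps)
    qed
    also have "\<dots> \<le> ennreal (K * (C1 * r1 + 1)) * sobolev_norm n I Z f" by (intro mult_left_mono Zg_le) simp
    finally show "mixed_norm_k k X (Linf I) f \<le> ennreal (K * (C1 * r1 + 1)) * sobolev_norm n I Z f"
      by (simp add: mixed_norm_k_def \<psi>_def)
  qed
qed

lemma sobolev_ZR_embeds:
  assumes n: "n = Suc m" and m: "0 < m" and X: "ri_norm (cube m I) X"
  shows "embeds (sobolev n I (ZR_norm n I X)) (sobolev_norm n I (ZR_norm n I X))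
      (mixed_space n I X (Linf I)) (mixed_norm n X (Linf I))"
proof -
  obtain C where C: "0 \<le> C" "\<And>f k. f \<in> sobolev n I (ZR_norm n I X) \<Longrightarrow> k < n \<Longrightarrow>
    mixed_norm_k k X (Linf I) f \<le> ennreal C * sobolev_norm n I (ZR_norm n I X) f"
    using mixed_norm_k_le[OF n m X] by blast
  show ?thesis
    unfolding embeds_def
  proof (intro conjI subsetI exI[of _ "real n * C"] ballI)
    fix f assume f: "f \<in> sobolev n I (ZR_norm n I X)"
    then have "f \<in> borel_measurable (cube n I)" "sobolev_norm n I (ZR_norm n I X) f < \<infinity>"
      by (auto simp: sobolev_def fspace_def sobolev_norm_def fnorm_def)
    moreover from this(2) have "ennreal C * sobolev_norm n I (ZR_norm n I X) f < \<infinity>" by (simp add: ennreal_mult_less_top)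
    ultimately show "f \<in> mixed_space n I X (Linf I)"
      using C(2)[OF f] by (auto simp: mixed_space_def intro: le_less_trans)
    have "mixed_norm n X (Linf I) f \<le> (\<Sum>k<n. ennreal C * sobolev_norm n I (ZR_norm n I X) f)"
      unfolding mixed_norm_def using C(2)[OF f] by (intro sum_mono) auto
    also have "\<dots> = ennreal (real n * C) * sobolev_norm n I (ZR_norm n I X) f"
      using C(1) by (simp add: ennreal_of_nat_eq_real_of_nat ennreal_mult mult.assoc)
    finally show "mixed_norm n X (Linf I) f \<le> ennreal (real n * C) * sobolev_norm n I (ZR_norm n I X) f" .
  qed
qed

end


section \<open>Weak derivatives of primitives\<close>

lemma continuous_on_fun_upd: "continuous_on UNIV (\<lambda>t. (x :: nat \<Rightarrow> real)(i := t))"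
proof (rule continuous_on_coordinatewise_then_product)
  fix j show "continuous_on UNIV (\<lambda>t. (x(i := t)) j)" by (cases "j = i") (auto intro: continuous_intros)
qed

lemma eventually_fun_upd_notin:
  fixes x :: "nat \<Rightarrow> real"
  assumes "compact K" "x(i := t) \<notin> K" shows "eventually (\<lambda>s. x(i := s) \<notin> K) (nhds t)"
proof -
  have "open ((\<lambda>s. x(i := s)) -` (- K))"
    by (rule open_vimage[OF _ continuous_on_fun_upd]) (use compact_imp_closed[OF assms(1)] in auto)
  then show ?thesis using assms(2) by (auto simp: eventually_nhds intro: exI[of _ "(\<lambda>s. x(i := s)) -` (- K)"])
qed

context unit_length
begin

lemma measurable_id_pcube: "(\<lambda>x. x) \<in> measurable (pcube n I) (borel :: (nat \<Rightarrow> real) measure)"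
proof -
  have "(\<lambda>x. x i) \<in> borel_measurable (pcube n I)" for i
  proof (cases "i < n")
    case False
    have "(\<lambda>x. x i) \<in> borel_measurable (pcube n I) \<longleftrightarrow> (\<lambda>_. undefined :: real) \<in> borel_measurable (pcube n I)"
      using False by (intro measurable_cong) (auto simp: space_pcube PiE_iff extensional_def)
    then show ?thesis by simp
  qed (rule measurable_component_pcube_borel)
  then have "(\<lambda>x i. x i) \<in> measurable (pcube n I) (Pi\<^sub>M UNIV (\<lambda>_::nat. borel :: real measure))"
    by (intro measurable_PiM_single'[of UNIV "\<lambda>i x. x i" "pcube n I" "\<lambda>_. borel"]) auto
  then show ?thesis by (simp cong: measurable_cong_sets[OF refl sets_PiM_equal_borel])
qed

lemma open_cube_borel: "open_cube n I \<in> sets borel"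
proof -
  have "open_cube n I = (\<Inter>i. (\<lambda>x. x i) -` (if i < n then {a<..<a + 1} else {undefined}) \<inter> space borel)"
    unfolding open_cube_def interior_I by (auto simp: PiE_iff extensional_def split: if_splits)
  also have "\<dots> \<in> sets borel"
    by (intro sets.countable_INT'' measurable_sets[OF borel_measurable_continuous_onI[OF continuous_on_product_coordinates]]) auto
  finally show ?thesis .
qed

lemma compactly_supported_bounded_measurable:
  fixes g :: "(nat \<Rightarrow> real) \<Rightarrow> real"
  assumes g: "continuous_on (open_cube n I) g" and K: "compact K" "K \<subseteq> open_cube n I" "\<And>x. x \<notin> K \<Longrightarrow> g x = 0"
  shows "g \<in> borel_measurable (pcube n I)" "\<exists>B. \<forall>x. \<bar>g x\<bar> \<le> B"
proof -
  have "(\<lambda>x. indicator (open_cube n I) x *\<^sub>R g x) \<in> borel_measurable borel"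
    by (rule borel_measurable_continuous_on_indicator[OF open_cube_borel g])
  also have "(\<lambda>x. indicator (open_cube n I) x *\<^sub>R g x) = g" using K by (auto simp: indicator_def fun_eq_iff)
  finally show "g \<in> borel_measurable (pcube n I)" by (rule measurable_compose[OF measurable_id_pcube])
  have "bounded (g ` K)"
    by (intro compact_imp_bounded compact_continuous_image continuous_on_subset[OF g] K)
  then obtain B where "\<forall>y\<in>g ` K. \<bar>y\<bar> \<le> B" by (auto simp: bounded_iff)
  then have "\<bar>g x\<bar> \<le> max B 0" for x using K(3)[of x] by (cases "x \<in> K") force+
  then show "\<exists>B. \<forall>x. \<bar>g x\<bar> \<le> B" by blast
qed

lemma test_function_facts:
  assumes \<phi>: "\<phi> \<in> test_functions n I"
  obtains K B where "compact K" "K \<subseteq> open_cube n I" "\<And>x. x \<notin> K \<Longrightarrow> \<phi> x = 0"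
    "\<phi> \<in> borel_measurable (pcube n I)" "\<And>x. \<bar>\<phi> x\<bar> \<le> B"
proof -
  obtain K where K: "compact K" "K \<subseteq> open_cube n I" "\<And>x. x \<notin> K \<Longrightarrow> \<phi> x = 0"
    using \<phi> by (auto simp: test_functions_def)
  have "continuous_on (open_cube n I) (foldr partial [] \<phi>)"
    using \<phi> unfolding test_functions_def smooth_on_cube_def by (auto dest!: spec[of _ "[]"])
  then have "continuous_on (open_cube n I) \<phi>" by simp
  from compactly_supported_bounded_measurable[OF this K] show thesis using that K by metis
qed

text \<open>On a line through the open cube a test function is a function on the whole real line which
  vanishes near the ends of the interval, so that no boundary terms occur in an integration by parts.\<close>

lemma partial_test_function:
  assumes \<phi>: "\<phi> \<in> test_functions n I" and i: "i < n"
  obtains B where "partial i \<phi> \<in> borel_measurable (pcube n I)" "\<And>x. \<bar>partial i \<phi> x\<bar> \<le> B"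
    "\<And>x t. x \<in> open_cube n I \<Longrightarrow> ((\<lambda>t. \<phi> (x(i := t))) has_real_derivative partial i \<phi> (x(i := t))) (at t)"
    "\<And>x. x \<in> open_cube n I \<Longrightarrow> continuous_on UNIV (\<lambda>t. partial i \<phi> (x(i := t)))"
    "\<And>x. x \<in> open_cube n I \<Longrightarrow> \<phi> (x(i := a + 1)) = 0"
proof -
  obtain K where K: "compact K" "K \<subseteq> open_cube n I" "\<And>x. x \<notin> K \<Longrightarrow> \<phi> x = 0"
    using \<phi> by (auto simp: test_functions_def)
  have smooth: "smooth_on_cube n I \<phi>" using \<phi> by (simp add: test_functions_def)
  have cont: "continuous_on (open_cube n I) (partial i \<phi>)"
    using smooth[unfolded smooth_on_cube_def, rule_format, of "[i]"] i by simp
  have diff: "(\<lambda>t. \<phi> (x(i := t))) differentiable (at (x i))" if "x \<in> open_cube n I" for x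
    using smooth[unfolded smooth_on_cube_def, rule_format, of "[]"] i that by simp
  have out: "((\<lambda>t. \<phi> (x(i := t))) has_real_derivative 0) (at t)" if "x(i := t) \<notin> K" for x t
  proof -
    have "eventually (\<lambda>s. \<phi> (x(i := s)) = 0) (nhds t)"
      using eventually_fun_upd_notin[OF K(1) that] by eventually_elim (rule K(3))
    then show ?thesis by (subst DERIV_cong_ev[OF refl _ refl, of _ "\<lambda>_. 0"]) auto
  qed
  have upd: "partial i \<phi> (x(i := t)) = deriv (\<lambda>t. \<phi> (x(i := t))) t" for x t by (simp add: partial_def)
  have zero: "partial i \<phi> x = 0" if "x \<notin> K" for x
    using DERIV_imp_deriv[OF out[of x "x i"]] that upd[of x "x i"] by simp
  obtain B where B: "\<And>x. \<bar>partial i \<phi> x\<bar> \<le> B"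
    using compactly_supported_bounded_measurable(2)[OF cont K(1,2) zero] by blast
  show thesis
  proof (rule that)
    show "partial i \<phi> \<in> borel_measurable (pcube n I)" by (rule compactly_supported_bounded_measurable(1)[OF cont K(1,2) zero])
    show "\<bar>partial i \<phi> x\<bar> \<le> B" for x by (rule B)
    show "((\<lambda>t. \<phi> (x(i := t))) has_real_derivative partial i \<phi> (x(i := t))) (at t)" for x t
    proof (cases "x(i := t) \<in> K")
      case True
      then have "(\<lambda>s. \<phi> (x(i := s))) differentiable (at t)" using diff[of "x(i := t)"] K(2) by auto
      then show ?thesis unfolding upd by (metis DERIV_imp_deriv real_differentiable_def)
    next
      case False
      show ?thesis using out[OF False] zero[OF False] by simp
    qed
    show "\<phi> (x(i := a + 1)) = 0" for x
    proof -
      have "x(i := a + 1) \<notin> open_cube n I" using i by (auto simp: open_cube_def interior_I PiE_iff)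
      then show ?thesis using K by blast
    qed
    show "continuous_on UNIV (\<lambda>t. partial i \<phi> (x(i := t)))" if x: "x \<in> open_cube n I" for x
      unfolding continuous_on_eq_continuous_at[OF open_UNIV]
    proof
      fix t
      show "isCont (\<lambda>t. partial i \<phi> (x(i := t))) t"
      proof (cases "x(i := t) \<in> K")
        case True
        have "x(i := s) \<in> open_cube n I" if "s \<in> {a<..<a + 1}" for s
          using x that i by (auto simp: open_cube_def interior_I PiE_iff extensional_def)
        then have "continuous_on {a<..<a + 1} (\<lambda>t. partial i \<phi> (x(i := t)))"
          by (intro continuous_on_compose2[OF cont continuous_on_subset[OF continuous_on_fun_upd]]) auto
        moreover have "t \<in> {a<..<a + 1}" using True K(2) i by (force simp: open_cube_def interior_I PiE_iff)
        ultimately show ?thesis by (simp add: continuous_on_eq_continuous_at)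
      next
        case False
        have "eventually (\<lambda>s. partial i \<phi> (x(i := s)) = 0) (nhds t)"
          using eventually_fun_upd_notin[OF K(1) False] by eventually_elim (rule zero)
        then show ?thesis by (subst isCont_cong[of _ "\<lambda>_. 0"]) auto
      qed
    qed
  qed
qed

lemma integrable_bounded_pcube:
  fixes f :: "(nat \<Rightarrow> real) \<Rightarrow> real"
  shows "f \<in> borel_measurable (pcube n I) \<Longrightarrow> (\<And>x. x \<in> space (pcube n I) \<Longrightarrow> \<bar>f x\<bar> \<le> B) \<Longrightarrow> integrable (pcube n I) f"
  by (rule N.integrable_const_bound[where B = B]) auto

text \<open>On a line, \<open>u\<close> is the integral of \<open>v\<close> up to the given point. Exchanging the order of
  integration moves the derivative from \<open>\<phi>\<close> to \<open>u\<close>, and no regularity of \<open>v\<close> is involved.\<close>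

lemma weak_derivative_of_primitive:
  fixes u v :: "(nat \<Rightarrow> real) \<Rightarrow> real"
  assumes i: "i < n" and u: "u \<in> borel_measurable (pcube n I)" "\<And>x. \<bar>u x\<bar> \<le> B"
    and v: "v \<in> borel_measurable (pcube n I)" "\<And>x. \<bar>v x\<bar> \<le> B"
    and prim: "\<And>x s. x \<in> open_cube n I \<Longrightarrow> a < s \<Longrightarrow> s < a + 1 \<Longrightarrow>
      u (x(i := s)) = (\<integral>r. (if r < s then v (x(i := r)) else 0) \<partial>L)"
    and \<phi>: "\<phi> \<in> test_functions n I"
  shows "(\<integral>x. u x * partial i \<phi> x \<partial>cube n I) = - (\<integral>x. v x * \<phi> x \<partial>cube n I)"
proof -
  obtain B1 where d: "partial i \<phi> \<in> borel_measurable (pcube n I)" "\<And>x. \<bar>partial i \<phi> x\<bar> \<le> B1"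
    "\<And>x t. x \<in> open_cube n I \<Longrightarrow> ((\<lambda>t. \<phi> (x(i := t))) has_real_derivative partial i \<phi> (x(i := t))) (at t)"
    "\<And>x. x \<in> open_cube n I \<Longrightarrow> continuous_on UNIV (\<lambda>t. partial i \<phi> (x(i := t)))"
    "\<And>x. x \<in> open_cube n I \<Longrightarrow> \<phi> (x(i := a + 1)) = 0"
    using partial_test_function[OF \<phi> i] by blast
  obtain K B2 where p: "\<phi> \<in> borel_measurable (pcube n I)" "\<And>x. \<bar>\<phi> x\<bar> \<le> B2"
    using test_function_facts[OF \<phi>] by metis
  note [measurable] = u(1) v(1) d(1) p(1)
  have uint: "integrable (pcube n I) u" and vint: "integrable (pcube n I) v"
    using integrable_bounded_pcube[OF u] integrable_bounded_pcube[OF v] by auto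
  have i1: "integrable (pcube n I) (\<lambda>x. u x * partial i \<phi> x)" and i2: "integrable (pcube n I) (\<lambda>x. v x * \<phi> x)"
    using integrable_mult_bounded[OF uint d(1,2)] integrable_mult_bounded[OF vint p(1,2)] by auto
  have eq: "(\<integral>x. h x \<partial>cube n I) = (\<integral>x. (\<integral>r. h (x(i := r)) \<partial>L) \<partial>pcube n I)"
    if "integrable (pcube n I) h" for h :: "(nat \<Rightarrow> real) \<Rightarrow> real"
    using integrable_resample(4)[OF i that] that unfolding cube_eq_completion by (simp add: integral_completion)
  have "AE x in pcube n I. (\<integral>r. u (x(i := r)) * partial i \<phi> (x(i := r)) \<partial>L) = - (\<integral>r. v (x(i := r)) * \<phi> (x(i := r)) \<partial>L)"
    using AE_pcube_interior AE_space integrable_resample(2)[OF i vint] integrable_resample(2)[OF i i2] integrable_resample(2)[OF i i1]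
  proof eventually_elim
    case (elim x)
    have x: "x \<in> open_cube n I" using elim(1,2) by (auto simp: open_cube_def interior_I space_pcube PiE_iff)
    note [measurable] = borel_measurable_integrable[OF elim(3)]
    have [measurable]: "(\<lambda>t. partial i \<phi> (x(i := t))) \<in> borel_measurable borel"
      by (rule borel_measurable_continuous_onI[OF d(4)[OF x]])
    have [measurable]: "(\<lambda>t. \<phi> (x(i := t))) \<in> borel_measurable borel"
      by (intro borel_measurable_continuous_onI continuous_at_imp_continuous_on ballI DERIV_isCont[OF d(3)[OF x]])
    have id: "(\<lambda>s. s) \<in> borel_measurable L" by (rule measurable_L) simp
    note [measurable] = measurable_compose[OF measurable_fst id] measurable_compose[OF measurable_snd id]
    have [measurable]: "(\<lambda>s. \<integral>r. (if r < s then v (x(i := r)) else 0) \<partial>L) \<in> borel_measurable L"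
      by (rule L.borel_measurable_lebesgue_integral) (unfold case_prod_beta', measurable)
    have "AE s in L. partial i \<phi> (x(i := s)) * (\<integral>r. (if r < s then v (x(i := r)) else 0) \<partial>L) = u (x(i := s)) * partial i \<phi> (x(i := s))"
      using AE_L by eventually_elim (simp add: prim[OF x])
    then have "(\<integral>s. u (x(i := s)) * partial i \<phi> (x(i := s)) \<partial>L) = (\<integral>s. partial i \<phi> (x(i := s)) * (\<integral>r. (if r < s then v (x(i := r)) else 0) \<partial>L) \<partial>L)"
      using elim(5) by (intro integral_cong_AE) (auto dest: AE_symmetric)
    also have "\<dots> = (\<integral>r. v (x(i := r)) * (\<integral>s. (if r < s then partial i \<phi> (x(i := s)) else 0) \<partial>L) \<partial>L)"
      by (rule Fubini_triangle[OF elim(3) _ d(2)]) simp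
    also have "\<dots> = (\<integral>r. - (v (x(i := r)) * \<phi> (x(i := r))) \<partial>L)"
    proof (rule Bochner_Integration.integral_cong[OF refl])
      fix r assume "r \<in> space L"
      then have "r \<in> {a<..<a + 1} \<union> (I \<inter> {a, a + 1})" unfolding space_L using I_eq by blast
      then have "a \<le> r" "r \<le> a + 1" by auto
      from integral_L_greaterThan[OF d(3)[OF x] d(4)[OF x] this] d(5)[OF x]
      show "v (x(i := r)) * (\<integral>s. (if r < s then partial i \<phi> (x(i := s)) else 0) \<partial>L) = - (v (x(i := r)) * \<phi> (x(i := r)))"
        by simp
    qed
    also have "\<dots> = - (\<integral>r. v (x(i := r)) * \<phi> (x(i := r)) \<partial>L)" by simp
    finally show ?case .
  qed
  then have "(\<integral>x. (\<integral>r. u (x(i := r)) * partial i \<phi> (x(i := r)) \<partial>L) \<partial>pcube n I) = (\<integral>x. - (\<integral>r. v (x(i := r)) * \<phi> (x(i := r)) \<partial>L) \<partial>pcube n I)"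
    using borel_measurable_integrable[OF integrable_resample(3)[OF i i1]] borel_measurable_integrable[OF integrable_resample(3)[OF i i2]]
    by (intro integral_cong_AE) auto
  then show ?thesis using eq[OF i1] eq[OF i2] by simp
qed

text \<open>The difference of two weak partial derivatives is annihilated by all tensor products, so the
  fundamental lemma applies. Hence the length of the chosen gradient can be computed from any weak
  gradient.\<close>

lemma weak_gradient_unique:
  assumes v: "is_weak_gradient n I u v" and w: "is_weak_gradient n I u w" and i: "i < n"
  shows "AE x in pcube n I. v i x = w i x"
proof -
  have vi: "loc_integrable n I (v i)" and wi: "loc_integrable n I (w i)" using v w i by (auto simp: is_weak_gradient_def)
  define h where "h x = v i x - w i x" for x
  have hm: "h \<in> borel_measurable (cube n I)" using vi wi unfolding h_def[abs_def] loc_integrable_def by auto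
  obtain h0 where h0: "h0 \<in> borel_measurable (pcube n I)" "AE x in pcube n I. h x = h0 x"
    using borel_representative[OF hm] .
  have "AE x in pcube n I. h0 x = 0"
  proof (rule fundamental_lemma[OF h0(1)])
    fix c d assume cd: "a < c" "c < d" "d < a + 1"
    let ?K = "Pi\<^sub>E {..<n} (\<lambda>_. {c..d})"
    have "?K \<subseteq> open_cube n I" unfolding open_cube_def interior_I using cd by (intro PiE_mono) auto
    then have "set_integrable (cube n I) ?K (v i)" "set_integrable (cube n I) ?K (w i)"
      using vi wi compact_box[of n "\<lambda>_. c" "\<lambda>_. d"] by (auto simp: loc_integrable_def)
    then have "integrable (cube n I) (\<lambda>x. h x * indicator ?K x)"
      unfolding set_integrable_def h_def[abs_def] using Bochner_Integration.integrable_diff by (fastforce simp: algebra_simps)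
    moreover have Km: "(indicator ?K :: _ \<Rightarrow> real) \<in> borel_measurable (pcube n I)"
      using measurable_compose[OF measurable_id_pcube borel_measurable_indicator[OF borel_compact[OF compact_box[of n "\<lambda>_. c" "\<lambda>_. d"]]]] .
    ultimately have "integrable (cube n I) (\<lambda>x. h0 x * indicator ?K x)"
      using h0 hm measurable_completion[OF h0(1)] measurable_completion[OF Km] unfolding cube_eq_completion
      by (subst integrable_cong_AE[where g = "\<lambda>x. h x * indicator ?K x"]) (auto simp: AE_completion_iff elim: eventually_mono)
    then show "integrable (pcube n I) (\<lambda>x. h0 x * indicator ?K x)"
      using h0(1) Km by (simp add: cube_eq_completion integrable_completion)
  next
    fix \<eta> :: "nat \<Rightarrow> real \<Rightarrow> real" assume "\<And>i. i < n \<Longrightarrow> test_real (\<eta> i)"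
    then have T: "tensor n \<eta> \<in> test_functions n I" by (rule tensor_test_function)
    obtain K B where K: "compact K" "K \<subseteq> open_cube n I" "\<And>x. x \<notin> K \<Longrightarrow> tensor n \<eta> x = 0"
      and tm: "tensor n \<eta> \<in> borel_measurable (pcube n I)" and B: "\<And>x. \<bar>tensor n \<eta> x\<bar> \<le> B"
      using test_function_facts[OF T] by blast
    have tm': "tensor n \<eta> \<in> borel_measurable (cube n I)" unfolding cube_eq_completion by (rule measurable_completion[OF tm])
    have int: "integrable (cube n I) (\<lambda>x. g x * tensor n \<eta> x)" if "loc_integrable n I g" for g
    proof -
      have "integrable (cube n I) (\<lambda>x. indicator K x *\<^sub>R g x)"
        using that K(1,2) by (auto simp: loc_integrable_def set_integrable_def)
      from integrable_mult_bounded[OF this tm' B] have "integrable (cube n I) (\<lambda>x. indicator K x *\<^sub>R g x * tensor n \<eta> x)" .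
      also have "(\<lambda>x. indicator K x *\<^sub>R g x * tensor n \<eta> x) = (\<lambda>x. g x * tensor n \<eta> x)"
        using K(3) by (auto simp: indicator_def fun_eq_iff)
      finally show ?thesis .
    qed
    have "(\<integral>x. h0 x * tensor n \<eta> x \<partial>pcube n I) = (\<integral>x. h x * tensor n \<eta> x \<partial>cube n I)"
    proof (rule integral_cube_eq[symmetric])
      show "AE x in pcube n I. h x * tensor n \<eta> x = h0 x * tensor n \<eta> x" using h0(2) by eventually_elim simp
    qed (use hm tm' h0(1) tm in auto)
    also have "\<dots> = (\<integral>x. v i x * tensor n \<eta> x - w i x * tensor n \<eta> x \<partial>cube n I)" by (simp add: h_def algebra_simps)
    also have "\<dots> = (\<integral>x. v i x * tensor n \<eta> x \<partial>cube n I) - (\<integral>x. w i x * tensor n \<eta> x \<partial>cube n I)"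
      by (rule Bochner_Integration.integral_diff[OF int[OF vi] int[OF wi]])
    also have "\<dots> = 0"
    proof -
      have "(\<integral>x. u x * partial i (tensor n \<eta>) x \<partial>cube n I) = - (\<integral>x. v i x * tensor n \<eta> x \<partial>cube n I)"
        "(\<integral>x. u x * partial i (tensor n \<eta>) x \<partial>cube n I) = - (\<integral>x. w i x * tensor n \<eta> x \<partial>cube n I)"
        using v w i T unfolding is_weak_gradient_def by blast+
      then show ?thesis by simp
    qed
    finally show "(\<integral>x. h0 x * tensor n \<eta> x \<partial>pcube n I) = 0" .
  qed
  with h0(2) show ?thesis by eventually_elim (simp add: h_def)
qed

lemma loc_integrable_bounded:
  assumes "v \<in> borel_measurable (pcube n I)" "\<And>x. \<bar>v x\<bar> \<le> B"
  shows "loc_integrable n I v"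
  unfolding loc_integrable_def
proof (intro conjI allI impI)
  show "v \<in> borel_measurable (cube n I)" unfolding cube_eq_completion by (rule measurable_completion[OF assms(1)])
  fix K assume K: "compact K \<and> K \<subseteq> open_cube n I"
  have Km: "indicator K \<in> borel_measurable (pcube n I)"
    using measurable_compose[OF measurable_id_pcube borel_measurable_indicator[OF borel_compact]] K by blast
  have "integrable (pcube n I) (\<lambda>x. v x * indicator K x)"
    by (rule integrable_mult_bounded[OF integrable_bounded_pcube[OF assms] Km, of 1]) (simp add: indicator_def)
  then show "set_integrable (cube n I) K v"
    unfolding set_integrable_def cube_eq_completion using assms(1) Km
    by (subst integrable_completion) (auto simp: mult.commute)
qed

end


section \<open>A radial test function\<close>

lemma integrable_lborel_bounded_support:
  fixes f :: "real \<Rightarrow> real"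
  assumes "f \<in> borel_measurable borel" "\<And>q. \<bar>f q\<bar> \<le> B" "\<And>q. q \<notin> {u..v} \<Longrightarrow> f q = 0"
  shows "integrable lborel f"
proof (rule Bochner_Integration.integrable_bound)
  show "integrable lborel (\<lambda>q. B * indicator {u..v} q)"
    by (intro integrable_mult_right integrable_real_indicator) (auto simp: emeasure_lborel_Icc_eq)
  show "AE q in lborel. norm (f q) \<le> norm (B * indicator {u..v} q)"
  proof (rule AE_I2)
    fix q
    show "norm (f q) \<le> norm (B * indicator {u..v} q)"
      using assms(2)[of q] assms(3)[of q] by (cases "q \<in> {u..v}") auto
  qed
qed (use assms(1) in simp)

lemma power_powr_ratio:
  assumes x: "0 < (x::real)" and m: "0 < m" shows "(x ^ m) powr (real n / real m) = x ^ n"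
proof -
  have "(x ^ m) powr (real n / real m) = x powr (real m * (real n / real m))"
    by (simp only: powr_realpow[OF x, symmetric] powr_powr)
  also have "real m * (real n / real m) = real n" using m by simp
  finally show ?thesis by (simp only: powr_realpow[OF x])
qed

lemma power_powr_minus_inverse:
  assumes x: "0 < (x::real)" and "0 < m" and n: "0 < n" shows "(x ^ n) powr (- 1 / (real n / real m)) = 1 / x ^ m"
proof -
  have "- 1 / (real n / real m) = - (real m / real n)" by simp
  then show ?thesis by (simp only: powr_minus power_powr_ratio[OF x n] inverse_eq_divide)
qed

context unit_length
begin

text \<open>The left side is the even function of \<open>s - c\<close>, with \<open>c = a + 1/2\<close>, that decreases with slope
  \<open>h\<close> as \<open>\<bar>s - c\<bar>\<close> grows; the right side integrates its derivative. The proof substitutes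
  \<open>q = c - r\<close> and \<open>q = r - c\<close> in the two halves.\<close>

lemma symmetric_primitive:
  fixes h :: "real \<Rightarrow> real"
  assumes h[measurable]: "h \<in> borel_measurable borel" and B: "\<And>q. \<bar>h q\<bar> \<le> B"
    and supp: "\<And>q. \<not> (0 < q \<and> q < 1/2) \<Longrightarrow> h q = 0" and s: "a < s" "s < a + 1"
  shows "(\<integral>q. (if \<bar>s - (a + 1/2)\<bar> < q then h q else 0) \<partial>lborel)
    = (\<integral>r. (if r < s then h (a + 1/2 - r) - h (r - (a + 1/2)) else 0) \<partial>L)"
proof -
  define c where "c = a + 1/2"
  have B0: "0 \<le> B" using B[of 0] by linarith
  have 1: "integrable lborel (\<lambda>q. if c - q < s then h q else 0)"
    by (rule integrable_lborel_bounded_support[of _ B 0 1]) (use B B0 supp in auto)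
  have 2: "integrable lborel (\<lambda>q. if c + q < s then h q else 0)"
    by (rule integrable_lborel_bounded_support[of _ B 0 1]) (use B B0 supp in auto)
  have 3: "integrable lborel (\<lambda>r. if r < s then h (c - r) else 0)"
    by (rule integrable_lborel_bounded_support[of _ B a "a + 1"]) (use B B0 supp in \<open>auto simp: c_def\<close>)
  have 4: "integrable lborel (\<lambda>r. if r < s then h (r - c) else 0)"
    by (rule integrable_lborel_bounded_support[of _ B a "a + 1"]) (use B B0 supp in \<open>auto simp: c_def\<close>)
  have "(\<integral>r. (if r < s then h (c - r) - h (r - c) else 0) \<partial>L)
      = (\<integral>r. indicator I r *\<^sub>R (if r < s then h (c - r) - h (r - c) else 0) \<partial>lborel)"
    by (rule integral_restrict_space) (simp only: space_lborel space_borel Int_UNIV_right sets_lborel I_borel)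
  also have "(\<integral>r. indicator I r *\<^sub>R (if r < s then h (c - r) - h (r - c) else 0) \<partial>lborel) = (\<integral>r. (if r < s then h (c - r) else 0) - (if r < s then h (r - c) else 0) \<partial>lborel)"
  proof (rule Bochner_Integration.integral_cong[OF refl])
    fix r
    show "indicator I r *\<^sub>R (if r < s then h (c - r) - h (r - c) else 0) = (if r < s then h (c - r) else 0) - (if r < s then h (r - c) else 0)"
    proof (cases "r \<in> I")
      case False
      then have "r \<notin> {a<..<a + 1}" using I_eq by blast
      then have "h (c - r) = 0" "h (r - c) = 0" by (auto intro!: supp simp: c_def)
      then show ?thesis by simp
    next
      case True
      then show ?thesis by simp
    qed
  qed
  also have "\<dots> = (\<integral>r. (if r < s then h (c - r) else 0) \<partial>lborel) - (\<integral>r. (if r < s then h (r - c) else 0) \<partial>lborel)"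
    by (rule Bochner_Integration.integral_diff[OF 3 4])
  also have "(\<integral>r. (if r < s then h (c - r) else 0) \<partial>lborel) = (\<integral>q. (if c - q < s then h q else 0) \<partial>lborel)"
    by (subst (2) lborel_integral_real_affine[where c = "-1" and t = c]) (simp_all cong: if_cong)
  also have "(\<integral>r. (if r < s then h (r - c) else 0) \<partial>lborel) = (\<integral>q. (if c + q < s then h q else 0) \<partial>lborel)"
    by (subst (2) lborel_integral_real_affine[where c = 1 and t = "- c"]) (simp_all cong: if_cong)
  also have "(\<integral>q. (if c - q < s then h q else 0) \<partial>lborel) - (\<integral>q. (if c + q < s then h q else 0) \<partial>lborel)
      = (\<integral>q. (if c - q < s then h q else 0) - (if c + q < s then h q else 0) \<partial>lborel)"
    by (rule Bochner_Integration.integral_diff[OF 1 2, symmetric])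
  also have "\<dots> = (\<integral>q. (if \<bar>s - c\<bar> < q then h q else 0) \<partial>lborel)"
  proof (rule integral_cong_AE)
    show "AE q in lborel. (if c - q < s then h q else 0) - (if c + q < s then h q else 0) = (if \<bar>s - c\<bar> < q then h q else 0)"
      using AE_lborel_singleton[of "\<bar>s - c\<bar>"]
    proof eventually_elim
      case (elim q)
      show ?case
      proof (cases "0 < q")
        case True
        then have "c - q < s \<and> \<not> c + q < s \<longleftrightarrow> \<bar>s - c\<bar> < q" "c + q < s \<Longrightarrow> c - q < s" using elim by linarith+
        then show ?thesis by auto
      qed (simp add: supp)
    qed
  qed auto
  finally show ?thesis unfolding c_def by (rule sym)
qed

text \<open>Under \<open>t = (2 * q) ^ n\<close> the measure \<open>\<phi> t * t powr (-1/p) dt\<close> with \<open>p = n / (n - 1)\<close>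
  becomes \<open>radial_density n \<phi> q dq\<close>.\<close>

definition radial_density :: "nat \<Rightarrow> (real \<Rightarrow> real) \<Rightarrow> real \<Rightarrow> real" where
  "radial_density n \<phi> q = 2 * real n * \<phi> ((2 * q) ^ n)"

definition radial :: "nat \<Rightarrow> (real \<Rightarrow> real) \<Rightarrow> (nat \<Rightarrow> real) \<Rightarrow> real" where
  "radial n \<phi> x = (\<integral>q. (if 0 < q \<and> q < 1/2 \<and> center_dist n x < q then radial_density n \<phi> q else 0) \<partial>lborel)"

text \<open>On a line in direction \<open>i\<close> the sup-distance from the centre is the larger one of the distance
  in the coordinate \<open>i\<close> and of the sup-distance in the others. The latter is obtained by moving the
  coordinate \<open>i\<close> to the centre.\<close>

definition radial_slice :: "nat \<Rightarrow> (real \<Rightarrow> real) \<Rightarrow> nat \<Rightarrow> (nat \<Rightarrow> real) \<Rightarrow> real \<Rightarrow> real" where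
  "radial_slice n \<phi> i x q = (if 0 < q \<and> q < 1/2 \<and> center_dist n (x(i := a + 1/2)) < q then radial_density n \<phi> q else 0)"

definition radial_grad :: "nat \<Rightarrow> (real \<Rightarrow> real) \<Rightarrow> nat \<Rightarrow> (nat \<Rightarrow> real) \<Rightarrow> real" where
  "radial_grad n \<phi> i x = radial_slice n \<phi> i x (a + 1/2 - x i) - radial_slice n \<phi> i x (x i - (a + 1/2))"

lemma center_dist_less_iff: "0 < m \<Longrightarrow> center_dist m x < r \<longleftrightarrow> (\<forall>i<m. \<bar>x i - (a + 1/2)\<bar> < r)"
  unfolding center_dist_def by (subst Max_less_iff) auto

lemma center_dist_fun_upd:
  assumes "0 < q" "i < n"
  shows "center_dist n (x(i := s)) < q \<longleftrightarrow> \<bar>s - (a + 1/2)\<bar> < q \<and> center_dist n (x(i := a + 1/2)) < q"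
proof -
  have "0 < n" using assms by simp
  show ?thesis unfolding center_dist_less_iff[OF \<open>0 < n\<close>] using assms by (auto simp: fun_upd_apply)
qed

lemma center_dist_insert_coord:
  assumes "0 < m"
  shows "center_dist (Suc m) (insert_coord 0 y s) < q \<longleftrightarrow> \<bar>s - (a + 1/2)\<bar> < q \<and> center_dist m y < q"
  unfolding center_dist_less_iff[OF assms] center_dist_less_iff[OF zero_less_Suc] All_less_Suc2
  by (simp add: insert_coord_def)

context
  fixes n :: nat and \<phi> :: "real \<Rightarrow> real" and B :: real
  assumes n: "0 < n" and \<phi>[measurable]: "\<phi> \<in> borel_measurable borel"
    and \<phi>_nonneg: "\<And>s. 0 \<le> \<phi> s" and \<phi>_le: "\<And>s. \<phi> s \<le> B" and \<phi>_antimono: "antimono \<phi>"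
begin

lemma measurable_radial_density[measurable]: "radial_density n \<phi> \<in> borel_measurable borel"
  unfolding radial_density_def[abs_def] by measurable

lemma radial_density_bounds: "0 \<le> radial_density n \<phi> q" "radial_density n \<phi> q \<le> 2 * real n * B"
  unfolding radial_density_def using \<phi>_nonneg \<phi>_le by (auto intro: mult_left_mono)

lemma radial_density_antimono: "0 \<le> q \<Longrightarrow> q \<le> q' \<Longrightarrow> radial_density n \<phi> q' \<le> radial_density n \<phi> q"
  unfolding radial_density_def by (intro mult_left_mono antimonoD[OF \<phi>_antimono] power_mono) auto

lemma bound_nonneg: "0 \<le> 2 * real n * B"
  using radial_density_bounds[of 0] by linarith

lemma measurable_radial: "radial n \<phi> \<in> borel_measurable (pcube n I)"
  unfolding radial_def[abs_def] by (rule lborel.borel_measurable_lebesgue_integral) measurable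

lemma measurable_radial_grad:
  assumes "i < n" shows "radial_grad n \<phi> i \<in> borel_measurable (pcube n I)"
proof -
  have "a + 1/2 \<in> space L" unfolding space_L by (subst I_eq) simp
  from measurable_compose[OF measurable_compose[OF measurable_Pair2'[OF this] measurable_resample[OF assms]] measurable_center_dist]
  have [measurable]: "(\<lambda>x. center_dist n (x(i := a + 1/2))) \<in> borel_measurable (pcube n I)" by simp
  note [measurable] = measurable_component_pcube_borel[OF assms]
  show ?thesis unfolding radial_grad_def[abs_def] radial_slice_def by measurable
qed

lemma radial_bounds: "0 \<le> radial n \<phi> x" "radial n \<phi> x \<le> radial_density n \<phi> (center_dist n x)"
proof -
  let ?R = "center_dist n x"
  let ?F = "\<lambda>q. if 0 < q \<and> q < 1/2 \<and> ?R < q then radial_density n \<phi> q else 0"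
  show "0 \<le> radial n \<phi> x"
    unfolding radial_def using radial_density_bounds by (intro Bochner_Integration.integral_nonneg) auto
  have "radial n \<phi> x \<le> (\<integral>q. radial_density n \<phi> ?R * indicator {0..1/2::real} q \<partial>lborel)"
    unfolding radial_def
  proof (rule Bochner_Integration.integral_mono)
    show "integrable lborel ?F"
      by (rule integrable_lborel_bounded_support[of _ "2 * real n * B" 0 "1/2"])
         (use radial_density_bounds bound_nonneg in auto)
    show "integrable lborel (\<lambda>q. radial_density n \<phi> ?R * indicator {0..1/2::real} q)"
      by (rule integrable_lborel_bounded_support[of _ "radial_density n \<phi> ?R" 0 "1/2"])
         (use radial_density_bounds in \<open>auto simp: indicator_def\<close>)
    show "?F q \<le> radial_density n \<phi> ?R * indicator {0..1/2::real} q" for q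
      using radial_density_antimono[OF center_dist_nonneg[OF n], of x q] radial_density_bounds(1)[of ?R] by (auto simp: indicator_def)
  qed
  also have "\<dots> = radial_density n \<phi> ?R * (1/2)" by simp
  also have "\<dots> \<le> radial_density n \<phi> ?R" using radial_density_bounds(1)[of ?R] by simp
  finally show "radial n \<phi> x \<le> radial_density n \<phi> ?R" .
qed

text \<open>A partial derivative can be different from zero only where its coordinate alone realises the
  sup-distance. So the length of the gradient is the size of a single partial derivative.\<close>

lemma radial_grad_cases:
  assumes i: "i < n" and nz: "radial_grad n \<phi> i x \<noteq> 0"
  shows "center_dist n x = \<bar>x i - (a + 1/2)\<bar>" "\<And>l. l < n \<Longrightarrow> l \<noteq> i \<Longrightarrow> \<bar>x l - (a + 1/2)\<bar> < \<bar>x i - (a + 1/2)\<bar>"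
    "\<bar>radial_grad n \<phi> i x\<bar> = radial_density n \<phi> (center_dist n x)"
proof -
  let ?q = "\<bar>x i - (a + 1/2)\<bar>"
  have q: "0 < ?q \<and> center_dist n (x(i := a + 1/2)) < ?q \<and> \<bar>radial_grad n \<phi> i x\<bar> = radial_density n \<phi> ?q"
    using nz radial_density_bounds(1) unfolding radial_grad_def radial_slice_def by (auto split: if_splits)
  then show less: "\<bar>x l - (a + 1/2)\<bar> < ?q" if "l < n" "l \<noteq> i" for l
    using that unfolding center_dist_less_iff[OF n] by (metis fun_upd_apply)
  show "center_dist n x = ?q"
  proof (rule antisym)
    show "center_dist n x \<le> ?q" unfolding center_dist_le_iff[OF n] using less by (metis order.refl less_imp_le)
    show "?q \<le> center_dist n x" using center_dist_le_iff[OF n, of x "center_dist n x"] i by blast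
  qed
  with q show "\<bar>radial_grad n \<phi> i x\<bar> = radial_density n \<phi> (center_dist n x)" by simp
qed

lemma radial_grad_bounded: "i < n \<Longrightarrow> \<bar>radial_grad n \<phi> i x\<bar> \<le> 2 * real n * B"
  using radial_grad_cases(3)[of i x] radial_density_bounds(2)[of "center_dist n x"] bound_nonneg
  by (cases "radial_grad n \<phi> i x = 0") auto

lemma radial_grad_length: "sqrt (\<Sum>i<n. (radial_grad n \<phi> i x)\<^sup>2) \<le> radial_density n \<phi> (center_dist n x)"
proof (cases "\<exists>i<n. radial_grad n \<phi> i x \<noteq> 0")
  case True
  then obtain i where i: "i < n" "radial_grad n \<phi> i x \<noteq> 0" by blast
  have "radial_grad n \<phi> l x = 0" if "l < n" "l \<noteq> i" for l
  proof (rule ccontr)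
    assume "radial_grad n \<phi> l x \<noteq> 0"
    from radial_grad_cases(2)[OF i that] radial_grad_cases(2)[OF that(1) this i(1)] that(2)
    show False by simp
  qed
  then have "(\<Sum>l<n. (radial_grad n \<phi> l x)\<^sup>2) = (\<Sum>l\<in>{i}. (radial_grad n \<phi> l x)\<^sup>2)"
    using i(1) by (intro sum.mono_neutral_right) auto
  then show ?thesis using radial_grad_cases(3)[OF i] by simp
next
  case False
  then show ?thesis using radial_density_bounds(1) by simp
qed

lemma radial_primitive:
  assumes i: "i < n" and s: "a < s" "s < a + 1"
  shows "radial n \<phi> (x(i := s)) = (\<integral>r. (if r < s then radial_grad n \<phi> i (x(i := r)) else 0) \<partial>L)"
proof -
  define h where "h = radial_slice n \<phi> i x"
  have h: "h q = (if 0 < q \<and> q < 1/2 \<and> center_dist n (x(i := a + 1/2)) < q then radial_density n \<phi> q else 0)" for q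
    by (simp add: h_def radial_slice_def)
  have hm: "h \<in> borel_measurable borel" unfolding h[abs_def] by measurable
  have "radial n \<phi> (x(i := s)) = (\<integral>q. (if \<bar>s - (a + 1/2)\<bar> < q then h q else 0) \<partial>lborel)"
    unfolding radial_def
  proof (rule Bochner_Integration.integral_cong[OF refl])
    fix q
    show "(if 0 < q \<and> q < 1/2 \<and> center_dist n (x(i := s)) < q then radial_density n \<phi> q else 0) = (if \<bar>s - (a + 1/2)\<bar> < q then h q else 0)"
    proof (cases "0 < q")
      case True
      show ?thesis unfolding h center_dist_fun_upd[OF True i, of x s] by simp
    qed (simp add: h)
  qed
  also have "\<dots> = (\<integral>r. (if r < s then h (a + 1/2 - r) - h (r - (a + 1/2)) else 0) \<partial>L)"
    by (rule symmetric_primitive[OF hm _ _ s, of "2 * real n * B"])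
       (use radial_density_bounds bound_nonneg in \<open>auto simp: h\<close>)
  also have "(\<lambda>r. if r < s then h (a + 1/2 - r) - h (r - (a + 1/2)) else 0) = (\<lambda>r. if r < s then radial_grad n \<phi> i (x(i := r)) else 0)"
    by (simp add: radial_grad_def h radial_slice_def fun_eq_iff)
  finally show ?thesis .
qed

lemma radial_weak_gradient: "is_weak_gradient n I (radial n \<phi>) (radial_grad n \<phi>)"
proof -
  have b: "\<bar>radial n \<phi> x\<bar> \<le> 2 * real n * B" for x
    using radial_bounds[of x] radial_density_bounds(2)[of "center_dist n x"] by simp
  show ?thesis
    unfolding is_weak_gradient_def
    by (intro conjI allI impI ballI loc_integrable_bounded[OF measurable_radial b]
        loc_integrable_bounded[OF measurable_radial_grad radial_grad_bounded]
        weak_derivative_of_primitive[OF _ measurable_radial b measurable_radial_grad radial_grad_bounded] radial_primitive)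
qed

text \<open>Near the centre of the line over \<open>y\<close> the sup-distance is that of \<open>y\<close>, so the function is
  constant there. Its value is the tail integral by the substitution \<open>t = (2 * q) ^ n\<close>.\<close>

lemma radial_insert_coord:
  assumes m: "n = Suc m" "0 < m" and y: "0 < center_dist m y" "center_dist m y < 1/2"
    and s: "\<bar>s - (a + 1/2)\<bar> < center_dist m y"
  shows "ennreal (radial n \<phi> (insert_coord 0 y s))
    = tail_integral (real n / real m) (\<lambda>t. ennreal (\<phi> t)) ((2 * center_dist m y) ^ m)"
proof -
  define r0 where "r0 = center_dist m y"
  note r0 = y[folded r0_def] and s' = s[folded r0_def]
  define p where "p = real n / real m"
  have pos: "0 < real n" "0 < real m" using m by auto
  let ?F = "\<lambda>q. if 0 < q \<and> q < 1/2 \<and> r0 < q then radial_density n \<phi> q else 0"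
  have "radial n \<phi> (insert_coord 0 y s) = (\<integral>q. ?F q \<partial>lborel)"
    unfolding radial_def m(1) center_dist_insert_coord[OF m(2)] r0_def[symmetric]
    by (intro Bochner_Integration.integral_cong refl) (use s' in auto)
  then have "ennreal (radial n \<phi> (insert_coord 0 y s)) = ennreal (\<integral>q. ?F q \<partial>lborel)" by (rule arg_cong)
  also have "\<dots> = (\<integral>\<^sup>+q. ennreal (?F q) \<partial>lborel)"
  proof (rule nn_integral_eq_integral[symmetric])
    show "integrable lborel ?F"
      by (rule integrable_lborel_bounded_support[of _ "2 * real n * B" 0 "1/2"])
         (use radial_density_bounds bound_nonneg in auto)
  qed (use radial_density_bounds in auto)
  also have "\<dots> = (\<integral>\<^sup>+q. ennreal (\<phi> ((2 * q) ^ n) * ((2 * q) ^ n) powr (- 1 / p) * (real n * (2 * q) ^ m * 2) * indicator {r0..1/2} q) \<partial>lborel)"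
  proof (rule nn_integral_cong_AE)
    show "AE q in lborel. ennreal (?F q) = ennreal (\<phi> ((2 * q) ^ n) * ((2 * q) ^ n) powr (- 1 / p) * (real n * (2 * q) ^ m * 2) * indicator {r0..1/2} q)"
      using AE_lborel_singleton[of r0] AE_lborel_singleton[of "1/2"]
    proof eventually_elim
      case (elim q)
      show ?case
      proof (cases "r0 < q \<and> q < 1/2")
        case True
        then have q: "0 < 2 * q" using r0 by simp
        have c: "1 / y * (real n * y * 2) = 2 * real n" if "y \<noteq> 0" for y :: real using that by simp
        have "((2 * q) ^ n) powr (- 1 / p) * (real n * (2 * q) ^ m * 2) = 2 * real n"
          unfolding p_def power_powr_minus_inverse[OF q m(2) n] by (rule c) (use q in simp)
        then have "\<phi> ((2 * q) ^ n) * ((2 * q) ^ n) powr (- 1 / p) * (real n * (2 * q) ^ m * 2) = \<phi> ((2 * q) ^ n) * (2 * real n)"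
          by (simp only: mult.assoc)
        also have "\<dots> = radial_density n \<phi> q" unfolding radial_density_def by (rule mult.commute)
        finally show ?thesis using True r0 by simp
      next
        case False
        then have "q \<notin> {r0..1/2}" using elim by auto
        then show ?thesis using False by auto
      qed
    qed
  qed
  also have "\<dots> = (\<integral>\<^sup>+t. ennreal (\<phi> t * t powr (- 1 / p) * indicator {(2 * r0) ^ n..(2 * (1/2)) ^ n} t) \<partial>lborel)"
  proof (rule nn_integral_substitution[symmetric])
    show "set_borel_measurable borel {(2 * r0) ^ n..(2 * (1/2)) ^ n} (\<lambda>t. \<phi> t * t powr (- 1 / p))"
      unfolding set_borel_measurable_def by measurable
    show "((\<lambda>q. (2 * q) ^ n) has_real_derivative real n * (2 * q) ^ m * 2) (at q)" for q
    proof -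
      have "((\<lambda>q. 2 * q) has_real_derivative 2) (at q)" by (auto intro!: derivative_eq_intros)
      from DERIV_power[OF this, of n] show ?thesis
        by (simp only: m(1) diff_Suc_Suc minus_nat.diff_0 mult.assoc mult.commute mult.left_commute)
    qed
    show "continuous_on {r0..1/2} (\<lambda>q. real n * (2 * q) ^ m * 2)" by (intro continuous_intros)
    show "0 \<le> real n * (2 * q) ^ m * 2" if "q \<in> {r0..1/2}" for q using that r0 by simp
  qed (use r0 in simp)
  also have "\<dots> = tail_integral p (\<lambda>t. ennreal (\<phi> t)) ((2 * r0) ^ m)"
  proof -
    have "((2 * r0) ^ m) powr p = (2 * r0) ^ n"
      unfolding p_def by (rule power_powr_ratio) (use r0 m in auto)
    then show ?thesis unfolding tail_integral_def using \<phi>_nonneg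
      by (intro nn_integral_cong) (auto simp: ennreal_mult indicator_def)
  qed
  finally show ?thesis unfolding p_def r0_def .
qed

end

end


section \<open>Optimality of the domain space\<close>

context unit_length
begin

lemma distr_fun_cube_to_interval:
  assumes m: "0 < m" and \<psi>: "\<psi> \<in> borel_measurable unit_interval"
  shows "distr_fun (cube m I) (\<lambda>x. \<psi> (cube_to_interval m x)) s = distr_fun unit_interval \<psi> s"
proof -
  note c = cube_to_interval_measure_preserving[OF m]
  have S: "{t \<in> space unit_interval. s < \<psi> t} \<in> sets unit_interval" using \<psi> by measurable
  have "distr_fun unit_interval \<psi> s = emeasure (distr (cube m I) unit_interval (cube_to_interval m)) {t \<in> space unit_interval. s < \<psi> t}"
    unfolding c(2) distr_fun_def ..
  also have "\<dots> = emeasure (cube m I) (cube_to_interval m -` {t \<in> space unit_interval. s < \<psi> t} \<inter> space (cube m I))"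
    by (rule emeasure_distr[OF c(1) S])
  also have "cube_to_interval m -` {t \<in> space unit_interval. s < \<psi> t} \<inter> space (cube m I) = {x \<in> space (cube m I). s < \<psi> (cube_to_interval m x)}"
    using cube_to_interval_range[of m] by auto
  finally show ?thesis by (simp add: distr_fun_def)
qed

lemma measurable_compose_cube_to_interval:
  "0 < m \<Longrightarrow> \<psi> \<in> borel_measurable unit_interval \<Longrightarrow> (\<lambda>x. \<psi> (cube_to_interval m x)) \<in> borel_measurable (cube m I)"
  by (rule measurable_compose[OF cube_to_interval_measure_preserving(1)])

lemma AE_L_obtain:
  assumes "AE s in L. P s" "0 < r0" "r0 < 1/2"
  obtains s where "P s" "\<bar>s - (a + 1/2)\<bar> < r0"
proof -
  have "\<exists>s. P s \<and> \<bar>s - (a + 1/2)\<bar> < r0"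
  proof (rule ccontr)
    assume N: "\<not> (\<exists>s. P s \<and> \<bar>s - (a + 1/2)\<bar> < r0)"
    have "AE s in lborel. s \<in> I \<longrightarrow> P s" using assms(1) by (simp add: AE_restrict_space_iff)
    then have "AE s in lborel. \<not> (s \<in> {a + 1/2 - r0<..<a + 1/2 + r0})"
      using AE_lborel_I
    proof eventually_elim
      case (elim s)
      show ?case
      proof
        assume s: "s \<in> {a + 1/2 - r0<..<a + 1/2 + r0}"
        then have "s \<in> {a<..<a + 1}" "\<bar>s - (a + 1/2)\<bar> < r0" using assms(2,3) by (auto simp: abs_less_iff)
        then show False using elim N by blast
      qed
    qed
    then have "emeasure lborel {s \<in> space lborel. s \<in> {a + 1/2 - r0<..<a + 1/2 + r0}} = 0" by (rule emeasure_eq_0_AE)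
    then have "emeasure lborel {a + 1/2 - r0<..<a + 1/2 + r0} = 0" unfolding space_lborel space_borel by (simp only: UNIV_I simp_thms Collect_mem_eq)
    then have "ennreal (2 * r0) = 0" using assms(2) by simp
    then show False using assms(2) by simp
  qed
  then show thesis using that by blast
qed

text \<open>The embedding is applied to the radial function. Its values and its gradient are at most
  \<open>w\<close>, which is equimeasurable with \<open>2 * n * g\<close>, and its supremum along the lines in direction \<open>0\<close>
  is at least the tail integral.\<close>

lemma tail_integral_le_of_embeds:
  assumes n: "n = Suc m" and m: "0 < m" and X: "ri_norm (cube m I) X" and Zri: "ri_norm (cube n I) Z"
    and C: "0 \<le> C" "\<And>f. f \<in> sobolev n I Z \<Longrightarrow> mixed_norm n X (Linf I) f \<le> ennreal C * sobolev_norm n I Z f"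
    and g: "g \<in> borel_measurable (cube n I)" and B: "0 \<le> B" "\<And>x. g x \<le> ennreal B"
  shows "luxemburg (cube m I) X (tail_integral (real n / real m) (rearr (cube n I) g)) \<le> ennreal (C * (4 * real n)) * Z g"
proof -
  have n0: "0 < n" using n by simp
  define F where "F = rearr (cube n I) g"
  define \<phi> where "\<phi> t = enn2real (F t)" for t
  define p where "p = real n / real m"
  define r where "r = luxemburg (cube m I) X"
  have rri: "ri_norm unit_interval r" unfolding r_def by (rule ri_norm_luxemburg[OF m X])
  note Z = ri_norm_bfn[OF Zri] and Xb = ri_norm_bfn[OF X]
  have F_le: "F t \<le> ennreal B" for t
    unfolding F_def rearr_le_iff[OF g] distr_fun_def using B(2) by (simp add: not_less[symmetric])
  have F_eq: "ennreal (\<phi> t) = F t" for t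
    unfolding \<phi>_def using le_less_trans[OF F_le ennreal_less_top] by simp
  have Fm[measurable]: "F \<in> borel_measurable borel" unfolding F_def by measurable
  have \<phi>: "\<phi> \<in> borel_measurable borel" unfolding \<phi>_def[abs_def] by measurable
  have \<phi>0: "0 \<le> \<phi> t" for t by (simp add: \<phi>_def)
  have \<phi>B: "\<phi> t \<le> B" for t unfolding \<phi>_def using F_le B(1) by (intro enn2real_leI) auto
  have \<phi>anti: "antimono \<phi>"
  proof (rule antimonoI)
    fix s t :: real assume st: "s \<le> t"
    show "\<phi> t \<le> \<phi> s"
      unfolding \<phi>_def using rearr_antimono[OF st, of "cube n I" g, folded F_def] le_less_trans[OF F_le ennreal_less_top]
      by (intro enn2real_mono) auto
  qed
  note rad = n0 \<phi> \<phi>0 \<phi>B \<phi>anti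
  define u where "u = radial n \<phi>"
  define v where "v = radial_grad n \<phi>"
  define D where "D x = radial_density n \<phi> (center_dist n x)" for x
  define w where "w x = ennreal (2 * real n) * F (cube_to_interval n x)" for x
  note um = measurable_radial[OF rad, folded u_def]
  have um': "u \<in> borel_measurable (cube n I)" unfolding cube_eq_completion by (rule measurable_completion[OF um])
  have wg: "is_weak_gradient n I u v" unfolding u_def v_def by (rule radial_weak_gradient[OF rad])
  have wg': "is_weak_gradient n I u (weak_gradient n I u)" unfolding weak_gradient_def by (rule someI[of _ v]) (rule wg)
  have gm: "grad_length n I u \<in> borel_measurable (cube n I)"
  proof -
    have "weak_gradient n I u i \<in> borel_measurable (cube n I)" if "i < n" for i
      using wg' that by (auto simp: is_weak_gradient_def loc_integrable_def)
    then show ?thesis unfolding grad_length_def[abs_def]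
      by (intro measurable_compose[OF _ borel_measurable_sqrt] borel_measurable_sum borel_measurable_power) simp
  qed
  have FZ: "F \<in> borel_measurable unit_interval" by (rule measurable_unit_interval[OF Fm])
  note Fc = measurable_compose_cube_to_interval[OF n0 FZ]
  have wm: "w \<in> borel_measurable (cube n I)" unfolding w_def[abs_def] using Fc by measurable
  have Dw: "AE x in cube n I. ennreal (D x) = w x"
    unfolding cube_eq_completion AE_completion_iff using AE_cube_to_interval[OF n0]
    by eventually_elim (simp add: D_def w_def radial_density_def ennreal_mult \<phi>0 F_eq[symmetric])
  have Zw: "Z w = ennreal (2 * real n) * Z g"
  proof -
    have "Z w = ennreal (2 * real n) * Z (\<lambda>x. F (cube_to_interval n x))"
      unfolding w_def[abs_def] by (rule bfn_cmult[OF Z Fc]) simp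
    also have "Z (\<lambda>x. F (cube_to_interval n x)) = Z g"
    proof (rule ri_norm_equimeasurable[OF Zri prob_space_cube Fc g])
      interpret C: prob_space "cube n I" by (rule prob_space_cube)
      fix s
      show "distr_fun (cube n I) (\<lambda>x. F (cube_to_interval n x)) s = distr_fun (cube n I) g s"
        unfolding distr_fun_cube_to_interval[OF n0 FZ] unfolding F_def
        by (rule distr_fun_rearr[OF g]) (simp add: C.emeasure_space_1)
    qed
    finally show ?thesis .
  qed
  have Zu: "Z (absf u) \<le> Z w"
  proof (rule bfn_mono[OF Z measurable_absf[OF um'] wm])
    show "AE x in cube n I. absf u x \<le> w x" using Dw
    proof eventually_elim
      case (elim x)
      have "absf u x = ennreal (u x)" using radial_bounds(1)[OF rad, of x] by (simp add: absf_def u_def)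
      also have "\<dots> \<le> ennreal (D x)" unfolding u_def D_def by (rule ennreal_leI[OF radial_bounds(2)[OF rad]])
      finally show ?case using elim by simp
    qed
  qed
  have Zgr: "Z (absf (grad_length n I u)) \<le> Z w"
  proof (rule bfn_mono[OF Z measurable_absf[OF gm] wm])
    have "AE x in pcube n I. \<forall>i\<in>{..<n}. weak_gradient n I u i x = v i x"
      using weak_gradient_unique[OF wg' wg] by (intro AE_finite_allI) auto
    then have "AE x in cube n I. \<forall>i\<in>{..<n}. weak_gradient n I u i x = v i x" unfolding cube_eq_completion AE_completion_iff .
    then show "AE x in cube n I. absf (grad_length n I u) x \<le> w x" using Dw
    proof eventually_elim
      case (elim x)
      have "grad_length n I u x = sqrt (\<Sum>i<n. (v i x)\<^sup>2)" using elim(1) by (simp add: grad_length_def)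
      then have "absf (grad_length n I u) x = ennreal (sqrt (\<Sum>i<n. (v i x)\<^sup>2))" by (simp add: absf_def sum_nonneg)
      also have "\<dots> \<le> ennreal (D x)" unfolding v_def D_def by (rule ennreal_leI[OF radial_grad_length[OF rad]])
      finally show ?case using elim(2) by simp
    qed
  qed
  have "Z g \<le> Z (\<lambda>_. ennreal B)" using B(2) by (intro bfn_mono[OF Z g]) auto
  also have "\<dots> < \<infinity>" unfolding bfn_const[OF Z B(1)] using bfn_one[OF Z] by (simp add: ennreal_mult_less_top)
  finally have "Z w < \<infinity>" unfolding Zw by (simp add: ennreal_mult_less_top)
  then have "u \<in> sobolev n I Z"
    using um' gm wg le_less_trans[OF Zu] le_less_trans[OF Zgr] by (auto simp: sobolev_def fspace_def)
  note emb = C(2)[OF this]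
  define \<Phi> where "\<Phi> = tail_integral p F"
  have \<Phi>m: "\<Phi> \<in> borel_measurable unit_interval" unfolding \<Phi>_def by (rule measurable_unit_interval) simp
  note \<Phi>c = measurable_compose_cube_to_interval[OF m \<Phi>m]
  have ae: "AE x in pcube n I. u x = u x" by simp
  note psi = psi_Linf[OF n n0 um ae]
  have "X (\<lambda>y. \<Phi> (cube_to_interval m y)) \<le> X (psi 0 u (Linf I))"
  proof (rule bfn_mono[OF Xb \<Phi>c psi(1)])
    show "AE y in cube m I. \<Phi> (cube_to_interval m y) \<le> psi 0 u (Linf I) y"
      unfolding cube_eq_completion AE_completion_iff using psi(2) AE_cube_to_interval[OF m]
    proof eventually_elim
      case (elim y)
      have "AE s in L. absf u (insert_coord 0 y s) \<le> psi 0 u (Linf I) y" using elim(1) by blast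
      then obtain s where s: "absf u (insert_coord 0 y s) \<le> psi 0 u (Linf I) y" "\<bar>s - (a + 1/2)\<bar> < center_dist m y"
        using AE_L_obtain elim(2) by blast
      have "absf u (insert_coord 0 y s) = ennreal (u (insert_coord 0 y s))"
        using radial_bounds(1)[OF rad, of "insert_coord 0 y s"] by (simp add: absf_def u_def)
      also have "\<dots> = \<Phi> (cube_to_interval m y)"
        unfolding u_def \<Phi>_def p_def using radial_insert_coord[OF rad n m _ _ s(2)] elim(2) by (simp add: F_eq)
      finally show ?case using s(1) by simp
    qed
  qed
  moreover have "X (\<lambda>y. \<Phi> (cube_to_interval m y)) = r \<Phi>"
  proof -
    have "rearr (cube m I) (\<lambda>y. \<Phi> (cube_to_interval m y)) = rearr unit_interval \<Phi>"
      by (intro ext rearr_cong_distr_fun distr_fun_cube_to_interval[OF m \<Phi>m])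
    then show ?thesis
      using luxemburg_represents'[OF X prob_space_cube cube_to_interval_measure_preserving[OF m] \<Phi>c]
        ri_norm_unit_interval_rearr[OF rri \<Phi>m] by (simp add: r_def)
  qed
  ultimately have "r \<Phi> \<le> mixed_norm_k 0 X (Linf I) u" by (simp add: mixed_norm_k_def)
  also have "\<dots> \<le> mixed_norm n X (Linf I) u"
    unfolding mixed_norm_def using n0 by (intro member_le_sum) auto
  also have "\<dots> \<le> ennreal C * sobolev_norm n I Z u" by (rule emb)
  also have "\<dots> \<le> ennreal C * (Z w + Z w)"
    unfolding sobolev_norm_def fnorm_def using Zu Zgr by (intro mult_left_mono add_mono) auto
  also have "\<dots> = ennreal (C * (4 * real n)) * Z g"
  proof -
    have "ennreal (4 * real n) = ennreal (2 * real n) + ennreal (2 * real n)" by (simp add: ennreal_plus[symmetric] del: ennreal_plus)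
    then show ?thesis unfolding Zw using C(1) by (simp add: ennreal_mult distrib_left distrib_right mult.assoc)
  qed
  finally show ?thesis unfolding \<Phi>_def F_def p_def r_def .
qed

text \<open>For bounded functions, \<open>tail_integral_average_le\<close> and the boundedness of averaging
  reduce the claim to \<open>tail_integral_le_of_embeds\<close>. Both norms have the Fatou property, so
  truncations suffice.\<close>

lemma ZR_norm_optimal:
  assumes n: "n = Suc m" and m: "0 < m" and X: "ri_norm (cube m I) X" "upper_boyd (cube m I) X < 1"
    and Zri: "ri_norm (cube n I) Z"
    and emb: "embeds (sobolev n I Z) (sobolev_norm n I Z) (mixed_space n I X (Linf I)) (mixed_norm n X (Linf I))"
  shows "embeds (fspace (cube n I) Z) (fnorm Z) (fspace (cube n I) (ZR_norm n I X)) (fnorm (ZR_norm n I X))"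
proof -
  define r where "r = luxemburg (cube m I) X"
  define p where "p = real n / real m"
  have p: "1 < p" using n m by (simp add: p_def)
  have rri: "ri_norm unit_interval r" unfolding r_def by (rule ri_norm_luxemburg[OF m X(1)])
  note r = ri_norm_bfn[OF rri] and Z = ri_norm_bfn[OF Zri] and ZR = ri_norm_bfn[OF ri_norm_ZR_norm[OF n m X(1)]]
  obtain C' where C': "\<And>f. f \<in> sobolev n I Z \<Longrightarrow> mixed_norm n X (Linf I) f \<le> ennreal C' * sobolev_norm n I Z f"
    using emb unfolding embeds_def by blast
  define C where "C = max C' 0"
  have C: "0 \<le> C" "\<And>f. f \<in> sobolev n I Z \<Longrightarrow> mixed_norm n X (Linf I) f \<le> ennreal C * sobolev_norm n I Z f"
    using C' unfolding C_def by (auto simp: max_def ennreal_neg split: if_splits)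
  obtain t h where th: "1 < t" "0 < h" "h < t" "dilation_norm r t \<le> ennreal h"
    using upper_boyd_less_1E[OF X(2) rri[unfolded r_def]] unfolding r_def by blast
  obtain H where H: "0 < H" "\<And>\<phi>. \<phi> \<in> borel_measurable borel \<Longrightarrow> (\<And>x y. 0 < x \<Longrightarrow> x \<le> y \<Longrightarrow> \<phi> y \<le> \<phi> x) \<Longrightarrow>
      r (\<lambda>x. ennreal (1 / x) * (\<integral>\<^sup>+y\<in>{0..x}. \<phi> y \<partial>lborel)) \<le> ennreal H * r \<phi>"
    using hardy_bounded[OF rri th] by blast
  define K where "K = p * (H * (C * (4 * real n)))"
  have K: "0 \<le> K" using p H C by (simp add: K_def)
  have bounded: "ZR_norm n I X g \<le> ennreal K * Z g"
    if g: "g \<in> borel_measurable (cube n I)" and B: "0 \<le> B" "\<And>x. g x \<le> ennreal B" for g B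
  proof -
    define F where "F = rearr (cube n I) g"
    define \<Phi> where "\<Phi> = tail_integral p F"
    have Fm[measurable]: "F \<in> borel_measurable borel" and \<Phi>m[measurable]: "\<Phi> \<in> borel_measurable borel"
      unfolding F_def \<Phi>_def by measurable
    define A where "A x = ennreal (1 / x) * (\<integral>\<^sup>+y\<in>{0..x}. \<Phi> y \<partial>lborel)" for x
    have "(\<lambda>x. \<integral>\<^sup>+y\<in>{0..x}. \<Phi> y \<partial>lborel) \<in> borel_measurable borel"
      by (rule borel_measurable_mono_ennreal, rule monoI, rule nn_integral_mono) (auto simp: indicator_def)
    then have Am: "A \<in> borel_measurable unit_interval"
      unfolding A_def[abs_def] by (intro measurable_unit_interval borel_measurable_times_ennreal) auto
    have avg: "rearr_avg (cube n I) g = (\<lambda>s. ennreal (1 / s) * (\<integral>\<^sup>+x\<in>{0..s}. F x \<partial>lborel))"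
      by (simp add: rearr_avg_def[abs_def] F_def)
    have "ZR_norm n I X g = r (tail_integral p (rearr_avg (cube n I) g))"
      unfolding r_def p_def by (rule ZR_norm_eq[OF n])
    also have "\<dots> \<le> r (\<lambda>x. ennreal p * A x)"
    proof (rule bfn_mono[OF r])
      show "tail_integral p (rearr_avg (cube n I) g) \<in> borel_measurable unit_interval"
        by (rule measurable_unit_interval) simp
      show "(\<lambda>x. ennreal p * A x) \<in> borel_measurable unit_interval" using Am by measurable
      show "AE t in unit_interval. tail_integral p (rearr_avg (cube n I) g) t \<le> ennreal p * A t"
      proof (rule AE_I2)
        fix t :: real assume "t \<in> space unit_interval"
        then have "0 < t" "t < 1" by auto
        from tail_integral_average_le[OF Fm this p]
        show "tail_integral p (rearr_avg (cube n I) g) t \<le> ennreal p * A t" unfolding avg A_def \<Phi>_def .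
      qed
    qed
    also have "\<dots> = ennreal p * r A" using p by (intro bfn_cmult[OF r Am]) simp
    also have "r A \<le> ennreal H * r \<Phi>"
      unfolding A_def[abs_def]
    proof (rule H(2)[OF \<Phi>m])
      fix x y :: real assume "0 < x" "x \<le> y"
      then show "\<Phi> y \<le> \<Phi> x" unfolding \<Phi>_def by (rule tail_integral_antimono) (use p in simp)
    qed
    also have "r \<Phi> \<le> ennreal (C * (4 * real n)) * Z g"
      unfolding r_def \<Phi>_def p_def F_def by (rule tail_integral_le_of_embeds[OF n m X(1) Zri C g B])
    finally have "ZR_norm n I X g \<le> ennreal p * (ennreal H * (ennreal (C * (4 * real n)) * Z g))"
      by (simp add: mult_left_mono)
    also have "\<dots> = ennreal K * Z g"
      unfolding K_def using p H(1) C(1) by (simp add: ennreal_mult mult.assoc)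
    finally show ?thesis .
  qed
  have le: "ZR_norm n I X g \<le> ennreal K * Z g" if g: "g \<in> borel_measurable (cube n I)" for g
  proof -
    define G where "G j x = min (g x) (ennreal (real j))" for j :: nat and x
    have Gm: "G j \<in> borel_measurable (cube n I)" for j unfolding G_def[abs_def] using g by measurable
    have "AE x in cube n I. incseq (\<lambda>j. G j x) \<and> (SUP j. G j x) = g x"
    proof (rule AE_I2, rule conjI)
      fix x
      show "incseq (\<lambda>j. G j x)" unfolding G_def by (intro monoI min.mono ennreal_leI) auto
      have sup_top: "(SUP j::nat. ennreal (real j)) = top"
        using ennreal_SUP_of_nat_eq_top by (simp add: ennreal_of_nat_eq_real_of_nat)
      show "(SUP j. G j x) = g x" unfolding G_def inf_min[symmetric] by (simp only: inf_SUP[symmetric] sup_top inf_top_right)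
    qed
    note fat = bfn_Fatou(2)[OF ZR g Gm this]
    have "ZR_norm n I X (G j) \<le> ennreal K * Z g" for j
    proof -
      have "ZR_norm n I X (G j) \<le> ennreal K * Z (G j)"
        by (rule bounded[OF Gm, of "real j"]) (auto simp: G_def)
      also have "\<dots> \<le> ennreal K * Z g"
        by (intro mult_left_mono bfn_mono[OF Z Gm g]) (auto simp: G_def)
      finally show ?thesis .
    qed
    then show ?thesis unfolding fat[symmetric] by (intro SUP_least)
  qed
  show ?thesis
    unfolding embeds_def
  proof (intro conjI subsetI exI[of _ K] ballI)
    fix f assume f: "f \<in> fspace (cube n I) Z"
    then have fm: "f \<in> borel_measurable (cube n I)" and Zf: "Z (absf f) < \<infinity>" by (auto simp: fspace_def)
    show "fnorm (ZR_norm n I X) f \<le> ennreal K * fnorm Z f" unfolding fnorm_def by (rule le[OF measurable_absf[OF fm]])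
    moreover have "ennreal K * fnorm Z f < \<infinity>" using Zf by (simp add: fnorm_def ennreal_mult_less_top)
    ultimately have "fnorm (ZR_norm n I X) f < \<infinity>" by (rule le_less_trans)
    then show "f \<in> fspace (cube n I) (ZR_norm n I X)" using fm by (simp add: fspace_def fnorm_def)
  qed
qed

end

theorem theorem4p9:
  fixes n :: nat and I :: "real set"
    and X :: "((nat \<Rightarrow> real) \<Rightarrow> ennreal) \<Rightarrow> ennreal"
  assumes "n \<ge> 2"
    and "is_interval I" and "emeasure lborel I = 1"
    and "ri_norm (cube (n - 1) I) X"
    and "upper_boyd (cube (n - 1) I) X < 1"
  shows "ri_norm (cube n I) (ZR_norm n I X) \<and>
    embeds (sobolev n I (ZR_norm n I X)) (sobolev_norm n I (ZR_norm n I X))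
      (mixed_space n I X (Linf I)) (mixed_norm n X (Linf I)) \<and>
    (\<forall>Z. ri_norm (cube n I) Z \<longrightarrow>
      embeds (sobolev n I Z) (sobolev_norm n I Z)
        (mixed_space n I X (Linf I)) (mixed_norm n X (Linf I)) \<longrightarrow>
      embeds (fspace (cube n I) Z) (fnorm Z)
        (fspace (cube n I) (ZR_norm n I X)) (fnorm (ZR_norm n I X)))"
proof -
  define m where "m = n - 1"
  have n: "n = Suc m" and m: "0 < m" using assms(1) by (auto simp: m_def)
  have X: "ri_norm (cube m I) X" "upper_boyd (cube m I) X < 1" using assms(4,5) by (simp_all add: m_def)
  obtain a where a: "{a<..<a + 1} \<subseteq> I" "I \<subseteq> {a..a + 1}"
    using unit_length_interval_bounds[OF assms(2,3)] by blast
  interpret unit_length I a by (unfold_locales; rule a)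
  show ?thesis
    by (intro conjI allI impI ri_norm_ZR_norm[OF n m X(1)] sobolev_ZR_embeds[OF n m X(1)] ZR_norm_optimal[OF n m X])
qed

end
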